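(* Let $(M,g)$ be a simply connected Lorentzian surface and $E$ a Lorentzian vector bundle of rank 2 on $M$ equipped with a compatible connection; assume that $M$ and $E$ are oriented in space and in time, with given spin structures. Let $B:TM\times TM\to E$ be a symmetric bilinear map satisfying the Gauss, Ricci and Codazzi equations. Then these equations may be integrated in two steps to an isometric immersion $F:M\to\mathbb{R}^{2,2}$ with normal bundle $E$ and second fundamental form $B$: (1) first solving $$\nabla_X\varphi=\eta(X)\cdot\varphi\quad\text{for all }X\in TM,\qquad \eta(X)=-\frac12\sum_{j=2}^3\epsilon_j\,e_j\cdot B(X,e_j),\quad\epsilon_j=g(e_j,e_j):$$ there is a solution $\varphi\in\Gamma(\Sigma)$ such that $H(\varphi,\varphi)=1$, unique up to the natural right-action of $Spin(2,2)$ on $\Gamma(\Sigma)$; (2) then solving $dF=\xi$, where $\xi(X)=\langle\langle X\cdot\varphi,\varphi\rangle\rangle$: the solution $F:M\to\mathbb{R}^{2,2}\subset\mathbb{H}_1$ exists and is unique up to translations in $\mathbb{R}^{2,2}$.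
   Context: Algebra. $\mathbb{R}^{2,2}$ is $\mathbb{R}^4$ with metric $-dx_0^2+dx_1^2-dx_2^2+dx_3^2$. $\mathcal{A}=\{u+\sigma v:u,v\in\mathbb{R}\}$, $\sigma^2=1$, $\mathcal{A}_{\mathbb{C}}=\mathcal{A}\otimes\mathbb{C}$ ($i$ is the imaginary unit of $\mathbb{C}$). $\mathbb{H}^{\mathcal{A}_{\mathbb{C}}}$ is the algebra of quaternions $\zeta=\zeta_01+\zeta_1I+\zeta_2J+\zeta_3K$ with $\zeta_j\in\mathcal{A}_{\mathbb{C}}$, $I^2=J^2=K^2=-1$, $IJ=-JI=K$; $\overline{\zeta}=\zeta_01-\zeta_1I-\zeta_2J-\zeta_3K$, and $\widehat{\zeta}$ is obtained by replacing each coefficient $u+\sigma v$ ($u,v\in\mathbb{C}$) by $u-\sigma v$. $\mathbb{H}_0=\{p_01+ip_1I+p_2J+ip_3K:p_j\in\mathcal{A}\}$, $\mathbb{H}_1=\{iq_01+q_1I+iq_2J+q_3K:q_j\in\mathcal{A}\}$. On $\mathbb{H}_0$, $H(p,p')=p_0p_0'-p_1p_1'+p_2p_2'-p_3p_3'\in\mathcal{A}$; $Spin(2,2)=\{p\in\mathbb{H}_0:H(p,p)=1\}$. $\mathbb{R}^{2,2}$ is identified with $\{\sigma i x_01+x_1I+ix_2J+x_3K:x_j\in\mathbb{R}\}\subset\mathbb{H}_1$. Bundles. "Oriented in space and in time" means: oriented, with a continuous choice of future-directed timelike vectors in each fibre. Positively oriented orthonormal frames are $(e_0,e_1)$ of $E$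 and $(e_2,e_3)$ of $TM$ having the given orientations, with $\langle e_0,e_0\rangle=\langle e_2,e_2\rangle=-1$, $\langle e_1,e_1\rangle=\langle e_3,e_3\rangle=1$, $e_0,e_2$ future-directed; $\tilde Q_E,\tilde Q_M$ are the spin structures over the bundles of such frames, $\tilde Q=\tilde Q_E\times_M\tilde Q_M$, with structure group $Spin'(1,1)\times Spin''(1,1)$, $Spin'(1,1)=\{\pm(\cosh v+\sigma i\sinh v\,I):v\in\mathbb{R}\}$, $Spin''(1,1)=\{\pm(\cosh u+i\sinh u\,I):u\in\mathbb{R}\}$. $\Sigma=\Sigma E\otimes\Sigma M$ is the bundle associated to $\tilde Q$ and the representation $(g_1,g_2)\mapsto(\xi\mapsto g_1g_2\xi)$ on $\mathbb{H}_0$, with the spinorial connection $\nabla=\nabla^{\Sigma E}\otimes id+id\otimes\nabla^{\Sigma M}$. In a local section $\tilde s$ of $\tilde Q$ over $(e_0,e_1,e_2,e_3)$, $\varphi\in\Sigma$ has a coordinate $[\varphi]\in\mathbb{H}_0$, $X=\sum x_je_j\in E\oplus TM$ is represented by $[X]=\sigma i x_01+x_1I+ix_2J+x_3K$, and the Clifford action is $[X\cdot\varphi]=\sigma i\,[X]\widehat{[\varphi]}$. $Spin(2,2)$ acts on $\Gamma(\Sigma)$ by right-multiplication of coordinates, $[\varphi]\mapsto[\varphi]a$. $H(\psi,\psi'):=H([\psi],[\psi'])$ and $\langle\langle\psi,\psi'\rangle\rangle:=\sigma i\,\overline{[\psi']}[\psi]\in\mathbb{H}_1$. Fundamental equations.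 With $\langle S_\nu X,Y\rangle=\langle B(X,Y),\nu\rangle$ for $\nu\in E$, $K$ the curvature of $M$, $K_N=\langle R^E(e_2,e_3)e_0,e_1\rangle$ the curvature of $E$ (where $R^E(X,Y)=\nabla_X\nabla_Y-\nabla_Y\nabla_X-\nabla_{[X,Y]}$), and $\tilde\nabla$ the natural connection on $T^*M^{\otimes2}\otimes E$: Gauss: $K=|B(e_2,e_3)|^2-\langle B(e_2,e_2),B(e_3,e_3)\rangle$; Ricci: $K_N=\langle(S_{e_0}\circ S_{e_1}-S_{e_1}\circ S_{e_0})(e_2),e_3\rangle$; Codazzi: $(\tilde\nabla_XB)(Y,Z)-(\tilde\nabla_YB)(X,Z)=0$. "With normal bundle $E$ and second fundamental form $B$" is up to a bundle isometry of $E$ with the normal bundle preserving connections and second fundamental forms. *)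

theory Defs
  imports "HOL-Analysis.Analysis" "HOL-Library.Function_Algebras"
begin

section \<open>Quaternions over the complexified Lorentz numbers\<close>

text \<open>The pair \<open>(u, v)\<close> stands for \<open>u + \<sigma> v\<close> with \<open>\<sigma>\<^sup>2 = 1\<close>; the quadruple
  \<open>(a, b, c, d)\<close> stands for \<open>a 1 + b I + c J + d K\<close>.  As product types both carry the
  componentwise real vector space structure and norm of the library.\<close>

type_synonym ac = "complex \<times> complex"
type_synonym hac = "ac \<times> ac \<times> ac \<times> ac"

fun amul :: "ac \<Rightarrow> ac \<Rightarrow> ac" (infixl \<open>\<odot>\<close> 70) where
  "(u, v) \<odot> (u', v') = (u * u' + v * v', u * v' + v * u')"

definition aconst :: "complex \<Rightarrow> ac" where
  "aconst z = (z, 0)"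

text \<open>The scalar \<open>\<sigma> z\<close>.\<close>

definition asigma :: "complex \<Rightarrow> ac" where
  "asigma z = (0, z)"

definition lorentz_numbers :: "ac set" where
  "lorentz_numbers = {(of_real u, of_real v) | u v. True}"

fun hmul :: "hac \<Rightarrow> hac \<Rightarrow> hac" (infixl \<open>\<otimes>\<close> 70) where
  "(a, b, c, d) \<otimes> (a', b', c', d') =
    (a \<odot> a' - b \<odot> b' - c \<odot> c' - d \<odot> d',
     a \<odot> b' + b \<odot> a' + c \<odot> d' - d \<odot> c',
     a \<odot> c' - b \<odot> d' + c \<odot> a' + d \<odot> b',
     a \<odot> d' + b \<odot> c' - c \<odot> b' + d \<odot> a')"

fun hscale :: "ac \<Rightarrow> hac \<Rightarrow> hac" where
  "hscale s (a, b, c, d) = (s \<odot> a, s \<odot> b, s \<odot> c, s \<odot> d)"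

fun hconj :: "hac \<Rightarrow> hac" where
  "hconj (a, b, c, d) = (a, - b, - c, - d)"

fun ahat :: "ac \<Rightarrow> ac" where
  "ahat (u, v) = (u, - v)"

fun hhat :: "hac \<Rightarrow> hac" where
  "hhat (a, b, c, d) = (ahat a, ahat b, ahat c, ahat d)"

definition hone :: hac where
  "hone = (aconst 1, 0, 0, 0)"

definition H0 :: "hac set" where
  "H0 = {(p0, aconst \<i> \<odot> p1, p2, aconst \<i> \<odot> p3) | p0 p1 p2 p3.
     {p0, p1, p2, p3} \<subseteq> lorentz_numbers}"

text \<open>The coordinates \<open>(p0, p1, p2, p3)\<close> of an element \<open>p0 1 + i p1 I + p2 J + i p3 K\<close>.\<close>

fun h0_coords :: "hac \<Rightarrow> ac \<times> ac \<times> ac \<times> ac" where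
  "h0_coords (a, b, c, d) = (a, aconst (- \<i>) \<odot> b, c, aconst (- \<i>) \<odot> d)"

definition hform :: "hac \<Rightarrow> hac \<Rightarrow> ac" where
  "hform p p' = (case h0_coords p of (p0, p1, p2, p3) \<Rightarrow>
     case h0_coords p' of (p0', p1', p2', p3') \<Rightarrow>
       p0 \<odot> p0' - p1 \<odot> p1' + p2 \<odot> p2' - p3 \<odot> p3')"

definition Spin22 :: "hac set" where
  "Spin22 = {p \<in> H0. hform p p = aconst 1}"

definition SpinE :: "hac set" where
  "SpinE = {g. \<exists>v::real. let h = (aconst (of_real (cosh v)), asigma (\<i> * of_real (sinh v)), 0, 0)
     in g = h \<or> g = - h}"

definition SpinM :: "hac set" where
  "SpinM = {g. \<exists>u::real. let h = (aconst (of_real (cosh u)), aconst (\<i> * of_real (sinh u)), 0, 0)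
     in g = h \<or> g = - h}"

type_synonym r22 = "real \<times> real \<times> real \<times> real"

fun metric22 :: "r22 \<Rightarrow> r22 \<Rightarrow> real" where
  "metric22 (x0, x1, x2, x3) (y0, y1, y2, y3) = - x0 * y0 + x1 * y1 - x2 * y2 + x3 * y3"

fun r22_to_hac :: "r22 \<Rightarrow> hac" where
  "r22_to_hac (x0, x1, x2, x3) =
    (asigma (\<i> * of_real x0), aconst (of_real x1), aconst (\<i> * of_real x2), aconst (of_real x3))"

text \<open>If \<open>z\<close> and \<open>p\<close> are the coordinates of a vector and of a spinor in one spinorial frame,
  this is the coordinate of their Clifford product.\<close>

definition clifford_coord :: "hac \<Rightarrow> hac \<Rightarrow> hac" where
  "clifford_coord z p = hscale (asigma \<i>) (z \<otimes> hhat p)"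

section \<open>Smooth surfaces\<close>

primrec differentiable_of_order ::
  "nat \<Rightarrow> 'a::real_normed_vector set \<Rightarrow> ('a \<Rightarrow> 'b::real_normed_vector) \<Rightarrow> bool" where
  "differentiable_of_order 0 S f = continuous_on S f"
| "differentiable_of_order (Suc n) S f =
    ((\<forall>x\<in>S. f differentiable (at x)) \<and>
     (\<forall>v. differentiable_of_order n S (\<lambda>x. frechet_derivative f (at x) v)))"

text \<open>The set \<open>S\<close> is always open below.\<close>

definition smooth_on :: "'a::real_normed_vector set \<Rightarrow> ('a \<Rightarrow> 'b::real_normed_vector) \<Rightarrow> bool" where
  "smooth_on S f \<longleftrightarrow> (\<forall>n. differentiable_of_order n S f)"

text \<open>A chart is a pair of its domain and its coordinate map.  The points of a surface are all
  the elements of the type \<open>'m\<close>.\<close>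

type_synonym 'm chart = "'m set \<times> ('m \<Rightarrow> real^2)"
type_synonym 'm atlas = "'m chart set"

definition chart_at :: "'m atlas \<Rightarrow> 'm \<Rightarrow> 'm chart \<Rightarrow> bool" where
  "chart_at \<A> x \<kappa> \<longleftrightarrow> \<kappa> \<in> \<A> \<and> x \<in> fst \<kappa>"

definition chart_inv :: "'m chart \<Rightarrow> real^2 \<Rightarrow> 'm" where
  "chart_inv \<kappa> = inv_into (fst \<kappa>) (snd \<kappa>)"

definition smooth_surface :: "'m::{t2_space, second_countable_topology} atlas \<Rightarrow> bool" where
  "smooth_surface \<A> \<longleftrightarrow>
    (\<forall>\<kappa>\<in>\<A>. open (fst \<kappa>) \<and> open (snd \<kappa> ` fst \<kappa>) \<and>
       homeomorphism (fst \<kappa>) (snd \<kappa> ` fst \<kappa>) (snd \<kappa>) (chart_inv \<kappa>)) \<and>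
    (\<forall>x. \<exists>\<kappa>. chart_at \<A> x \<kappa>) \<and>
    (\<forall>\<kappa>\<in>\<A>. \<forall>\<kappa>'\<in>\<A>. smooth_on (snd \<kappa> ` (fst \<kappa> \<inter> fst \<kappa>')) (snd \<kappa>' \<circ> chart_inv \<kappa>))"

definition msmooth_on :: "'m atlas \<Rightarrow> 'm set \<Rightarrow> ('m \<Rightarrow> 'b::real_normed_vector) \<Rightarrow> bool" where
  "msmooth_on \<A> W f \<longleftrightarrow> (\<forall>\<kappa>\<in>\<A>. smooth_on (snd \<kappa> ` (fst \<kappa> \<inter> W)) (f \<circ> chart_inv \<kappa>))"

text \<open>A tangent vector at \<open>x\<close> is the family of its components in the charts around \<open>x\<close>, extended
  by zero to all other charts; the components transform with the differentials of the chart
  changes.\<close>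

type_synonym 'm tvec = "'m chart \<Rightarrow> real^2"

instantiation "fun" :: (type, real_vector) real_vector
begin
definition scaleR_fun :: "real \<Rightarrow> ('a \<Rightarrow> 'b) \<Rightarrow> 'a \<Rightarrow> 'b" where
  "scaleR_fun r f = (\<lambda>x. r *\<^sub>R f x)"
instance
  by standard (auto simp: scaleR_fun_def fun_eq_iff scaleR_add_right scaleR_add_left)
end

definition chart_change_deriv :: "'m chart \<Rightarrow> 'm chart \<Rightarrow> 'm \<Rightarrow> real^2 \<Rightarrow> real^2" where
  "chart_change_deriv \<kappa> \<kappa>' x = frechet_derivative (snd \<kappa>' \<circ> chart_inv \<kappa>) (at (snd \<kappa> x))"

definition tangent_space :: "'m atlas \<Rightarrow> 'm \<Rightarrow> 'm tvec set" where
  "tangent_space \<A> x = {v.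
     (\<forall>\<kappa> \<kappa>'. chart_at \<A> x \<kappa> \<and> chart_at \<A> x \<kappa>' \<longrightarrow> v \<kappa>' = chart_change_deriv \<kappa> \<kappa>' x (v \<kappa>)) \<and>
     (\<forall>\<kappa>. \<not> chart_at \<A> x \<kappa> \<longrightarrow> v \<kappa> = 0)}"

text \<open>The tangent vector at \<open>x\<close> with components \<open>w\<close> in the chart \<open>\<kappa>\<close>.\<close>

definition coord_vector :: "'m atlas \<Rightarrow> 'm chart \<Rightarrow> real^2 \<Rightarrow> 'm \<Rightarrow> 'm tvec" where
  "coord_vector \<A> \<kappa> w x = (\<lambda>\<kappa>'. if chart_at \<A> x \<kappa>' then chart_change_deriv \<kappa> \<kappa>' x w else 0)"

text \<open>The differential \<open>df\<^sub>x(v)\<close>, computed in an arbitrary chart around \<open>x\<close>.\<close>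

definition mdiff :: "'m atlas \<Rightarrow> ('m \<Rightarrow> 'b::real_normed_vector) \<Rightarrow> 'm \<Rightarrow> 'm tvec \<Rightarrow> 'b" where
  "mdiff \<A> f x v = (let \<kappa> = (SOME \<kappa>. chart_at \<A> x \<kappa>)
     in frechet_derivative (f \<circ> chart_inv \<kappa>) (at (snd \<kappa> x)) (v \<kappa>))"

definition lie_bracket ::
  "'m atlas \<Rightarrow> ('m \<Rightarrow> 'm tvec) \<Rightarrow> ('m \<Rightarrow> 'm tvec) \<Rightarrow> 'm \<Rightarrow> 'm tvec" where
  "lie_bracket \<A> X Y x = (\<lambda>\<kappa>. if chart_at \<A> x \<kappa>
     then mdiff \<A> (\<lambda>y. Y y \<kappa>) x (X x) - mdiff \<A> (\<lambda>y. X y \<kappa>) x (Y x) else 0)"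

section \<open>Rank two vector bundles\<close>

text \<open>The fibres are subspaces of one real vector space \<open>'v\<close>.  This is no restriction, since \<open>'v\<close> is
  arbitrary: any bundle has its fibres in the direct sum of all of them.  The smooth structure
  is given by local frames \<open>(W, f0, f1)\<close>, and values outside of the domain of a local
  section are irrelevant.\<close>

record ('m, 'v) vb =
  fib :: "'m \<Rightarrow> 'v set"
  frames :: "('m set \<times> ('m \<Rightarrow> 'v) \<times> ('m \<Rightarrow> 'v)) set"

definition section_on ::
  "('m set \<Rightarrow> ('m \<Rightarrow> real) \<Rightarrow> bool) \<Rightarrow> ('m, 'v::real_vector, 'z) vb_scheme \<Rightarrow> 'm set \<Rightarrow>
   ('m \<Rightarrow> 'v) \<Rightarrow> bool" where
  "section_on P V W s \<longleftrightarrow> (\<forall>x\<in>W. s x \<in> fib V x) \<and>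
    (\<forall>(U, f0, f1)\<in>frames V. \<exists>a b. P (U \<inter> W) a \<and> P (U \<inter> W) b \<and>
       (\<forall>x\<in>U \<inter> W. s x = a x *\<^sub>R f0 x + b x *\<^sub>R f1 x))"

definition smooth_section ::
  "'m atlas \<Rightarrow> ('m, 'v::real_vector, 'z) vb_scheme \<Rightarrow> 'm set \<Rightarrow> ('m \<Rightarrow> 'v) \<Rightarrow> bool" where
  "smooth_section \<A> = section_on (msmooth_on \<A>)"

definition continuous_section ::
  "('m::topological_space, 'v::real_vector, 'z) vb_scheme \<Rightarrow> 'm set \<Rightarrow> ('m \<Rightarrow> 'v) \<Rightarrow> bool" where
  "continuous_section = section_on continuous_on"

definition is_basis2 :: "'v::real_vector set \<Rightarrow> 'v \<Rightarrow> 'v \<Rightarrow> bool" where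
  "is_basis2 F a b \<longleftrightarrow> a \<noteq> b \<and> independent {a, b} \<and> span {a, b} = F"

definition vector_bundle ::
  "'m::topological_space atlas \<Rightarrow> ('m, 'v::real_vector, 'z) vb_scheme \<Rightarrow> bool" where
  "vector_bundle \<A> V \<longleftrightarrow>
    (\<forall>x. \<exists>(W, f0, f1)\<in>frames V. x \<in> W) \<and>
    (\<forall>(W, f0, f1)\<in>frames V. open W \<and> (\<forall>x\<in>W. is_basis2 (fib V x) (f0 x) (f1 x)) \<and>
       smooth_section \<A> V W f0 \<and> smooth_section \<A> V W f1)"

definition tangent_bundle :: "'m atlas \<Rightarrow> ('m, 'm tvec) vb" where
  "tangent_bundle \<A> = \<lparr>fib = tangent_space \<A>,
     frames = {(fst \<kappa>, coord_vector \<A> \<kappa> (axis 1 1), coord_vector \<A> \<kappa> (axis 2 1)) | \<kappa>. \<kappa> \<in> \<A>}\<rparr>"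

abbreviation vector_field :: "'m atlas \<Rightarrow> 'm set \<Rightarrow> ('m \<Rightarrow> 'm tvec) \<Rightarrow> bool" where
  "vector_field \<A> \<equiv> smooth_section \<A> (tangent_bundle \<A>)"

text \<open>Additional data: a metric, the set of positively oriented bases, the set of future-directed
  timelike vectors, and a connection, where \<open>nabla V s x X\<close> is \<open>\<nabla>\<^sub>X s\<close> at \<open>x\<close> for a section
  \<open>s\<close> defined near \<open>x\<close>.\<close>

record ('m, 'v) lvb = "('m, 'v) vb" +
  met :: "'m \<Rightarrow> 'v \<Rightarrow> 'v \<Rightarrow> real"
  pos :: "'m \<Rightarrow> ('v \<times> 'v) set"
  fut :: "'m \<Rightarrow> 'v set"
  nabla :: "('m \<Rightarrow> 'v) \<Rightarrow> 'm \<Rightarrow> 'm tvec \<Rightarrow> 'v"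

definition linear_map_on ::
  "'a::real_vector set \<Rightarrow> ('a \<Rightarrow> 'b::real_vector) \<Rightarrow> bool" where
  "linear_map_on F f \<longleftrightarrow>
    (\<forall>a\<in>F. \<forall>b\<in>F. f (a + b) = f a + f b) \<and> (\<forall>r. \<forall>a\<in>F. f (r *\<^sub>R a) = r *\<^sub>R f a)"

definition lorentzian_metric ::
  "'m::topological_space atlas \<Rightarrow> ('m, 'v::real_vector) lvb \<Rightarrow> bool" where
  "lorentzian_metric \<A> V \<longleftrightarrow>
    (\<forall>x. \<forall>a\<in>fib V x. linear_map_on (fib V x) (met V x a) \<and>
       (\<forall>b\<in>fib V x. met V x a b = met V x b a)) \<and>
    (\<forall>x. \<exists>a\<in>fib V x. \<exists>b\<in>fib V x. met V x a a = -1 \<and> met V x b b = 1 \<and> met V x a b = 0) \<and>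
    (\<forall>W s t. open W \<and> smooth_section \<A> V W s \<and> smooth_section \<A> V W t \<longrightarrow>
       msmooth_on \<A> W (\<lambda>x. met V x (s x) (t x)))"

definition connection ::
  "'m::topological_space atlas \<Rightarrow> ('m, 'v::real_vector) lvb \<Rightarrow> bool" where
  "connection \<A> V \<longleftrightarrow>
    (\<forall>W s. open W \<and> smooth_section \<A> V W s \<longrightarrow>
       (\<forall>x\<in>W. linear_map_on (tangent_space \<A> x) (nabla V s x) \<and>
          nabla V s x ` tangent_space \<A> x \<subseteq> fib V x) \<and>
       (\<forall>X. vector_field \<A> W X \<longrightarrow> smooth_section \<A> V W (\<lambda>x. nabla V s x (X x))) \<and>
       (\<forall>t. smooth_section \<A> V W t \<longrightarrow> (\<forall>x\<in>W. \<forall>v\<in>tangent_space \<A> x.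
          nabla V (\<lambda>y. s y + t y) x v = nabla V s x v + nabla V t x v)) \<and>
       (\<forall>f. msmooth_on \<A> W f \<longrightarrow> (\<forall>x\<in>W. \<forall>v\<in>tangent_space \<A> x.
          nabla V (\<lambda>y. f y *\<^sub>R s y) x v = mdiff \<A> f x v *\<^sub>R s x + f x *\<^sub>R nabla V s x v)) \<and>
       (\<forall>t. (\<forall>y\<in>W. t y = s y) \<longrightarrow> (\<forall>x\<in>W. \<forall>v\<in>tangent_space \<A> x. nabla V t x v = nabla V s x v)))"

definition metric_connection ::
  "'m::topological_space atlas \<Rightarrow> ('m, 'v::real_vector) lvb \<Rightarrow> bool" where
  "metric_connection \<A> V \<longleftrightarrow> connection \<A> V \<and>
    (\<forall>W s t. open W \<and> smooth_section \<A> V W s \<and> smooth_section \<A> V W t \<longrightarrow>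
       (\<forall>x\<in>W. \<forall>v\<in>tangent_space \<A> x. mdiff \<A> (\<lambda>y. met V y (s y) (t y)) x v =
          met V x (nabla V s x v) (t x) + met V x (s x) (nabla V t x v)))"

definition torsion_free ::
  "'m::topological_space atlas \<Rightarrow> ('m, 'm tvec) lvb \<Rightarrow> bool" where
  "torsion_free \<A> T \<longleftrightarrow> (\<forall>W X Y. open W \<and> vector_field \<A> W X \<and> vector_field \<A> W Y \<longrightarrow>
     (\<forall>x\<in>W. nabla T Y x (X x) - nabla T X x (Y x) = lie_bracket \<A> X Y x))"

definition space_time_oriented :: "('m::topological_space, 'v::real_vector) lvb \<Rightarrow> bool" where
  "space_time_oriented V \<longleftrightarrow>
    (\<forall>x. \<exists>a b. is_basis2 (fib V x) a b \<and>
       pos V x = {(\<alpha> *\<^sub>R a + \<beta> *\<^sub>R b, \<gamma> *\<^sub>R a + \<delta> *\<^sub>R b) | \<alpha> \<beta> \<gamma> \<delta>. \<alpha> * \<delta> - \<beta> * \<gamma> > 0}) \<and>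
    (\<forall>x. \<exists>W s t. open W \<and> x \<in> W \<and> continuous_section V W s \<and> continuous_section V W t \<and>
       (\<forall>y\<in>W. (s y, t y) \<in> pos V y)) \<and>
    (\<forall>x. \<exists>\<tau>\<in>fib V x. met V x \<tau> \<tau> < 0 \<and>
       fut V x = {v \<in> fib V x. met V x v v < 0 \<and> met V x v \<tau> < 0}) \<and>
    (\<forall>x. \<exists>W \<tau>. open W \<and> x \<in> W \<and> continuous_section V W \<tau> \<and> (\<forall>y\<in>W. \<tau> y \<in> fut V y))"

text \<open>Lorentzian bundles of rank 2, with a compatible connection, oriented in space and in time.\<close>

definition oriented_lorentzian_bundle ::
  "'m::topological_space atlas \<Rightarrow> ('m, 'v::real_vector) lvb \<Rightarrow> bool" where
  "oriented_lorentzian_bundle \<A> V \<longleftrightarrow> vector_bundle \<A> V \<and> lorentzian_metric \<A> V \<and>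
     metric_connection \<A> V \<and> space_time_oriented V"

text \<open>Lorentzian surfaces, oriented in space and in time; \<open>T\<close> is the tangent bundle with the
  Lorentzian metric, its Levi-Civita connection and the orientations.\<close>

definition oriented_lorentzian_surface ::
  "'m::{t2_space, second_countable_topology} atlas \<Rightarrow> ('m, 'm tvec) lvb \<Rightarrow> bool" where
  "oriented_lorentzian_surface \<A> T \<longleftrightarrow> smooth_surface \<A> \<and> vb.truncate T = tangent_bundle \<A> \<and>
     oriented_lorentzian_bundle \<A> T \<and> torsion_free \<A> T"

text \<open>Positively oriented orthonormal bases with a future-directed first vector.\<close>

definition oframes :: "('m, 'v) lvb \<Rightarrow> 'm \<Rightarrow> ('v \<times> 'v) set" where
  "oframes V x = {(a, b). (a, b) \<in> pos V x \<and> a \<in> fut V x \<and>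
     met V x a a = -1 \<and> met V x b b = 1 \<and> met V x a b = 0}"

text \<open>Coordinates of a vector in such a basis.\<close>

fun ocoords :: "('m, 'v) lvb \<Rightarrow> 'm \<Rightarrow> 'v \<times> 'v \<Rightarrow> 'v \<Rightarrow> real \<times> real" where
  "ocoords V x (a, b) v = (- met V x v a, met V x v b)"

definition bundle_curvature ::
  "'m atlas \<Rightarrow> ('m, 'v::real_vector) lvb \<Rightarrow> ('m \<Rightarrow> 'm tvec) \<Rightarrow> ('m \<Rightarrow> 'm tvec) \<Rightarrow>
   ('m \<Rightarrow> 'v) \<Rightarrow> 'm \<Rightarrow> 'v" where
  "bundle_curvature \<A> V X Y s x =
     nabla V (\<lambda>y. nabla V s y (Y y)) x (X x) - nabla V (\<lambda>y. nabla V s y (X y)) x (Y x)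
     - nabla V s x (lie_bracket \<A> X Y x)"

section \<open>The fundamental equations\<close>

definition symmetric_bilinear_map ::
  "'m::topological_space atlas \<Rightarrow> ('m, 'v::real_vector) lvb \<Rightarrow>
   ('m \<Rightarrow> 'm tvec \<Rightarrow> 'm tvec \<Rightarrow> 'v) \<Rightarrow> bool" where
  "symmetric_bilinear_map \<A> E B \<longleftrightarrow>
    (\<forall>x. \<forall>X\<in>tangent_space \<A> x. linear_map_on (tangent_space \<A> x) (B x X) \<and>
       (\<forall>Y\<in>tangent_space \<A> x. B x X Y \<in> fib E x \<and> B x X Y = B x Y X)) \<and>
    (\<forall>W X Y. open W \<and> vector_field \<A> W X \<and> vector_field \<A> W Y \<longrightarrow>
       smooth_section \<A> E W (\<lambda>x. B x (X x) (Y x)))"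

text \<open>The adjoint \<open>S\<^sub>\<nu>\<close> with \<open>\<langle>S\<^sub>\<nu> X, Y\<rangle> = \<langle>B(X, Y), \<nu>\<rangle>\<close>.\<close>

definition shape_operator ::
  "('m, 'm tvec) lvb \<Rightarrow> ('m, 'v::real_vector) lvb \<Rightarrow> ('m \<Rightarrow> 'm tvec \<Rightarrow> 'm tvec \<Rightarrow> 'v) \<Rightarrow>
   'm \<Rightarrow> 'v \<Rightarrow> 'm tvec \<Rightarrow> 'm tvec" where
  "shape_operator T E B x \<nu> X =
     (THE Z. Z \<in> fib T x \<and> (\<forall>Y\<in>fib T x. met T x Z Y = met E x (B x X Y) \<nu>))"

definition oframe_on ::
  "'m atlas \<Rightarrow> ('m, 'v::real_vector) lvb \<Rightarrow> 'm set \<Rightarrow> ('m \<Rightarrow> 'v) \<Rightarrow> ('m \<Rightarrow> 'v) \<Rightarrow> bool" where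
  "oframe_on \<A> V W a b \<longleftrightarrow> smooth_section \<A> V W a \<and> smooth_section \<A> V W b \<and>
     (\<forall>x\<in>W. (a x, b x) \<in> oframes V x)"

text \<open>The sectional curvature of the tangent plane, in terms of a local frame.\<close>

definition gauss_curvature ::
  "'m atlas \<Rightarrow> ('m, 'm tvec) lvb \<Rightarrow> ('m \<Rightarrow> 'm tvec) \<Rightarrow> ('m \<Rightarrow> 'm tvec) \<Rightarrow> 'm \<Rightarrow> real" where
  "gauss_curvature \<A> T X Y x = met T x (bundle_curvature \<A> T X Y Y x) (X x) /
     (met T x (X x) (X x) * met T x (Y x) (Y x) - (met T x (X x) (Y x))\<^sup>2)"

definition gauss_equation ::
  "'m::topological_space atlas \<Rightarrow> ('m, 'm tvec) lvb \<Rightarrow> ('m, 'v::real_vector) lvb \<Rightarrow>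
   ('m \<Rightarrow> 'm tvec \<Rightarrow> 'm tvec \<Rightarrow> 'v) \<Rightarrow> bool" where
  "gauss_equation \<A> T E B \<longleftrightarrow> (\<forall>W e2 e3. open W \<and> oframe_on \<A> T W e2 e3 \<longrightarrow>
     (\<forall>x\<in>W. gauss_curvature \<A> T e2 e3 x =
        met E x (B x (e2 x) (e3 x)) (B x (e2 x) (e3 x)) -
        met E x (B x (e2 x) (e2 x)) (B x (e3 x) (e3 x))))"

definition ricci_equation ::
  "'m::topological_space atlas \<Rightarrow> ('m, 'm tvec) lvb \<Rightarrow> ('m, 'v::real_vector) lvb \<Rightarrow>
   ('m \<Rightarrow> 'm tvec \<Rightarrow> 'm tvec \<Rightarrow> 'v) \<Rightarrow> bool" where
  "ricci_equation \<A> T E B \<longleftrightarrow>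
    (\<forall>W e0 e1 e2 e3. open W \<and> oframe_on \<A> E W e0 e1 \<and> oframe_on \<A> T W e2 e3 \<longrightarrow>
     (\<forall>x\<in>W. let S = shape_operator T E B x in
        met E x (bundle_curvature \<A> E e2 e3 e0 x) (e1 x) =
        met T x (S (e0 x) (S (e1 x) (e2 x)) - S (e1 x) (S (e0 x) (e2 x))) (e3 x)))"

definition deriv_bilinear ::
  "('m, 'm tvec) lvb \<Rightarrow> ('m, 'v::real_vector) lvb \<Rightarrow> ('m \<Rightarrow> 'm tvec \<Rightarrow> 'm tvec \<Rightarrow> 'v) \<Rightarrow>
   ('m \<Rightarrow> 'm tvec) \<Rightarrow> ('m \<Rightarrow> 'm tvec) \<Rightarrow> ('m \<Rightarrow> 'm tvec) \<Rightarrow> 'm \<Rightarrow> 'v" where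
  "deriv_bilinear T E B X Y Z x = nabla E (\<lambda>y. B y (Y y) (Z y)) x (X x)
     - B x (nabla T Y x (X x)) (Z x) - B x (Y x) (nabla T Z x (X x))"

definition codazzi_equation ::
  "'m::topological_space atlas \<Rightarrow> ('m, 'm tvec) lvb \<Rightarrow> ('m, 'v::real_vector) lvb \<Rightarrow>
   ('m \<Rightarrow> 'm tvec \<Rightarrow> 'm tvec \<Rightarrow> 'v) \<Rightarrow> bool" where
  "codazzi_equation \<A> T E B \<longleftrightarrow>
    (\<forall>W X Y Z. open W \<and> vector_field \<A> W X \<and> vector_field \<A> W Y \<and> vector_field \<A> W Z \<longrightarrow>
     (\<forall>x\<in>W. deriv_bilinear T E B X Y Z x - deriv_bilinear T E B Y X Z x = 0))"

section \<open>Spin structures\<close>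

text \<open>A principal bundle with structure group \<open>G \<subseteq> hac\<close> (under \<open>\<otimes>\<close>) and right action \<open>sact\<close>.
  Its smooth structure is given by local sections.  The map \<open>sframe\<close> is the projection to the
  bundle of oriented orthonormal frames.\<close>

record ('m, 'v, 'q) spin_bundle =
  sfib :: "'m \<Rightarrow> 'q set"
  sact :: "'q \<Rightarrow> hac \<Rightarrow> 'q"
  ssecs :: "('m set \<times> ('m \<Rightarrow> 'q)) set"
  sframe :: "'q \<Rightarrow> 'v \<times> 'v"

definition smooth_principal_section ::
  "'m atlas \<Rightarrow> hac set \<Rightarrow> ('m, 'v, 'q) spin_bundle \<Rightarrow> 'm set \<Rightarrow> ('m \<Rightarrow> 'q) \<Rightarrow> bool" where
  "smooth_principal_section \<A> G S W s \<longleftrightarrow> (\<forall>x\<in>W. s x \<in> sfib S x) \<and>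
    (\<forall>(U, t)\<in>ssecs S. \<exists>g. msmooth_on \<A> (U \<inter> W) g \<and>
       (\<forall>x\<in>U \<inter> W. g x \<in> G \<and> s x = sact S (t x) (g x)))"

definition principal_bundle ::
  "'m::topological_space atlas \<Rightarrow> hac set \<Rightarrow> ('m, 'v, 'q) spin_bundle \<Rightarrow> bool" where
  "principal_bundle \<A> G S \<longleftrightarrow>
    (\<forall>x y. x \<noteq> y \<longrightarrow> sfib S x \<inter> sfib S y = {}) \<and>
    (\<forall>x. \<forall>q\<in>sfib S x. sact S q hone = q \<and>
       (\<forall>g\<in>G. sact S q g \<in> sfib S x \<and> (\<forall>h\<in>G. sact S (sact S q g) h = sact S q (g \<otimes> h))) \<and>
       (\<forall>q'\<in>sfib S x. \<exists>!g. g \<in> G \<and> q' = sact S q g)) \<and>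
    (\<forall>x. \<exists>(W, s)\<in>ssecs S. x \<in> W) \<and>
    (\<forall>(W, s)\<in>ssecs S. open W \<and> smooth_principal_section \<A> G S W s)"

text \<open>The Clifford action is compatible with a change \<open>p = g p'\<close> of spinor coordinates if vector
  coordinates change by \<open>z = g z' (hhat g)\<^sup>-\<^sup>1\<close>, where \<open>(hhat g)\<^sup>-\<^sup>1\<close> is the conjugate of \<open>hhat g\<close> on the
  groups considered here.  This is the double cover of the identity component of the
  orthogonal group along which \<open>sframe\<close> is equivariant.  The map \<open>\<iota>\<close> sends the coordinates of a
  vector in an orthonormal basis to the quaternion representing it.\<close>

definition spin_structure ::
  "'m::topological_space atlas \<Rightarrow> hac set \<Rightarrow> (real \<times> real \<Rightarrow> hac) \<Rightarrow>
   ('m, 'v::real_vector) lvb \<Rightarrow> ('m, 'v, 'q) spin_bundle \<Rightarrow> bool" where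
  "spin_structure \<A> G \<iota> V S \<longleftrightarrow> principal_bundle \<A> G S \<and>
    (\<forall>x. \<forall>q\<in>sfib S x. sframe S q \<in> oframes V x \<and>
       (\<forall>g\<in>G. \<forall>X\<in>fib V x. \<iota> (ocoords V x (sframe S q) X) =
          g \<otimes> \<iota> (ocoords V x (sframe S (sact S q g)) X) \<otimes> hconj (hhat g))) \<and>
    (\<forall>(W, s)\<in>ssecs S. oframe_on \<A> V W (fst \<circ> sframe S \<circ> s) (snd \<circ> sframe S \<circ> s))"

fun iotaE :: "real \<times> real \<Rightarrow> hac" where
  "iotaE (x0, x1) = r22_to_hac (x0, x1, 0, 0)"

fun iotaM :: "real \<times> real \<Rightarrow> hac" where
  "iotaM (x2, x3) = r22_to_hac (0, 0, x2, x3)"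

abbreviation spin_structure_normal ::
  "'m::topological_space atlas \<Rightarrow> ('m, 'v::real_vector) lvb \<Rightarrow> ('m, 'v, 'q) spin_bundle \<Rightarrow> bool" where
  "spin_structure_normal \<A> \<equiv> spin_structure \<A> SpinE iotaE"

abbreviation spin_structure_tangent ::
  "'m::topological_space atlas \<Rightarrow> ('m, 'm tvec) lvb \<Rightarrow> ('m, 'm tvec, 'q) spin_bundle \<Rightarrow> bool" where
  "spin_structure_tangent \<A> \<equiv> spin_structure \<A> SpinM iotaM"

section \<open>Spinor fields\<close>

text \<open>The data on \<open>M\<close>: the bundles \<open>E\<close> and \<open>TM\<close>, and the spin structures of both.\<close>

record ('m, 'v, 'q, 'p) spin_data =
  atl :: "'m atlas"
  bT :: "('m, 'm tvec) lvb"
  bE :: "('m, 'v) lvb"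
  sT :: "('m, 'm tvec, 'p) spin_bundle"
  sE :: "('m, 'v, 'q) spin_bundle"

text \<open>An element of the associated bundle \<open>\<Sigma>\<close> is an equivalence class of pairs of a spinorial frame
  and an element of \<open>H0\<close>, where \<open>(q g, p)\<close> and \<open>(q, g p)\<close> are identified.  Operations on
  spinors are carried out on representatives with a common spinorial frame.\<close>

type_synonym ('q, 'p) spinor = "(('q \<times> 'p) \<times> hac) set"

definition spin_frames :: "('m, 'v, 'q, 'p) spin_data \<Rightarrow> 'm \<Rightarrow> ('q \<times> 'p) set" where
  "spin_frames D x = sfib (sE D) x \<times> sfib (sT D) x"

fun spinor_class ::
  "('m, 'v, 'q, 'p) spin_data \<Rightarrow> 'q \<times> 'p \<Rightarrow> hac \<Rightarrow> ('q, 'p) spinor" where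
  "spinor_class D (q1, q2) p = {((sact (sE D) q1 g1, sact (sT D) q2 g2), p') | g1 g2 p'.
     g1 \<in> SpinE \<and> g2 \<in> SpinM \<and> p' \<in> H0 \<and> p = g1 \<otimes> g2 \<otimes> p'}"

definition spinor_fibre :: "('m, 'v, 'q, 'p) spin_data \<Rightarrow> 'm \<Rightarrow> ('q, 'p) spinor set" where
  "spinor_fibre D x = {spinor_class D q p | q p. q \<in> spin_frames D x \<and> p \<in> H0}"

definition spinor_coord :: "('q, 'p) spinor \<Rightarrow> 'q \<times> 'p \<Rightarrow> hac" where
  "spinor_coord \<psi> q = (THE p. (q, p) \<in> \<psi>)"

text \<open>The space \<open>\<Gamma>(\<Sigma>)\<close>.\<close>

definition spinor_fields :: "('m, 'v, 'q, 'p) spin_data \<Rightarrow> ('m \<Rightarrow> ('q, 'p) spinor) set" where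
  "spinor_fields D = {\<phi>. (\<forall>x. \<phi> x \<in> spinor_fibre D x) \<and>
     (\<forall>(W1, s1)\<in>ssecs (sE D). \<forall>(W2, s2)\<in>ssecs (sT D).
        msmooth_on (atl D) (W1 \<inter> W2) (\<lambda>x. spinor_coord (\<phi> x) (s1 x, s2 x)))}"

definition spinor_add :: "('q, 'p) spinor \<Rightarrow> ('q, 'p) spinor \<Rightarrow> ('q, 'p) spinor" where
  "spinor_add \<psi> \<psi>' = {(q, p + p') | q p p'. (q, p) \<in> \<psi> \<and> (q, p') \<in> \<psi>'}"

definition spinor_scale :: "real \<Rightarrow> ('q, 'p) spinor \<Rightarrow> ('q, 'p) spinor" where
  "spinor_scale r \<psi> = {(q, r *\<^sub>R p) | q p. (q, p) \<in> \<psi>}"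

definition spinor_right :: "('q, 'p) spinor \<Rightarrow> hac \<Rightarrow> ('q, 'p) spinor" where
  "spinor_right \<psi> a = {(q, p \<otimes> a) | q p. (q, p) \<in> \<psi>}"

definition spinor_H :: "('q, 'p) spinor \<Rightarrow> ('q, 'p) spinor \<Rightarrow> ac" where
  "spinor_H \<psi> \<psi>' = (THE h. \<exists>q p p'. (q, p) \<in> \<psi> \<and> (q, p') \<in> \<psi>' \<and> h = hform p p')"

definition spinor_pairing :: "('q, 'p) spinor \<Rightarrow> ('q, 'p) spinor \<Rightarrow> hac" where
  "spinor_pairing \<psi> \<psi>' = (THE h. \<exists>q p p'. (q, p) \<in> \<psi> \<and> (q, p') \<in> \<psi>' \<and>
     h = hscale (asigma \<i>) (hconj p' \<otimes> p))"

text \<open>The quaternion \<open>[X]\<close> representing \<open>X \<in> E \<oplus> TM\<close> in a spinorial frame.\<close>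

fun vector_coord ::
  "('m, 'v, 'q, 'p) spin_data \<Rightarrow> 'm \<Rightarrow> 'q \<times> 'p \<Rightarrow> 'v \<times> 'm tvec \<Rightarrow> hac" where
  "vector_coord D x (q1, q2) (\<nu>, X) =
     iotaE (ocoords (bE D) x (sframe (sE D) q1) \<nu>) + iotaM (ocoords (bT D) x (sframe (sT D) q2) X)"

definition clifford ::
  "('m, 'v, 'q, 'p) spin_data \<Rightarrow> 'm \<Rightarrow> 'v \<times> 'm tvec \<Rightarrow> ('q, 'p) spinor \<Rightarrow> ('q, 'p) spinor" where
  "clifford D x Z \<psi> = {(q, clifford_coord (vector_coord D x q Z) p) | q p. (q, p) \<in> \<psi>}"

text \<open>The spinor \<open>\<nabla>\<^sub>X \<phi>\<close> at \<open>x\<close> is \<open>\<psi>\<close>.  In a local section of the spin bundles over the frame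
  \<open>(e0, e1, e2, e3)\<close>, a connection acts on spinors by
  \<open>\<partial>\<^sub>X + 1/2 \<Sum> \<epsilon>\<^sub>j \<epsilon>\<^sub>k \<langle>\<nabla>\<^sub>X e\<^sub>j, e\<^sub>k\<rangle> e\<^sub>j \<cdot> e\<^sub>k \<cdot>\<close> (sum over \<open>j < k\<close>); for the direct sum connection
  on \<open>E \<oplus> TM\<close> only the pairs \<open>(0, 1)\<close> and \<open>(2, 3)\<close> contribute, and
  \<open>\<epsilon>\<^sub>0 \<epsilon>\<^sub>1 = \<epsilon>\<^sub>2 \<epsilon>\<^sub>3 = -1\<close>.\<close>

definition has_spinor_deriv ::
  "('m::topological_space, 'v::real_vector, 'q, 'p) spin_data \<Rightarrow> ('m \<Rightarrow> ('q, 'p) spinor) \<Rightarrow>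
   'm \<Rightarrow> 'm tvec \<Rightarrow> ('q, 'p) spinor \<Rightarrow> bool" where
  "has_spinor_deriv D \<phi> x X \<psi> \<longleftrightarrow> \<psi> \<in> spinor_fibre D x \<and>
    (\<forall>W s1 s2. open W \<and> x \<in> W \<and> smooth_principal_section (atl D) SpinE (sE D) W s1 \<and>
       smooth_principal_section (atl D) SpinM (sT D) W s2 \<longrightarrow>
     (let p = (\<lambda>y. spinor_coord (\<phi> y) (s1 y, s2 y));
          e0 = (\<lambda>y. fst (sframe (sE D) (s1 y))); e1 = (\<lambda>y. snd (sframe (sE D) (s1 y)));
          e2 = (\<lambda>y. fst (sframe (sT D) (s2 y))); e3 = (\<lambda>y. snd (sframe (sT D) (s2 y)));
          c = (\<lambda>Z. clifford_coord (vector_coord D x (s1 x, s2 x) Z))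
      in spinor_coord \<psi> (s1 x, s2 x) = mdiff (atl D) p x X
         - (1/2 * met (bE D) x (nabla (bE D) e0 x X) (e1 x)) *\<^sub>R c (e0 x, 0) (c (e1 x, 0) (p x))
         - (1/2 * met (bT D) x (nabla (bT D) e2 x X) (e3 x)) *\<^sub>R c (0, e2 x) (c (0, e3 x) (p x))))"

text \<open>The action of \<open>\<eta>(X)\<close>, written in a basis \<open>(e2, e3)\<close> of the tangent plane at \<open>x\<close>.\<close>

definition eta_action ::
  "('m, 'v::real_vector, 'q, 'p) spin_data \<Rightarrow> ('m \<Rightarrow> 'm tvec \<Rightarrow> 'm tvec \<Rightarrow> 'v) \<Rightarrow> 'm \<Rightarrow>
   'm tvec \<Rightarrow> 'm tvec \<Rightarrow> 'm tvec \<Rightarrow> ('q, 'p) spinor \<Rightarrow> ('q, 'p) spinor" where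
  "eta_action D B x e2 e3 X \<psi> =
    (let t = (\<lambda>e. spinor_scale (met (bT D) x e e) (clifford D x (0, e) (clifford D x (B x X e, 0) \<psi>)))
     in spinor_scale (- 1/2) (spinor_add (t e2) (t e3)))"

text \<open>Solutions \<open>\<phi> \<in> \<Gamma>(\<Sigma>)\<close> of \<open>\<nabla>\<^sub>X \<phi> = \<eta>(X) \<cdot> \<phi>\<close> with \<open>H(\<phi>, \<phi>) = 1\<close>.\<close>

definition spinor_solution ::
  "('m::topological_space, 'v::real_vector, 'q, 'p) spin_data \<Rightarrow>
   ('m \<Rightarrow> 'm tvec \<Rightarrow> 'm tvec \<Rightarrow> 'v) \<Rightarrow> ('m \<Rightarrow> ('q, 'p) spinor) \<Rightarrow> bool" where
  "spinor_solution D B \<phi> \<longleftrightarrow> \<phi> \<in> spinor_fields D \<and>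
    (\<forall>x. \<forall>X\<in>tangent_space (atl D) x. \<forall>(e2, e3)\<in>oframes (bT D) x.
       has_spinor_deriv D \<phi> x X (eta_action D B x e2 e3 X (\<phi> x))) \<and>
    (\<forall>x. spinor_H (\<phi> x) (\<phi> x) = aconst 1)"

text \<open>Solutions \<open>F\<close> of \<open>dF = \<xi>\<close> with \<open>\<xi>(X) = \<langle>\<langle>X \<cdot> \<phi>, \<phi>\<rangle>\<rangle>\<close>, where \<open>r22\<close> is embedded into \<open>hac\<close>
  by the linear map \<open>r22_to_hac\<close>.\<close>

definition immersion_solution ::
  "('m::topological_space, 'v::real_vector, 'q, 'p) spin_data \<Rightarrow>
   ('m \<Rightarrow> ('q, 'p) spinor) \<Rightarrow> ('m \<Rightarrow> r22) \<Rightarrow> bool" where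
  "immersion_solution D \<phi> F \<longleftrightarrow> msmooth_on (atl D) UNIV F \<and>
    (\<forall>x. \<forall>X\<in>tangent_space (atl D) x.
       r22_to_hac (mdiff (atl D) F x X) = spinor_pairing (clifford D x (0, X) (\<phi> x)) (\<phi> x))"

section \<open>Isometric immersions\<close>

definition isometric_immersion ::
  "'m atlas \<Rightarrow> ('m, 'm tvec) lvb \<Rightarrow> ('m \<Rightarrow> r22) \<Rightarrow> bool" where
  "isometric_immersion \<A> T F \<longleftrightarrow> msmooth_on \<A> UNIV F \<and>
    (\<forall>x. inj_on (mdiff \<A> F x) (tangent_space \<A> x)) \<and>
    (\<forall>x. \<forall>X\<in>tangent_space \<A> x. \<forall>Y\<in>tangent_space \<A> x.
       metric22 (mdiff \<A> F x X) (mdiff \<A> F x Y) = met T x X Y)"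

definition normal_space :: "'m atlas \<Rightarrow> ('m \<Rightarrow> r22) \<Rightarrow> 'm \<Rightarrow> r22 set" where
  "normal_space \<A> F x = {n. \<forall>X\<in>tangent_space \<A> x. metric22 n (mdiff \<A> F x X) = 0}"

definition normal_part :: "'m atlas \<Rightarrow> ('m \<Rightarrow> r22) \<Rightarrow> 'm \<Rightarrow> r22 \<Rightarrow> r22" where
  "normal_part \<A> F x w =
     (THE n. n \<in> normal_space \<A> F x \<and> w - n \<in> mdiff \<A> F x ` tangent_space \<A> x)"

text \<open>\<open>F\<close> has normal bundle \<open>E\<close> and second fundamental form \<open>B\<close>: there is a bundle isometry \<open>\<Theta>\<close> from
  \<open>E\<close> to the normal bundle, mapping the connection of \<open>E\<close> to the normal connection and \<open>B\<close> to
  the normal part of \<open>\<partial>\<^sub>X(dF(Y))\<close>.\<close>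

definition has_normal_bundle_and_form ::
  "'m::topological_space atlas \<Rightarrow> ('m, 'v::real_vector) lvb \<Rightarrow>
   ('m \<Rightarrow> 'm tvec \<Rightarrow> 'm tvec \<Rightarrow> 'v) \<Rightarrow> ('m \<Rightarrow> r22) \<Rightarrow> bool" where
  "has_normal_bundle_and_form \<A> E B F \<longleftrightarrow> (\<exists>\<Theta>.
    (\<forall>x. linear_map_on (fib E x) (\<Theta> x) \<and> bij_betw (\<Theta> x) (fib E x) (normal_space \<A> F x) \<and>
       (\<forall>\<nu>\<in>fib E x. \<forall>\<mu>\<in>fib E x. metric22 (\<Theta> x \<nu>) (\<Theta> x \<mu>) = met E x \<nu> \<mu>)) \<and>
    (\<forall>W s. open W \<and> smooth_section \<A> E W s \<longrightarrow>
       msmooth_on \<A> W (\<lambda>x. \<Theta> x (s x)) \<and>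
       (\<forall>x\<in>W. \<forall>X\<in>tangent_space \<A> x. \<Theta> x (nabla E s x X) =
          normal_part \<A> F x (mdiff \<A> (\<lambda>y. \<Theta> y (s y)) x X))) \<and>
    (\<forall>W Y. open W \<and> vector_field \<A> W Y \<longrightarrow>
       (\<forall>x\<in>W. \<forall>X\<in>tangent_space \<A> x. \<Theta> x (B x X (Y x)) =
          normal_part \<A> F x (mdiff \<A> (\<lambda>y. mdiff \<A> F y (Y y)) x X))))"

end

theory Submission
  imports Defs
begin

text \<open>In an adapted section of the spin bundles, lying over an orthonormal frame \<open>(e0, e1)\<close> of \<open>E\<close> and
  \<open>(e2, e3)\<close> of \<open>TM\<close>, the spinor equation reads \<open>dp = u p\<close> for the coordinate \<open>p\<close> of the spinor.  Here
  \<open>u\<close> is a one-form with values in the Lie algebra of \<open>Spin(2,2)\<close> (\<open>lie_at\<close>, \<open>has_spinor_deriv_eta\<close>),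
  whose six components are the connection forms of \<open>E\<close> and \<open>TM\<close> and the four components of \<open>B\<close>.
  The reason for the theorem is that the Ricci equation, the Gauss equation and the Codazzi equations
  are, component by component, the flatness condition \<open>du = u \<and> u\<close> (\<open>lie_at_flat\<close>).

  A flat linear system has a local solution with any given value at a point
  (\<open>flat_linear_system_local_solution\<close>; this is the Frobenius theorem in the linear case and in two
  variables, proved by Picard iteration).  Since \<open>u\<close> takes values in the Lie algebra,
  \<open>hconj p \<otimes> p'\<close> is constant for any two local solutions (\<open>hconj_hmul_constant\<close>).  Applied to \<open>p = p'\<close>
  this keeps the solution in the group \<open>Spin22\<close> when it starts there, and in general it says that two
  normalized solutions differ by right-multiplication with a constant element of \<open>Spin22\<close>.
  The equation does not depend on the adapted section (\<open>section_change\<close>), and therefore the local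
  solutions are spinor fields.  They form a locally constant sheaf.  On a simply connected surface,
  continuation along paths turns a local solution into a global one (\<open>global_solution\<close>).

  A solution \<open>\<phi>\<close> trivializes \<open>E \<oplus> TM\<close>: the map \<open>Z \<mapsto> \<langle>\<langle>Z \<cdot> \<phi>, \<phi>\<rangle>\<rangle>\<close> (\<open>ambient\<close>) is at each point an
  isometry onto \<open>\<real>\<^sup>2\<^sup>,\<^sup>2\<close>, because in coordinates it is the rotation \<open>z \<mapsto> - (hconj p \<otimes> z \<otimes> hhat p)\<close> by
  a unit spinor.  The spinor equation becomes the statement that the directional derivative in
  \<open>\<real>\<^sup>2\<^sup>,\<^sup>2\<close> of the image of a section \<open>\<nu> + Y\<close> is the image of
  \<open>\<nabla>\<^sub>X \<nu> + B(X, Y) + \<nabla>\<^sub>X Y - S\<^sub>\<nu> X\<close> (\<open>ambient_deriv\<close>).  These are the Gauss and Weingarten formulas.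
  The tangential case \<open>\<nu> = 0\<close>, the symmetry of \<open>B\<close> and the absence of torsion show that the one-form
  \<open>\<xi>(X) = \<langle>\<langle>X \<cdot> \<phi>, \<phi>\<rangle>\<rangle>\<close> is closed, so that \<open>dF = \<xi>\<close> has a solution, by the same two existence theorems.
  Its differential is the trivialization restricted to \<open>TM\<close>; hence \<open>F\<close> is an isometric immersion, its
  normal bundle is the image of \<open>E\<close>, and the normal parts of the formulas above say that the connection
  of \<open>E\<close> is the normal connection and \<open>B\<close> the second fundamental form.\<close>

section \<open>Flat linear systems in two variables\<close>

lemma scaled_mem_interval:
  fixes x :: real assumes "x \<in> {-h..h}" "t \<in> {0..1}" shows "t * x \<in> {-h..h}"
proof -
  have "\<bar>t * x\<bar> \<le> 1 * \<bar>x\<bar>" unfolding abs_mult using assms by (intro mult_right_mono) auto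
  then show ?thesis using assms by auto
qed

text \<open>The integral from \<open>0\<close> to \<open>x\<close> is written as \<open>x\<close> times an integral over the unit interval.  In this form
  both signs of \<open>x\<close> are covered, and the dependence on parameters is governed by the theorems on
  integrals over a fixed interval.\<close>

lemma scaled_integral_of_derivative:
  fixes f :: "real \<Rightarrow> 'b::banach"
  assumes g: "\<And>x. x \<in> {-h..h} \<Longrightarrow> (g has_vector_derivative f x) (at x within {-h..h})"
    and x: "x \<in> {-h..h}"
  shows "x *\<^sub>R integral {0..1} (\<lambda>t. f (t * x)) = g x - g 0"
proof -
  have sub: "(\<lambda>t. t * x) ` {0..1} \<subseteq> {-h..h}"
    using scaled_mem_interval[OF x] by blast
  have "((\<lambda>t. x *\<^sub>R f (t * x)) has_integral (g (1 * x) - g (0 * x))) {0..1}"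
  proof (rule fundamental_theorem_of_calculus[of 0 1 "\<lambda>t. g (t * x)"])
    fix t :: real assume t: "t \<in> {0..1}"
    have "t * x \<in> {-h..h}" using sub t by blast
    then have "(g has_vector_derivative f (t * x)) (at (t * x) within (\<lambda>t. t * x) ` {0..1})"
      by (intro has_vector_derivative_within_subset[OF g sub])
    moreover have "((\<lambda>t. t * x) has_vector_derivative x) (at t within {0..1})"
      by (auto intro!: derivative_eq_intros)
    ultimately have "((g \<circ> (\<lambda>t. t * x)) has_vector_derivative x *\<^sub>R f (t * x)) (at t within {0..1})"
      by (rule vector_diff_chain_within[rotated])
    then show "((\<lambda>t. g (t * x)) has_vector_derivative x *\<^sub>R f (t * x)) (at t within {0..1})"
      by (simp add: o_def)
  qed simp
  then have "integral {0..1} (\<lambda>t. x *\<^sub>R f (t * x)) = g (1 * x) - g (0 * x)"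
    by (rule integral_unique)
  then show ?thesis by simp
qed

lemma has_vector_derivative_scaled_integral:
  fixes f :: "real \<Rightarrow> 'b::banach"
  assumes f: "continuous_on {-h..h} f" and y: "y \<in> {-h..h}"
  shows "((\<lambda>y. y *\<^sub>R integral {0..1} (\<lambda>t. f (t * y))) has_vector_derivative f y) (at y within {-h..h})"
proof -
  obtain g where g: "\<And>x. x \<in> {-h..h} \<Longrightarrow> (g has_vector_derivative f x) (at x within {-h..h})"
    using antiderivative_continuous[OF f] by blast
  have "((\<lambda>y. g y - g 0) has_vector_derivative f y) (at y within {-h..h})"
    using g[OF y] by (auto intro!: derivative_eq_intros)
  then show ?thesis
    using scaled_integral_of_derivative[OF g] y by (auto intro: has_vector_derivative_transform)
qed

lemma square_eq_Times: "cbox (-h, -h) (h, h) = {-h..h} \<times> {-h..(h::real)}"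
  by (simp add: cbox_Pair_eq)

text \<open>The right-hand side transports \<open>c\<close> along the first axis with \<open>a\<close> and then parallel to the second axis
  with \<open>b\<close>.  As a map of \<open>p\<close> it has the Lipschitz constant \<open>2 h K \<le> 1/2\<close> in the supremum norm, and the
  Banach fixed point theorem applies.\<close>

lemma volterra_equation_on_square:
  fixes a b :: "real \<times> real \<Rightarrow> 'a::real_normed_vector" and c :: "'b::banach"
    and mul :: "'a \<Rightarrow> 'b \<Rightarrow> 'b" and h :: real
  defines "Q \<equiv> cbox (-h, -h) (h, h)"
  assumes bil: "bounded_bilinear mul"
    and a: "continuous_on Q a" and b: "continuous_on Q b"
    and h: "0 \<le> h" "4 * h * K \<le> 1" and K0: "0 \<le> K"
    and Ka: "\<And>z v. z \<in> Q \<Longrightarrow> norm (mul (a z) v) \<le> K * norm v"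
    and Kb: "\<And>z v. z \<in> Q \<Longrightarrow> norm (mul (b z) v) \<le> K * norm v"
  shows "\<exists>p. continuous_on Q p \<and> (\<forall>x\<in>{-h..h}. \<forall>y\<in>{-h..h}. p (x, y) = c
     + x *\<^sub>R integral {0..1} (\<lambda>t. mul (a (t * x, 0)) (p (t * x, 0)))
     + y *\<^sub>R integral {0..1} (\<lambda>t. mul (b (x, t * y)) (p (x, t * y))))"
proof -
  interpret bounded_bilinear mul by fact
  have Q: "Q = {-h..h} \<times> {-h..h}" unfolding Q_def by (rule square_eq_Times)
  define I where "I p x y = x *\<^sub>R integral {0..1} (\<lambda>t. mul (a (t * x, 0)) (p (t * x, 0)))
     + y *\<^sub>R integral {0..1} (\<lambda>t. mul (b (x, t * y)) (p (x, t * y)))" for p :: "real \<times> real \<Rightarrow> 'b" and x y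
  have h0: "0 \<in> {-h..h}" using h by auto
  note mem = scaled_mem_interval[of _ h]
  have cont1: "continuous_on (Q \<times> cbox 0 1) (\<lambda>(z, t). mul (a (t * fst z, 0)) (p (t * fst z, 0)))"
    and cont2: "continuous_on (Q \<times> cbox 0 1) (\<lambda>(z, t). mul (b (fst z, t * snd z)) (p (fst z, t * snd z)))"
    if p: "continuous_on Q p" for p :: "real \<times> real \<Rightarrow> 'b"
    unfolding split_beta atomize_conj
    by (intro conjI continuous_on_compose2[OF a] continuous_on_compose2[OF b] bounded_bilinear.continuous_on[OF bil] continuous_on_compose2[OF p]
        continuous_intros; use mem h0 in \<open>auto simp: Q\<close>)+
  have contI: "continuous_on Q (\<lambda>z. I p (fst z) (snd z))" if p: "continuous_on Q p" for p
    unfolding I_def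
    using integral_continuous_on_param[OF cont1[OF p]] integral_continuous_on_param[OF cont2[OF p]]
    by (intro continuous_intros) auto
  have int1: "(\<lambda>t. mul (a (t * x, 0)) (p (t * x, 0))) integrable_on {0..1}"
    and int2: "(\<lambda>t. mul (b (x, t * y)) (p (x, t * y))) integrable_on {0..1}"
    if p: "continuous_on Q p" and xy: "x \<in> {-h..h}" "y \<in> {-h..h}" for p :: "real \<times> real \<Rightarrow> 'b" and x y
    unfolding atomize_conj
    by (intro conjI integrable_continuous_real continuous_on_compose2[OF a] continuous_on_compose2[OF b]
       bounded_bilinear.continuous_on[OF bil] continuous_on_compose2[OF p] continuous_intros; use mem h0 xy in \<open>auto simp: Q\<close>)
  have diff: "norm (I p x y - I q x y) \<le> (1/2) * B"
    if p: "continuous_on Q p" and q: "continuous_on Q q" and B: "\<And>z. z \<in> Q \<Longrightarrow> norm (p z - q z) \<le> B"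
      and xy: "x \<in> {-h..h}" "y \<in> {-h..h}" for p q :: "real \<times> real \<Rightarrow> 'b" and x y B
  proof -
    have "0 \<le> B" using order_trans[OF norm_ge_zero B[of "(0,0)"]] h0 by (auto simp: Q)
    have KB: "K * norm (p z - q z) \<le> K * B" if "z \<in> Q" for z
      using B[OF that] K0 by (rule mult_left_mono)
    have 1: "norm (integral {0..1} (\<lambda>t. mul (a (t * x, 0)) (p (t * x, 0)))
       - integral {0..1} (\<lambda>t. mul (a (t * x, 0)) (q (t * x, 0)))) \<le> K * B * (1 - 0)"
      unfolding Henstock_Kurzweil_Integration.integral_diff[OF int1[OF p xy] int1[OF q xy], symmetric]
      unfolding diff_right[symmetric]
    proof (rule integral_bound)
      show "continuous_on {0..1} (\<lambda>t. mul (a (t * x, 0)) (p (t * x, 0) - q (t * x, 0)))"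
        by (intro continuous_on_compose2[OF a] bounded_bilinear.continuous_on[OF bil] continuous_on_compose2[OF p] continuous_on_compose2[OF q]
             continuous_intros; use mem h0 xy in \<open>auto simp: Q\<close>)
      fix t :: real assume "t \<in> {0..1}"
      then have "(t * x, 0) \<in> Q" using mem h0 xy by (auto simp: Q)
      then show "norm (mul (a (t * x, 0)) (p (t * x, 0) - q (t * x, 0))) \<le> K * B"
        using Ka KB order_trans by blast
    qed simp
    have 2: "norm (integral {0..1} (\<lambda>t. mul (b (x, t * y)) (p (x, t * y)))
       - integral {0..1} (\<lambda>t. mul (b (x, t * y)) (q (x, t * y)))) \<le> K * B * (1 - 0)"
      unfolding Henstock_Kurzweil_Integration.integral_diff[OF int2[OF p xy] int2[OF q xy], symmetric]
      unfolding diff_right[symmetric]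
    proof (rule integral_bound)
      show "continuous_on {0..1} (\<lambda>t. mul (b (x, t * y)) (p (x, t * y) - q (x, t * y)))"
        by (intro continuous_on_compose2[OF b] bounded_bilinear.continuous_on[OF bil] continuous_on_compose2[OF p] continuous_on_compose2[OF q]
             continuous_intros; use mem h0 xy in \<open>auto simp: Q\<close>)
      fix t :: real assume "t \<in> {0..1}"
      then have "(x, t * y) \<in> Q" using mem h0 xy by (auto simp: Q)
      then show "norm (mul (b (x, t * y)) (p (x, t * y) - q (x, t * y))) \<le> K * B"
        using Kb KB order_trans by blast
    qed simp
    have "\<bar>x\<bar> * (K * B) \<le> h * (K * B)" "\<bar>y\<bar> * (K * B) \<le> h * (K * B)"
      using xy K0 \<open>0 \<le> B\<close> by (auto intro!: mult_right_mono)
    moreover have "norm (I p x y - I q x y) \<le> \<bar>x\<bar> * (K * B) + \<bar>y\<bar> * (K * B)"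
    proof -
      have "I p x y - I q x y = x *\<^sub>R (integral {0..1} (\<lambda>t. mul (a (t * x, 0)) (p (t * x, 0)))
       - integral {0..1} (\<lambda>t. mul (a (t * x, 0)) (q (t * x, 0)))) + y *\<^sub>R (integral {0..1} (\<lambda>t. mul (b (x, t * y)) (p (x, t * y)))
       - integral {0..1} (\<lambda>t. mul (b (x, t * y)) (q (x, t * y))))"
        by (simp add: I_def algebra_simps)
      also have "norm \<dots> \<le> \<bar>x\<bar> * (K * B) + \<bar>y\<bar> * (K * B)"
        using mult_left_mono[OF 1, of "\<bar>x\<bar>"] mult_left_mono[OF 2, of "\<bar>y\<bar>"]
        by (intro norm_triangle_le) (simp)
      finally show ?thesis .
    qed
    ultimately have "norm (I p x y - I q x y) \<le> (2 * h * K) * B" by (simp add: algebra_simps)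
    also have "\<dots> \<le> (1/2) * B" using h(2) \<open>0 \<le> B\<close> by (intro mult_right_mono) auto
    finally show ?thesis .
  qed
  \<comment> \<open>The fixed point is sought among bounded continuous functions on the plane, which form a
    Banach space; functions on the square are extended by composition with the retraction
    \<open>clamp\<close>.\<close>
  have "\<exists>g :: (real \<times> real) \<Rightarrow>\<^sub>C 'b. (\<forall>z\<in>Q. g z = c + I (apply_bcontfun p) (fst z) (snd z)) \<and>
      (\<forall>z. g z = c + I (apply_bcontfun p) (fst (clamp (-h,-h) (h,h) z)) (snd (clamp (-h,-h) (h,h) z)))"
    for p :: "(real \<times> real) \<Rightarrow>\<^sub>C 'b"
  proof -
    have "continuous_on Q (\<lambda>z. c + I (apply_bcontfun p) (fst z) (snd z))"
      by (intro continuous_intros contI) simp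
    then show ?thesis unfolding Q_def by (rule continuous_on_cbox_bcontfunE) blast
  qed
  then obtain T :: "((real \<times> real) \<Rightarrow>\<^sub>C 'b) \<Rightarrow> ((real \<times> real) \<Rightarrow>\<^sub>C 'b)"
    where T1: "\<And>p z. z \<in> Q \<Longrightarrow> T p z = c + I (apply_bcontfun p) (fst z) (snd z)"
     and T2: "\<And>p z. T p z = c + I (apply_bcontfun p) (fst (clamp (-h,-h) (h,h) z)) (snd (clamp (-h,-h) (h,h) z))"
    by metis
  have clQ: "clamp (-h,-h) (h,h) z \<in> Q" for z :: "real \<times> real"
    unfolding Q_def by (rule clamp_in_interval) (use h in \<open>auto simp: Basis_prod_def\<close>)
  have "dist (T p) (T q) \<le> (1/2) * dist p q" for p q
  proof (rule dist_bound)
    fix z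
    let ?w = "clamp (-h,-h) (h,h) z"
    have "norm (I (apply_bcontfun p) (fst ?w) (snd ?w) - I (apply_bcontfun q) (fst ?w) (snd ?w)) \<le> (1/2) * dist p q"
      using clQ[of z] dist_bounded[of p _ q] by (intro diff) (auto simp: dist_norm Q)
    then show "dist (T p z) (T q z) \<le> (1/2) * dist p q"
      by (simp add: T2 dist_norm)
  qed
  then have "\<exists>!p. T p = p" by (intro banach_fix_type[of "1/2"]) auto
  then obtain p where "T p = p" by blast
  then have "p z = c + I (apply_bcontfun p) (fst z) (snd z)" if "z \<in> Q" for z
    using T1[OF that, of p] by simp
  then have "p (x, y) = c + I (apply_bcontfun p) x y" if "x \<in> {-h..h}" "y \<in> {-h..h}" for x y
    using that by (force simp: Q)
  then show ?thesis by (intro exI[of _ "apply_bcontfun p"]) (auto simp: I_def)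
qed

lemma norm_diff_le_of_derivative_bound:
  fixes f :: "real \<Rightarrow> 'b::real_normed_vector"
  assumes "\<And>x. x \<in> {-h..h} \<Longrightarrow> (f has_vector_derivative f' x) (at x within {-h..h})"
    and "\<And>x. x \<in> {-h..h} \<Longrightarrow> norm (f' x) \<le> B" and "x \<in> {-h..h}" "y \<in> {-h..h}"
  shows "norm (f x - f y) \<le> B * \<bar>x - y\<bar>"
proof -
  have "norm (f x - f y) \<le> B * norm (x - y)"
  proof (rule differentiable_bound[of "{-h..h}" f "\<lambda>x s. s *\<^sub>R f' x"])
    fix x assume x: "x \<in> {-h..h}"
    show "onorm (\<lambda>s. s *\<^sub>R f' x) \<le> B"
      using assms(2)[OF x] order_trans[OF norm_ge_zero assms(2)[OF x]]
      by (intro onorm_bound) (auto simp: mult.commute[of B] mult_left_mono)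
  qed (use assms in \<open>auto simp: has_vector_derivative_def\<close>)
  then show ?thesis by simp
qed

text \<open>The solution \<open>p\<close> of the Volterra equation has the right derivative in the second variable everywhere,
  but in the first variable only on the first axis.  Let \<open>r\<close> be the function that has the right derivative
  in the first variable everywhere and equals \<open>p\<close> on the second axis.  When \<open>r\<close> is differentiated in the
  second variable, flatness shows that \<open>e = p - r\<close> solves a homogeneous linear integro-differential
  equation with \<open>e(x, 0) = 0\<close>.  On a small square this forces \<open>e = 0\<close>, and \<open>p\<close> has both partial
  derivatives.\<close>

lemma flat_linear_system_on_square:
  fixes a b a' b' :: "real \<times> real \<Rightarrow> 'a::real_normed_vector" and c :: "'b::banach"
    and mul :: "'a \<Rightarrow> 'b \<Rightarrow> 'b" and h :: real
  defines "Q \<equiv> cbox (-h, -h) (h, h)"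
  assumes bil: "bounded_bilinear mul"
    and a: "continuous_on Q a" and b: "continuous_on Q b"
    and a': "continuous_on Q a'" and b': "continuous_on Q b'"
    and da: "\<And>x y. x \<in> {-h..h} \<Longrightarrow> y \<in> {-h..h} \<Longrightarrow>
       ((\<lambda>y. a (x, y)) has_vector_derivative a' (x, y)) (at y within {-h..h})"
    and db: "\<And>x y. x \<in> {-h..h} \<Longrightarrow> y \<in> {-h..h} \<Longrightarrow>
       ((\<lambda>x. b (x, y)) has_vector_derivative b' (x, y)) (at x within {-h..h})"
    and flat: "\<And>z v. z \<in> Q \<Longrightarrow>
       mul (b' z) v - mul (a' z) v = mul (a z) (mul (b z) v) - mul (b z) (mul (a z) v)"
    and h: "0 < h" "h \<le> 1" "4 * h * K \<le> 1" and K0: "0 \<le> K"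
    and Ka: "\<And>z v. z \<in> Q \<Longrightarrow> norm (mul (a z) v) \<le> K * norm v"
    and Kb: "\<And>z v. z \<in> Q \<Longrightarrow> norm (mul (b z) v) \<le> K * norm v"
    and Kb': "\<And>z v. z \<in> Q \<Longrightarrow> norm (mul (b' z) v) \<le> K * norm v"
  shows "\<exists>p. p (0, 0) = c \<and> (\<forall>z\<in>box (-h, -h) (h, h).
     (p has_derivative (\<lambda>v. fst v *\<^sub>R mul (a z) (p z) + snd v *\<^sub>R mul (b z) (p z))) (at z))"
proof -
  interpret bounded_bilinear mul by fact
  define I where "I = {-h..h}"
  have Q: "Q = I \<times> I" unfolding Q_def I_def by (rule square_eq_Times)
  have h0: "0 \<in> I" and cI: "convex I" using h by (auto simp: I_def)
  have mem: "t * x \<in> I" if "x \<in> I" "t \<in> {0..1}" for t x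
    using scaled_mem_interval[of x h t] that by (simp add: I_def)
  note dint = has_vector_derivative_scaled_integral[where h = h, folded I_def]
  note ftc = scaled_integral_of_derivative[where h = h, folded I_def]
  note mul_cont = bounded_bilinear.continuous_on[OF bil]
  obtain p where p: "continuous_on Q p" and peq: "\<And>x y. x \<in> I \<Longrightarrow> y \<in> I \<Longrightarrow> p (x, y) = c
     + x *\<^sub>R integral {0..1} (\<lambda>t. mul (a (t * x, 0)) (p (t * x, 0)))
     + y *\<^sub>R integral {0..1} (\<lambda>t. mul (b (x, t * y)) (p (x, t * y)))"
    using volterra_equation_on_square[OF bil a[unfolded Q_def] b[unfolded Q_def] _ h(3) K0
        Ka[unfolded Q_def] Kb[unfolded Q_def], of c] h(1)
    unfolding Q_def[symmetric] I_def by force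
  note cts = continuous_on_compose2[OF a] continuous_on_compose2[OF b] continuous_on_compose2[OF a']
     continuous_on_compose2[OF b'] continuous_on_compose2[OF p] mul_cont
  have py: "((\<lambda>y. p (x, y)) has_vector_derivative mul (b (x, y)) (p (x, y))) (at y within I)"
    if x: "x \<in> I" and y: "y \<in> I" for x y
  proof (rule has_vector_derivative_transform[OF y])
    let ?c = "c + x *\<^sub>R integral {0..1} (\<lambda>t. mul (a (t * x, 0)) (p (t * x, 0)))"
    show "p (x, y) = ?c + y *\<^sub>R integral {0..1} (\<lambda>t. mul (b (x, t * y)) (p (x, t * y)))"
      if "y \<in> I" for y using peq[OF x that] .
    have "((\<lambda>y. y *\<^sub>R integral {0..1} (\<lambda>t. mul (b (x, t * y)) (p (x, t * y))))
        has_vector_derivative mul (b (x, y)) (p (x, y))) (at y within I)"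
      by (rule dint[OF _ y, of "\<lambda>y. mul (b (x, y)) (p (x, y))"])
        (intro cts continuous_intros; use x in \<open>auto simp: Q\<close>)
    from has_vector_derivative_add[OF has_vector_derivative_const this]
    show "((\<lambda>y. ?c + y *\<^sub>R integral {0..1} (\<lambda>t. mul (b (x, t * y)) (p (x, t * y))))
        has_vector_derivative mul (b (x, y)) (p (x, y))) (at y within I)" by simp
  qed
  \<comment> \<open>The function \<open>r\<close>: transport along the second axis, then parallel to the first
    axis.\<close>
  define J where "J x y = x *\<^sub>R integral {0..1} (\<lambda>t. mul (a (t * x, y)) (p (t * x, y)))" for x y
  define r where "r z = p (0, snd z) + J (fst z) (snd z)" for z
  have r_cont: "continuous_on Q r"
  proof -
    have "continuous_on (Q \<times> cbox 0 1) (\<lambda>(z, t). mul (a (t * fst z, snd z)) (p (t * fst z, snd z)))"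
      unfolding split_beta by (intro cts continuous_intros; use mem h0 in \<open>auto simp: Q\<close>)
    from integral_continuous_on_param[OF this] show ?thesis
      unfolding r_def J_def by (intro cts continuous_intros) (use h0 in \<open>auto simp: Q\<close>)
  qed
  have rx: "((\<lambda>x. r (x, y)) has_vector_derivative mul (a (x, y)) (p (x, y))) (at x within I)"
    if x: "x \<in> I" and y: "y \<in> I" for x y
  proof -
    have "((\<lambda>x. J x y) has_vector_derivative mul (a (x, y)) (p (x, y))) (at x within I)"
      unfolding J_def
      by (rule dint[OF _ x, of "\<lambda>x. mul (a (x, y)) (p (x, y))"])
        (intro cts continuous_intros; use y in \<open>auto simp: Q\<close>)
    from has_vector_derivative_add[OF has_vector_derivative_const this] show ?thesis
      unfolding r_def by simp
  qed
  have ry: "((\<lambda>y. r (x, y)) has_vector_derivative mul (b (0, y)) (p (0, y))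
      + x *\<^sub>R integral {0..1} (\<lambda>t. mul (a' (t * x, y)) (p (t * x, y)) +
          mul (a (t * x, y)) (mul (b (t * x, y)) (p (t * x, y))))) (at y within I)"
    if x: "x \<in> I" and y: "y \<in> I" for x y
  proof -
    have "((\<lambda>y. integral (cbox 0 1) (\<lambda>t. mul (a (t * x, y)) (p (t * x, y)))) has_vector_derivative
      integral (cbox 0 1) (\<lambda>t. mul (a' (t * x, y)) (p (t * x, y)) +
          mul (a (t * x, y)) (mul (b (t * x, y)) (p (t * x, y))))) (at y within I)"
    proof (rule leibniz_rule_vector_derivative[OF _ _ _ y cI, of 0 1 "\<lambda>y t. mul (a (t * x, y)) (p (t * x, y))"
        "\<lambda>y t. mul (a' (t * x, y)) (p (t * x, y)) + mul (a (t * x, y)) (mul (b (t * x, y)) (p (t * x, y)))"])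
      fix y t :: real assume y: "y \<in> I" and t: "t \<in> cbox 0 1"
      have tx: "t * x \<in> I" using mem x t by auto
      show "((\<lambda>y. mul (a (t * x, y)) (p (t * x, y))) has_vector_derivative mul (a' (t * x, y)) (p (t * x, y)) +
          mul (a (t * x, y)) (mul (b (t * x, y)) (p (t * x, y)))) (at y within I)"
        using bounded_bilinear.has_vector_derivative[OF bil da[of "t * x" y, folded I_def] py] tx y
        by (simp add: add.commute)
    next
      fix y assume y: "y \<in> I"
      show "(\<lambda>t. mul (a (t * x, y)) (p (t * x, y))) integrable_on cbox 0 1"
        by (intro integrable_continuous cts continuous_intros; use mem x y in \<open>auto simp: Q\<close>)
    next
      show "continuous_on (I \<times> cbox 0 1) (\<lambda>(y, t). mul (a' (t * x, y)) (p (t * x, y)) +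
          mul (a (t * x, y)) (mul (b (t * x, y)) (p (t * x, y))))"
        unfolding split_beta by (intro cts continuous_intros; use mem x in \<open>auto simp: Q\<close>)
    qed
    then have "((\<lambda>y. J x y) has_vector_derivative
      x *\<^sub>R integral {0..1} (\<lambda>t. mul (a' (t * x, y)) (p (t * x, y)) +
          mul (a (t * x, y)) (mul (b (t * x, y)) (p (t * x, y))))) (at y within I)"
      unfolding J_def by (auto intro!: derivative_eq_intros)
    from has_vector_derivative_add[OF py[OF h0 y] this] show ?thesis unfolding r_def by simp
  qed
  have br: "x *\<^sub>R integral {0..1} (\<lambda>t. mul (b' (t * x, y)) (r (t * x, y)) +
       mul (b (t * x, y)) (mul (a (t * x, y)) (p (t * x, y)))) = mul (b (x, y)) (r (x, y)) - mul (b (0, y)) (r (0, y))"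
    if x: "x \<in> I" and y: "y \<in> I" for x y
  proof (rule ftc[OF _ x, of "\<lambda>x. mul (b (x, y)) (r (x, y))" "\<lambda>x. mul (b' (x, y)) (r (x, y)) + mul (b (x, y)) (mul (a (x, y)) (p (x, y)))"])
    fix x assume x: "x \<in> I"
    show "((\<lambda>x. mul (b (x, y)) (r (x, y))) has_vector_derivative mul (b' (x, y)) (r (x, y)) +
       mul (b (x, y)) (mul (a (x, y)) (p (x, y)))) (at x within I)"
      using bounded_bilinear.has_vector_derivative[OF bil db[of x y, folded I_def] rx] x y
      by (simp add: add.commute)
  qed
  define e where "e z = p z - r z" for z
  have e_cont: "continuous_on Q e" unfolding e_def by (intro continuous_intros p r_cont)
  note cts = cts continuous_on_compose2[OF r_cont] continuous_on_compose2[OF e_cont]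
  have r0: "r (0, y) = p (0, y)" for y by (simp add: r_def J_def)
  have ey: "((\<lambda>y. e (x, y)) has_vector_derivative mul (b (x, y)) (e (x, y))
      - x *\<^sub>R integral {0..1} (\<lambda>t. mul (b' (t * x, y)) (e (t * x, y)))) (at y within I)"
    if x: "x \<in> I" and y: "y \<in> I" for x y
  proof -
    \<comment> \<open>The terms with \<open>p\<close> alone cancel by flatness, and only the error
      \<open>e\<close> is left under the integral.\<close>
    have int: "integral {0..1} (\<lambda>t. mul (a' (t * x, y)) (p (t * x, y)) +
          mul (a (t * x, y)) (mul (b (t * x, y)) (p (t * x, y))))
       - integral {0..1} (\<lambda>t. mul (b' (t * x, y)) (r (t * x, y)) +
       mul (b (t * x, y)) (mul (a (t * x, y)) (p (t * x, y)))) =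
       integral {0..1} (\<lambda>t. mul (b' (t * x, y)) (e (t * x, y)))"
    proof (subst Henstock_Kurzweil_Integration.integral_diff[symmetric])
      show "integral {0..1} (\<lambda>t. (mul (a' (t * x, y)) (p (t * x, y)) +
          mul (a (t * x, y)) (mul (b (t * x, y)) (p (t * x, y)))) - (mul (b' (t * x, y)) (r (t * x, y)) +
       mul (b (t * x, y)) (mul (a (t * x, y)) (p (t * x, y))))) = integral {0..1} (\<lambda>t. mul (b' (t * x, y)) (e (t * x, y)))"
      proof (rule Henstock_Kurzweil_Integration.integral_cong)
        fix t :: real assume "t \<in> {0..1}"
        then have "(t * x, y) \<in> Q" using mem x y by (auto simp: Q)
        from flat[OF this, of "p (t * x, y)"]
        show "(mul (a' (t * x, y)) (p (t * x, y)) +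
          mul (a (t * x, y)) (mul (b (t * x, y)) (p (t * x, y)))) - (mul (b' (t * x, y)) (r (t * x, y)) +
          mul (b (t * x, y)) (mul (a (t * x, y)) (p (t * x, y)))) = mul (b' (t * x, y)) (e (t * x, y))"
          unfolding e_def diff_right by (simp add: algebra_simps)
      qed
    qed (intro integrable_continuous_real cts continuous_intros; use mem x y in \<open>auto simp: Q\<close>)+
    have "mul (b (x, y)) (p (x, y)) - (mul (b (0, y)) (p (0, y))
      + x *\<^sub>R integral {0..1} (\<lambda>t. mul (a' (t * x, y)) (p (t * x, y)) +
          mul (a (t * x, y)) (mul (b (t * x, y)) (p (t * x, y))))) =
      mul (b (x, y)) (e (x, y)) - x *\<^sub>R integral {0..1} (\<lambda>t. mul (b' (t * x, y)) (e (t * x, y)))"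
      unfolding int[symmetric] scaleR_diff_right br[OF x y] by (simp add: e_def r0 diff_right)
    with has_vector_derivative_diff[OF py[OF x y] ry[OF x y]] show ?thesis
      unfolding e_def by simp
  qed
  have e0: "e (x, 0) = 0" if "x \<in> I" for x
    using peq[OF that h0] peq[OF h0 h0] by (simp add: e_def r_def J_def)
  obtain z0 where z0: "z0 \<in> Q" "\<And>z. z \<in> Q \<Longrightarrow> norm (e z) \<le> norm (e z0)"
  proof -
    have "compact Q" "Q \<noteq> {}" using h0 unfolding Q_def[symmetric] by (auto simp: Q_def[symmetric] Q I_def compact_Times)
    moreover have "continuous_on Q (\<lambda>z. norm (e z))" by (intro continuous_intros e_cont)
    ultimately have "\<exists>x\<in>Q. \<forall>y\<in>Q. norm (e y) \<le> norm (e x)" by (rule continuous_attains_sup)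
    then show ?thesis using that by auto
  qed
  define E where "E = norm (e z0)"
  have E: "norm (e z) \<le> E" if "z \<in> Q" for z using z0(2)[OF that] by (simp add: E_def)
  have KE: "K * norm (e z) \<le> K * E" if "z \<in> Q" for z using E[OF that] K0 by (rule mult_left_mono)
  \<comment> \<open>The supremum \<open>E\<close> of the error is at most half of itself: the derivative of
    \<open>e\<close> is bounded by \<open>2 K E\<close>, and the distance to the first axis
    by \<open>h\<close>.\<close>
  have "norm (e z) \<le> E / 2" if z: "z \<in> Q" for z
  proof -
    obtain x y where xy: "z = (x, y)" "x \<in> I" "y \<in> I" using z by (auto simp: Q)
    have "norm (e (x, y) - e (x, 0)) \<le> (2 * (K * E)) * \<bar>y - 0\<bar>"
    proof (rule norm_diff_le_of_derivative_bound[where h = h, folded I_def, OF ey[OF xy(2)] _ xy(3) h0])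
      fix y assume y: "y \<in> I"
      have q: "(t * x, y) \<in> Q" if "t \<in> {0..1}" for t using mem[OF xy(2) that] y by (auto simp: Q)
      have 1: "norm (integral {0..1} (\<lambda>t. mul (b' (t * x, y)) (e (t * x, y)))) \<le> K * E * (1 - 0)"
      proof (rule integral_bound)
        show "continuous_on {0..1} (\<lambda>t. mul (b' (t * x, y)) (e (t * x, y)))"
          by (intro cts continuous_intros; use mem xy y in \<open>auto simp: Q\<close>)
        show "norm (mul (b' (t * x, y)) (e (t * x, y))) \<le> K * E" if "t \<in> {0..1}" for t
          using Kb'[OF q[OF that]] KE[OF q[OF that]] by (rule order_trans)
      qed simp
      have "\<bar>x\<bar> * norm (integral {0..1} (\<lambda>t. mul (b' (t * x, y)) (e (t * x, y)))) \<le> 1 * (K * E)"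
        using 1 xy(2) h by (intro mult_mono) (auto simp: I_def)
      moreover have "norm (mul (b (x, y)) (e (x, y))) \<le> K * E"
        using Kb[of "(x, y)" "e (x, y)"] KE[of "(x, y)"] xy y by (force simp: Q)
      ultimately show "norm (mul (b (x, y)) (e (x, y))
         - x *\<^sub>R integral {0..1} (\<lambda>t. mul (b' (t * x, y)) (e (t * x, y)))) \<le> 2 * (K * E)"
        by (intro order_trans[OF norm_triangle_ineq4]) simp
    qed
    also have "\<dots> \<le> (2 * (K * E)) * h"
      using xy K0 by (intro mult_left_mono) (auto simp: I_def E_def)
    also have "\<dots> = (4 * h * K) * (E / 2)" by simp
    also have "\<dots> \<le> 1 * (E / 2)" using h(3) by (intro mult_right_mono) (auto simp: E_def)
    finally show ?thesis using e0[OF xy(2)] by (simp add: xy(1))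
  qed
  from this[OF z0(1)] have "E \<le> 0" unfolding E_def[symmetric] by simp
  then have pr: "p z = r z" if "z \<in> Q" for z
    using order_trans[OF E[OF that] \<open>E \<le> 0\<close>] by (simp add: e_def)
  have px: "((\<lambda>x. p (x, y)) has_vector_derivative mul (a (x, y)) (p (x, y))) (at x within I)"
    if x: "x \<in> I" and y: "y \<in> I" for x y
    by (rule has_vector_derivative_transform[OF x _ rx[OF x y]]) (use pr y in \<open>auto simp: Q\<close>)
  have "(p has_derivative (\<lambda>v. fst v *\<^sub>R mul (a z) (p z) + snd v *\<^sub>R mul (b z) (p z))) (at z)"
    if z: "z \<in> box (-h, -h) (h, h)" for z
  proof -
    obtain x y where xy: "z = (x, y)" by (cases z)
    have zQ: "z \<in> Q" "x \<in> I" "y \<in> I" using z box_subset_cbox[of "(-h,-h)" "(h,h)"] xy by (auto simp: Q_def[symmetric] Q)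
    have "((\<lambda>(x, y). p (x, y)) has_derivative (\<lambda>(s, t). s *\<^sub>R mul (a (x, y)) (p (x, y)) +
        blinfun_scaleR_left (mul (b (x, y)) (p (x, y))) t)) (at (x, y) within I \<times> I)"
    proof (rule has_derivative_partialsI[where fy = "\<lambda>x y. blinfun_scaleR_left (mul (b (x, y)) (p (x, y)))"])
      show "((\<lambda>x. p (x, y)) has_derivative (\<lambda>s. s *\<^sub>R mul (a (x, y)) (p (x, y)))) (at x within I)"
        using px zQ by (simp add: has_vector_derivative_def)
      show "((\<lambda>y. p (x, y)) has_derivative blinfun_scaleR_left (mul (b (x, y)) (p (x, y)))) (at y within I)"
        if "x \<in> I" "y \<in> I" for x y
        using py[OF that] by (simp add: has_vector_derivative_def)
      have "continuous_on (I \<times> I) (\<lambda>z. blinfun_scaleR_left (mul (b z) (p z)))"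
        by (intro cts continuous_intros) (auto simp: Q)
      then show "continuous (at (x, y) within I \<times> I) (\<lambda>(x, y). blinfun_scaleR_left (mul (b (x, y)) (p (x, y))))"
        unfolding case_prod_unfold prod.collapse
        using zQ continuous_on_eq_continuous_within by blast
    qed (use zQ cI in auto)
    moreover have "at z within I \<times> I = at z"
      unfolding Q[symmetric] by (rule at_within_interior) (use z in \<open>simp add: Q_def interior_cbox\<close>)
    ultimately show ?thesis by (simp add: xy case_prod_unfold)
  qed
  moreover have "p (0, 0) = c" using peq[OF h0 h0] by simp
  ultimately show ?thesis by blast
qed

lemma smooth_on_imp_differentiable: "smooth_on S f \<Longrightarrow> x \<in> S \<Longrightarrow> f differentiable (at x)"
  by (auto simp: smooth_on_def dest!: spec[of _ 1])

lemma smooth_on_imp_continuous_on: "smooth_on S f \<Longrightarrow> continuous_on S f"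
  by (auto simp: smooth_on_def dest!: spec[of _ 0])

lemma smooth_on_frechet_derivative:
  "smooth_on S f \<Longrightarrow> smooth_on S (\<lambda>x. frechet_derivative f (at x) v)"
  unfolding smooth_on_def
proof
  fix n assume "\<forall>n. differentiable_of_order n S f"
  then have "differentiable_of_order (Suc n) S f" by blast
  then show "differentiable_of_order n S (\<lambda>x. frechet_derivative f (at x) v)" by simp
qed

text \<open>The coefficients are bounded by some \<open>K\<close> on a compact ball, and a square with \<open>4 h K \<le> 1\<close> fits the
  previous lemma.  Its size does not depend on the initial value, so that all initial values share one
  domain.\<close>

theorem flat_linear_system_local_solution:
  fixes A1 A2 :: "real^2 \<Rightarrow> 'a::real_normed_vector" and mul :: "'a \<Rightarrow> 'b::banach \<Rightarrow> 'b"
  assumes S: "open S" "z0 \<in> S" and bil: "bounded_bilinear mul"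
    and A: "smooth_on S A1" "smooth_on S A2"
    and flat: "\<And>z v. z \<in> S \<Longrightarrow>
      mul (frechet_derivative A2 (at z) (axis 1 1)) v - mul (frechet_derivative A1 (at z) (axis 2 1)) v =
      mul (A1 z) (mul (A2 z) v) - mul (A2 z) (mul (A1 z) v)"
  shows "\<exists>r>0. ball z0 r \<subseteq> S \<and> (\<forall>c. \<exists>p. p z0 = c \<and> (\<forall>z\<in>ball z0 r.
    (p has_derivative (\<lambda>v. v $ 1 *\<^sub>R mul (A1 z) (p z) + v $ 2 *\<^sub>R mul (A2 z) (p z))) (at z)))"
proof -
  define A1' where "A1' z = frechet_derivative A1 (at z) (axis 2 1)" for z
  define A2' where "A2' z = frechet_derivative A2 (at z) (axis 1 1)" for z
  obtain R where R: "R > 0" "cball z0 R \<subseteq> S" using S open_contains_cball by blast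
  have cont: "continuous_on (cball z0 R) A1" "continuous_on (cball z0 R) A2"
     "continuous_on (cball z0 R) A1'" "continuous_on (cball z0 R) A2'"
    unfolding A1'_def A2'_def
    by (intro continuous_on_subset[OF smooth_on_imp_continuous_on R(2)] smooth_on_frechet_derivative A)+
  obtain C where C: "C > 0" "\<And>u v. norm (mul u v) \<le> norm u * norm v * C"
    using bounded_bilinear.pos_bounded[OF bil] by blast
  have ex_bound: "\<exists>K>0. \<forall>z\<in>cball z0 R. norm (f z) \<le> K" if "continuous_on (cball z0 R) f" for f :: "real^2 \<Rightarrow> 'a"
    using compact_continuous_image[OF that compact_cball, THEN compact_imp_bounded] by (auto simp: bounded_pos)
  obtain K1 K2 K3 where K: "K1 > 0" "K2 > 0" "K3 > 0" "\<And>z. z \<in> cball z0 R \<Longrightarrow> norm (A1 z) \<le> K1"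
    "\<And>z. z \<in> cball z0 R \<Longrightarrow> norm (A2 z) \<le> K2" "\<And>z. z \<in> cball z0 R \<Longrightarrow> norm (A2' z) \<le> K3"
    using ex_bound[OF cont(1)] ex_bound[OF cont(2)] ex_bound[OF cont(4)] by metis
  define K where "K = C * (K1 + K2 + K3)"
  have K0: "K > 0" using C K by (simp add: K_def)
  have mulK: "norm (mul u v) \<le> K * norm v" if "norm u \<le> K1 \<or> norm u \<le> K2 \<or> norm u \<le> K3" for u v
  proof -
    have "norm u * (norm v * C) \<le> (K1 + K2 + K3) * (norm v * C)"
      using that K C by (intro mult_right_mono) auto
    then show ?thesis using C(2)[of u v] by (simp add: K_def algebra_simps)
  qed
  define h where "h = min 1 (min (R/2) (1 / (4 * K)))"
  have h: "0 < h" "h \<le> 1" "2 * h \<le> R" "4 * h * K \<le> 1"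
  proof -
    have "h \<le> 1 / (4 * K)" by (simp add: h_def)
    then show "4 * h * K \<le> 1" using K0 by (simp add: field_simps)
    have "h \<le> R / 2" by (simp add: h_def)
    then show "2 * h \<le> R" by simp
  qed (use R K0 in \<open>auto simp: h_def min_def\<close>)
  define \<iota> :: "real \<times> real \<Rightarrow> real^2" where "\<iota> w = z0 + fst w *\<^sub>R axis 1 1 + snd w *\<^sub>R axis 2 1" for w
  define \<pi> :: "real^2 \<Rightarrow> real \<times> real" where "\<pi> z = (z $ 1 - z0 $ 1, z $ 2 - z0 $ 2)" for z
  have \<iota>\<pi>: "\<iota> (\<pi> z) = z" for z
    by (simp add: \<iota>_def \<pi>_def vec_eq_iff forall_2 axis_def)
  have \<iota>_cont: "continuous_on T \<iota>" for T unfolding \<iota>_def by (intro continuous_intros)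
  have \<iota>Q: "\<iota> w \<in> cball z0 R" if "w \<in> cbox (-h, -h) (h, h)" for w
  proof -
    have "\<bar>fst w\<bar> \<le> h" "\<bar>snd w\<bar> \<le> h" using that by (cases w; auto simp: cbox_Pair_eq)+
    moreover have "dist z0 (\<iota> w) \<le> \<bar>fst w\<bar> + \<bar>snd w\<bar>"
      unfolding \<iota>_def dist_norm
      by (rule order_trans[OF _ norm_triangle_le[of "- (fst w *\<^sub>R axis 1 1)" "- (snd w *\<^sub>R axis 2 1) :: real^2"]]) (auto simp: norm_axis_1)
    ultimately show ?thesis using h by simp
  qed
  have \<iota>1: "((\<lambda>x. \<iota> (x, y)) has_derivative (\<lambda>s. s *\<^sub>R axis 1 1)) (at x within T)"
    and \<iota>2: "((\<lambda>y. \<iota> (x, y)) has_derivative (\<lambda>s. s *\<^sub>R axis 2 1)) (at y within T)" for x y T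
    unfolding \<iota>_def by (auto intro!: derivative_eq_intros)
  have dA: "(f has_derivative frechet_derivative f (at z)) (at z within T)" "linear (frechet_derivative f (at z))"
    if "smooth_on S f" "z \<in> cball z0 R" for f :: "real^2 \<Rightarrow> 'a" and z T
    using smooth_on_imp_differentiable[OF that(1) subsetD[OF R(2) that(2)]]
    unfolding frechet_derivative_works by (auto intro: has_derivative_at_withinI has_derivative_linear)
  have "\<exists>p. p (0, 0) = c \<and> (\<forall>z\<in>box (-h, -h) (h, h).
     (p has_derivative (\<lambda>v. fst v *\<^sub>R mul (A1 (\<iota> z)) (p z) + snd v *\<^sub>R mul (A2 (\<iota> z)) (p z))) (at z))" for c
  proof (rule flat_linear_system_on_square[where a = "\<lambda>w. A1 (\<iota> w)" and b = "\<lambda>w. A2 (\<iota> w)"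
        and a' = "\<lambda>w. A1' (\<iota> w)" and b' = "\<lambda>w. A2' (\<iota> w)", OF bil _ _ _ _ _ _ _ h(1,2,4)])
    fix x y assume "x \<in> {-h..h}" "y \<in> {-h..h}"
    then have z: "\<iota> (x, y) \<in> cball z0 R" by (intro \<iota>Q) (auto simp: cbox_Pair_eq)
    show "((\<lambda>y. A1 (\<iota> (x, y))) has_vector_derivative A1' (\<iota> (x, y))) (at y within {-h..h})"
      using has_derivative_compose[OF \<iota>2[of x y "{-h..h}"] dA(1)[OF A(1) z]] dA(2)[OF A(1) z]
      by (simp add: has_vector_derivative_def A1'_def linear_cmul)
    show "((\<lambda>x. A2 (\<iota> (x, y))) has_vector_derivative A2' (\<iota> (x, y))) (at x within {-h..h})"
      using has_derivative_compose[OF \<iota>1[of y x "{-h..h}"] dA(1)[OF A(2) z]] dA(2)[OF A(2) z]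
      by (simp add: has_vector_derivative_def A2'_def linear_cmul)
  next
    fix w v assume "w \<in> cbox (-h, -h) (h, h)"
    from \<iota>Q[OF this] show "mul (A2' (\<iota> w)) v - mul (A1' (\<iota> w)) v =
        mul (A1 (\<iota> w)) (mul (A2 (\<iota> w)) v) - mul (A2 (\<iota> w)) (mul (A1 (\<iota> w)) v)"
      using flat R unfolding A1'_def A2'_def by blast
  qed (use \<iota>Q K K0 in \<open>auto intro!: continuous_on_compose2[OF cont(1) \<iota>_cont] continuous_on_compose2[OF cont(2) \<iota>_cont]
      continuous_on_compose2[OF cont(3) \<iota>_cont] continuous_on_compose2[OF cont(4) \<iota>_cont] mulK simp del: mem_cball\<close>)
  note ex = this
  show ?thesis
  proof (intro exI[of _ h] conjI allI)
    show "ball z0 h \<subseteq> S" using R h by force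
    fix c
    obtain p where p: "p (0, 0) = c" "\<forall>z\<in>box (-h, -h) (h, h).
       (p has_derivative (\<lambda>v. fst v *\<^sub>R mul (A1 (\<iota> z)) (p z) + snd v *\<^sub>R mul (A2 (\<iota> z)) (p z))) (at z)"
      using ex[of c] by blast
    show "\<exists>q. q z0 = c \<and> (\<forall>z\<in>ball z0 h. (q has_derivative
        (\<lambda>v. v $ 1 *\<^sub>R mul (A1 z) (q z) + v $ 2 *\<^sub>R mul (A2 z) (q z))) (at z))"
    proof (intro exI[of _ "\<lambda>z. p (\<pi> z)"] conjI ballI)
      show "p (\<pi> z0) = c" using p(1) by (simp add: \<pi>_def)
      fix z assume z: "z \<in> ball z0 h"
      have "\<bar>(z - z0) $ i\<bar> < h" for i
        using component_le_norm_cart[of "z - z0" i] z by (simp add: dist_norm norm_minus_commute)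
      from this[of 1] this[of 2] have "\<pi> z \<in> box (-h, -h) (h, h)" by (auto simp: \<pi>_def mem_box Basis_prod_def)
      moreover have "(\<pi> has_derivative (\<lambda>v. (v $ 1, v $ 2))) (at z)"
        unfolding \<pi>_def
        by (auto intro!: derivative_eq_intros bounded_linear_imp_has_derivative bounded_linear_vec_nth)
      ultimately have "((\<lambda>z. p (\<pi> z)) has_derivative (\<lambda>v. fst (v $ 1, v $ 2) *\<^sub>R mul (A1 (\<iota> (\<pi> z))) (p (\<pi> z)) +
          snd (v $ 1, v $ 2) *\<^sub>R mul (A2 (\<iota> (\<pi> z))) (p (\<pi> z)))) (at z)"
        by (intro has_derivative_compose[OF _ bspec[OF p(2)]])
      then show "((\<lambda>z. p (\<pi> z)) has_derivative (\<lambda>v. v $ 1 *\<^sub>R mul (A1 z) (p (\<pi> z)) + v $ 2 *\<^sub>R mul (A2 z) (p (\<pi> z)))) (at z)"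
        by (simp add: \<iota>\<pi>)
    qed
  qed (use h in auto)
qed

section \<open>Calculus of smooth maps\<close>

lemma differentiable_of_order_Suc_imp:
  "differentiable_of_order (Suc n) S f \<Longrightarrow> differentiable_of_order n S f"
proof (induction n arbitrary: f)
  case 0
  then show ?case
    by (auto intro!: continuous_at_imp_continuous_on differentiable_imp_continuous_within)
next
  case (Suc n)
  then show ?case by (metis differentiable_of_order.simps(2))
qed

lemma differentiable_of_order_subset:
  "differentiable_of_order n S f \<Longrightarrow> T \<subseteq> S \<Longrightarrow> differentiable_of_order n T f"
  by (induction n arbitrary: f) (auto intro: continuous_on_subset)

lemma frechet_derivative_cong_open:
  assumes "open S" "x \<in> S" "\<And>x. x \<in> S \<Longrightarrow> f x = g x"
  shows "frechet_derivative f (at x) = frechet_derivative g (at x)"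
proof -
  have "(f has_derivative f') (at x) \<longleftrightarrow> (g has_derivative f') (at x)" for f'
    using assms has_derivative_transform_within_open[of f f' x UNIV S g]
      has_derivative_transform_within_open[of g f' x UNIV S f] by auto
  then show ?thesis unfolding frechet_derivative_def by simp
qed

lemma differentiable_cong_open:
  assumes "open S" "x \<in> S" "\<And>x. x \<in> S \<Longrightarrow> f x = g x" "f differentiable (at x)"
  shows "g differentiable (at x)"
  using assms has_derivative_transform_within_open[of f _ x UNIV S g] unfolding differentiable_def by blast

lemma differentiable_of_order_cong:
  assumes "open S" "\<And>x. x \<in> S \<Longrightarrow> f x = g x" "differentiable_of_order n S f"
  shows "differentiable_of_order n S g"
  using assms(2,3)
proof (induction n arbitrary: f g)
  case 0
  then show ?case by (simp cong: continuous_on_cong)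
next
  case (Suc n)
  have "frechet_derivative f (at x) v = frechet_derivative g (at x) v" if "x \<in> S" for x v
    using frechet_derivative_cong_open[OF assms(1) that Suc.prems(1)] by simp
  then have "differentiable_of_order n S (\<lambda>x. frechet_derivative g (at x) v)" for v
    by (rule Suc.IH) (use Suc.prems in auto)
  moreover have "g differentiable (at x)" if "x \<in> S" for x
    using differentiable_cong_open[OF assms(1) that Suc.prems(1)] Suc.prems(2) that by auto
  ultimately show ?case by simp
qed

lemma differentiable_of_order_const: "differentiable_of_order n S (\<lambda>x. c)"
  by (induction n arbitrary: c) (auto simp: frechet_derivative_const)

lemma differentiable_of_order_add:
  assumes S: "open S" and "differentiable_of_order n S f" "differentiable_of_order n S g"
  shows "differentiable_of_order n S (\<lambda>x. f x + g x)"
  using assms(2,3)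
proof (induction n arbitrary: f g)
  case 0
  then show ?case by (simp add: continuous_on_add)
next
  case (Suc n)
  have "differentiable_of_order n S (\<lambda>x. frechet_derivative (\<lambda>x. f x + g x) (at x) v)" for v
  proof (rule differentiable_of_order_cong[OF S])
    show "differentiable_of_order n S (\<lambda>x. frechet_derivative f (at x) v + frechet_derivative g (at x) v)"
      using Suc by simp
  next
    fix x assume "x \<in> S"
    then have "((\<lambda>x. f x + g x) has_derivative (\<lambda>v. frechet_derivative f (at x) v + frechet_derivative g (at x) v)) (at x)"
      using Suc.prems by (intro has_derivative_add) (auto simp: frechet_derivative_works)
    then show "frechet_derivative f (at x) v + frechet_derivative g (at x) v = frechet_derivative (\<lambda>x. f x + g x) (at x) v"
      by (metis frechet_derivative_at)
  qed
  with Suc.prems show ?case by auto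
qed

lemma differentiable_of_order_bilinear:
  assumes S: "open S" and bil: "bounded_bilinear mul"
    and "differentiable_of_order n S f" "differentiable_of_order n S g"
  shows "differentiable_of_order n S (\<lambda>x. mul (f x) (g x))"
  using assms(3,4)
proof (induction n arbitrary: f g)
  case 0
  then show ?case by (simp add: bounded_bilinear.continuous_on[OF bil])
next
  case (Suc n)
  have der: "((\<lambda>x. mul (f x) (g x)) has_derivative (\<lambda>v. mul (f x) (frechet_derivative g (at x) v) +
      mul (frechet_derivative f (at x) v) (g x))) (at x)" if "x \<in> S" for x
    using that Suc.prems by (intro bounded_bilinear.FDERIV[OF bil]) (auto simp: frechet_derivative_works)
  have "differentiable_of_order n S (\<lambda>x. frechet_derivative (\<lambda>x. mul (f x) (g x)) (at x) v)" for v
  proof (rule differentiable_of_order_cong[OF S])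
    show "differentiable_of_order n S (\<lambda>x. mul (f x) (frechet_derivative g (at x) v) +
      mul (frechet_derivative f (at x) v) (g x))"
      using Suc.prems differentiable_of_order_Suc_imp[OF Suc.prems(1)] differentiable_of_order_Suc_imp[OF Suc.prems(2)]
      by (intro differentiable_of_order_add[OF S] Suc.IH) auto
    show "mul (f x) (frechet_derivative g (at x) v) + mul (frechet_derivative f (at x) v) (g x) =
       frechet_derivative (\<lambda>x. mul (f x) (g x)) (at x) v" if "x \<in> S" for x
      using der[OF that] by (metis frechet_derivative_at)
  qed
  then show ?case using der by (auto simp: differentiable_def)
qed

lemma differentiable_of_order_linear:
  assumes S: "open S" and lin: "bounded_linear h" and "differentiable_of_order n S f"
  shows "differentiable_of_order n S (\<lambda>x. h (f x))"
  using assms(3)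
proof (induction n arbitrary: f)
  case 0
  then show ?case by (simp add: bounded_linear.continuous_on[OF lin])
next
  case (Suc n)
  have der: "((\<lambda>x. h (f x)) has_derivative (\<lambda>v. h (frechet_derivative f (at x) v))) (at x)" if "x \<in> S" for x
    using that Suc.prems by (intro bounded_linear.has_derivative[OF lin]) (auto simp: frechet_derivative_works)
  have "differentiable_of_order n S (\<lambda>x. frechet_derivative (\<lambda>x. h (f x)) (at x) v)" for v
  proof (rule differentiable_of_order_cong[OF S])
    show "differentiable_of_order n S (\<lambda>x. h (frechet_derivative f (at x) v))"
      using Suc by simp
    show "h (frechet_derivative f (at x) v) = frechet_derivative (\<lambda>x. h (f x)) (at x) v" if "x \<in> S" for x
      using der[OF that] by (metis frechet_derivative_at)
  qed
  then show ?case using der by (auto simp: differentiable_def)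
qed

lemma differentiable_of_order_local:
  assumes "\<And>x. x \<in> S \<Longrightarrow> \<exists>U. open U \<and> x \<in> U \<and> differentiable_of_order n (S \<inter> U) f"
  shows "differentiable_of_order n S f"
  using assms
proof (induction n arbitrary: f)
  case 0
  show ?case unfolding differentiable_of_order.simps continuous_on_eq_continuous_within
  proof
    fix x assume x: "x \<in> S"
    then obtain U where U: "open U" "x \<in> U" "continuous_on (S \<inter> U) f" using 0 by auto
    have "at x within S = at x within (S \<inter> U)"
      by (rule at_within_nhd[OF U(2,1)]) auto
    then show "continuous (at x within S) f"
      using U x by (simp add: continuous_on_eq_continuous_within)
  qed
next
  case (Suc n)
  have 1: "f differentiable (at x)" if "x \<in> S" for x
    using Suc.prems[OF that] that by auto
  have 2: "differentiable_of_order n S (\<lambda>x. frechet_derivative f (at x) v)" for v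
    by (rule Suc.IH) (use Suc.prems in fastforce)
  show ?case using 1 2 by simp
qed

lemma smooth_on_subset: "smooth_on S f \<Longrightarrow> T \<subseteq> S \<Longrightarrow> smooth_on T f"
  unfolding smooth_on_def by (blast intro: differentiable_of_order_subset)

lemma smooth_on_cong: "open S \<Longrightarrow> (\<And>x. x \<in> S \<Longrightarrow> f x = g x) \<Longrightarrow> smooth_on S f \<Longrightarrow> smooth_on S g"
  unfolding smooth_on_def by (blast intro: differentiable_of_order_cong)

lemma smooth_on_const: "smooth_on S (\<lambda>x. c)"
  unfolding smooth_on_def by (blast intro: differentiable_of_order_const)

lemma smooth_on_add: "open S \<Longrightarrow> smooth_on S f \<Longrightarrow> smooth_on S g \<Longrightarrow> smooth_on S (\<lambda>x. f x + g x)"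
  unfolding smooth_on_def by (blast intro: differentiable_of_order_add)

lemma smooth_on_bilinear:
  "open S \<Longrightarrow> bounded_bilinear mul \<Longrightarrow> smooth_on S f \<Longrightarrow> smooth_on S g \<Longrightarrow> smooth_on S (\<lambda>x. mul (f x) (g x))"
  unfolding smooth_on_def by (blast intro: differentiable_of_order_bilinear)

lemma smooth_on_linear: "open S \<Longrightarrow> bounded_linear h \<Longrightarrow> smooth_on S f \<Longrightarrow> smooth_on S (\<lambda>x. h (f x))"
  unfolding smooth_on_def by (blast intro: differentiable_of_order_linear)

lemma smooth_on_local:
  assumes "\<And>x. x \<in> S \<Longrightarrow> \<exists>U. open U \<and> x \<in> U \<and> smooth_on (S \<inter> U) f"
  shows "smooth_on S f"
  unfolding smooth_on_def
proof
  fix n show "differentiable_of_order n S f"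
    by (rule differentiable_of_order_local) (use assms in \<open>auto simp: smooth_on_def\<close>)
qed

text \<open>If the derivative of \<open>f\<close> is as often differentiable as \<open>f\<close> itself, as it is for a solution of a differential
  equation with smooth coefficients, then each order of differentiability implies the next one.\<close>

lemma smooth_on_bootstrap:
  assumes S: "open S" and der: "\<And>x. x \<in> S \<Longrightarrow> (f has_derivative f' x) (at x)"
    and step: "\<And>n v. differentiable_of_order n S f \<Longrightarrow> differentiable_of_order n S (\<lambda>x. f' x v)"
  shows "smooth_on S f"
  unfolding smooth_on_def
proof
  fix n show "differentiable_of_order n S f"
  proof (induction n)
    case 0
    then show ?case using der by (auto intro!: continuous_at_imp_continuous_on has_derivative_continuous)
  next
    case (Suc n)
    have "differentiable_of_order n S (\<lambda>x. frechet_derivative f (at x) v)" for v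
      by (rule differentiable_of_order_cong[OF S _ step[OF Suc]])
        (rule fun_cong[OF frechet_derivative_at[OF der]])
    then show ?case using der by (auto simp: differentiable_def)
  qed
qed

section \<open>Global sections of locally constant sheaves\<close>

text \<open>Simple connectedness is defined by free homotopies of loops.  It includes connectedness by paths,
  because a homotopy between two constant loops moves the first point to the second.\<close>

lemma simply_connected_imp_path:
  assumes "simply_connected (UNIV :: 'm::topological_space set)"
  obtains g where "path g" "pathstart g = x" "pathfinish g = (y::'m)"
proof -
  have "homotopic_loops UNIV (\<lambda>_::real. x) (\<lambda>_. y)"
    using assms unfolding simply_connected_def by (auto simp: path_def pathstart_def pathfinish_def)
  then obtain h where h: "continuous_on ({0..1::real} \<times> {0..1::real}) h" "\<forall>t\<in>{0..1}. h (0, t) = x" "\<forall>t\<in>{0..1}. h (1, t) = y"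
    unfolding homotopic_loops by auto
  have "path (\<lambda>s. h (s, 0))" unfolding path_def
    by (rule continuous_on_compose2[OF h(1)]) (auto intro!: continuous_intros)
  then show ?thesis using that[of "\<lambda>s. h (s, 0)"] h by (auto simp: pathstart_def pathfinish_def)
qed

text \<open>\<open>P \<phi> x\<close> is a local condition on a function \<open>\<phi>\<close> at the point \<open>x\<close>, such as a differential equation.
  The last axiom says that the functions satisfying it form a locally constant sheaf with the stalks
  \<open>F x\<close>: around each point there is a domain on which a solution is given by its value at any one
  point, and on which every value is attained.\<close>

locale locally_constant_sheaf =
  fixes P :: "('m::topological_space \<Rightarrow> 'f) \<Rightarrow> 'm \<Rightarrow> bool" and F :: "'m \<Rightarrow> 'f set"
  assumes germ: "open V \<Longrightarrow> x \<in> V \<Longrightarrow> (\<And>y. y \<in> V \<Longrightarrow> \<phi> y = \<psi> y) \<Longrightarrow> P \<phi> x \<Longrightarrow> P \<psi> x"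
    and fib: "P \<phi> x \<Longrightarrow> \<phi> x \<in> F x"
    and loc: "open U \<Longrightarrow> x \<in> U \<Longrightarrow> \<exists>V. open V \<and> x \<in> V \<and> V \<subseteq> U \<and> path_connected V \<and>
       (\<forall>y\<in>V. \<forall>c\<in>F y. \<exists>\<phi>. \<phi> y = c \<and> (\<forall>z\<in>V. P \<phi> z)) \<and>
       (\<forall>\<phi> \<psi>. (\<forall>z\<in>V. P \<phi> z \<and> P \<psi> z) \<longrightarrow> (\<exists>y\<in>V. \<phi> y = \<psi> y) \<longrightarrow> (\<forall>z\<in>V. \<phi> z = \<psi> z))"
begin

text \<open>The continuation of solutions along a map \<open>h\<close>, for instance along a path.  The values of \<open>L\<close> are indexed by
  the parameter \<open>k\<close> and not by the point \<open>h k\<close>, since the continuation along a loop might return with a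
  different value.\<close>

definition lift :: "'k::topological_space set \<Rightarrow> ('k \<Rightarrow> 'm) \<Rightarrow> ('k \<Rightarrow> 'f) \<Rightarrow> bool" where
  "lift K h L \<longleftrightarrow> (\<forall>k\<in>K. \<exists>V \<phi> N. open V \<and> h k \<in> V \<and> (\<forall>z\<in>V. P \<phi> z) \<and> open N \<and> k \<in> N \<and>
     (\<forall>k'\<in>K \<inter> N. h k' \<in> V \<and> L k' = \<phi> (h k')))"

lemma liftE:
  assumes "lift K h L" "k \<in> K"
  obtains V \<phi> N where "open V" "h k \<in> V" "\<forall>z\<in>V. P \<phi> z" "open N" "k \<in> N"
    "\<forall>k'\<in>K \<inter> N. h k' \<in> V \<and> L k' = \<phi> (h k')"
proof -
  have "\<exists>V \<phi> N. open V \<and> h k \<in> V \<and> (\<forall>z\<in>V. P \<phi> z) \<and> open N \<and> k \<in> N \<and>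
     (\<forall>k'\<in>K \<inter> N. h k' \<in> V \<and> L k' = \<phi> (h k'))"
    using assms unfolding lift_def by (rule bspec)
  then show thesis by (elim exE conjE) (rule that)
qed

lemma lift_fib: "lift K h L \<Longrightarrow> k \<in> K \<Longrightarrow> L k \<in> F (h k)"
  by (erule liftE, assumption) (use fib in auto)

lemma lift_subset: "lift K h L \<Longrightarrow> K' \<subseteq> K \<Longrightarrow> lift K' h L"
  unfolding lift_def
  by (intro ballI, drule bspec, erule subsetD, assumption, elim exE conjE, rule exI, rule exI, rule exI) auto

lemma lift_cong:
  assumes "lift K h L" "\<And>k. k \<in> K \<Longrightarrow> h k = h' k" "\<And>k. k \<in> K \<Longrightarrow> L k = L' k"
  shows "lift K h' L'"
  unfolding lift_def
proof
  fix k assume k: "k \<in> K"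
  from liftE[OF assms(1) this] obtain V \<phi> N where "open V" "h k \<in> V" "\<forall>z\<in>V. P \<phi> z" "open N" "k \<in> N"
    "\<forall>k'\<in>K \<inter> N. h k' \<in> V \<and> L k' = \<phi> (h k')" .
  with k show "\<exists>V \<phi> N. open V \<and> h' k \<in> V \<and> (\<forall>z\<in>V. P \<phi> z) \<and> open N \<and> k \<in> N \<and>
     (\<forall>k'\<in>K \<inter> N. h' k' \<in> V \<and> L' k' = \<phi> (h' k'))"
    by (intro exI[of _ V] exI[of _ \<phi>] exI[of _ N]) (auto simp: assms(2,3)[symmetric])
qed

lemma lift_compose:
  assumes L: "lift K h L" and f: "continuous_on K' f" "f ` K' \<subseteq> K"
  shows "lift K' (\<lambda>k. h (f k)) (\<lambda>k. L (f k))"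
  unfolding lift_def
proof
  fix k assume k: "k \<in> K'"
  then have "f k \<in> K" using f by blast
  from liftE[OF L this] obtain V \<phi> N where V: "open V" "h (f k) \<in> V" "\<forall>z\<in>V. P \<phi> z" "open N" "f k \<in> N"
    "\<forall>k'\<in>K \<inter> N. h k' \<in> V \<and> L k' = \<phi> (h k')" .
  obtain N' where N': "open N'" "N' \<inter> K' = f -` N \<inter> K'"
    using f(1) V(4) unfolding continuous_on_open_invariant by metis
  have "k \<in> N'" "\<forall>k'\<in>K' \<inter> N'. h (f k') \<in> V \<and> L (f k') = \<phi> (h (f k'))"
    using N' V k f(2) by blast+
  with V N' show "\<exists>V \<phi> N. open V \<and> h (f k) \<in> V \<and> (\<forall>z\<in>V. P \<phi> z) \<and> open N \<and> k \<in> N \<and>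
     (\<forall>k'\<in>K' \<inter> N. h (f k') \<in> V \<and> L (f k') = \<phi> (h (f k')))"
    by (intro exI[of _ V] exI[of _ \<phi>] exI[of _ N']) simp
qed

lemma lift_of_solution:
  assumes "continuous_on K h" "open V" "h ` K \<subseteq> V" "\<forall>z\<in>V. P \<phi> z"
  shows "lift K h (\<lambda>k. \<phi> (h k))"
  unfolding lift_def using assms by (intro ballI exI[of _ V] exI[of _ \<phi>] exI[of _ UNIV]) auto

lemma lift_const:
  assumes "c \<in> F x" shows "lift K (\<lambda>_. x) (\<lambda>_. c)"
proof -
  obtain V where V: "open V" "x \<in> V" "\<forall>y\<in>V. \<forall>c\<in>F y. \<exists>\<phi>. \<phi> y = c \<and> (\<forall>z\<in>V. P \<phi> z)"
    using loc[of UNIV x] by auto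
  then obtain \<phi> where "\<phi> x = c" "\<forall>z\<in>V. P \<phi> z" using assms by blast
  then show ?thesis using lift_of_solution[of K "\<lambda>_. x" V \<phi>] V by auto
qed

lemma local_dichotomy:
  assumes "open V1" "\<forall>z\<in>V1. P \<phi> z" "open V2" "\<forall>z\<in>V2. P \<psi> z" "x \<in> V1" "x \<in> V2"
  obtains V where "open V" "x \<in> V" "V \<subseteq> V1 \<inter> V2" "\<And>y z. y \<in> V \<Longrightarrow> z \<in> V \<Longrightarrow> \<phi> y = \<psi> y \<Longrightarrow> \<phi> z = \<psi> z"
proof -
  obtain V where V: "open V" "x \<in> V" "V \<subseteq> V1 \<inter> V2"
    and u: "\<forall>\<phi> \<psi>. (\<forall>z\<in>V. P \<phi> z \<and> P \<psi> z) \<longrightarrow> (\<exists>y\<in>V. \<phi> y = \<psi> y) \<longrightarrow> (\<forall>z\<in>V. \<phi> z = \<psi> z)"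
    using loc[of "V1 \<inter> V2" x] assms by blast
  have "\<forall>z\<in>V. P \<phi> z \<and> P \<psi> z" using V assms by blast
  then show ?thesis using that[OF V] u by blast
qed

text \<open>Locally two lifts are two solutions pulled back by \<open>h\<close>; so the set where they agree is open and
  closed.\<close>

lemma lift_unique:
  assumes "connected K" "continuous_on K h" "lift K h L1" "lift K h L2" "k0 \<in> K" "L1 k0 = L2 k0" "k1 \<in> K"
  shows "L1 k1 = L2 k1"
proof (rule connected_induction_simple[where P = "\<lambda>k. L1 k = L2 k", OF assms(1,5,7,6)])
  fix k assume k: "k \<in> K"
  obtain V1 \<phi>1 N1 where 1: "open V1" "h k \<in> V1" "\<forall>z\<in>V1. P \<phi>1 z" "open N1" "k \<in> N1"
    "\<forall>k'\<in>K \<inter> N1. h k' \<in> V1 \<and> L1 k' = \<phi>1 (h k')"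
    using liftE[OF assms(3) k] .
  obtain V2 \<phi>2 N2 where 2: "open V2" "h k \<in> V2" "\<forall>z\<in>V2. P \<phi>2 z" "open N2" "k \<in> N2"
    "\<forall>k'\<in>K \<inter> N2. h k' \<in> V2 \<and> L2 k' = \<phi>2 (h k')"
    using liftE[OF assms(4) k] .
  obtain V where V: "open V" "h k \<in> V" "\<And>y z. y \<in> V \<Longrightarrow> z \<in> V \<Longrightarrow> \<phi>1 y = \<phi>2 y \<Longrightarrow> \<phi>1 z = \<phi>2 z"
    using local_dichotomy[OF 1(1,3) 2(1,3) 1(2) 2(2)] by metis
  obtain N where N: "open N" "N \<inter> K = h -` V \<inter> K"
    using assms(2) V(1) unfolding continuous_on_open_invariant by metis
  show "\<exists>T. openin (top_of_set K) T \<and> k \<in> T \<and> (\<forall>x\<in>T. \<forall>y\<in>T. L1 x = L2 x \<longrightarrow> L1 y = L2 y)"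
  proof (intro exI[of _ "K \<inter> (N \<inter> N1 \<inter> N2)"] conjI ballI impI)
    show "openin (top_of_set K) (K \<inter> (N \<inter> N1 \<inter> N2))" using N 1 2 by (auto intro: openin_open_Int)
    show "k \<in> K \<inter> (N \<inter> N1 \<inter> N2)" using k N V 1 2 by auto
    fix x y assume x: "x \<in> K \<inter> (N \<inter> N1 \<inter> N2)" and y: "y \<in> K \<inter> (N \<inter> N1 \<inter> N2)" and "L1 x = L2 x"
    then have "\<phi>1 (h x) = \<phi>2 (h x)" using 1 2 by auto
    moreover have "h x \<in> V" "h y \<in> V" using x y N by blast+
    ultimately have "\<phi>1 (h y) = \<phi>2 (h y)" using V(3) by blast
    then show "L1 y = L2 y" using y 1 2 by auto
  qed
qed

text \<open>Near a common parameter both lifts are the pullbacks of one and the same solution.\<close>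

lemma lift_glue:
  assumes "closed K1" "closed K2" and h: "continuous_on (K1 \<union> K2) h"
    and L1: "lift K1 h L1" and L2: "lift K2 h L2" and eq: "\<And>k. k \<in> K1 \<inter> K2 \<Longrightarrow> L1 k = L2 k"
  shows "lift (K1 \<union> K2) h (\<lambda>k. if k \<in> K1 then L1 k else L2 k)"
  unfolding lift_def
proof
  let ?L = "\<lambda>k. if k \<in> K1 then L1 k else L2 k"
  have L2': "?L k = L2 k" if "k \<in> K2" for k using eq that by auto
  fix k assume k: "k \<in> K1 \<union> K2"
  consider "k \<in> K1" "k \<notin> K2" | "k \<notin> K1" "k \<in> K2" | "k \<in> K1" "k \<in> K2" using k by blast
  then show "\<exists>V \<phi> N. open V \<and> h k \<in> V \<and> (\<forall>z\<in>V. P \<phi> z) \<and> open N \<and> k \<in> N \<and>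
     (\<forall>k'\<in>(K1 \<union> K2) \<inter> N. h k' \<in> V \<and> ?L k' = \<phi> (h k'))"
  proof cases
    case 1
    obtain V \<phi> N where V: "open V" "h k \<in> V" "\<forall>z\<in>V. P \<phi> z" "open N" "k \<in> N"
      "\<forall>k'\<in>K1 \<inter> N. h k' \<in> V \<and> L1 k' = \<phi> (h k')"
      using liftE[OF L1 1(1)] .
    show ?thesis
      by (rule exI[of _ V], rule exI[of _ \<phi>], rule exI[of _ "N - K2"]) (use V 1 assms(2) in auto)
  next
    case 2
    obtain V \<phi> N where V: "open V" "h k \<in> V" "\<forall>z\<in>V. P \<phi> z" "open N" "k \<in> N"
      "\<forall>k'\<in>K2 \<inter> N. h k' \<in> V \<and> L2 k' = \<phi> (h k')"
      using liftE[OF L2 2(2)] .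
    show ?thesis
      by (rule exI[of _ V], rule exI[of _ \<phi>], rule exI[of _ "N - K1"]) (use V 2 assms(1) in auto)
  next
    case 3
    obtain V1 \<phi>1 N1 where 1: "open V1" "h k \<in> V1" "\<forall>z\<in>V1. P \<phi>1 z" "open N1" "k \<in> N1"
      "\<forall>k'\<in>K1 \<inter> N1. h k' \<in> V1 \<and> L1 k' = \<phi>1 (h k')"
      using liftE[OF L1 3(1)] .
    obtain V2 \<phi>2 N2 where 2: "open V2" "h k \<in> V2" "\<forall>z\<in>V2. P \<phi>2 z" "open N2" "k \<in> N2"
      "\<forall>k'\<in>K2 \<inter> N2. h k' \<in> V2 \<and> L2 k' = \<phi>2 (h k')"
      using liftE[OF L2 3(2)] .
    obtain V where V: "open V" "h k \<in> V" "V \<subseteq> V1 \<inter> V2" "\<And>y z. y \<in> V \<Longrightarrow> z \<in> V \<Longrightarrow> \<phi>1 y = \<phi>2 y \<Longrightarrow> \<phi>1 z = \<phi>2 z"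
      using local_dichotomy[OF 1(1,3) 2(1,3) 1(2) 2(2)] by metis
    have "\<phi>1 (h k) = \<phi>2 (h k)" using 1(5,6) 2(5,6) 3 eq by (metis Int_iff)
    with V(2,4) have agree: "\<phi>1 z = \<phi>2 z" if "z \<in> V" for z using that by blast
    obtain N where N: "open N" "N \<inter> (K1 \<union> K2) = h -` V \<inter> (K1 \<union> K2)"
      using h V(1) unfolding continuous_on_open_invariant by metis
    have "\<forall>k'\<in>(K1 \<union> K2) \<inter> (N \<inter> N1 \<inter> N2). h k' \<in> V \<and> ?L k' = \<phi>1 (h k')"
    proof (intro ballI conjI)
      fix k' assume k': "k' \<in> (K1 \<union> K2) \<inter> (N \<inter> N1 \<inter> N2)"
      then show hV: "h k' \<in> V" using N by blast
      show "?L k' = \<phi>1 (h k')" using k' 1(6) 2(6) agree[OF hV] by auto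
    qed
    moreover have "k \<in> N \<inter> N1 \<inter> N2" using N V(2) k 1 2 by blast
    moreover have "\<forall>z\<in>V. P \<phi>1 z" using V(3) 1(3) by blast
    ultimately show ?thesis
      using V(1,2) N 1 2 by (intro exI[of _ V] exI[of _ \<phi>1] exI[of _ "N \<inter> N1 \<inter> N2"]) auto
  qed
qed

definition liftable :: "'k::topological_space set \<Rightarrow> ('k \<Rightarrow> 'm) \<Rightarrow> bool" where
  "liftable K h \<longleftrightarrow> (\<forall>k\<in>K. \<forall>c\<in>F (h k). \<exists>L. lift K h L \<and> L k = c)"

lemma liftableD:
  assumes "liftable K h" "k \<in> K" "c \<in> F (h k)"
  obtains L where "lift K h L" "L k = c"
  using assms unfolding liftable_def by blast

text \<open>Continue over \<open>K1\<close> first, and from some point \<open>m\<close> of the intersection over \<open>K2\<close>.  Connectedness of the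
  intersection makes the two lifts agree on all of it.\<close>

lemma liftable_Un_aux:
  assumes "closed K1" "closed K2" and h: "continuous_on (K1 \<union> K2) h" and c: "connected (K1 \<inter> K2)"
    and m: "m \<in> K1 \<inter> K2" and K: "liftable K1 h" "liftable K2 h" and k: "k \<in> K1" "v \<in> F (h k)"
  shows "\<exists>L. lift (K1 \<union> K2) h L \<and> L k = v"
proof -
  obtain L1 where L1: "lift K1 h L1" "L1 k = v" using K k unfolding liftable_def by blast
  obtain L2 where L2: "lift K2 h L2" "L2 m = L1 m"
    using K(2) lift_fib[OF L1(1)] m unfolding liftable_def by blast
  have "L1 x = L2 x" if "x \<in> K1 \<inter> K2" for x
    by (rule lift_unique[OF c continuous_on_subset[OF h] lift_subset[OF L1(1)] lift_subset[OF L2(1)] m _ that])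
      (use L2 in auto)
  from lift_glue[OF assms(1,2) h L1(1) L2(1) this]
  show ?thesis using L1(2) k by (intro exI[of _ "\<lambda>k. if k \<in> K1 then L1 k else L2 k"]) auto
qed

lemma liftable_Un:
  assumes "closed K1" "closed K2" and h: "continuous_on (K1 \<union> K2) h" and c: "connected (K1 \<inter> K2)"
    and m: "m \<in> K1 \<inter> K2" and K: "liftable K1 h" "liftable K2 h"
  shows "liftable (K1 \<union> K2) h"
  unfolding liftable_def
proof (intro ballI)
  fix k v assume k: "k \<in> K1 \<union> K2" "v \<in> F (h k)"
  show "\<exists>L. lift (K1 \<union> K2) h L \<and> L k = v"
  proof (cases "k \<in> K1")
    case True
    then show ?thesis using liftable_Un_aux[OF assms] k by blast
  next
    case False
    then show ?thesis
      using liftable_Un_aux[OF assms(2,1), of h m] h c m K k by (auto simp: Un_commute Int_commute)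
  qed
qed

text \<open>Sufficiently small rectangles are mapped into domains of the last axiom of the locale.  By bisection in
  the second variable they are assembled to narrow strips, and by bisection in the first variable
  these are assembled to the whole rectangle.\<close>

lemma liftable_rectangle:
  fixes h :: "real \<times> real \<Rightarrow> 'm"
  assumes h: "continuous_on UNIV h" and ab: "a \<le> b" "c \<le> d"
  shows "liftable ({a..b} \<times> {c..d}) h"
proof -
  have hS: "continuous_on S h" for S using h continuous_on_subset by blast
  have small: "\<exists>e>0. \<forall>a b t1 t2. a \<le> s \<and> s \<le> b \<and> b - a < e \<and> t1 \<le> t \<and> t \<le> t2 \<and> t2 - t1 < e
      \<longrightarrow> liftable ({a..b} \<times> {t1..t2}) h" for s t
  proof -
    obtain V where V: "open V" "h (s, t) \<in> V" "\<forall>y\<in>V. \<forall>c\<in>F y. \<exists>\<phi>. \<phi> y = c \<and> (\<forall>z\<in>V. P \<phi> z)"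
      using loc[of UNIV "h (s, t)"] by auto
    have "open (h -` V)" using h V(1) by (simp add: continuous_on_open_vimage)
    moreover have "(s, t) \<in> h -` V" using V by simp
    ultimately obtain A B where AB: "open A" "open B" "s \<in> A" "t \<in> B" "A \<times> B \<subseteq> h -` V"
      by (rule open_prod_elim) auto
    obtain e1 where e1: "e1 > 0" "ball s e1 \<subseteq> A" using AB open_contains_ball by blast
    obtain e2 where e2: "e2 > 0" "ball t e2 \<subseteq> B" using AB open_contains_ball by blast
    show ?thesis
    proof (intro exI[of _ "min e1 e2"] conjI allI impI)
      fix a b t1 t2
      assume *: "a \<le> s \<and> s \<le> b \<and> b - a < min e1 e2 \<and> t1 \<le> t \<and> t \<le> t2 \<and> t2 - t1 < min e1 e2"
      have "{a..b} \<subseteq> ball s e1" "{t1..t2} \<subseteq> ball t e2" using * by (auto simp: dist_real_def)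
      then have sub: "h ` ({a..b} \<times> {t1..t2}) \<subseteq> V" using e1 e2 AB by blast
      show "liftable ({a..b} \<times> {t1..t2}) h"
        unfolding liftable_def
      proof (intro ballI)
        fix k v assume k: "k \<in> {a..b} \<times> {t1..t2}" "v \<in> F (h k)"
        then obtain \<phi> where "\<phi> (h k) = v" "\<forall>z\<in>V. P \<phi> z" using V(3) sub by blast
        then show "\<exists>L. lift ({a..b} \<times> {t1..t2}) h L \<and> L k = v"
          using lift_of_solution[OF hS V(1) sub] by blast
      qed
    qed (use e1 e2 in auto)
  qed
  have strip: "\<exists>e>0. \<forall>a b. a \<le> s \<and> s \<le> b \<and> b - a < e \<longrightarrow> liftable ({a..b} \<times> {c..d}) h" for s
    using ab(2)
  proof (induction c d rule: Bolzano)
    case (trans u v w)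
    then obtain e1 e2 where e: "e1 > 0" "e2 > 0"
      "\<forall>a b. a \<le> s \<and> s \<le> b \<and> b - a < e1 \<longrightarrow> liftable ({a..b} \<times> {u..v}) h"
      "\<forall>a b. a \<le> s \<and> s \<le> b \<and> b - a < e2 \<longrightarrow> liftable ({a..b} \<times> {v..w}) h" by blast
    show ?case
    proof (intro exI[of _ "min e1 e2"] conjI allI impI)
      fix a b assume *: "a \<le> s \<and> s \<le> b \<and> b - a < min e1 e2"
      have eq: "{a..b} \<times> {u..w} = {a..b} \<times> {u..v} \<union> {a..b} \<times> {v..w}" using trans(3,4) by auto
      have int: "{a..b} \<times> {u..v} \<inter> {a..b} \<times> {v..w} = {a..b} \<times> {v}" using trans(3,4) by auto
      show "liftable ({a..b} \<times> {u..w}) h"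
        unfolding eq
        by (rule liftable_Un[of _ _ _ "(a, v)"]; (unfold int)?)
          (use * e trans(3,4) in \<open>auto intro!: hS closed_Times convex_connected convex_Times\<close>)
    qed (use e in auto)
  next
    case (local t)
    obtain e where "e > 0" "\<forall>a b t1 t2. a \<le> s \<and> s \<le> b \<and> b - a < e \<and> t1 \<le> t \<and> t \<le> t2 \<and> t2 - t1 < e
      \<longrightarrow> liftable ({a..b} \<times> {t1..t2}) h" using small by blast
    then show ?case by (intro exI[of _ e]) blast
  qed
  show ?thesis
    using ab(1)
  proof (induction a b rule: Bolzano)
    case (trans u v w)
    have eq: "{u..w} \<times> {c..d} = {u..v} \<times> {c..d} \<union> {v..w} \<times> {c..d}" using trans(3,4) by auto
    have int: "{u..v} \<times> {c..d} \<inter> {v..w} \<times> {c..d} = {v} \<times> {c..d}" using trans(3,4) by auto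
    show ?case
      unfolding eq
      by (rule liftable_Un[of _ _ _ "(v, c)"]; (unfold int)?)
        (use trans ab(2) in \<open>auto intro!: hS closed_Times convex_connected convex_Times\<close>)
  next
    case (local s)
    then show ?case using strip by blast
  qed
qed

text \<open>A path is a rectangle of height zero, after it has been extended to the line by constants.\<close>

lemma path_lift:
  assumes g: "path g" and v: "v \<in> F (g t0)" and t0: "t0 \<in> {0..1}"
  obtains L where "lift {0..1} g L" "L t0 = v"
proof -
  define cl :: "real \<Rightarrow> real" where "cl t = max 0 (min 1 t)" for t
  have "continuous_on UNIV (\<lambda>z::real \<times> real. g (cl (fst z)))"
    using g unfolding path_def cl_def
    by (rule continuous_on_compose2) (auto intro!: continuous_intros)
  then have "liftable ({0..1} \<times> {0..0}) (\<lambda>z::real \<times> real. g (cl (fst z)))"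
    by (rule liftable_rectangle) auto
  then obtain L where L: "lift ({0..1} \<times> {0..0::real}) (\<lambda>z. g (cl (fst z))) L" "L (t0, 0) = v"
    by (rule liftableD[of _ _ "(t0, 0)" v]) (use v t0 in \<open>auto simp: cl_def\<close>)
  have "lift {0..1} (\<lambda>t. g (cl (fst (t, 0::real)))) (\<lambda>t. L (t, 0))"
    by (rule lift_compose[OF L(1)]) (auto intro!: continuous_intros)
  then have "lift {0..1} g (\<lambda>t. L (t, 0))" by (rule lift_cong) (auto simp: cl_def)
  then show ?thesis using that L(2) by blast
qed

text \<open>Contract the loop to a constant loop and lift the homotopy to the square.  Over the edge of the constant
  loop the lift is constant.  The two edges next to it lie over the same path and the lift agrees at their
  ends on that edge, hence also at their other ends, which are the ends of the given loop.\<close>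

lemma loop_holonomy_trivial:
  assumes sc: "simply_connected (UNIV :: 'm set)" and g: "path g" "pathfinish g = pathstart g"
    and L: "lift {0..1} g L"
  shows "L 1 = L 0"
proof -
  define cl :: "real \<Rightarrow> real" where "cl t = max 0 (min 1 t)" for t
  let ?x = "g 0"
  have "homotopic_loops UNIV g (\<lambda>_. ?x)"
    using sc g unfolding simply_connected_def by (auto simp: path_def pathstart_def pathfinish_def)
  then obtain h' where h': "continuous_on ({0..1::real} \<times> {0..1::real}) h'" "\<forall>t\<in>{0..1}. h' (0, t) = g t"
    "\<forall>t\<in>{0..1}. h' (1, t) = ?x" "\<forall>s\<in>{0..1}. h' (s, 1) = h' (s, 0)"
    unfolding homotopic_loops by (auto simp: pathstart_def pathfinish_def o_def)
  define h where "h z = h' (cl (fst z), cl (snd z))" for z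
  have hcl: "h (s, t) = h' (s, t)" if "s \<in> {0..1}" "t \<in> {0..1}" for s t using that by (simp add: h_def cl_def)
  have h: "continuous_on UNIV h" unfolding h_def cl_def
    by (rule continuous_on_compose2[OF h'(1)]) (auto intro!: continuous_intros)
  have "L 0 \<in> F (h (0, 0))" using lift_fib[OF L, of 0] hcl h'(2) by simp
  then obtain M where M: "lift ({0..1} \<times> {0..1}) h M" "M (0, 0) = L 0"
    using liftableD[OF liftable_rectangle[OF h, of 0 1 0 1], of "(0, 0)" "L 0"] by auto
  have edge: "lift {0..1} (\<lambda>t. h (f t)) (\<lambda>t. M (f t))"
    if "continuous_on {0..1} f" "f ` {0..1} \<subseteq> {0..1} \<times> {0..1}" for f :: "real \<Rightarrow> real \<times> real"
    by (rule lift_compose[OF M(1) that])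
  have edge_cont: "continuous_on {0..1} (\<lambda>t. h (f t))" if "continuous_on {0..1} f" for f :: "real \<Rightarrow> real \<times> real"
    by (rule continuous_on_compose2[OF h that]) auto
  have c1: "connected {0..1::real}" by (simp add: convex_connected)
  have edge_unique: "M (f t1) = L' t1"
    if f: "continuous_on {0..1} f" "f ` {0..1} \<subseteq> {0..1} \<times> {0..1}" and L': "lift {0..1} (\<lambda>t. h (f t)) L'"
      and t: "t0 \<in> {0..1}" "M (f t0) = L' t0" "t1 \<in> {0..1}" for f :: "real \<Rightarrow> real \<times> real" and L' t0 t1
    by (rule lift_unique[OF c1 edge_cont[OF f(1)] edge[OF f] L' t])
  have left: "M (0, 1) = L 1"
  proof (rule edge_unique[of "\<lambda>t. (0, t)" L 0 1])
    show "lift {0..1} (\<lambda>t. h (0, t)) L" using L by (rule lift_cong) (use hcl h' in auto)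
  qed (use M in \<open>auto intro!: continuous_intros\<close>)
  have right: "M (1, 1) = M (1, 0)"
  proof (rule edge_unique[of "\<lambda>t. (1, t)" "\<lambda>_. M (1, 0)" 0 1])
    have "M (1, 0) \<in> F ?x" using lift_fib[OF M(1), of "(1, 0)"] hcl h' by auto
    from lift_const[OF this] show "lift {0..1} (\<lambda>t. h (1, t)) (\<lambda>_. M (1, 0))"
      by (rule lift_cong) (use hcl h' in auto)
  qed (auto intro!: continuous_intros)
  have "M (0, 0) = M (0, 1)"
  proof (rule edge_unique[of "\<lambda>s. (s, 0)" "\<lambda>s. M (s, 1)" 1 0])
    show "lift {0..1} (\<lambda>s. h (s, 0)) (\<lambda>s. M (s, 1))"
      by (rule lift_cong[OF edge[of "\<lambda>s. (s, 1)"]]) (use hcl h' in \<open>auto intro!: continuous_intros\<close>)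
  qed (use right in \<open>auto intro!: continuous_intros\<close>)
  then show ?thesis using left M(2) by simp
qed

lemma lift_join:
  assumes g: "path g1" "path g2" "pathfinish g1 = pathstart g2"
    and L: "lift {0..1} g1 L1" "lift {0..1} g2 L2" "L1 1 = L2 0"
  obtains L where "lift {0..1} (g1 +++ g2) L" "L 0 = L1 0" "L 1 = L2 1" "L (1/2) = L1 1"
proof -
  let ?L = "\<lambda>t. if t \<in> {0..1/2} then L1 (2 * t) else L2 (2 * t - 1)"
  have "lift ({0..1/2} \<union> {1/2..1}) (g1 +++ g2) ?L"
  proof (rule lift_glue)
    show "continuous_on ({0..1 / 2} \<union> {1 / 2..1}) (g1 +++ g2)"
      using path_join_imp[OF g] unfolding path_def by (rule continuous_on_subset) auto
    have "lift {0..1/2} (\<lambda>t. g1 (2 * t)) (\<lambda>t. L1 (2 * t))"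
      by (rule lift_compose[OF L(1)]) (auto intro!: continuous_intros)
    then show "lift {0..1/2} (g1 +++ g2) (\<lambda>t. L1 (2 * t))"
      by (rule lift_cong) (auto simp: joinpaths_def)
    have "lift {1/2..1} (\<lambda>t. g2 (2 * t - 1)) (\<lambda>t. L2 (2 * t - 1))"
      by (rule lift_compose[OF L(2)]) (auto intro!: continuous_intros)
    then show "lift {1/2..1} (g1 +++ g2) (\<lambda>t. L2 (2 * t - 1))"
    proof (rule lift_cong)
      show "g2 (2 * k - 1) = (g1 +++ g2) k" if "k \<in> {1/2..1}" for k
      proof (cases "k = 1/2")
        case True
        show ?thesis unfolding True using g by (simp add: joinpaths_def pathfinish_def pathstart_def)
      qed (use that in \<open>auto simp: joinpaths_def\<close>)
    qed auto
    show "L1 (2 * k) = L2 (2 * k - 1)" if "k \<in> {0..1/2} \<inter> {1/2..1}" for k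
    proof -
      have "k = 1/2" using that by auto
      show ?thesis unfolding \<open>k = 1/2\<close> using L(3) by simp
    qed
  qed auto
  moreover have "{0..1/2} \<union> {1/2..1} = {0..1::real}" by auto
  ultimately show ?thesis using that[of ?L] by simp
qed

text \<open>The value at \<open>x\<close> is obtained by continuation of \<open>c\<close> along a path from \<open>x0\<close> to \<open>x\<close>, and it does not depend
  on the path because the holonomy of loops is trivial.  Prolonging the path inside of a small domain
  around \<open>x\<close> shows that the function so defined is a solution.\<close>

theorem global_solution:
  assumes sc: "simply_connected (UNIV :: 'm set)" and c: "c \<in> F x0"
  shows "\<exists>\<phi>. \<phi> x0 = c \<and> (\<forall>x. P \<phi> x)"
proof -
  define Tr where "Tr x v \<longleftrightarrow> (\<exists>g L. path g \<and> pathstart g = x0 \<and> pathfinish g = x \<and> lift {0..1} g L \<and> L 0 = c \<and> L 1 = v)" for x v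
  have ex: "\<exists>v. Tr x v" for x
  proof -
    obtain g where g: "path g" "pathstart g = x0" "pathfinish g = x" using simply_connected_imp_path[OF sc] .
    obtain L where "lift {0..1} g L" "L 0 = c" using path_lift[OF g(1), of c 0] g c by (auto simp: pathstart_def)
    then show ?thesis unfolding Tr_def using g by blast
  qed
  have uniq: "v = w" if v: "Tr x v" and w: "Tr x w" for x v w
  proof -
    obtain g1 L1 where 1: "path g1" "pathstart g1 = x0" "pathfinish g1 = x" "lift {0..1} g1 L1" "L1 0 = c" "L1 1 = v"
      using v unfolding Tr_def by blast
    obtain g2 L2 where 2: "path g2" "pathstart g2 = x0" "pathfinish g2 = x" "lift {0..1} g2 L2" "L2 0 = c" "L2 1 = w"
      using w unfolding Tr_def by blast
    have "v \<in> F (reversepath g2 0)" using lift_fib[OF 1(4), of 1] 1 2 by (auto simp: reversepath_def pathfinish_def)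
    then obtain L3 where L3: "lift {0..1} (reversepath g2) L3" "L3 0 = v"
      using path_lift[of "reversepath g2" v 0] 2(1) by auto
    obtain L where L: "lift {0..1} (g1 +++ reversepath g2) L" "L 0 = c" "L 1 = L3 1"
      using lift_join[of g1 "reversepath g2" L1 L3] 1 2 L3 by auto
    have "L 1 = L 0" by (rule loop_holonomy_trivial[OF sc _ _ L(1)]) (use 1 2 in auto)
    then have "L3 1 = c" using L by simp
    have "lift {0..1} (\<lambda>t. reversepath g2 (1 - t)) (\<lambda>t. L3 (1 - t))"
      by (rule lift_compose[OF L3(1)]) (auto intro!: continuous_intros)
    then have "lift {0..1} g2 (\<lambda>t. L3 (1 - t))" by (rule lift_cong) (auto simp: reversepath_def)
    from lift_unique[OF _ _ this 2(4), of 0 1] show ?thesis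
      using 2 L3 \<open>L3 1 = c\<close> by (auto simp: path_def convex_connected)
  qed
  define \<phi> where "\<phi> x = (THE v. Tr x v)" for x
  have \<phi>: "Tr x (\<phi> x)" for x unfolding \<phi>_def using ex uniq by (metis theI)
  have \<phi>_eq: "\<phi> x = v" if "Tr x v" for x v using uniq[OF \<phi> that] .
  have "P \<phi> x" for x
  proof -
    obtain g L where g: "path g" "pathstart g = x0" "pathfinish g = x" "lift {0..1} g L" "L 0 = c" "L 1 = \<phi> x"
      using \<phi>[of x] unfolding Tr_def by blast
    have "\<phi> x \<in> F x" using lift_fib[OF g(4), of 1] g by (auto simp: pathfinish_def)
    moreover obtain V where V: "open V" "x \<in> V" "path_connected V" "\<forall>y\<in>V. \<forall>c\<in>F y. \<exists>\<phi>. \<phi> y = c \<and> (\<forall>z\<in>V. P \<phi> z)"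
      using loc[of UNIV x] by auto
    ultimately obtain \<psi> where \<psi>: "\<psi> x = \<phi> x" "\<forall>z\<in>V. P \<psi> z" by blast
    have "\<phi> y = \<psi> y" if y: "y \<in> V" for y
    proof (rule \<phi>_eq)
      obtain k where k: "path k" "path_image k \<subseteq> V" "pathstart k = x" "pathfinish k = y"
        using V y unfolding path_connected_def by blast
      have "lift {0..1} k (\<lambda>t. \<psi> (k t))"
        by (rule lift_of_solution[OF _ V(1) _ \<psi>(2)]) (use k in \<open>auto simp: path_def path_image_def\<close>)
      then obtain L' where "lift {0..1} (g +++ k) L'" "L' 0 = c" "L' 1 = \<psi> (k 1)"
        by (rule lift_join[OF g(1) k(1) _ g(4), rotated]) (use g k \<psi> in \<open>auto simp: pathstart_def\<close>)
      then show "Tr y (\<psi> y)"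
        unfolding Tr_def using g k k(4)[unfolded pathfinish_def] by (intro exI[of _ "g +++ k"] exI[of _ L']) auto
    qed
    then show ?thesis using germ[OF V(1,2), of \<psi> \<phi>] \<psi> V by auto
  qed
  moreover have "\<phi> x0 = c"
    by (rule \<phi>_eq) (use lift_const[OF c, of "{0..1}"] in
      \<open>auto simp: Tr_def path_def pathstart_def pathfinish_def intro!: exI[of _ "\<lambda>_. x0"] exI[of _ "\<lambda>_. c"]\<close>)
  ultimately show ?thesis by blast
qed

end

section \<open>Quaternions\<close>

lemma amul_simps: "fst (x \<odot> y) = fst x * fst y + snd x * snd y" "snd (x \<odot> y) = fst x * snd y + snd x * fst y"
  by (cases x; cases y; simp)+

lemma amul_comm: "x \<odot> y = y \<odot> x" and amul_assoc: "(x \<odot> y) \<odot> z = x \<odot> (y \<odot> z)"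
  and amul_add_left: "(x + y) \<odot> z = x \<odot> z + y \<odot> z" and amul_add_right: "z \<odot> (x + y) = z \<odot> x + z \<odot> y"
  and amul_diff_left: "(x - y) \<odot> z = x \<odot> z - y \<odot> z" and amul_diff_right: "z \<odot> (x - y) = z \<odot> x - z \<odot> y"
  and amul_minus_right: "z \<odot> (- x) = - (z \<odot> x)"
  by (auto simp: prod_eq_iff amul_simps algebra_simps)

lemma bounded_bilinear_amul: "bounded_bilinear (\<odot>)"
proof (rule bilinear_conv_bounded_bilinear[THEN iffD1])
  show "bilinear (\<odot>)"
    by (auto simp: bilinear_def prod_eq_iff amul_simps algebra_simps intro!: linearI)
qed

text \<open>The standard case distinction for pairs would split the four coefficients into real and imaginary
  parts; this one keeps them in one piece.\<close>

lemma hac_cases: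
  fixes x :: hac obtains a b c d where "x = (a, b, c, d)"
  by (cases x)

lemma hmul_assoc: "(x \<otimes> y) \<otimes> z = x \<otimes> (y \<otimes> z)"
proof -
  obtain a b c d where x: "x = (a, b, c, d)" by (rule hac_cases)
  obtain a' b' c' d' where y: "y = (a', b', c', d')" by (rule hac_cases)
  obtain a'' b'' c'' d'' where z: "z = (a'', b'', c'', d'')" by (rule hac_cases)
  show ?thesis
    unfolding x y z hmul.simps prod.inject amul_add_left amul_add_right amul_diff_left amul_diff_right amul_assoc
    by (intro conjI; simp only: algebra_simps)
qed

lemma hmul_add_left: "(x + y) \<otimes> z = x \<otimes> z + y \<otimes> z" and hmul_add_right: "z \<otimes> (x + y) = z \<otimes> x + z \<otimes> y"
  by (cases x rule: hac_cases; cases y rule: hac_cases; cases z rule: hac_cases; simp only: hmul.simps add_Pair amul_add_left amul_add_right prod.inject;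
      intro conjI; simp only: algebra_simps)+

lemma bilinear_hmul: "bilinear (\<otimes>)"
proof -
  have sc: "(r *\<^sub>R x) \<otimes> y = r *\<^sub>R (x \<otimes> y)" "x \<otimes> (r *\<^sub>R y) = r *\<^sub>R (x \<otimes> y)" for r x y
    by (cases x rule: hac_cases; cases y rule: hac_cases; simp only: hmul.simps scaleR_Pair bounded_bilinear.scaleR_left[OF bounded_bilinear_amul]
       bounded_bilinear.scaleR_right[OF bounded_bilinear_amul] scaleR_diff_right scaleR_add_right)+
  show ?thesis
    unfolding bilinear_def by (intro conjI allI linearI; simp only: hmul_add_left hmul_add_right sc)
qed

lemma bounded_bilinear_hmul: "bounded_bilinear (\<otimes>)"
  using bilinear_hmul by (rule bilinear_conv_bounded_bilinear[THEN iffD1])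

interpretation hmul: bounded_bilinear "(\<otimes>)" by (rule bounded_bilinear_hmul)

lemma amul_unit_simps: "aconst 1 \<odot> x = x" "x \<odot> aconst 1 = x" "0 \<odot> x = 0" "x \<odot> 0 = 0"
  by (cases x; simp add: aconst_def zero_prod_def)+

lemma hone_simps [simp]: "hone \<otimes> x = x" "x \<otimes> hone = x"
  by (cases x rule: hac_cases; simp only: hone_def hmul.simps amul_unit_simps; simp)+

lemma bounded_linear_hconj: "bounded_linear hconj"
proof (rule linear_conv_bounded_linear[THEN iffD1], rule linearI)
  show "hconj (x + y) = hconj x + hconj y" "hconj (r *\<^sub>R x) = r *\<^sub>R hconj x" for x y r
    by (cases x rule: hac_cases; cases y rule: hac_cases; simp)+
qed

lemma bounded_linear_hhat: "bounded_linear hhat"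
proof (rule linear_conv_bounded_linear[THEN iffD1], rule linearI)
  have "ahat (x + y) = ahat x + ahat y" "ahat (r *\<^sub>R x) = r *\<^sub>R ahat x" for x y r
    by (cases x; cases y; simp)+
  then show "hhat (x + y) = hhat x + hhat y" "hhat (r *\<^sub>R x) = r *\<^sub>R hhat x" for x y r
    by (cases x rule: hac_cases; cases y rule: hac_cases; simp)+
qed

lemmas hconj_linear = bounded_linear.linear[OF bounded_linear_hconj]
lemmas hconj_hom = linear_add[OF hconj_linear] linear_diff[OF hconj_linear] linear_neg[OF hconj_linear] linear_cmul[OF hconj_linear] linear_0[OF hconj_linear]
lemmas hhat_linear = bounded_linear.linear[OF bounded_linear_hhat]
lemmas hhat_hom = linear_add[OF hhat_linear] linear_diff[OF hhat_linear] linear_neg[OF hhat_linear] linear_cmul[OF hhat_linear] linear_0[OF hhat_linear]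

lemma hconj_hconj [simp]: "hconj (hconj x) = x" by (cases x rule: hac_cases) simp
lemma hhat_hhat [simp]: "hhat (hhat x) = x"
proof -
  have "ahat (ahat a) = a" for a by (cases a) simp
  then show ?thesis by (cases x rule: hac_cases) simp
qed

lemma hconj_hmul: "hconj (x \<otimes> y) = hconj y \<otimes> hconj x"
  by (cases x rule: hac_cases; cases y rule: hac_cases)
    (simp add: amul_minus_right amul_comm[of "fst x"] amul_comm amul_comm[of "fst y"] algebra_simps)

lemma hhat_hmul: "hhat (x \<otimes> y) = hhat x \<otimes> hhat y"
proof -
  have "ahat (a \<odot> b) = ahat a \<odot> ahat b" "ahat (a + b) = ahat a + ahat b" "ahat (a - b) = ahat a - ahat b" for a b
    by (cases a; cases b; simp)+
  then show ?thesis by (cases x rule: hac_cases; cases y rule: hac_cases) simp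
qed

lemma hhat_hconj: "hhat (hconj x) = hconj (hhat x)"
proof -
  have "ahat (- a) = - ahat a" for a by (cases a) simp
  then show ?thesis by (cases x rule: hac_cases) simp
qed

lemma hconj_hone [simp]: "hconj hone = hone" and hhat_hone [simp]: "hhat hone = hone"
  by (auto simp: hone_def aconst_def zero_prod_def)

lemma hconj_hmul_self: "hconj p \<otimes> p = (hform p p, 0, 0, 0)"
proof -
  obtain a b c d where p: "p = (a, b, c, d)" by (rule hac_cases)
  have "aconst (- \<i>) \<odot> x \<odot> (aconst (- \<i>) \<odot> x) = - (x \<odot> x)" for x
  proof -
    have "\<i> * z * (\<i> * w) = - (z * w)" for z w by (simp add: complex_eq_iff)
    then show ?thesis by (simp add: prod_eq_iff amul_simps aconst_def)
  qed
  then show ?thesis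
    by (simp add: p hform_def amul_minus_right amul_comm)
qed

lemma hform_eq_1_iff: "hform p p = aconst 1 \<longleftrightarrow> hconj p \<otimes> p = hone"
  by (simp add: hconj_hmul_self hone_def)

lemma unit_right: assumes "hconj p \<otimes> p = hone" shows "p \<otimes> hconj p = hone"
proof -
  have "p \<otimes> hconj p = hconj p \<otimes> p"
    by (cases p rule: hac_cases) (simp add: amul_minus_right amul_comm)
  then show ?thesis using assms by simp
qed

lemma unit_cancel: assumes "hconj p \<otimes> p = hone"
  shows "hconj p \<otimes> (p \<otimes> x) = x" "p \<otimes> (hconj p \<otimes> x) = x"
  using assms unit_right[OF assms] by (simp_all add: hmul_assoc[symmetric])

text \<open>The conjugation of the complex algebra \<open>hac\<close> with respect to the real form \<open>H0\<close>: a multiplicative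
  involution with fixed point set \<open>H0\<close>.  It reduces all closure properties of \<open>H0\<close> to identities.\<close>

fun htau :: "hac \<Rightarrow> hac" where
  "htau ((a, a'), (b, b'), (c, c'), (d, d')) =
    ((cnj a, cnj a'), (- cnj b, - cnj b'), (cnj c, cnj c'), (- cnj d, - cnj d'))"

lemma bounded_linear_htau: "bounded_linear htau"
proof (rule linear_conv_bounded_linear[THEN iffD1], rule linearI)
  show "htau (x + y) = htau x + htau y" "htau (r *\<^sub>R x) = r *\<^sub>R htau x" for x y r
    by (cases x rule: htau.cases; cases y rule: htau.cases; simp)+
qed

lemmas htau_linear = bounded_linear.linear[OF bounded_linear_htau]
lemmas htau_hom = linear_add[OF htau_linear] linear_diff[OF htau_linear] linear_neg[OF htau_linear] linear_cmul[OF htau_linear] linear_0[OF htau_linear]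

lemma htau_hmul: "htau (x \<otimes> y) = htau x \<otimes> htau y"
  by (cases x rule: htau.cases; cases y rule: htau.cases; simp add: algebra_simps)

lemma htau_hconj: "htau (hconj x) = hconj (htau x)" and htau_hhat: "htau (hhat x) = hhat (htau x)"
  by (cases x rule: htau.cases; simp)+

lemma H0_iff: "p \<in> H0 \<longleftrightarrow> htau p = p"
proof
  assume "p \<in> H0"
  then show "htau p = p"
    unfolding H0_def lorentz_numbers_def by (auto simp: aconst_def)
next
  assume *: "htau p = p"
  obtain a a' b b' c c' d d' where p: "p = ((a, a'), (b, b'), (c, c'), (d, d'))" by (cases p rule: htau.cases)
  define L where "L x y = (complex_of_real x, complex_of_real y)" for x y
  have L: "L x y \<in> lorentz_numbers" for x y by (auto simp: L_def lorentz_numbers_def)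
  have "p = (L (Re a) (Re a'), aconst \<i> \<odot> L (Im b) (Im b'), L (Re c) (Re c'), aconst \<i> \<odot> L (Im d) (Im d'))"
    using * by (auto simp: p L_def aconst_def complex_eq_iff)
  then show "p \<in> H0" unfolding H0_def using L by blast
qed

lemma hone_H0: "hone \<in> H0"
  by (simp add: H0_iff hone_def aconst_def zero_prod_def)

lemma H0_hmul: "p \<in> H0 \<Longrightarrow> q \<in> H0 \<Longrightarrow> p \<otimes> q \<in> H0" and H0_hconj: "p \<in> H0 \<Longrightarrow> hconj p \<in> H0"
  and H0_add: "p \<in> H0 \<Longrightarrow> q \<in> H0 \<Longrightarrow> p + q \<in> H0" and H0_scaleR: "p \<in> H0 \<Longrightarrow> r *\<^sub>R p \<in> H0"
  by (auto simp: H0_iff htau_hmul htau_hconj htau_hom)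

lemma Spin22_iff: "p \<in> Spin22 \<longleftrightarrow> p \<in> H0 \<and> hconj p \<otimes> p = hone"
  by (simp add: Spin22_def hform_eq_1_iff)

lemma Spin22_hmul: "p \<in> Spin22 \<Longrightarrow> q \<in> Spin22 \<Longrightarrow> p \<otimes> q \<in> Spin22"
  by (simp add: Spin22_iff H0_hmul hconj_hmul hmul_assoc unit_cancel)

lemma Spin22_hconj: "p \<in> Spin22 \<Longrightarrow> hconj p \<in> Spin22"
  by (simp add: Spin22_iff H0_hconj unit_right)

subsection \<open>Vectors\<close>

lemmas explicit_simps = r22_to_hac.simps asigma_def aconst_def hone_def zero_prod_def hmul.simps hhat.simps
  ahat.simps amul.simps add_Pair diff_Pair uminus_Pair scaleR_Pair prod.inject

lemma bounded_linear_r22_to_hac: "bounded_linear r22_to_hac"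
proof (rule linear_conv_bounded_linear[THEN iffD1], rule linearI)
  show "r22_to_hac (x + y) = r22_to_hac x + r22_to_hac y" "r22_to_hac (r *\<^sub>R x) = r *\<^sub>R r22_to_hac x" for x y r
    by (cases x; cases y; simp add: asigma_def aconst_def algebra_simps scaleR_conv_of_real)+
qed

lemmas r22_to_hac_linear = bounded_linear.linear[OF bounded_linear_r22_to_hac]
lemmas r22_to_hac_hom = linear_add[OF r22_to_hac_linear] linear_diff[OF r22_to_hac_linear] linear_neg[OF r22_to_hac_linear] linear_cmul[OF r22_to_hac_linear] linear_0[OF r22_to_hac_linear]

fun hac_to_r22 :: "hac \<Rightarrow> r22" where
  "hac_to_r22 ((a, a'), (b, b'), (c, c'), (d, d')) = (Im a', Re b, Im c, Re d)"

lemma bounded_linear_hac_to_r22: "bounded_linear hac_to_r22"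
proof (rule linear_conv_bounded_linear[THEN iffD1], rule linearI)
  show "hac_to_r22 (x + y) = hac_to_r22 x + hac_to_r22 y" "hac_to_r22 (r *\<^sub>R x) = r *\<^sub>R hac_to_r22 x" for x y r
    by (cases x rule: hac_to_r22.cases; cases y rule: hac_to_r22.cases; simp)+
qed

lemma hac_to_r22_inverse [simp]: "hac_to_r22 (r22_to_hac x) = x"
  by (cases x) (simp add: asigma_def aconst_def)

lemma r22_to_hac_inj: "r22_to_hac x = r22_to_hac y \<longleftrightarrow> x = y"
  by (metis hac_to_r22_inverse)

lemma htau_r22: "htau (r22_to_hac x) = - r22_to_hac x"
  and hconj_hhat_r22: "hconj (hhat (r22_to_hac x)) = - r22_to_hac x"
  by (cases x; simp add: asigma_def aconst_def zero_prod_def)+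

text \<open>The two conditions characterize the quaternions that represent vectors.  Both are preserved by the
  rotations defined below.\<close>

lemma r22_to_hac_inverse: "htau z = - z \<Longrightarrow> hconj (hhat z) = - z \<Longrightarrow> r22_to_hac (hac_to_r22 z) = z"
  by (cases z rule: hac_to_r22.cases) (auto simp: asigma_def aconst_def complex_eq_iff)

lemma clifford_relation:
  "r22_to_hac x \<otimes> hhat (r22_to_hac y) + r22_to_hac y \<otimes> hhat (r22_to_hac x) = (- 2 * metric22 x y) *\<^sub>R hone"
  by (cases x; cases y; simp only: explicit_simps metric22.simps;
      intro conjI; simp add: complex_eq_iff; simp add: algebra_simps)

text \<open>The map \<open>z \<mapsto> \<langle>\<langle>Z \<cdot> \<phi>, \<phi>\<rangle>\<rangle>\<close> in coordinates, where \<open>p\<close> is the coordinate of \<open>\<phi>\<close> and \<open>z\<close> that of \<open>Z\<close>, see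
  \<open>pairing_clifford_coord\<close> below.  The sign is \<open>(\<sigma> i)\<^sup>2 = -1\<close>.\<close>

definition spin_rot :: "hac \<Rightarrow> hac \<Rightarrow> hac" where
  "spin_rot p z = - (hconj p \<otimes> z \<otimes> hhat p)"

lemma spin_rot_add: "spin_rot p (x + y) = spin_rot p x + spin_rot p y"
  and spin_rot_scaleR: "spin_rot p (r *\<^sub>R x) = r *\<^sub>R spin_rot p x"
  by (simp_all add: spin_rot_def hmul.add_left hmul.add_right hmul.scaleR_left hmul.scaleR_right)

lemma spin_rot_r22: "p \<in> H0 \<Longrightarrow> r22_to_hac (hac_to_r22 (spin_rot p (r22_to_hac x))) = spin_rot p (r22_to_hac x)"
  by (rule r22_to_hac_inverse)
    (simp_all add: spin_rot_def htau_hmul htau_hconj htau_hhat htau_r22 H0_iff hhat_hmul hconj_hmul hhat_hconj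
      htau_hom hhat_hom hconj_hom hmul.minus_left hmul.minus_right hconj_hhat_r22 hmul_assoc)

text \<open>The Clifford relation expresses the metric by the products \<open>z \<otimes> hhat w\<close>, which a unit spinor conjugates
  by itself.\<close>

lemma spin_rot_metric:
  assumes p: "p \<in> Spin22"
    and x': "r22_to_hac x' = spin_rot p (r22_to_hac x)" and y': "r22_to_hac y' = spin_rot p (r22_to_hac y)"
  shows "metric22 x' y' = metric22 x y"
proof -
  have u: "hconj p \<otimes> p = hone" using p by (simp add: Spin22_iff)
  have uh: "hhat p \<otimes> (hconj (hhat p) \<otimes> z) = z" for z
    using arg_cong[OF unit_right[OF u], of hhat] by (simp add: hhat_hmul hhat_hconj hmul_assoc[symmetric])
  have rot: "spin_rot p z \<otimes> hhat (spin_rot p w) = hconj p \<otimes> (z \<otimes> hhat w) \<otimes> p" for z w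
    by (simp add: spin_rot_def hhat_hmul hhat_hconj hhat_hom hmul.minus_left hmul.minus_right hmul_assoc uh)
  have "(- 2 * metric22 x' y') *\<^sub>R hone = hconj p \<otimes> ((- 2 * metric22 x y) *\<^sub>R hone) \<otimes> p"
    unfolding clifford_relation[symmetric] x' y' rot by (simp add: hmul.add_left hmul.add_right)
  also have "\<dots> = (- 2 * metric22 x y) *\<^sub>R hone"
    by (simp only: hmul.scaleR_left hmul.scaleR_right hone_simps u)
  finally show ?thesis by (simp add: hone_def aconst_def zero_prod_def)
qed

lemma clifford_coord_twice: "clifford_coord z (clifford_coord w p) = z \<otimes> hhat w \<otimes> p"
  and pairing_clifford_coord: "hscale (asigma \<i>) (hconj p \<otimes> clifford_coord z p) = spin_rot p z"
proof -
  define j :: hac where "j = (asigma \<i>, 0, 0, 0)"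
  have j: "hscale (asigma \<i>) x = j \<otimes> x" "x \<otimes> j = j \<otimes> x" "j \<otimes> (j \<otimes> x) = - x" "hhat j = - j" for x
  proof -
    have s: "asigma \<i> \<odot> (asigma \<i> \<odot> a) = - a" for a by (cases a) (simp add: asigma_def)
    show "hscale (asigma \<i>) x = j \<otimes> x" by (cases x rule: hac_cases; simp only: j_def hscale.simps hmul.simps amul_unit_simps; simp)
    show "x \<otimes> j = j \<otimes> x"
      by (cases x rule: hac_cases; simp only: j_def hmul.simps amul_unit_simps amul_comm[of _ "asigma \<i>"]; simp)
    show "j \<otimes> (j \<otimes> x) = - x"
      by (cases x rule: hac_cases; simp only: j_def hmul.simps amul_unit_simps diff_0_right add_0_right add_0_left diff_0 s uminus_Pair)
    show "hhat j = - j" by (simp add: j_def asigma_def zero_prod_def)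
  qed
  have jc: "x \<otimes> (j \<otimes> y) = j \<otimes> (x \<otimes> y)" for x y
    by (metis j(2) hmul_assoc)
  show "clifford_coord z (clifford_coord w p) = z \<otimes> hhat w \<otimes> p"
  proof -
    have "clifford_coord z (clifford_coord w p) = j \<otimes> (z \<otimes> (hhat j \<otimes> (hhat w \<otimes> p)))"
      by (simp only: clifford_coord_def j(1) hhat_hmul hhat_hhat)
    also have "\<dots> = - (j \<otimes> (z \<otimes> (j \<otimes> (hhat w \<otimes> p))))"
      by (simp only: j(4) hmul.minus_left hmul.minus_right)
    also have "\<dots> = z \<otimes> hhat w \<otimes> p"
      by (simp only: jc[of z] j(3) minus_minus hmul_assoc)
    finally show ?thesis .
  qed
  show "hscale (asigma \<i>) (hconj p \<otimes> clifford_coord z p) = spin_rot p z"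
    by (simp only: clifford_coord_def spin_rot_def j(1) hmul_assoc jc[of "hconj p"] j(3))
qed

subsection \<open>The Lie algebra\<close>

text \<open>Coordinates \<open>(wE, wT, b02, b03, b12, b13)\<close> on the Lie algebra of \<open>Spin(2,2)\<close>.  They are adapted to the
  splitting into \<open>E\<close> and \<open>TM\<close>: \<open>wE\<close> and \<open>wT\<close> generate the boosts of the two planes and will be the
  connection forms, and \<open>bjk\<close> mixes the planes and will be the \<open>j\<close>-th coordinate of \<open>B(X, e\<^sub>k)\<close>.\<close>

type_synonym lie_coords = "real \<times> real \<times> real \<times> real \<times> real \<times> real"

text \<open>This is \<open>1/2 ((wT + \<sigma> wE) i I + (\<sigma> b02 - b13) J + (\<sigma> b03 - b12) i K)\<close>.\<close>

fun lie_elem :: "lie_coords \<Rightarrow> hac" where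
  "lie_elem (wE, wT, b02, b03, b12, b13) = (1/2) *\<^sub>R
     (0, (\<i> * of_real wT, \<i> * of_real wE), (- of_real b13, of_real b02), (- \<i> * of_real b12, \<i> * of_real b03))"

lemma bounded_linear_lie_elem: "bounded_linear lie_elem"
proof (rule linear_conv_bounded_linear[THEN iffD1], rule linearI)
  show "lie_elem (x + y) = lie_elem x + lie_elem y" "lie_elem (r *\<^sub>R x) = r *\<^sub>R lie_elem x" for x y r
    by (cases x rule: lie_elem.cases; cases y rule: lie_elem.cases; simp add: algebra_simps scaleR_conv_of_real)+
qed

lemmas lie_elem_linear = bounded_linear.linear[OF bounded_linear_lie_elem]
lemmas lie_elem_hom = linear_add[OF lie_elem_linear] linear_diff[OF lie_elem_linear] linear_neg[OF lie_elem_linear] linear_cmul[OF lie_elem_linear] linear_0[OF lie_elem_linear]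

lemma hconj_lie_elem: "hconj (lie_elem u) = - lie_elem u" and lie_elem_H0: "lie_elem u \<in> H0"
  by (cases u rule: lie_elem.cases; simp add: H0_iff zero_prod_def)+

fun lie_bracket_coords :: "lie_coords \<Rightarrow> lie_coords \<Rightarrow> lie_coords" where
  "lie_bracket_coords (wE, wT, b02, b03, b12, b13) (wE', wT', b02', b03', b12', b13') =
    (b12 * b02' - b02 * b12' + b03 * b13' - b13 * b03',
     b02 * b03' - b03 * b02' + b13 * b12' - b12 * b13',
     wT * b03' - wE * b12' - wT' * b03 + wE' * b12,
     wT * b02' - wE * b13' - wT' * b02 + wE' * b13,
     wT * b13' - wE * b02' - wT' * b13 + wE' * b02,
     wT * b12' - wE * b03' - wT' * b12 + wE' * b03)"

text \<open>The structure constants of the Lie algebra are the right-hand sides of the Ricci equation (first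
  component), of the Gauss equation (second component) and of the Codazzi equations.\<close>

lemma lie_elem_commutator:
  "lie_elem u \<otimes> lie_elem v - lie_elem v \<otimes> lie_elem u = lie_elem (lie_bracket_coords u v)"
  by (cases u rule: lie_elem.cases; cases v rule: lie_elem.cases)
    (simp only: lie_elem.simps lie_bracket_coords.simps explicit_simps;
      intro conjI; simp add: complex_eq_iff; simp add: field_simps)

text \<open>The action of the Lie algebra on coordinates of vectors, as an infinitesimal isometry of \<open>metric22\<close>.\<close>

fun lie_action :: "lie_coords \<Rightarrow> r22 \<Rightarrow> r22" where
  "lie_action (wE, wT, b02, b03, b12, b13) (x0, x1, x2, x3) =
    (wE * x1 + x2 * b02 + x3 * b03, wE * x0 + x2 * b12 + x3 * b13,
     wT * x3 - x0 * b02 + x1 * b12, wT * x2 + x0 * b03 - x1 * b13)"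

lemma lie_elem_action:
  "r22_to_hac x \<otimes> hhat (lie_elem u) - lie_elem u \<otimes> r22_to_hac x = r22_to_hac (lie_action u x)"
  by (cases u rule: lie_elem.cases; cases x)
    (simp only: lie_elem.simps lie_action.simps explicit_simps;
      intro conjI; simp add: complex_eq_iff; simp add: algebra_simps)

section \<open>Calculus on surfaces\<close>

\<comment> \<open>Charts and spinorial frames are pairs that should stay in one piece.\<close>
declare split_paired_All [simp del] split_paired_Ex [simp del]

locale surface =
  fixes \<A> :: "'m::{t2_space, second_countable_topology} atlas"
  assumes smooth_surface: "smooth_surface \<A>"
begin

lemma chart_props:
  assumes "\<kappa> \<in> \<A>"
  shows "open (fst \<kappa>)" "open (snd \<kappa> ` fst \<kappa>)" "continuous_on (fst \<kappa>) (snd \<kappa>)"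
    "continuous_on (snd \<kappa> ` fst \<kappa>) (chart_inv \<kappa>)" "inj_on (snd \<kappa>) (fst \<kappa>)"
    "x \<in> fst \<kappa> \<Longrightarrow> chart_inv \<kappa> (snd \<kappa> x) = x"
proof -
  have h: "open (fst \<kappa>)" "open (snd \<kappa> ` fst \<kappa>)" "homeomorphism (fst \<kappa>) (snd \<kappa> ` fst \<kappa>) (snd \<kappa>) (chart_inv \<kappa>)"
    using smooth_surface assms unfolding smooth_surface_def by auto
  then show "open (fst \<kappa>)" "open (snd \<kappa> ` fst \<kappa>)" "continuous_on (fst \<kappa>) (snd \<kappa>)"
    "continuous_on (snd \<kappa> ` fst \<kappa>) (chart_inv \<kappa>)" "x \<in> fst \<kappa> \<Longrightarrow> chart_inv \<kappa> (snd \<kappa> x) = x"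
    by (auto simp: homeomorphism_def)
  show "inj_on (snd \<kappa>) (fst \<kappa>)"
    using h(3) by (intro inj_on_inverseI[of _ "chart_inv \<kappa>"]) (auto simp: homeomorphism_def)
qed

lemma ex_chart: obtains \<kappa> where "chart_at \<A> x \<kappa>"
  using smooth_surface unfolding smooth_surface_def by blast

lemma some_chart: "chart_at \<A> x (SOME \<kappa>. chart_at \<A> x \<kappa>)"
  by (rule someI_ex) (metis ex_chart)

lemma chart_at_D: "chart_at \<A> x \<kappa> \<Longrightarrow> \<kappa> \<in> \<A>" "chart_at \<A> x \<kappa> \<Longrightarrow> x \<in> fst \<kappa>"
  by (auto simp: chart_at_def)

lemma open_chart_image:
  assumes "\<kappa> \<in> \<A>" "open W"
  shows "open (snd \<kappa> ` (fst \<kappa> \<inter> W))"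
proof -
  have "snd \<kappa> ` (fst \<kappa> \<inter> W) = chart_inv \<kappa> -` W \<inter> snd \<kappa> ` fst \<kappa>"
    using chart_props(6)[OF assms(1)] by auto
  then show ?thesis
    using continuous_open_preimage[OF chart_props(4)[OF assms(1)] chart_props(2)[OF assms(1)] assms(2)]
    by (simp add: Int_commute)
qed

lemma chart_inv_mem:
  assumes "\<kappa> \<in> \<A>" "z \<in> snd \<kappa> ` (fst \<kappa> \<inter> W)"
  shows "chart_inv \<kappa> z \<in> fst \<kappa> \<inter> W" "snd \<kappa> (chart_inv \<kappa> z) = z"
  using assms(2) chart_props(6)[OF assms(1)] by auto

lemma chart_change:
  assumes "chart_at \<A> x \<kappa>" "chart_at \<A> x \<kappa>'"
  shows "((snd \<kappa>' \<circ> chart_inv \<kappa>) has_derivative chart_change_deriv \<kappa> \<kappa>' x) (at (snd \<kappa> x))"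
proof -
  have "smooth_on (snd \<kappa> ` (fst \<kappa> \<inter> fst \<kappa>')) (snd \<kappa>' \<circ> chart_inv \<kappa>)"
    using smooth_surface assms unfolding smooth_surface_def chart_at_def by auto
  then have "(snd \<kappa>' \<circ> chart_inv \<kappa>) differentiable (at (snd \<kappa> x))"
    by (rule smooth_on_imp_differentiable) (use assms in \<open>auto simp: chart_at_def\<close>)
  then show ?thesis unfolding chart_change_deriv_def by (simp add: frechet_derivative_works)
qed

lemma chart_change_unique:
  assumes "chart_at \<A> x \<kappa>" "chart_at \<A> x \<kappa>'" "((snd \<kappa>' \<circ> chart_inv \<kappa>) has_derivative D) (at (snd \<kappa> x))"
  shows "chart_change_deriv \<kappa> \<kappa>' x = D"
  using has_derivative_unique[OF chart_change[OF assms(1,2)] assms(3)] .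

lemma chart_switch:
  assumes x: "chart_at \<A> x \<kappa>" "chart_at \<A> x \<kappa>'" and D: "((f \<circ> chart_inv \<kappa>) has_derivative D) (at (snd \<kappa> x))"
  shows "((f \<circ> chart_inv \<kappa>') has_derivative (\<lambda>w. D (chart_change_deriv \<kappa>' \<kappa> x w))) (at (snd \<kappa>' x))"
proof -
  note c = chart_at_D[OF x(1)] chart_at_D[OF x(2)]
  have "((f \<circ> chart_inv \<kappa>) has_derivative D) (at ((snd \<kappa> \<circ> chart_inv \<kappa>') (snd \<kappa>' x)))"
    using D c by (simp add: chart_props)
  from has_derivative_compose[OF chart_change[OF x(2,1)] this]
  have "((\<lambda>z. (f \<circ> chart_inv \<kappa>) ((snd \<kappa> \<circ> chart_inv \<kappa>') z)) has_derivative (\<lambda>w. D (chart_change_deriv \<kappa>' \<kappa> x w))) (at (snd \<kappa>' x))" .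
  then show ?thesis
  proof (rule has_derivative_transform_within_open[OF _ open_chart_image[OF c(3) chart_props(1)[OF c(1)]]])
    fix z assume "z \<in> snd \<kappa>' ` (fst \<kappa>' \<inter> fst \<kappa>)"
    then show "(f \<circ> chart_inv \<kappa>) ((snd \<kappa> \<circ> chart_inv \<kappa>') z) = (f \<circ> chart_inv \<kappa>') z"
      using c by (auto simp: chart_props)
  qed (use c in auto)
qed

lemma chart_change_comp:
  assumes "chart_at \<A> x \<kappa>" "chart_at \<A> x \<kappa>'" "chart_at \<A> x \<kappa>''"
  shows "chart_change_deriv \<kappa>' \<kappa>'' x (chart_change_deriv \<kappa> \<kappa>' x w) = chart_change_deriv \<kappa> \<kappa>'' x w"
  using chart_switch[OF assms(2,1) chart_change[OF assms(2,3)]] chart_change_unique[OF assms(1,3)] by metis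

lemma chart_change_self: "chart_at \<A> x \<kappa> \<Longrightarrow> chart_change_deriv \<kappa> \<kappa> x w = w"
proof -
  assume x: "chart_at \<A> x \<kappa>"
  note c = chart_at_D[OF x]
  have "((\<lambda>z. z) has_derivative (\<lambda>w. w)) (at (snd \<kappa> x))" by (rule has_derivative_ident)
  then have "((snd \<kappa> \<circ> chart_inv \<kappa>) has_derivative (\<lambda>w. w)) (at (snd \<kappa> x))"
    by (rule has_derivative_transform_within_open[OF _ chart_props(2)[OF c(1)]]) (use c in \<open>auto simp: chart_props\<close>)
  then show ?thesis using chart_change_unique[OF x x] by metis
qed

lemma chart_change_linear:
  "chart_at \<A> x \<kappa> \<Longrightarrow> chart_at \<A> x \<kappa>' \<Longrightarrow> linear (chart_change_deriv \<kappa> \<kappa>' x)"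
  using chart_change has_derivative_linear by blast

subsection \<open>Tangent vectors\<close>

lemma coord_vector_tangent: "chart_at \<A> x \<kappa> \<Longrightarrow> coord_vector \<A> \<kappa> w x \<in> tangent_space \<A> x"
  by (auto simp: tangent_space_def coord_vector_def chart_change_comp)

lemma coord_vector_self [simp]: "chart_at \<A> x \<kappa> \<Longrightarrow> coord_vector \<A> \<kappa> w x \<kappa> = w"
  by (simp add: coord_vector_def chart_change_self)

lemma tangent_spaceI:
  assumes "\<And>\<kappa> \<kappa>'. chart_at \<A> x \<kappa> \<Longrightarrow> chart_at \<A> x \<kappa>' \<Longrightarrow> v \<kappa>' = chart_change_deriv \<kappa> \<kappa>' x (v \<kappa>)"
    "\<And>\<kappa>. \<not> chart_at \<A> x \<kappa> \<Longrightarrow> v \<kappa> = 0"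
  shows "v \<in> tangent_space \<A> x"
  unfolding tangent_space_def using assms by blast

lemma tangent_spaceD:
  assumes "v \<in> tangent_space \<A> x"
  shows "chart_at \<A> x \<kappa> \<Longrightarrow> chart_at \<A> x \<kappa>' \<Longrightarrow> chart_change_deriv \<kappa> \<kappa>' x (v \<kappa>) = v \<kappa>'"
    "\<not> chart_at \<A> x \<kappa> \<Longrightarrow> v \<kappa> = 0"
proof -
  note c = assms[unfolded tangent_space_def mem_Collect_eq]
  note 1 = conjunct1[OF c] and 2 = conjunct2[OF c]
  show "chart_change_deriv \<kappa> \<kappa>' x (v \<kappa>) = v \<kappa>'" if "chart_at \<A> x \<kappa>" "chart_at \<A> x \<kappa>'"
    using 1[rule_format, OF conjI[OF that]] by (rule sym)
  show "v \<kappa> = 0" if "\<not> chart_at \<A> x \<kappa>" using 2[rule_format, OF that] .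
qed

lemma coord_vector_component [simp]:
  assumes "v \<in> tangent_space \<A> x" "chart_at \<A> x \<kappa>" shows "coord_vector \<A> \<kappa> (v \<kappa>) x = v"
  by (rule ext) (simp add: coord_vector_def tangent_spaceD(1)[OF assms] tangent_spaceD(2)[OF assms(1)])

lemma tangent_eqI:
  assumes "v \<in> tangent_space \<A> x" "w \<in> tangent_space \<A> x" "chart_at \<A> x \<kappa>" "v \<kappa> = w \<kappa>"
  shows "v = w"
  using coord_vector_component[OF assms(1,3)] coord_vector_component[OF assms(2,3)] assms(4) by metis

lemma tangent_add: "v \<in> tangent_space \<A> x \<Longrightarrow> w \<in> tangent_space \<A> x \<Longrightarrow> v + w \<in> tangent_space \<A> x"
  by (rule tangent_spaceI) (simp_all add: linear_add[OF chart_change_linear] tangent_spaceD)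

lemma tangent_scaleR: "v \<in> tangent_space \<A> x \<Longrightarrow> r *\<^sub>R v \<in> tangent_space \<A> x"
  by (rule tangent_spaceI) (simp_all add: scaleR_fun_def linear_cmul[OF chart_change_linear] tangent_spaceD)

lemma coord_vector_add:
  assumes "chart_at \<A> x \<kappa>"
  shows "coord_vector \<A> \<kappa> (v + w) x = coord_vector \<A> \<kappa> v x + coord_vector \<A> \<kappa> w x"
  by (rule tangent_eqI[OF _ _ assms]) (simp_all add: assms coord_vector_tangent tangent_add)

lemma coord_vector_scaleR:
  assumes "chart_at \<A> x \<kappa>"
  shows "coord_vector \<A> \<kappa> (r *\<^sub>R v) x = r *\<^sub>R coord_vector \<A> \<kappa> v x"
proof (rule tangent_eqI[OF _ _ assms])
  show "coord_vector \<A> \<kappa> (r *\<^sub>R v) x \<kappa> = (r *\<^sub>R coord_vector \<A> \<kappa> v x) \<kappa>"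
    by (simp add: assms scaleR_fun_def)
qed (simp_all add: assms coord_vector_tangent tangent_scaleR)

abbreviation coord1 :: "'m chart \<Rightarrow> 'm \<Rightarrow> 'm tvec" where "coord1 \<kappa> \<equiv> coord_vector \<A> \<kappa> (axis 1 1)"
abbreviation coord2 :: "'m chart \<Rightarrow> 'm \<Rightarrow> 'm tvec" where "coord2 \<kappa> \<equiv> coord_vector \<A> \<kappa> (axis 2 1)"

lemma vec2_decomp: "(w :: real^2) = w $ 1 *\<^sub>R axis 1 1 + w $ 2 *\<^sub>R axis 2 1"
  by (simp add: vec_eq_iff forall_2 axis_def)

lemma coord_vector_decomp:
  assumes "chart_at \<A> x \<kappa>"
  shows "coord_vector \<A> \<kappa> w x = w $ 1 *\<^sub>R coord1 \<kappa> x + w $ 2 *\<^sub>R coord2 \<kappa> x"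
  by (subst vec2_decomp) (simp only: coord_vector_add[OF assms] coord_vector_scaleR[OF assms])

lemma tangent_decomp:
  assumes "v \<in> tangent_space \<A> x" "chart_at \<A> x \<kappa>"
  shows "v = v \<kappa> $ 1 *\<^sub>R coord1 \<kappa> x + v \<kappa> $ 2 *\<^sub>R coord2 \<kappa> x"
  using coord_vector_decomp[OF assms(2), of "v \<kappa>"] assms by simp

lemma linear_map_on_tangent:
  assumes "linear_map_on (tangent_space \<A> x) f" "v \<in> tangent_space \<A> x" "chart_at \<A> x \<kappa>"
  shows "f v = v \<kappa> $ 1 *\<^sub>R f (coord1 \<kappa> x) + v \<kappa> $ 2 *\<^sub>R f (coord2 \<kappa> x)"
proof -
  have "f v = f (v \<kappa> $ 1 *\<^sub>R coord1 \<kappa> x + v \<kappa> $ 2 *\<^sub>R coord2 \<kappa> x)" using tangent_decomp[OF assms(2,3)] by metis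
  then show ?thesis
    using assms(1) coord_vector_tangent[OF assms(3)] tangent_scaleR unfolding linear_map_on_def by simp
qed

subsection \<open>Differentials\<close>

text \<open>A relational form of the differential, which includes the differentiability of \<open>f\<close> at \<open>x\<close>.  The function
  \<open>mdiff\<close> computes the differential in some arbitrary chart and is recovered by \<open>has_mdiff_imp_mdiff\<close>.\<close>

definition has_mdiff :: "('m \<Rightarrow> 'b::real_normed_vector) \<Rightarrow> 'm \<Rightarrow> ('m tvec \<Rightarrow> 'b) \<Rightarrow> bool" where
  "has_mdiff f x L \<longleftrightarrow> (\<forall>\<kappa>. chart_at \<A> x \<kappa> \<longrightarrow>
     ((f \<circ> chart_inv \<kappa>) has_derivative (\<lambda>w. L (coord_vector \<A> \<kappa> w x))) (at (snd \<kappa> x)))"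

lemma has_mdiffD:
  "has_mdiff f x L \<Longrightarrow> chart_at \<A> x \<kappa> \<Longrightarrow>
    ((\<lambda>z. f (chart_inv \<kappa> z)) has_derivative (\<lambda>w. L (coord_vector \<A> \<kappa> w x))) (at (snd \<kappa> x))"
  by (simp add: has_mdiff_def o_def)

lemma has_mdiff_imp_mdiff:
  assumes "has_mdiff f x L" "v \<in> tangent_space \<A> x" shows "mdiff \<A> f x v = L v"
proof -
  define \<kappa> where "\<kappa> = (SOME \<kappa>. chart_at \<A> x \<kappa>)"
  have c: "chart_at \<A> x \<kappa>" unfolding \<kappa>_def by (rule some_chart)
  have "frechet_derivative (f \<circ> chart_inv \<kappa>) (at (snd \<kappa> x)) = (\<lambda>w. L (coord_vector \<A> \<kappa> w x))"
    using assms(1) c unfolding has_mdiff_def by (intro frechet_derivative_at[symmetric]) auto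
  then show ?thesis using assms(2) c by (simp add: mdiff_def \<kappa>_def[symmetric] Let_def)
qed

lemma has_mdiff_chartI:
  assumes "chart_at \<A> x \<kappa>" "((f \<circ> chart_inv \<kappa>) has_derivative D) (at (snd \<kappa> x))"
  shows "has_mdiff f x (\<lambda>v. D (v \<kappa>))"
  unfolding has_mdiff_def
proof (intro allI impI)
  fix \<kappa>' assume c: "chart_at \<A> x \<kappa>'"
  show "((f \<circ> chart_inv \<kappa>') has_derivative (\<lambda>w. D (coord_vector \<A> \<kappa>' w x \<kappa>))) (at (snd \<kappa>' x))"
    using chart_switch[OF assms(1) c assms(2)] assms(1) by (simp add: coord_vector_def)
qed

lemma has_mdiff_cong_deriv:
  assumes "has_mdiff f x L" "\<And>v. v \<in> tangent_space \<A> x \<Longrightarrow> L v = L' v" shows "has_mdiff f x L'"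
  using assms unfolding has_mdiff_def by (simp add: coord_vector_tangent)

lemma has_mdiff_cong:
  assumes "open W" "x \<in> W" "\<And>y. y \<in> W \<Longrightarrow> f y = g y" "has_mdiff f x L" shows "has_mdiff g x L"
  unfolding has_mdiff_def
proof (intro allI impI)
  fix \<kappa> assume c: "chart_at \<A> x \<kappa>"
  note c' = chart_at_D[OF c]
  have "((f \<circ> chart_inv \<kappa>) has_derivative (\<lambda>w. L (coord_vector \<A> \<kappa> w x))) (at (snd \<kappa> x))"
    using assms(4) c by (simp add: has_mdiff_def)
  then show "((g \<circ> chart_inv \<kappa>) has_derivative (\<lambda>w. L (coord_vector \<A> \<kappa> w x))) (at (snd \<kappa> x))"
    by (rule has_derivative_transform_within_open[OF _ open_chart_image[OF c'(1) assms(1)]])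
      (use assms(2,3) c' in \<open>auto simp: chart_props\<close>)
qed

lemma mdiff_cong:
  assumes "open W" "x \<in> W" "\<And>y. y \<in> W \<Longrightarrow> f y = g y" shows "mdiff \<A> f x v = mdiff \<A> g x v"
proof -
  define \<kappa> where "\<kappa> = (SOME \<kappa>. chart_at \<A> x \<kappa>)"
  have c: "chart_at \<A> x \<kappa>" unfolding \<kappa>_def by (rule some_chart)
  note c' = chart_at_D[OF c]
  have "frechet_derivative (f \<circ> chart_inv \<kappa>) (at (snd \<kappa> x)) = frechet_derivative (g \<circ> chart_inv \<kappa>) (at (snd \<kappa> x))"
    by (rule frechet_derivative_cong_open[OF open_chart_image[OF c'(1) assms(1)]])
      (use assms(2,3) c' in \<open>auto simp: chart_props\<close>)
  then show ?thesis by (simp add: mdiff_def \<kappa>_def[symmetric])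
qed

lemma has_mdiff_const: "has_mdiff (\<lambda>y. c) x (\<lambda>v. 0)"
  by (simp add: has_mdiff_def o_def)

lemma has_mdiff_linear:
  assumes h: "bounded_linear h" and f: "has_mdiff f x L"
  shows "has_mdiff (\<lambda>y. h (f y)) x (\<lambda>v. h (L v))"
  unfolding has_mdiff_def o_def
proof (intro allI impI)
  fix \<kappa> assume "chart_at \<A> x \<kappa>"
  from bounded_linear.has_derivative[OF h has_mdiffD[OF f this]]
  show "((\<lambda>z. h (f (chart_inv \<kappa> z))) has_derivative (\<lambda>w. h (L (coord_vector \<A> \<kappa> w x)))) (at (snd \<kappa> x))" .
qed

lemma has_mdiff_bilinear:
  "bounded_bilinear mul \<Longrightarrow> has_mdiff f x L \<Longrightarrow> has_mdiff g x M \<Longrightarrow>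
    has_mdiff (\<lambda>y. mul (f y) (g y)) x (\<lambda>v. mul (f x) (M v) + mul (L v) (g x))"
  unfolding has_mdiff_def o_def
proof (intro allI impI)
  fix \<kappa> assume bil: "bounded_bilinear mul" and c: "chart_at \<A> x \<kappa>"
    and f: "\<forall>\<kappa>. chart_at \<A> x \<kappa> \<longrightarrow> ((\<lambda>x. f (chart_inv \<kappa> x)) has_derivative (\<lambda>w. L (coord_vector \<A> \<kappa> w x))) (at (snd \<kappa> x))"
    and g: "\<forall>\<kappa>. chart_at \<A> x \<kappa> \<longrightarrow> ((\<lambda>x. g (chart_inv \<kappa> x)) has_derivative (\<lambda>w. M (coord_vector \<A> \<kappa> w x))) (at (snd \<kappa> x))"
  have "chart_inv \<kappa> (snd \<kappa> x) = x" using chart_at_D[OF c] by (simp add: chart_props)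
  then show "((\<lambda>x. mul (f (chart_inv \<kappa> x)) (g (chart_inv \<kappa> x))) has_derivative
      (\<lambda>w. mul (f x) (M (coord_vector \<A> \<kappa> w x)) + mul (L (coord_vector \<A> \<kappa> w x)) (g x))) (at (snd \<kappa> x))"
    using bounded_bilinear.FDERIV[OF bil f[rule_format, OF c] g[rule_format, OF c]] by simp
qed

lemma has_mdiff_add: "has_mdiff f x L \<Longrightarrow> has_mdiff g x M \<Longrightarrow> has_mdiff (\<lambda>y. f y + g y) x (\<lambda>v. L v + M v)"
  and has_mdiff_diff: "has_mdiff f x L \<Longrightarrow> has_mdiff g x M \<Longrightarrow> has_mdiff (\<lambda>y. f y - g y) x (\<lambda>v. L v - M v)"
  and has_mdiff_minus: "has_mdiff f x L \<Longrightarrow> has_mdiff (\<lambda>y. - f y) x (\<lambda>v. - L v)"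
  unfolding has_mdiff_def o_def by (auto intro!: has_derivative_add has_derivative_diff has_derivative_minus)

lemma has_mdiff_mult:
  fixes f g :: "'m \<Rightarrow> real"
  shows "has_mdiff f x L \<Longrightarrow> has_mdiff g x M \<Longrightarrow> has_mdiff (\<lambda>y. f y * g y) x (\<lambda>v. f x * M v + L v * g x)"
  by (rule has_mdiff_bilinear[OF bounded_bilinear_mult])

lemma has_mdiff_Pair:
  assumes "has_mdiff f x L" "has_mdiff g x M" shows "has_mdiff (\<lambda>y. (f y, g y)) x (\<lambda>v. (L v, M v))"
  using assms unfolding has_mdiff_def o_def by (auto intro: has_derivative_Pair)

lemma has_mdiff_imp_linear:
  assumes "has_mdiff f x L" shows "linear_map_on (tangent_space \<A> x) L"
proof -
  obtain \<kappa> where c: "chart_at \<A> x \<kappa>" by (rule ex_chart)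
  have "linear (\<lambda>w. L (coord_vector \<A> \<kappa> w x))" using assms c has_derivative_linear unfolding has_mdiff_def by blast
  then have *: "L (coord_vector \<A> \<kappa> (v + w) x) = L (coord_vector \<A> \<kappa> v x) + L (coord_vector \<A> \<kappa> w x)"
    "L (coord_vector \<A> \<kappa> (r *\<^sub>R v) x) = r *\<^sub>R L (coord_vector \<A> \<kappa> v x)" for v w r
    using linear_add[of "\<lambda>w. L (coord_vector \<A> \<kappa> w x)"] linear_cmul[of "\<lambda>w. L (coord_vector \<A> \<kappa> w x)"] by auto
  have "L (v + w) = L v + L w" "L (r *\<^sub>R v) = r *\<^sub>R L v"
    if "v \<in> tangent_space \<A> x" "w \<in> tangent_space \<A> x" for v w r
    using *(1)[of "v \<kappa>" "w \<kappa>"] *(2)[of r "v \<kappa>"] that c by (simp_all add: coord_vector_add coord_vector_scaleR)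
  then show ?thesis unfolding linear_map_on_def by blast
qed

text \<open>Coordinate balls are the path-connected domains on which local solutions will be constructed.\<close>

lemma chart_ball_nbhd:
  assumes "chart_at \<A> x \<kappa>" "r > 0" "ball (snd \<kappa> x) r \<subseteq> snd \<kappa> ` fst \<kappa>"
  shows "open (chart_inv \<kappa> ` ball (snd \<kappa> x) r)" "x \<in> chart_inv \<kappa> ` ball (snd \<kappa> x) r"
    "path_connected (chart_inv \<kappa> ` ball (snd \<kappa> x) r)"
proof -
  note c = chart_at_D[OF assms(1)]
  have "chart_inv \<kappa> ` ball (snd \<kappa> x) r = snd \<kappa> -` ball (snd \<kappa> x) r \<inter> fst \<kappa>"
  proof
    show "chart_inv \<kappa> ` ball (snd \<kappa> x) r \<subseteq> snd \<kappa> -` ball (snd \<kappa> x) r \<inter> fst \<kappa>"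
    proof
      fix y assume "y \<in> chart_inv \<kappa> ` ball (snd \<kappa> x) r"
      then obtain z where z: "z \<in> ball (snd \<kappa> x) r" "y = chart_inv \<kappa> z" by blast
      then obtain y' where "y' \<in> fst \<kappa>" "z = snd \<kappa> y'" using assms(3) by blast
      then show "y \<in> snd \<kappa> -` ball (snd \<kappa> x) r \<inter> fst \<kappa>" using z chart_props(6)[OF c(1)] by simp
    qed
    show "snd \<kappa> -` ball (snd \<kappa> x) r \<inter> fst \<kappa> \<subseteq> chart_inv \<kappa> ` ball (snd \<kappa> x) r"
    proof
      fix y assume y: "y \<in> snd \<kappa> -` ball (snd \<kappa> x) r \<inter> fst \<kappa>"
      then have "y = chart_inv \<kappa> (snd \<kappa> y)" using chart_props(6)[OF c(1)] by simp
      then show "y \<in> chart_inv \<kappa> ` ball (snd \<kappa> x) r" using y by blast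
    qed
  qed
  then show "open (chart_inv \<kappa> ` ball (snd \<kappa> x) r)"
    using continuous_open_preimage[OF chart_props(3)[OF c(1)] chart_props(1)[OF c(1)] open_ball]
    by (simp add: Int_commute)
  show "x \<in> chart_inv \<kappa> ` ball (snd \<kappa> x) r"
    using assms(2) chart_props(6)[OF c] by (intro image_eqI[of _ _ "snd \<kappa> x"]) auto
  show "path_connected (chart_inv \<kappa> ` ball (snd \<kappa> x) r)"
    by (rule path_connected_continuous_image[OF continuous_on_subset[OF chart_props(4)[OF c(1)] assms(3)]])
      (rule convex_imp_path_connected[OF convex_ball])
qed

lemma ex_chart_ball:
  assumes "chart_at \<A> x \<kappa>" "open U" "x \<in> U"
  obtains r where "r > 0" "ball (snd \<kappa> x) r \<subseteq> snd \<kappa> ` (fst \<kappa> \<inter> U)"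
proof -
  have "snd \<kappa> x \<in> snd \<kappa> ` (fst \<kappa> \<inter> U)" using chart_at_D[OF assms(1)] assms(3) by blast
  then show thesis
    using that openE[OF open_chart_image[OF chart_at_D(1)[OF assms(1)] assms(2)]] by metis
qed

lemma has_mdiff_zero_constant:
  assumes V: "open V" "connected V" and f: "\<And>x. x \<in> V \<Longrightarrow> has_mdiff f x (\<lambda>v. 0)" and xy: "x \<in> V" "y \<in> V"
  shows "f x = f y"
proof (rule connected_induction_simple[where P = "\<lambda>z. f x = f z", OF V(2) xy refl])
  fix a assume a: "a \<in> V"
  obtain \<kappa> where c: "chart_at \<A> a \<kappa>" by (rule ex_chart)
  note c' = chart_at_D[OF c]
  obtain r where r: "r > 0" "ball (snd \<kappa> a) r \<subseteq> snd \<kappa> ` (fst \<kappa> \<inter> V)" using ex_chart_ball[OF c V(1) a] .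
  define N where "N = chart_inv \<kappa> ` ball (snd \<kappa> a) r"
  have r': "ball (snd \<kappa> a) r \<subseteq> snd \<kappa> ` fst \<kappa>" using r(2) by blast
  note N = chart_ball_nbhd[OF c r(1) r', folded N_def]
  have NV: "N \<subseteq> V" using r(2) chart_inv_mem(1)[OF c'(1)] unfolding N_def by blast
  have const: "f (chart_inv \<kappa> z) = f (chart_inv \<kappa> z')" if "z \<in> ball (snd \<kappa> a) r" "z' \<in> ball (snd \<kappa> a) r" for z z'
  proof -
    have "((\<lambda>z. f (chart_inv \<kappa> z)) has_derivative (\<lambda>h. 0)) (at z within ball (snd \<kappa> a) r)" if z: "z \<in> ball (snd \<kappa> a) r" for z
    proof -
      have "chart_inv \<kappa> z \<in> fst \<kappa> \<inter> V" "snd \<kappa> (chart_inv \<kappa> z) = z"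
        using z r(2) chart_inv_mem(1)[OF c'(1)] chart_inv_mem(2)[OF c'(1)] by blast+
      then show ?thesis
        using has_mdiffD[OF f, of "chart_inv \<kappa> z" \<kappa>] c' by (auto simp: chart_at_def intro: has_derivative_at_withinI)
    qed
    from has_derivative_zero_constant[OF convex_ball this] obtain k where "\<And>z. z \<in> ball (snd \<kappa> a) r \<Longrightarrow> f (chart_inv \<kappa> z) = k" by blast
    then show ?thesis using that by simp
  qed
  have "f p = f q" if "p \<in> N" "q \<in> N" for p q
    using that const unfolding N_def by blast
  then show "\<exists>T. openin (top_of_set V) T \<and> a \<in> T \<and> (\<forall>p\<in>T. \<forall>q\<in>T. f x = f p \<longrightarrow> f x = f q)"
    using N(1,2) NV open_subset[OF NV N(1)] by (intro exI[of _ N]) metis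
qed

subsection \<open>Smooth functions\<close>

lemma msmooth_on_imp_has_mdiff:
  assumes "msmooth_on \<A> W f" "x \<in> W" shows "has_mdiff f x (mdiff \<A> f x)"
proof -
  obtain \<kappa> where c: "chart_at \<A> x \<kappa>" by (rule ex_chart)
  have "(f \<circ> chart_inv \<kappa>) differentiable (at (snd \<kappa> x))"
    using assms chart_at_D[OF c] unfolding msmooth_on_def
    by (intro smooth_on_imp_differentiable[of "snd \<kappa> ` (fst \<kappa> \<inter> W)"]) auto
  then obtain D where "((f \<circ> chart_inv \<kappa>) has_derivative D) (at (snd \<kappa> x))" unfolding differentiable_def by blast
  from has_mdiff_chartI[OF c this] show ?thesis
    by (rule has_mdiff_cong_deriv) (metis \<open>has_mdiff f x (\<lambda>v. D (v \<kappa>))\<close> has_mdiff_imp_mdiff)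
qed

lemma msmooth_on_subset: "msmooth_on \<A> W f \<Longrightarrow> W' \<subseteq> W \<Longrightarrow> msmooth_on \<A> W' f"
  unfolding msmooth_on_def by (blast intro: smooth_on_subset)

lemma msmooth_on_const: "msmooth_on \<A> W (\<lambda>x. c)"
  unfolding msmooth_on_def o_def by (blast intro: smooth_on_const)

lemma msmooth_onD: "msmooth_on \<A> W f \<Longrightarrow> \<kappa> \<in> \<A> \<Longrightarrow> smooth_on (snd \<kappa> ` (fst \<kappa> \<inter> W)) (\<lambda>z. f (chart_inv \<kappa> z))"
  and msmooth_onI: "(\<And>\<kappa>. \<kappa> \<in> \<A> \<Longrightarrow> smooth_on (snd \<kappa> ` (fst \<kappa> \<inter> W)) (\<lambda>z. f (chart_inv \<kappa> z))) \<Longrightarrow> msmooth_on \<A> W f"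
  unfolding msmooth_on_def o_def by blast+

lemma msmooth_on_add:
  assumes "open W" "msmooth_on \<A> W f" "msmooth_on \<A> W g" shows "msmooth_on \<A> W (\<lambda>x. f x + g x)"
  by (rule msmooth_onI, rule smooth_on_add[OF open_chart_image msmooth_onD msmooth_onD]) (use assms in blast)+

lemma msmooth_on_bilinear:
  assumes "open W" "bounded_bilinear mul" "msmooth_on \<A> W f" "msmooth_on \<A> W g"
  shows "msmooth_on \<A> W (\<lambda>x. mul (f x) (g x))"
  by (rule msmooth_onI, rule smooth_on_bilinear[OF open_chart_image[OF _ assms(1)] assms(2) msmooth_onD[OF assms(3)] msmooth_onD[OF assms(4)]])

lemma msmooth_on_linear:
  assumes "open W" "bounded_linear h" "msmooth_on \<A> W f" shows "msmooth_on \<A> W (\<lambda>x. h (f x))"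
  by (rule msmooth_onI, rule smooth_on_linear[OF open_chart_image[OF _ assms(1)] assms(2) msmooth_onD[OF assms(3)]])

lemma msmooth_on_mult:
  fixes f g :: "'m \<Rightarrow> real"
  shows "open W \<Longrightarrow> msmooth_on \<A> W f \<Longrightarrow> msmooth_on \<A> W g \<Longrightarrow> msmooth_on \<A> W (\<lambda>x. f x * g x)"
  by (rule msmooth_on_bilinear[OF _ bounded_bilinear_mult])

lemma msmooth_on_minus: "open W \<Longrightarrow> msmooth_on \<A> W f \<Longrightarrow> msmooth_on \<A> W (\<lambda>x. - f x)"
  by (rule msmooth_on_linear[OF _ bounded_linear_minus[OF bounded_linear_ident]])

lemma msmooth_on_Pair:
  assumes "open W" "msmooth_on \<A> W f" "msmooth_on \<A> W g" shows "msmooth_on \<A> W (\<lambda>x. (f x, g x))"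
proof -
  have "msmooth_on \<A> W (\<lambda>x. (f x, 0) + (0, g x))"
    by (intro msmooth_on_add assms msmooth_on_linear[OF assms(1), of "\<lambda>y. (y, 0)"] msmooth_on_linear[OF assms(1), of "\<lambda>y. (0, y)"])
      (auto intro!: bounded_linear_Pair bounded_linear_ident bounded_linear_zero)
  then show ?thesis by simp
qed

lemma msmooth_on_cong:
  assumes "open W" "\<And>x. x \<in> W \<Longrightarrow> f x = g x" "msmooth_on \<A> W f" shows "msmooth_on \<A> W g"
proof (rule msmooth_onI)
  fix \<kappa> assume \<kappa>: "\<kappa> \<in> \<A>"
  show "smooth_on (snd \<kappa> ` (fst \<kappa> \<inter> W)) (\<lambda>z. g (chart_inv \<kappa> z))"
    by (rule smooth_on_cong[OF open_chart_image[OF \<kappa> assms(1)] assms(2) msmooth_onD[OF assms(3) \<kappa>]])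
      (use chart_inv_mem(1)[OF \<kappa>] in blast)
qed

lemma msmooth_on_local:
  assumes "\<And>x. x \<in> W \<Longrightarrow> \<exists>U. open U \<and> x \<in> U \<and> msmooth_on \<A> (W \<inter> U) f"
  shows "msmooth_on \<A> W f"
  unfolding msmooth_on_def
proof
  fix \<kappa> assume \<kappa>: "\<kappa> \<in> \<A>"
  show "smooth_on (snd \<kappa> ` (fst \<kappa> \<inter> W)) (f \<circ> chart_inv \<kappa>)"
  proof (rule smooth_on_local)
    fix z assume "z \<in> snd \<kappa> ` (fst \<kappa> \<inter> W)"
    then obtain x where x: "x \<in> fst \<kappa>" "x \<in> W" "z = snd \<kappa> x" by blast
    obtain U where U: "open U" "x \<in> U" "msmooth_on \<A> (W \<inter> U) f" using assms[OF x(2)] by blast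
    have "snd \<kappa> ` (fst \<kappa> \<inter> W) \<inter> snd \<kappa> ` (fst \<kappa> \<inter> U) = snd \<kappa> ` (fst \<kappa> \<inter> (W \<inter> U))"
      using chart_props(5)[OF \<kappa>] by (auto simp: inj_on_def)
    then show "\<exists>U. open U \<and> z \<in> U \<and> smooth_on (snd \<kappa> ` (fst \<kappa> \<inter> W) \<inter> U) (f \<circ> chart_inv \<kappa>)"
      using open_chart_image[OF \<kappa> U(1)] U x \<kappa> unfolding msmooth_on_def
      by (intro exI[of _ "snd \<kappa> ` (fst \<kappa> \<inter> U)"]) auto
  qed
qed

text \<open>The right-hand side is as often differentiable as \<open>f\<close>, so bootstrapping applies in each chart.\<close>

lemma msmooth_on_linear_system:
  assumes W: "open W" and bil: "bounded_bilinear mul"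
    and f: "\<And>x. x \<in> W \<Longrightarrow> has_mdiff f x (\<lambda>v. mul (A x v) (f x))"
    and A: "\<And>\<kappa> w. \<kappa> \<in> \<A> \<Longrightarrow> msmooth_on \<A> (W \<inter> fst \<kappa>) (\<lambda>x. A x (coord_vector \<A> \<kappa> w x))"
  shows "msmooth_on \<A> W f"
  unfolding msmooth_on_def
proof
  fix \<kappa> assume \<kappa>: "\<kappa> \<in> \<A>"
  note S = open_chart_image[OF \<kappa> W]
  show "smooth_on (snd \<kappa> ` (fst \<kappa> \<inter> W)) (f \<circ> chart_inv \<kappa>)"
  proof (rule smooth_on_bootstrap[OF S])
    fix z assume "z \<in> snd \<kappa> ` (fst \<kappa> \<inter> W)"
    then have z: "chart_inv \<kappa> z \<in> fst \<kappa> \<inter> W" "snd \<kappa> (chart_inv \<kappa> z) = z"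
      using chart_inv_mem(1)[OF \<kappa>] chart_inv_mem(2)[OF \<kappa>] by blast+
    then show "((f \<circ> chart_inv \<kappa>) has_derivative (\<lambda>w. mul (A (chart_inv \<kappa> z) (coord_vector \<A> \<kappa> w (chart_inv \<kappa> z))) (f (chart_inv \<kappa> z)))) (at z)"
      using f[of "chart_inv \<kappa> z"] \<kappa> unfolding has_mdiff_def chart_at_def by auto
  next
    fix n w assume n: "differentiable_of_order n (snd \<kappa> ` (fst \<kappa> \<inter> W)) (f \<circ> chart_inv \<kappa>)"
    have "smooth_on (snd \<kappa> ` (fst \<kappa> \<inter> W)) ((\<lambda>x. A x (coord_vector \<A> \<kappa> w x)) \<circ> chart_inv \<kappa>)"
      using A[OF \<kappa>, of w] \<kappa> unfolding msmooth_on_def by (auto simp: Int_ac Int_absorb1 dest!: bspec)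
    then show "differentiable_of_order n (snd \<kappa> ` (fst \<kappa> \<inter> W)) (\<lambda>z. mul (A (chart_inv \<kappa> z) (coord_vector \<A> \<kappa> w (chart_inv \<kappa> z))) (f (chart_inv \<kappa> z)))"
      using differentiable_of_order_bilinear[OF S bil _ n] unfolding smooth_on_def o_def by blast
  qed
qed

lemma frechet_coord:
  assumes "has_mdiff f x L" "chart_at \<A> x \<kappa>"
  shows "frechet_derivative (f \<circ> chart_inv \<kappa>) (at (snd \<kappa> x)) w = L (coord_vector \<A> \<kappa> w x)"
proof -
  have "((f \<circ> chart_inv \<kappa>) has_derivative (\<lambda>w. L (coord_vector \<A> \<kappa> w x))) (at (snd \<kappa> x))"
    using assms unfolding has_mdiff_def by blast
  from frechet_derivative_at[OF this] show ?thesis by (metis (lifting))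
qed

end

section \<open>Lorentzian bundles of rank two\<close>

lemma section_onI:
  assumes "\<And>x. x \<in> W \<Longrightarrow> s x \<in> fib V x"
    and "\<And>U f0 f1. (U, f0, f1) \<in> frames V \<Longrightarrow> \<exists>a b. P (U \<inter> W) a \<and> P (U \<inter> W) b \<and>
       (\<forall>x\<in>U \<inter> W. s x = a x *\<^sub>R f0 x + b x *\<^sub>R f1 x)"
  shows "section_on P V W s"
  using assms unfolding section_on_def by auto

lemma section_onE:
  assumes "section_on P V W s" "(U, f0, f1) \<in> frames V"
  obtains a b where "P (U \<inter> W) a" "P (U \<inter> W) b" "\<And>x. x \<in> U \<Longrightarrow> x \<in> W \<Longrightarrow> s x = a x *\<^sub>R f0 x + b x *\<^sub>R f1 x"
  using assms unfolding section_on_def by fastforce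

lemma section_on_fib: "section_on P V W s \<Longrightarrow> x \<in> W \<Longrightarrow> s x \<in> fib V x"
  unfolding section_on_def by auto

locale lorentz_bundle = surface \<A> for \<A> :: "'m::{t2_space, second_countable_topology} atlas" +
  fixes V :: "('m, 'v::real_vector) lvb"
  assumes lorentz: "oriented_lorentzian_bundle \<A> V"
begin

lemmas lorentz_conjuncts = lorentz[unfolded oriented_lorentzian_bundle_def]
lemmas vector_bundle = lorentz_conjuncts[THEN conjunct1]
lemmas lorentzian_metric = lorentz_conjuncts[THEN conjunct2, THEN conjunct1]
lemmas metric_connection = lorentz_conjuncts[THEN conjunct2, THEN conjunct2, THEN conjunct1]
lemmas oriented = lorentz_conjuncts[THEN conjunct2, THEN conjunct2, THEN conjunct2]
lemmas connection = metric_connection[unfolded metric_connection_def, THEN conjunct1]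

lemma ex_frame:
  obtains W f0 f1 where "(W, f0, f1) \<in> frames V" "x \<in> W"
proof -
  obtain t where "t \<in> frames V" "case t of (W, f0, f1) \<Rightarrow> x \<in> W"
    using vector_bundle[unfolded vector_bundle_def, THEN conjunct1, rule_format, of x] by (elim bexE)
  then show thesis using that by (cases t) simp
qed

lemma frame_open: "(W, f0, f1) \<in> frames V \<Longrightarrow> open W"
  and frame_basis: "(W, f0, f1) \<in> frames V \<Longrightarrow> x \<in> W \<Longrightarrow> is_basis2 (fib V x) (f0 x) (f1 x)"
  using vector_bundle[unfolded vector_bundle_def, THEN conjunct2, rule_format, of "(W, f0, f1)"] by simp_all

lemma fib_span: obtains S where "fib V x = span S"
proof -
  obtain W f0 f1 where "(W, f0, f1) \<in> frames V" "x \<in> W" by (rule ex_frame)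
  from frame_basis[OF this] show ?thesis using that unfolding is_basis2_def by metis
qed

lemma fib_add: "a \<in> fib V x \<Longrightarrow> b \<in> fib V x \<Longrightarrow> a + b \<in> fib V x"
  and fib_scaleR: "a \<in> fib V x \<Longrightarrow> r *\<^sub>R a \<in> fib V x"
  and fib_diff: "a \<in> fib V x \<Longrightarrow> b \<in> fib V x \<Longrightarrow> a - b \<in> fib V x"
  and fib_zero: "0 \<in> fib V x"
  using fib_span[of x] by (metis span_add, metis span_scale, metis span_diff, metis span_zero)

subsection \<open>The metric\<close>

lemma met_sym: "a \<in> fib V x \<Longrightarrow> b \<in> fib V x \<Longrightarrow> met V x a b = met V x b a"
  and met_linear: "a \<in> fib V x \<Longrightarrow> linear_map_on (fib V x) (met V x a)"
  using lorentzian_metric unfolding lorentzian_metric_def by blast+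

lemma met_add_right: "a \<in> fib V x \<Longrightarrow> b \<in> fib V x \<Longrightarrow> c \<in> fib V x \<Longrightarrow> met V x a (b + c) = met V x a b + met V x a c"
  and met_scaleR_right: "a \<in> fib V x \<Longrightarrow> b \<in> fib V x \<Longrightarrow> met V x a (r *\<^sub>R b) = r * met V x a b"
  using met_linear[of a x] unfolding linear_map_on_def by auto

lemma met_add_left: "a \<in> fib V x \<Longrightarrow> b \<in> fib V x \<Longrightarrow> c \<in> fib V x \<Longrightarrow> met V x (b + c) a = met V x b a + met V x c a"
  using met_add_right[of a x b c] met_sym[of "b + c" x a] met_sym[of b x a] met_sym[of c x a] by (simp add: fib_add)

lemma met_scaleR_left: "a \<in> fib V x \<Longrightarrow> b \<in> fib V x \<Longrightarrow> met V x (r *\<^sub>R b) a = r * met V x b a"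
  using met_scaleR_right[of a x b r] met_sym[of "r *\<^sub>R b" x a] met_sym[of b x a] by (simp add: fib_scaleR)

lemma met_zero_left: "a \<in> fib V x \<Longrightarrow> met V x 0 a = 0"
  using met_scaleR_left[of a x a 0] by simp

lemma met_diff_left: "a \<in> fib V x \<Longrightarrow> b \<in> fib V x \<Longrightarrow> c \<in> fib V x \<Longrightarrow> met V x (b - c) a = met V x b a - met V x c a"
  using met_add_left[of a x "b - c" c] by (simp add: fib_diff)

lemmas met_simps = met_add_left met_add_right met_scaleR_left met_scaleR_right met_zero_left fib_add fib_scaleR fib_zero

lemma oframeD:
  assumes "(a, b) \<in> oframes V x"
  shows "a \<in> fib V x" "b \<in> fib V x" "met V x a a = -1" "met V x b b = 1" "met V x a b = 0" "met V x b a = 0"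
    "\<And>\<nu>. \<nu> \<in> fib V x \<Longrightarrow> \<nu> = (- met V x \<nu> a) *\<^sub>R a + met V x \<nu> b *\<^sub>R b"
proof -
  have pos: "(a, b) \<in> pos V x" and m: "met V x a a = -1" "met V x b b = 1" "met V x a b = 0"
    using assms by (auto simp: oframes_def)
  obtain A B where AB: "is_basis2 (fib V x) A B"
    "pos V x = {(\<alpha> *\<^sub>R A + \<beta> *\<^sub>R B, \<gamma> *\<^sub>R A + \<delta> *\<^sub>R B) | \<alpha> \<beta> \<gamma> \<delta>. \<alpha> * \<delta> - \<beta> * \<gamma> > 0}"
    using oriented[unfolded space_time_oriented_def, THEN conjunct1, rule_format, of x] by (elim exE conjE)
  then obtain \<alpha> \<beta> \<gamma> \<delta> where c: "a = \<alpha> *\<^sub>R A + \<beta> *\<^sub>R B" "b = \<gamma> *\<^sub>R A + \<delta> *\<^sub>R B" "\<alpha> * \<delta> - \<beta> * \<gamma> > 0"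
    using pos by auto
  have sp: "fib V x = span {A, B}" using AB unfolding is_basis2_def by simp
  have AB': "A \<in> fib V x" "B \<in> fib V x" unfolding sp by (auto intro: span_base)
  show ab: "a \<in> fib V x" "b \<in> fib V x" unfolding c by (intro fib_add fib_scaleR AB')+
  show m': "met V x a a = -1" "met V x b b = 1" "met V x a b = 0" "met V x b a = 0"
    using m met_sym[OF ab] by auto
  fix \<nu> assume \<nu>: "\<nu> \<in> fib V x"
  obtain k where "\<nu> - k *\<^sub>R A \<in> span {B}" using \<nu> unfolding sp span_insert by auto
  then obtain l where "\<nu> - k *\<^sub>R A = l *\<^sub>R B" unfolding span_singleton by auto
  then have kl: "\<nu> = k *\<^sub>R A + l *\<^sub>R B" by (simp add: algebra_simps)
  define d where "d = \<alpha> * \<delta> - \<beta> * \<gamma>"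
  define s t where "s = (k * \<delta> - l * \<gamma>) / d" and "t = (l * \<alpha> - k * \<beta>) / d"
  have d: "d \<noteq> 0" using c(3) by (simp add: d_def)
  have "s * \<alpha> + t * \<gamma> = k * (\<alpha> * \<delta> - \<beta> * \<gamma>) / d" "s * \<beta> + t * \<delta> = l * (\<alpha> * \<delta> - \<beta> * \<gamma>) / d"
    unfolding s_def t_def using d by (simp_all add: field_simps)
  then have st: "s * \<alpha> + t * \<gamma> = k" "s * \<beta> + t * \<delta> = l" using d by (simp_all add: d_def[symmetric])
  have "\<nu> = (s * \<alpha> + t * \<gamma>) *\<^sub>R A + (s * \<beta> + t * \<delta>) *\<^sub>R B" unfolding st by (rule kl)
  then have \<nu>': "\<nu> = s *\<^sub>R a + t *\<^sub>R b" by (simp add: c algebra_simps)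
  have "met V x \<nu> a = - s" "met V x \<nu> b = t" unfolding \<nu>' using ab m' by (simp_all add: met_simps)
  then show "\<nu> = (- met V x \<nu> a) *\<^sub>R a + met V x \<nu> b *\<^sub>R b" using \<nu>' by simp
qed

lemma met_oframe:
  assumes f: "(a, b) \<in> oframes V x" and \<nu>: "\<nu> \<in> fib V x" "\<mu> \<in> fib V x"
  shows "met V x \<nu> \<mu> = - met V x \<nu> a * met V x \<mu> a + met V x \<nu> b * met V x \<mu> b"
proof -
  note o = oframeD[OF f]
  have "met V x \<nu> \<mu> = met V x \<nu> ((- met V x \<mu> a) *\<^sub>R a + met V x \<mu> b *\<^sub>R b)"
    using o(7)[OF \<nu>(2)] by simp
  also have "\<dots> = - met V x \<nu> a * met V x \<mu> a + met V x \<nu> b * met V x \<mu> b"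
    by (simp only: met_add_right met_scaleR_right fib_scaleR o(1,2) \<nu>) simp
  finally show ?thesis .
qed

subsection \<open>Smooth sections\<close>

lemma section_fib: "smooth_section \<A> V W s \<Longrightarrow> x \<in> W \<Longrightarrow> s x \<in> fib V x"
  unfolding smooth_section_def by (rule section_on_fib)

lemma section_subset:
  assumes "smooth_section \<A> V W s" "W' \<subseteq> W" shows "smooth_section \<A> V W' s"
  unfolding smooth_section_def
proof (rule section_onI)
  show "s x \<in> fib V x" if "x \<in> W'" for x using section_fib[OF assms(1)] assms(2) that by blast
  fix U f0 f1 assume "(U, f0, f1) \<in> frames V"
  from section_onE[OF assms(1)[unfolded smooth_section_def] this]
  obtain a b where "msmooth_on \<A> (U \<inter> W) a" "msmooth_on \<A> (U \<inter> W) b"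
    "\<And>x. x \<in> U \<Longrightarrow> x \<in> W \<Longrightarrow> s x = a x *\<^sub>R f0 x + b x *\<^sub>R f1 x" by metis
  moreover have "U \<inter> W' \<subseteq> U \<inter> W" using assms(2) by blast
  ultimately show "\<exists>a b. msmooth_on \<A> (U \<inter> W') a \<and> msmooth_on \<A> (U \<inter> W') b \<and> (\<forall>x\<in>U \<inter> W'. s x = a x *\<^sub>R f0 x + b x *\<^sub>R f1 x)"
    using msmooth_on_subset assms(2) by (metis IntE subsetD)
qed

lemma section_cong:
  assumes "smooth_section \<A> V W s" "\<And>x. x \<in> W \<Longrightarrow> s x = t x" shows "smooth_section \<A> V W t"
  using assms unfolding smooth_section_def section_on_def by (auto split: prod.splits)

lemma section_add:
  assumes W: "open W" and s: "smooth_section \<A> V W s" and t: "smooth_section \<A> V W t"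
  shows "smooth_section \<A> V W (\<lambda>x. s x + t x)"
  unfolding smooth_section_def
proof (rule section_onI)
  show "s x + t x \<in> fib V x" if "x \<in> W" for x using fib_add section_fib[OF s that] section_fib[OF t that] .
  fix U f0 f1 assume f: "(U, f0, f1) \<in> frames V"
  have o: "open (U \<inter> W)" using frame_open[OF f] W by auto
  from section_onE[OF s[unfolded smooth_section_def] f]
  obtain a b where 1: "msmooth_on \<A> (U \<inter> W) a" "msmooth_on \<A> (U \<inter> W) b"
    "\<And>x. x \<in> U \<Longrightarrow> x \<in> W \<Longrightarrow> s x = a x *\<^sub>R f0 x + b x *\<^sub>R f1 x" by metis
  from section_onE[OF t[unfolded smooth_section_def] f]
  obtain a' b' where 2: "msmooth_on \<A> (U \<inter> W) a'" "msmooth_on \<A> (U \<inter> W) b'"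
    "\<And>x. x \<in> U \<Longrightarrow> x \<in> W \<Longrightarrow> t x = a' x *\<^sub>R f0 x + b' x *\<^sub>R f1 x" by metis
  show "\<exists>a b. msmooth_on \<A> (U \<inter> W) a \<and> msmooth_on \<A> (U \<inter> W) b \<and> (\<forall>x\<in>U \<inter> W. s x + t x = a x *\<^sub>R f0 x + b x *\<^sub>R f1 x)"
    by (intro exI[of _ "\<lambda>x. a x + a' x"] exI[of _ "\<lambda>x. b x + b' x"] conjI msmooth_on_add o 1 2)
      (auto simp: 1 2 algebra_simps)
qed

lemma section_scaleR:
  assumes W: "open W" and s: "smooth_section \<A> V W s" and f: "msmooth_on \<A> W f"
  shows "smooth_section \<A> V W (\<lambda>x. f x *\<^sub>R s x)"
  unfolding smooth_section_def
proof (rule section_onI)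
  show "f x *\<^sub>R s x \<in> fib V x" if "x \<in> W" for x using fib_scaleR section_fib[OF s that] .
  fix U f0 f1 assume fr: "(U, f0, f1) \<in> frames V"
  have o: "open (U \<inter> W)" using frame_open[OF fr] W by auto
  have f': "msmooth_on \<A> (U \<inter> W) f" by (rule msmooth_on_subset[OF f]) auto
  from section_onE[OF s[unfolded smooth_section_def] fr]
  obtain a b where 1: "msmooth_on \<A> (U \<inter> W) a" "msmooth_on \<A> (U \<inter> W) b"
    "\<And>x. x \<in> U \<Longrightarrow> x \<in> W \<Longrightarrow> s x = a x *\<^sub>R f0 x + b x *\<^sub>R f1 x" by metis
  show "\<exists>a b. msmooth_on \<A> (U \<inter> W) a \<and> msmooth_on \<A> (U \<inter> W) b \<and> (\<forall>x\<in>U \<inter> W. f x *\<^sub>R s x = a x *\<^sub>R f0 x + b x *\<^sub>R f1 x)"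
    by (intro exI[of _ "\<lambda>x. f x * a x"] exI[of _ "\<lambda>x. f x * b x"] conjI msmooth_on_mult o 1 f')
      (auto simp: 1 scaleR_add_right)
qed

lemma met_smooth:
  "open W \<Longrightarrow> smooth_section \<A> V W s \<Longrightarrow> smooth_section \<A> V W t \<Longrightarrow> msmooth_on \<A> W (\<lambda>x. met V x (s x) (t x))"
  using lorentzian_metric unfolding lorentzian_metric_def by blast

subsection \<open>The connection\<close>

lemma nabla_props:
  assumes "open W" "smooth_section \<A> V W s"
  shows nabla_linear: "x \<in> W \<Longrightarrow> linear_map_on (tangent_space \<A> x) (nabla V s x)"
    and nabla_fib: "x \<in> W \<Longrightarrow> X \<in> tangent_space \<A> x \<Longrightarrow> nabla V s x X \<in> fib V x"
    and nabla_smooth: "vector_field \<A> W Z \<Longrightarrow> smooth_section \<A> V W (\<lambda>x. nabla V s x (Z x))"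
    and nabla_add: "smooth_section \<A> V W t \<Longrightarrow> x \<in> W \<Longrightarrow> X \<in> tangent_space \<A> x \<Longrightarrow>
      nabla V (\<lambda>y. s y + t y) x X = nabla V s x X + nabla V t x X"
    and nabla_scaleR: "msmooth_on \<A> W f \<Longrightarrow> x \<in> W \<Longrightarrow> X \<in> tangent_space \<A> x \<Longrightarrow>
      nabla V (\<lambda>y. f y *\<^sub>R s y) x X = mdiff \<A> f x X *\<^sub>R s x + f x *\<^sub>R nabla V s x X"
    and nabla_cong: "(\<And>y. y \<in> W \<Longrightarrow> t y = s y) \<Longrightarrow> x \<in> W \<Longrightarrow> X \<in> tangent_space \<A> x \<Longrightarrow>
      nabla V t x X = nabla V s x X"
proof -
  note c = connection[unfolded connection_def, rule_format, OF conjI[OF assms]]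
  show "x \<in> W \<Longrightarrow> linear_map_on (tangent_space \<A> x) (nabla V s x)" using c by blast
  show "x \<in> W \<Longrightarrow> X \<in> tangent_space \<A> x \<Longrightarrow> nabla V s x X \<in> fib V x" using c by blast
  show "vector_field \<A> W Z \<Longrightarrow> smooth_section \<A> V W (\<lambda>x. nabla V s x (Z x))" using c by blast
  show "smooth_section \<A> V W t \<Longrightarrow> x \<in> W \<Longrightarrow> X \<in> tangent_space \<A> x \<Longrightarrow>
      nabla V (\<lambda>y. s y + t y) x X = nabla V s x X + nabla V t x X" using c by blast
  show "msmooth_on \<A> W f \<Longrightarrow> x \<in> W \<Longrightarrow> X \<in> tangent_space \<A> x \<Longrightarrow>
      nabla V (\<lambda>y. f y *\<^sub>R s y) x X = mdiff \<A> f x X *\<^sub>R s x + f x *\<^sub>R nabla V s x X" using c by blast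
  show "(\<And>y. y \<in> W \<Longrightarrow> t y = s y) \<Longrightarrow> x \<in> W \<Longrightarrow> X \<in> tangent_space \<A> x \<Longrightarrow>
      nabla V t x X = nabla V s x X" using c by blast
qed

lemma has_mdiff_met:
  assumes "open W" "smooth_section \<A> V W s" "smooth_section \<A> V W t" "x \<in> W"
  shows "has_mdiff (\<lambda>y. met V y (s y) (t y)) x
    (\<lambda>X. met V x (nabla V s x X) (t x) + met V x (s x) (nabla V t x X))"
proof (rule has_mdiff_cong_deriv[OF msmooth_on_imp_has_mdiff[OF met_smooth[OF assms(1-3)] assms(4)]])
  fix X assume "X \<in> tangent_space \<A> x"
  then show "mdiff \<A> (\<lambda>y. met V y (s y) (t y)) x X = met V x (nabla V s x X) (t x) + met V x (s x) (nabla V t x X)"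
    using metric_connection assms unfolding metric_connection_def by blast
qed

definition conn_form :: "('m \<Rightarrow> 'v) \<Rightarrow> ('m \<Rightarrow> 'v) \<Rightarrow> 'm \<Rightarrow> 'm tvec \<Rightarrow> real" where
  "conn_form a b x X = met V x (nabla V a x X) (b x)"

lemma oframe_onD:
  assumes "oframe_on \<A> V W a b"
  shows "smooth_section \<A> V W a" "smooth_section \<A> V W b" "x \<in> W \<Longrightarrow> (a x, b x) \<in> oframes V x"
  using assms by (auto simp: oframe_on_def)

lemma oframe_on_subset: "oframe_on \<A> V W a b \<Longrightarrow> W' \<subseteq> W \<Longrightarrow> oframe_on \<A> V W' a b"
  unfolding oframe_on_def using section_subset by blast

context
  fixes W a b assumes W: "open W" and f: "oframe_on \<A> V W a b"
begin

lemmas sa = oframe_onD(1)[OF f] and sb = oframe_onD(2)[OF f] and ab = oframe_onD(3)[OF f]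

lemma nabla_oframe_met:
  assumes x: "x \<in> W" and X: "X \<in> tangent_space \<A> x"
  shows "met V x (nabla V a x X) (a x) = 0" "met V x (nabla V b x X) (b x) = 0"
    "met V x (nabla V b x X) (a x) = - conn_form a b x X"
proof -
  note o = oframeD[OF ab]
  have const: "met V x (nabla V s x X) (t x) + met V x (s x) (nabla V t x X) = 0"
    if s: "smooth_section \<A> V W s" "smooth_section \<A> V W t" and c: "\<And>y. y \<in> W \<Longrightarrow> c = met V y (s y) (t y)" for s t c
  proof -
    have "has_mdiff (\<lambda>y. met V y (s y) (t y)) x (\<lambda>X. 0)"
      by (rule has_mdiff_cong[OF W x c has_mdiff_const])
    from has_mdiff_imp_mdiff[OF this X] has_mdiff_imp_mdiff[OF has_mdiff_met[OF W s x] X]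
    show ?thesis by simp
  qed
  note fib = nabla_fib[OF W sa x X] nabla_fib[OF W sb x X] o(1,2)[OF x]
  show "met V x (nabla V a x X) (a x) = 0" using const[OF sa sa, of "-1"] o fib by (simp add: met_sym)
  show "met V x (nabla V b x X) (b x) = 0" using const[OF sb sb, of 1] o fib by (simp add: met_sym)
  show "met V x (nabla V b x X) (a x) = - conn_form a b x X"
    using const[OF sb sa, of 0] o fib met_sym[of "b x" x "nabla V a x X"] by (simp add: conn_form_def)
qed

text \<open>Differentiating the relations of orthonormality shows that in rank two a metric connection is given by
  a single one-form.\<close>

lemma nabla_oframe:
  assumes x: "x \<in> W" and X: "X \<in> tangent_space \<A> x"
  shows "nabla V a x X = conn_form a b x X *\<^sub>R b x" "nabla V b x X = conn_form a b x X *\<^sub>R a x"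
proof -
  note o = oframeD[OF ab[OF x]] and n = nabla_oframe_met[OF x X]
  show "nabla V a x X = conn_form a b x X *\<^sub>R b x"
    using o(7)[OF nabla_fib[OF W sa x X]] n by (simp add: conn_form_def)
  show "nabla V b x X = conn_form a b x X *\<^sub>R a x"
    using o(7)[OF nabla_fib[OF W sb x X]] n by simp
qed

lemma conn_form_linear:
  assumes x: "x \<in> W" shows "linear_map_on (tangent_space \<A> x) (conn_form a b x)"
  using nabla_linear[OF W sa x] nabla_fib[OF W sa x] oframeD[OF ab[OF x]]
  unfolding linear_map_on_def conn_form_def by (simp add: met_simps)

lemma conn_form_smooth: "vector_field \<A> W X \<Longrightarrow> msmooth_on \<A> W (\<lambda>x. conn_form a b x (X x))"
  unfolding conn_form_def by (intro met_smooth W nabla_smooth sa sb)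

text \<open>By compatibility with the metric; the connection form enters through the derivatives of the frame.\<close>

lemma has_mdiff_coords:
  assumes s: "smooth_section \<A> V W s" and x: "x \<in> W"
  shows "has_mdiff (\<lambda>y. met V y (s y) (a y)) x (\<lambda>X. met V x (nabla V s x X) (a x) + conn_form a b x X * met V x (s x) (b x))"
    "has_mdiff (\<lambda>y. met V y (s y) (b y)) x (\<lambda>X. met V x (nabla V s x X) (b x) + conn_form a b x X * met V x (s x) (a x))"
proof -
  note o = oframeD[OF ab[OF x]] section_fib[OF s x]
  show "has_mdiff (\<lambda>y. met V y (s y) (a y)) x (\<lambda>X. met V x (nabla V s x X) (a x) + conn_form a b x X * met V x (s x) (b x))"
    by (rule has_mdiff_cong_deriv[OF has_mdiff_met[OF W s sa x]]) (use o x in \<open>simp add: nabla_oframe met_simps\<close>)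
  show "has_mdiff (\<lambda>y. met V y (s y) (b y)) x (\<lambda>X. met V x (nabla V s x X) (b x) + conn_form a b x X * met V x (s x) (a x))"
    by (rule has_mdiff_cong_deriv[OF has_mdiff_met[OF W s sb x]]) (use o x in \<open>simp add: nabla_oframe met_simps\<close>)
qed

text \<open>In rank two there is no quadratic term, and the curvature is the exterior derivative of the connection
  form.\<close>

lemma curvature_conn_form:
  assumes X: "vector_field \<A> W X" "X x \<in> tangent_space \<A> x" and Y: "vector_field \<A> W Y" "Y x \<in> tangent_space \<A> x"
    and x: "x \<in> W" and br: "lie_bracket \<A> X Y x \<in> tangent_space \<A> x"
  shows "met V x (bundle_curvature \<A> V X Y a x) (b x) =
      mdiff \<A> (\<lambda>y. conn_form a b y (Y y)) x (X x) - mdiff \<A> (\<lambda>y. conn_form a b y (X y)) x (Y x)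
      - conn_form a b x (lie_bracket \<A> X Y x)"
    and "met V x (bundle_curvature \<A> V X Y b x) (a x) =
      - (mdiff \<A> (\<lambda>y. conn_form a b y (Y y)) x (X x) - mdiff \<A> (\<lambda>y. conn_form a b y (X y)) x (Y x)
      - conn_form a b x (lie_bracket \<A> X Y x))"
proof -
  note o = oframeD[OF ab[OF x]]
  have d: "met V x (nabla V (\<lambda>y. nabla V a y (Z y)) x U) (b x) = mdiff \<A> (\<lambda>y. conn_form a b y (Z y)) x U"
    "met V x (nabla V (\<lambda>y. nabla V b y (Z y)) x U) (a x) = - mdiff \<A> (\<lambda>y. conn_form a b y (Z y)) x U"
    if Z: "vector_field \<A> W Z" and Zx: "Z x \<in> tangent_space \<A> x" and U: "U \<in> tangent_space \<A> x" for Z U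
  proof -
    have s: "smooth_section \<A> V W (\<lambda>y. nabla V a y (Z y))" "smooth_section \<A> V W (\<lambda>y. nabla V b y (Z y))"
      by (intro nabla_smooth W sa sb Z)+
    show "met V x (nabla V (\<lambda>y. nabla V a y (Z y)) x U) (b x) = mdiff \<A> (\<lambda>y. conn_form a b y (Z y)) x U"
      using has_mdiff_imp_mdiff[OF has_mdiff_coords(2)[OF s(1) x] U] nabla_oframe_met[OF x Zx]
      by (simp add: conn_form_def[of _ _ _ "Z _"])
    have "mdiff \<A> (\<lambda>y. met V y (nabla V b y (Z y)) (a y)) x U = mdiff \<A> (\<lambda>y. - conn_form a b y (Z y)) x U"
    proof (rule mdiff_cong[OF W x])
      fix y assume y: "y \<in> W"
      have "Z y \<in> tangent_space \<A> y" using section_on_fib[OF Z[unfolded smooth_section_def] y] by (simp add: tangent_bundle_def)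
      then show "met V y (nabla V b y (Z y)) (a y) = - conn_form a b y (Z y)" using nabla_oframe_met[OF y] by simp
    qed
    also have "\<dots> = - mdiff \<A> (\<lambda>y. conn_form a b y (Z y)) x U"
      by (rule has_mdiff_imp_mdiff[OF has_mdiff_minus[OF msmooth_on_imp_has_mdiff[OF conn_form_smooth[OF Z] x]] U])
    finally show "met V x (nabla V (\<lambda>y. nabla V b y (Z y)) x U) (a x) = - mdiff \<A> (\<lambda>y. conn_form a b y (Z y)) x U"
      using has_mdiff_imp_mdiff[OF has_mdiff_coords(1)[OF s(2) x] U] nabla_oframe_met[OF x Zx] by simp
  qed
  have fib: "nabla V (\<lambda>y. nabla V s y (Z y)) x U \<in> fib V x"
    if "smooth_section \<A> V W s" "vector_field \<A> W Z" "U \<in> tangent_space \<A> x" for s Z U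
    by (rule nabla_fib[OF W nabla_smooth[OF W that(1,2)] x that(3)])
  note fibs = fib[OF sa X(1) Y(2)] fib[OF sa Y(1) X(2)] fib[OF sb X(1) Y(2)] fib[OF sb Y(1) X(2)]
    nabla_fib[OF W sa x br] nabla_fib[OF W sb x br] o(1,2)
  show "met V x (bundle_curvature \<A> V X Y a x) (b x) =
      mdiff \<A> (\<lambda>y. conn_form a b y (Y y)) x (X x) - mdiff \<A> (\<lambda>y. conn_form a b y (X y)) x (Y x)
      - conn_form a b x (lie_bracket \<A> X Y x)"
    unfolding bundle_curvature_def
    by (simp add: met_diff_left fib_diff fibs d[OF X Y(2)] d[OF Y X(2)] conn_form_def[of _ _ _ "lie_bracket \<A> X Y x"])
  show "met V x (bundle_curvature \<A> V X Y b x) (a x) =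
      - (mdiff \<A> (\<lambda>y. conn_form a b y (Y y)) x (X x) - mdiff \<A> (\<lambda>y. conn_form a b y (X y)) x (Y x)
      - conn_form a b x (lie_bracket \<A> X Y x))"
    unfolding bundle_curvature_def
    by (simp add: met_diff_left fib_diff fibs d[OF X Y(2)] d[OF Y X(2)] nabla_oframe_met(3)[OF x br])
qed

end

end

section \<open>One-forms in coordinates\<close>

context surface
begin

lemma vector_field_tangent: "vector_field \<A> W X \<Longrightarrow> x \<in> W \<Longrightarrow> X x \<in> tangent_space \<A> x"
  using section_on_fib[of "msmooth_on \<A>" "tangent_bundle \<A>" W X x] by (simp add: smooth_section_def tangent_bundle_def)

lemma vector_field_component_smooth:
  assumes \<kappa>: "\<kappa> \<in> \<A>" and X: "vector_field \<A> W X" and W: "open W"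
  shows "msmooth_on \<A> (fst \<kappa> \<inter> W) (\<lambda>x. X x \<kappa> $ i)"
proof -
  have fr: "(fst \<kappa>, coord1 \<kappa>, coord2 \<kappa>) \<in> frames (tangent_bundle \<A>)"
    using \<kappa> by (auto simp: tangent_bundle_def)
  obtain a b where ab: "msmooth_on \<A> (fst \<kappa> \<inter> W) a" "msmooth_on \<A> (fst \<kappa> \<inter> W) b"
    "\<And>x. x \<in> fst \<kappa> \<Longrightarrow> x \<in> W \<Longrightarrow> X x = a x *\<^sub>R coord1 \<kappa> x + b x *\<^sub>R coord2 \<kappa> x"
    using section_onE[OF X[unfolded smooth_section_def] fr] by metis
  have "X x \<kappa> = a x *\<^sub>R axis 1 1 + b x *\<^sub>R axis 2 1" if "x \<in> fst \<kappa>" "x \<in> W" for x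
    using \<kappa> that by (simp add: ab(3) scaleR_fun_def chart_at_def)
  then have *: "X x \<kappa> $ i = (if i = 1 then a x else b x)" if "x \<in> fst \<kappa> \<inter> W" for x
    using that exhaust_2[of i] by (auto simp: axis_def)
  have "open (fst \<kappa> \<inter> W)" using chart_props(1)[OF \<kappa>] W by auto
  then show ?thesis
    by (rule msmooth_on_cong[of _ "if i = 1 then a else b"]) (use * ab in auto)
qed

lemma lie_bracket_component:
  "chart_at \<A> x \<kappa> \<Longrightarrow> lie_bracket \<A> X Y x \<kappa> = mdiff \<A> (\<lambda>y. Y y \<kappa>) x (X x) - mdiff \<A> (\<lambda>y. X y \<kappa>) x (Y x)"
  by (simp add: lie_bracket_def)

lemma has_mdiff_component:
  assumes c: "chart_at \<A> x \<kappa>" and X: "vector_field \<A> W X" and W: "open W" "x \<in> W" and v: "v \<in> tangent_space \<A> x"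
  shows "has_mdiff (\<lambda>y. X y \<kappa> $ i) x (\<lambda>v. mdiff \<A> (\<lambda>y. X y \<kappa>) x v $ i)"
proof -
  note c' = chart_at_D[OF c]
  have o: "open (fst \<kappa> \<inter> W)" using chart_props(1)[OF c'(1)] W by auto
  note sm = vector_field_component_smooth[OF c'(1) X W(1)]
  have "msmooth_on \<A> (fst \<kappa> \<inter> W) (\<lambda>x. X x \<kappa> $ 1 *\<^sub>R axis 1 1 + X x \<kappa> $ 2 *\<^sub>R axis 2 1 :: real^2)"
    by (intro msmooth_on_add o msmooth_on_linear[OF o bounded_linear_scaleR_left sm])
  then have "msmooth_on \<A> (fst \<kappa> \<inter> W) (\<lambda>x. X x \<kappa>)"
    unfolding vec2_decomp[symmetric] .
  then have "has_mdiff (\<lambda>y. X y \<kappa>) x (mdiff \<A> (\<lambda>y. X y \<kappa>) x)"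
    by (rule msmooth_on_imp_has_mdiff) (use c' W in auto)
  from has_mdiff_linear[OF bounded_linear_vec_nth this] show ?thesis .
qed

text \<open>The left-hand side is the invariant formula for the exterior derivative on \<open>(X, Y)\<close>, which is
  alternating and linear over functions.  The lemma compares orthonormal frames, in which the
  fundamental equations are stated, with coordinate fields, in which linear systems are solved.\<close>

lemma exterior_derivative_coords:
  fixes \<omega> :: "'m \<Rightarrow> 'm tvec \<Rightarrow> real"
  assumes c: "chart_at \<A> x \<kappa>" and W: "open W" "x \<in> W" and lin: "\<And>y. y \<in> W \<Longrightarrow> linear_map_on (tangent_space \<A> y) (\<omega> y)"
    and \<omega>1: "has_mdiff (\<lambda>y. \<omega> y (coord1 \<kappa> y)) x d1" and \<omega>2: "has_mdiff (\<lambda>y. \<omega> y (coord2 \<kappa> y)) x d2"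
    and X: "vector_field \<A> W X" and Y: "vector_field \<A> W Y" and br: "lie_bracket \<A> X Y x \<in> tangent_space \<A> x"
  shows "mdiff \<A> (\<lambda>y. \<omega> y (Y y)) x (X x) - mdiff \<A> (\<lambda>y. \<omega> y (X y)) x (Y x) - \<omega> x (lie_bracket \<A> X Y x) =
    (X x \<kappa> $ 1 * Y x \<kappa> $ 2 - X x \<kappa> $ 2 * Y x \<kappa> $ 1) * (d2 (coord1 \<kappa> x) - d1 (coord2 \<kappa> x))"
proof -
  note c' = chart_at_D[OF c]
  have o: "open (fst \<kappa> \<inter> W)" using chart_props(1)[OF c'(1)] W by auto
  have Xx: "X x \<in> tangent_space \<A> x" and Yx: "Y x \<in> tangent_space \<A> x" using vector_field_tangent X Y W by auto
  have form: "mdiff \<A> (\<lambda>y. \<omega> y (Z y)) x v =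
      Z x \<kappa> $ 1 * d1 v + mdiff \<A> (\<lambda>y. Z y \<kappa>) x v $ 1 * \<omega> x (coord1 \<kappa> x) +
     (Z x \<kappa> $ 2 * d2 v + mdiff \<A> (\<lambda>y. Z y \<kappa>) x v $ 2 * \<omega> x (coord2 \<kappa> x))"
    if Z: "vector_field \<A> W Z" and v: "v \<in> tangent_space \<A> x" for Z v
  proof -
    have h1: "has_mdiff (\<lambda>y. Z y \<kappa> $ 1 * \<omega> y (coord1 \<kappa> y) + Z y \<kappa> $ 2 * \<omega> y (coord2 \<kappa> y)) x
      (\<lambda>v. Z x \<kappa> $ 1 * d1 v + mdiff \<A> (\<lambda>y. Z y \<kappa>) x v $ 1 * \<omega> x (coord1 \<kappa> x) +
     (Z x \<kappa> $ 2 * d2 v + mdiff \<A> (\<lambda>y. Z y \<kappa>) x v $ 2 * \<omega> x (coord2 \<kappa> x)))"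
      by (intro has_mdiff_add has_mdiff_mult \<omega>1 \<omega>2 has_mdiff_component[OF c Z W v])
    have h2: "Z y \<kappa> $ 1 * \<omega> y (coord1 \<kappa> y) + Z y \<kappa> $ 2 * \<omega> y (coord2 \<kappa> y) = \<omega> y (Z y)" if "y \<in> fst \<kappa> \<inter> W" for y
      using linear_map_on_tangent[OF lin vector_field_tangent[OF Z], of y \<kappa>] that c' by (simp add: chart_at_def)
    have "has_mdiff (\<lambda>y. \<omega> y (Z y)) x (\<lambda>v. Z x \<kappa> $ 1 * d1 v + mdiff \<A> (\<lambda>y. Z y \<kappa>) x v $ 1 * \<omega> x (coord1 \<kappa> x) +
     (Z x \<kappa> $ 2 * d2 v + mdiff \<A> (\<lambda>y. Z y \<kappa>) x v $ 2 * \<omega> x (coord2 \<kappa> x)))"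
      by (rule has_mdiff_cong[OF o _ h2 h1]) (use c' W in blast)
    from has_mdiff_imp_mdiff[OF this v] show ?thesis .
  qed
  have d: "d v = v \<kappa> $ 1 * d (coord1 \<kappa> x) + v \<kappa> $ 2 * d (coord2 \<kappa> x)" if "has_mdiff f x d" "v \<in> tangent_space \<A> x" for d v and f :: "'m \<Rightarrow> real"
    using linear_map_on_tangent[OF has_mdiff_imp_linear[OF that(1)] that(2) c] by simp
  show ?thesis
    unfolding form[OF X Yx] form[OF Y Xx] linear_map_on_tangent[OF lin[OF W(2)] br c] lie_bracket_component[OF c]
      d[OF \<omega>1 Xx] d[OF \<omega>2 Xx] d[OF \<omega>1 Yx] d[OF \<omega>2 Yx]
    by (simp add: algebra_simps)
qed

end

section \<open>The spin groups of the two bundles\<close>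

text \<open>With \<open>(C, S)\<close> on the hyperbola \<open>C\<^sup>2 - S\<^sup>2 = 1\<close> this is the general element of \<open>SpinE\<close>; the sign in the
  definition of the group selects the branch of the hyperbola.  The two parameters depend linearly on the
  group element, and so smoothness of a group-valued function is smoothness of \<open>C\<close> and \<open>S\<close>.\<close>

definition boostE :: "real \<Rightarrow> real \<Rightarrow> hac" where
  "boostE C S = (aconst (of_real C), asigma (\<i> * of_real S), 0, 0)"

definition boostM :: "real \<Rightarrow> real \<Rightarrow> hac" where
  "boostM C S = (aconst (of_real C), aconst (\<i> * of_real S), 0, 0)"

lemma hyperbola_param:
  assumes "C\<^sup>2 - S\<^sup>2 = (1::real)"
  obtains v where "(C = cosh v \<and> S = sinh v) \<or> (C = - cosh v \<and> S = - sinh v)"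
proof (cases "C \<ge> 0")
  case True
  then have "C = sqrt (S\<^sup>2 + 1)" using assms by (intro real_sqrt_unique[symmetric]) auto
  then show ?thesis using that[of "arsinh S"] by (simp add: cosh_arsinh_real)
next
  case False
  then have "- C = sqrt ((- S)\<^sup>2 + 1)" using assms by (intro real_sqrt_unique[symmetric]) auto
  then show ?thesis using that[of "arsinh (- S)"] cosh_arsinh_real[of "- S"] by simp
qed

lemma boostE_minus: "- boostE C S = boostE (- C) (- S)" and boostM_minus: "- boostM C S = boostM (- C) (- S)"
  by (simp_all add: boostE_def boostM_def aconst_def asigma_def)

lemma SpinE_alt: "SpinE = {boostE C S | C S. C\<^sup>2 - S\<^sup>2 = 1}"
proof (intro equalityI subsetI)
  fix g assume "g \<in> SpinE"
  then obtain v where "g = boostE (cosh v) (sinh v) \<or> g = - boostE (cosh v) (sinh v)"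
    unfolding SpinE_def boostE_def Let_def by blast
  then show "g \<in> {boostE C S | C S. C\<^sup>2 - S\<^sup>2 = 1}"
    unfolding boostE_minus using hyperbolic_pythagoras[of v] by force
next
  fix g assume "g \<in> {boostE C S | C S. C\<^sup>2 - S\<^sup>2 = 1}"
  then obtain C S where g: "g = boostE C S" "C\<^sup>2 - S\<^sup>2 = 1" by blast
  from hyperbola_param[OF g(2)] obtain v where "(C = cosh v \<and> S = sinh v) \<or> (C = - cosh v \<and> S = - sinh v)" .
  then have "g = boostE (cosh v) (sinh v) \<or> g = - boostE (cosh v) (sinh v)" unfolding g boostE_minus by auto
  then show "g \<in> SpinE" unfolding SpinE_def boostE_def Let_def by blast
qed

lemma SpinM_alt: "SpinM = {boostM C S | C S. C\<^sup>2 - S\<^sup>2 = 1}"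
proof (intro equalityI subsetI)
  fix g assume "g \<in> SpinM"
  then obtain v where "g = boostM (cosh v) (sinh v) \<or> g = - boostM (cosh v) (sinh v)"
    unfolding SpinM_def boostM_def Let_def by blast
  then show "g \<in> {boostM C S | C S. C\<^sup>2 - S\<^sup>2 = 1}"
    unfolding boostM_minus using hyperbolic_pythagoras[of v] by force
next
  fix g assume "g \<in> {boostM C S | C S. C\<^sup>2 - S\<^sup>2 = 1}"
  then obtain C S where g: "g = boostM C S" "C\<^sup>2 - S\<^sup>2 = 1" by blast
  from hyperbola_param[OF g(2)] obtain v where "(C = cosh v \<and> S = sinh v) \<or> (C = - cosh v \<and> S = - sinh v)" .
  then have "g = boostM (cosh v) (sinh v) \<or> g = - boostM (cosh v) (sinh v)" unfolding g boostM_minus by auto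
  then show "g \<in> SpinM" unfolding SpinM_def boostM_def Let_def by blast
qed

lemma boost_mult:
  "boostE C S \<otimes> boostE C' S' = boostE (C * C' + S * S') (C * S' + S * C')"
  "boostM C S \<otimes> boostM C' S' = boostM (C * C' + S * S') (C * S' + S * C')"
  by (simp_all only: boostE_def boostM_def explicit_simps; intro conjI; simp add: complex_eq_iff; simp add: algebra_simps)+

lemma boost_commute: "boostE C S \<otimes> boostM C' S' = boostM C' S' \<otimes> boostE C S"
  by (simp only: boostE_def boostM_def explicit_simps; intro conjI; simp add: complex_eq_iff; simp add: algebra_simps)

lemma boost_conj: "hconj (boostE C S) = boostE C (- S)" "hconj (boostM C S) = boostM C (- S)"
  "hhat (boostE C S) = boostE C (- S)" "hhat (boostM C S) = boostM C S"
  by (simp_all add: boostE_def boostM_def aconst_def asigma_def zero_prod_def)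

lemma boost_H0: "boostE C S \<in> H0" "boostM C S \<in> H0"
  by (simp_all add: H0_iff boostE_def boostM_def aconst_def asigma_def zero_prod_def)

lemma boost_hone: "boostE 1 0 = hone" "boostM 1 0 = hone"
  by (simp_all add: boostE_def boostM_def hone_def aconst_def asigma_def zero_prod_def)

lemma spin_group_SpinE: "hone \<in> SpinE" "g \<in> SpinE \<Longrightarrow> h \<in> SpinE \<Longrightarrow> g \<otimes> h \<in> SpinE" "g \<in> SpinE \<Longrightarrow> hconj g \<in> SpinE"
  and spin_group_SpinM: "hone \<in> SpinM" "g \<in> SpinM \<Longrightarrow> h \<in> SpinM \<Longrightarrow> g \<otimes> h \<in> SpinM" "g \<in> SpinM \<Longrightarrow> hconj g \<in> SpinM"
proof -
  have *: "(C * C' + S * S')\<^sup>2 - (C * S' + S * C')\<^sup>2 = 1" if "C\<^sup>2 - S\<^sup>2 = 1" "C'\<^sup>2 - S'\<^sup>2 = 1" for C S C' S' :: real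
  proof -
    have "(C * C' + S * S')\<^sup>2 - (C * S' + S * C')\<^sup>2 = (C\<^sup>2 - S\<^sup>2) * (C'\<^sup>2 - S'\<^sup>2)"
      by (simp add: power2_eq_square algebra_simps)
    then show ?thesis using that by simp
  qed
  show "hone \<in> SpinE" unfolding SpinE_alt boost_hone(1)[symmetric] by force
  show "hone \<in> SpinM" unfolding SpinM_alt boost_hone(2)[symmetric] by force
  show "g \<otimes> h \<in> SpinE" if "g \<in> SpinE" "h \<in> SpinE"
    using that * unfolding SpinE_alt by (fastforce simp: boost_mult)
  show "g \<otimes> h \<in> SpinM" if "g \<in> SpinM" "h \<in> SpinM"
    using that * unfolding SpinM_alt by (fastforce simp: boost_mult)
  show "hconj g \<in> SpinE" if "g \<in> SpinE" using that unfolding SpinE_alt by (force simp: boost_conj)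
  show "hconj g \<in> SpinM" if "g \<in> SpinM" using that unfolding SpinM_alt by (force simp: boost_conj)
qed

lemma SpinE_Spin22: "g \<in> SpinE \<Longrightarrow> g \<in> Spin22" and SpinM_Spin22: "g \<in> SpinM \<Longrightarrow> g \<in> Spin22"
  unfolding SpinE_alt SpinM_alt
  by (auto simp: Spin22_iff boost_H0 boost_conj boost_mult power2_eq_square boost_hone mult.commute)

lemma SpinE_SpinM_commute: "g \<in> SpinE \<Longrightarrow> h \<in> SpinM \<Longrightarrow> g \<otimes> h = h \<otimes> g"
  unfolding SpinE_alt SpinM_alt by (auto simp: boost_commute)

text \<open>Each of the two groups acts trivially on the vectors of the other bundle.  So \<open>g1 \<otimes> g2\<close> acts on the
  coordinates of \<open>E \<oplus> TM\<close> as \<open>g1\<close> on those of \<open>E\<close> and as \<open>g2\<close> on those of \<open>TM\<close>.\<close>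

lemma SpinM_iotaE:
  assumes "g \<in> SpinM" shows "g \<otimes> iotaE x \<otimes> hconj (hhat g) = iotaE x"
proof -
  obtain C S where g: "g = boostM C S" "C\<^sup>2 - S\<^sup>2 = 1" using assms unfolding SpinM_alt by blast
  obtain x0 x1 where x: "x = (x0, x1)" by fastforce
  have "g \<otimes> iotaE x = iotaE x \<otimes> g"
    by (simp only: g x iotaE.simps boostM_def explicit_simps; intro conjI; simp add: complex_eq_iff; simp add: algebra_simps)
  moreover have "g \<otimes> hconj g = hone" using SpinM_Spin22[OF assms] by (simp add: Spin22_iff unit_right)
  ultimately show ?thesis using g by (simp add: hmul_assoc boost_conj)
qed

lemma SpinE_iotaM:
  assumes "g \<in> SpinE" shows "g \<otimes> iotaM x \<otimes> hconj (hhat g) = iotaM x"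
proof -
  obtain C S where g: "g = boostE C S" "C\<^sup>2 - S\<^sup>2 = 1" using assms unfolding SpinE_alt by blast
  obtain x2 x3 where x: "x = (x2, x3)" by fastforce
  have "g \<otimes> iotaM x = iotaM x \<otimes> hconj g"
    by (simp only: g x iotaM.simps boost_conj; simp only: boostE_def explicit_simps; intro conjI; simp add: complex_eq_iff; simp add: algebra_simps)
  moreover have "hconj g \<otimes> g = hone" using SpinE_Spin22[OF assms] by (simp add: Spin22_iff)
  ultimately show ?thesis using g by (simp add: hmul_assoc boost_conj)
qed

section \<open>Principal bundles\<close>

lemma principalD:
  assumes "principal_bundle \<A> G S" "q \<in> sfib S x"
  shows "g \<in> G \<Longrightarrow> sact S q g \<in> sfib S x"
    "g \<in> G \<Longrightarrow> h \<in> G \<Longrightarrow> sact S (sact S q g) h = sact S q (g \<otimes> h)" "sact S q hone = q"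
    "q' \<in> sfib S x \<Longrightarrow> \<exists>!g. g \<in> G \<and> q' = sact S q g"
proof -
  note a = assms(1)[unfolded principal_bundle_def, THEN conjunct2, THEN conjunct1, rule_format, OF assms(2)]
  show "g \<in> G \<Longrightarrow> sact S q g \<in> sfib S x"
    "g \<in> G \<Longrightarrow> h \<in> G \<Longrightarrow> sact S (sact S q g) h = sact S q (g \<otimes> h)" "sact S q hone = q"
    using a by simp_all
  show "q' \<in> sfib S x \<Longrightarrow> \<exists>!g. g \<in> G \<and> q' = sact S q g" using a by blast
qed

lemma principal_sections:
  assumes "principal_bundle \<A> G S"
  obtains W s where "(W, s) \<in> ssecs S" "x \<in> W" "open W" "smooth_principal_section \<A> G S W s"
proof -
  obtain t where t: "t \<in> ssecs S" "case t of (W, s) \<Rightarrow> x \<in> W"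
    using assms[unfolded principal_bundle_def, THEN conjunct2, THEN conjunct2, THEN conjunct1, rule_format, of x]
    by (elim bexE)
  obtain W s where ws: "t = (W, s)" by (cases t)
  have "open W \<and> smooth_principal_section \<A> G S W s"
    using assms[unfolded principal_bundle_def, THEN conjunct2, THEN conjunct2, THEN conjunct2, rule_format, OF t(1)] ws by simp
  then show thesis using that t ws by simp
qed

section \<open>Spinors\<close>

locale spin_surface =
  fixes D :: "('m::{t2_space, second_countable_topology}, 'v::real_vector, 'q, 'p) spin_data"
    and B :: "'m \<Rightarrow> 'm tvec \<Rightarrow> 'm tvec \<Rightarrow> 'v"
  assumes tangent: "oriented_lorentzian_surface (atl D) (bT D)"
    and normal: "oriented_lorentzian_bundle (atl D) (bE D)"
    and spinT: "spin_structure_tangent (atl D) (bT D) (sT D)"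
    and spinE: "spin_structure_normal (atl D) (bE D) (sE D)"
    and form: "symmetric_bilinear_map (atl D) (bE D) B"
    and gauss: "gauss_equation (atl D) (bT D) (bE D) B"
    and ricci: "ricci_equation (atl D) (bT D) (bE D) B"
    and codazzi: "codazzi_equation (atl D) (bT D) (bE D) B"
begin

lemmas tangent_conjuncts = tangent[unfolded oriented_lorentzian_surface_def]

sublocale surface "atl D"
  by unfold_locales (rule tangent_conjuncts[THEN conjunct1])

sublocale T: lorentz_bundle "atl D" "bT D"
  by unfold_locales (rule tangent_conjuncts[THEN conjunct2, THEN conjunct2, THEN conjunct1])

sublocale E: lorentz_bundle "atl D" "bE D"
  by unfold_locales (rule normal)

lemmas torsion_free = tangent_conjuncts[THEN conjunct2, THEN conjunct2, THEN conjunct2]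

lemma tangent_fib: "fib (bT D) = tangent_space (atl D)"
  and tangent_frames: "frames (bT D) = frames (tangent_bundle (atl D))"
proof -
  have "vb.truncate (bT D) = tangent_bundle (atl D)" using tangent_conjuncts by blast
  then have "fib (vb.truncate (bT D)) = fib (tangent_bundle (atl D))" "frames (vb.truncate (bT D)) = frames (tangent_bundle (atl D))"
    by simp_all
  then show "fib (bT D) = tangent_space (atl D)" "frames (bT D) = frames (tangent_bundle (atl D))"
    by (cases "bT D"; simp add: vb.defs tangent_bundle_def)+
qed

lemma tangent_section: "smooth_section (atl D) (bT D) W s \<longleftrightarrow> vector_field (atl D) W s"
  unfolding smooth_section_def section_on_def tangent_frames by (simp add: tangent_fib tangent_bundle_def)

lemmas principalE = spinE[unfolded spin_structure_def, THEN conjunct1]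
  and principalT = spinT[unfolded spin_structure_def, THEN conjunct1]

lemma spin_frames_iff: "(q1, q2) \<in> spin_frames D x \<longleftrightarrow> q1 \<in> sfib (sE D) x \<and> q2 \<in> sfib (sT D) x"
  by (simp add: spin_frames_def)

definition frame_act :: "'q \<times> 'p \<Rightarrow> hac \<Rightarrow> hac \<Rightarrow> 'q \<times> 'p" where
  "frame_act q g1 g2 = (sact (sE D) (fst q) g1, sact (sT D) (snd q) g2)"

lemma frame_act_mem:
  "q \<in> spin_frames D x \<Longrightarrow> g1 \<in> SpinE \<Longrightarrow> g2 \<in> SpinM \<Longrightarrow> frame_act q g1 g2 \<in> spin_frames D x"
  by (cases q) (simp add: spin_frames_iff frame_act_def principalD(1)[OF principalE] principalD(1)[OF principalT])

lemma frame_act_act: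
  "q \<in> spin_frames D x \<Longrightarrow> g1 \<in> SpinE \<Longrightarrow> g2 \<in> SpinM \<Longrightarrow> h1 \<in> SpinE \<Longrightarrow> h2 \<in> SpinM \<Longrightarrow>
    frame_act (frame_act q g1 g2) h1 h2 = frame_act q (g1 \<otimes> h1) (g2 \<otimes> h2)"
  by (cases q) (simp add: spin_frames_iff frame_act_def principalD(2)[OF principalE, where x = x] principalD(2)[OF principalT, where x = x])

lemma frame_act_trans:
  assumes q: "q \<in> spin_frames D x" "q' \<in> spin_frames D x"
  obtains g1 g2 where "g1 \<in> SpinE" "g2 \<in> SpinM" "q' = frame_act q g1 g2"
proof -
  obtain q1 q2 q1' q2' where [simp]: "q = (q1, q2)" "q' = (q1', q2')" by fastforce
  obtain g1 where "g1 \<in> SpinE" "q1' = sact (sE D) q1 g1"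
    using principalD(4)[OF principalE, of q1 x q1'] q by (auto simp: spin_frames_iff)
  moreover obtain g2 where "g2 \<in> SpinM" "q2' = sact (sT D) q2 g2"
    using principalD(4)[OF principalT, of q2 x q2'] q by (auto simp: spin_frames_iff)
  ultimately show ?thesis using that by (auto simp: frame_act_def)
qed

lemma frame_act_free:
  assumes q: "q \<in> spin_frames D x" and g: "g1 \<in> SpinE" "g2 \<in> SpinM" "h1 \<in> SpinE" "h2 \<in> SpinM"
    and eq: "frame_act q g1 g2 = frame_act q h1 h2"
  shows "g1 = h1" "g2 = h2"
proof -
  obtain q1 q2 where [simp]: "q = (q1, q2)" by fastforce
  have 1: "q1 \<in> sfib (sE D) x" "q2 \<in> sfib (sT D) x" using q by (auto simp: spin_frames_iff)
  have 2: "sact (sE D) q1 g1 = sact (sE D) q1 h1" "sact (sT D) q2 g2 = sact (sT D) q2 h2"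
    using eq by (auto simp: frame_act_def)
  show "g1 = h1" using principalD(4)[OF principalE 1(1) principalD(1)[OF principalE 1(1) g(1)]] 2(1) g by blast
  show "g2 = h2" using principalD(4)[OF principalT 1(2) principalD(1)[OF principalT 1(2) g(2)]] 2(2) g by blast
qed

lemma ex_spin_frame: obtains q where "q \<in> spin_frames D x"
proof -
  obtain W s where "x \<in> W" "smooth_principal_section (atl D) SpinE (sE D) W s" by (rule principal_sections[OF principalE])
  moreover obtain W' s' where "x \<in> W'" "smooth_principal_section (atl D) SpinM (sT D) W' s'" by (rule principal_sections[OF principalT])
  ultimately have "(s x, s' x) \<in> spin_frames D x" by (auto simp: smooth_principal_section_def spin_frames_iff)
  then show ?thesis using that by blast
qed

lemma spinor_class_mem:
  "(q', p') \<in> spinor_class D q p \<longleftrightarrow>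
    (\<exists>g1 g2. g1 \<in> SpinE \<and> g2 \<in> SpinM \<and> q' = frame_act q g1 g2 \<and> p' \<in> H0 \<and> p = g1 \<otimes> g2 \<otimes> p')"
  by (cases q) (auto simp: frame_act_def)

lemma spin_unit: "g1 \<in> SpinE \<Longrightarrow> g2 \<in> SpinM \<Longrightarrow> g1 \<otimes> g2 \<in> Spin22"
  by (intro Spin22_hmul SpinE_Spin22 SpinM_Spin22)

lemma spin_cancel: "g1 \<in> SpinE \<Longrightarrow> g2 \<in> SpinM \<Longrightarrow> hconj (g1 \<otimes> g2) \<otimes> (g1 \<otimes> g2 \<otimes> p) = p"
  "g1 \<in> SpinE \<Longrightarrow> g2 \<in> SpinM \<Longrightarrow> g1 \<otimes> g2 \<otimes> (hconj (g1 \<otimes> g2) \<otimes> p) = p"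
  using spin_unit by (simp_all add: Spin22_iff unit_cancel)

lemma spinor_class_frame:
  assumes q: "q \<in> spin_frames D x" and g: "g1 \<in> SpinE" "g2 \<in> SpinM"
  shows "(frame_act q g1 g2, p') \<in> spinor_class D q p \<longleftrightarrow> p' \<in> H0 \<and> p = g1 \<otimes> g2 \<otimes> p'"
proof
  assume "(frame_act q g1 g2, p') \<in> spinor_class D q p"
  then obtain h1 h2 where h: "h1 \<in> SpinE" "h2 \<in> SpinM" "frame_act q g1 g2 = frame_act q h1 h2" "p' \<in> H0" "p = h1 \<otimes> h2 \<otimes> p'"
    unfolding spinor_class_mem by blast
  with frame_act_free[OF q g h(1,2,3)] show "p' \<in> H0 \<and> p = g1 \<otimes> g2 \<otimes> p'" by simp
next
  assume "p' \<in> H0 \<and> p = g1 \<otimes> g2 \<otimes> p'"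
  then show "(frame_act q g1 g2, p') \<in> spinor_class D q p" unfolding spinor_class_mem using g by blast
qed

text \<open>A spinor is the graph of its coordinate, which is an equivariant function on the spinorial frames.\<close>

lemma spinor_fibreD:
  assumes \<psi>: "\<psi> \<in> spinor_fibre D x"
  shows spinor_graph: "(q, p) \<in> \<psi> \<longleftrightarrow> q \<in> spin_frames D x \<and> p = spinor_coord \<psi> q"
    and spinor_coord_H0: "q \<in> spin_frames D x \<Longrightarrow> spinor_coord \<psi> q \<in> H0"
    and spinor_coord_act: "q \<in> spin_frames D x \<Longrightarrow> g1 \<in> SpinE \<Longrightarrow> g2 \<in> SpinM \<Longrightarrow>
      spinor_coord \<psi> q = g1 \<otimes> g2 \<otimes> spinor_coord \<psi> (frame_act q g1 g2)"
proof -
  obtain q0 p0 where 0: "\<psi> = spinor_class D q0 p0" "q0 \<in> spin_frames D x" "p0 \<in> H0"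
    using \<psi> unfolding spinor_fibre_def by blast
  have mem: "(frame_act q0 g1 g2, p) \<in> \<psi> \<longleftrightarrow> p = hconj (g1 \<otimes> g2) \<otimes> p0" if g: "g1 \<in> SpinE" "g2 \<in> SpinM" for g1 g2 p
    unfolding 0 spinor_class_frame[OF 0(2) g]
    using spin_cancel(1)[OF g, of p] spin_cancel(2)[OF g, of p0] spin_unit[OF g] 0(3)
    by (auto simp: Spin22_iff H0_hmul H0_hconj)
  have coord: "spinor_coord \<psi> (frame_act q0 g1 g2) = hconj (g1 \<otimes> g2) \<otimes> p0" if g: "g1 \<in> SpinE" "g2 \<in> SpinM" for g1 g2
    unfolding spinor_coord_def mem[OF g] by simp
  show "(q, p) \<in> \<psi> \<longleftrightarrow> q \<in> spin_frames D x \<and> p = spinor_coord \<psi> q"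
  proof
    assume qp: "(q, p) \<in> \<psi>"
    then obtain g1 g2 where g: "g1 \<in> SpinE" "g2 \<in> SpinM" "q = frame_act q0 g1 g2" unfolding 0 spinor_class_mem by blast
    then show "q \<in> spin_frames D x \<and> p = spinor_coord \<psi> q"
      using mem[OF g(1,2)] coord[OF g(1,2)] qp frame_act_mem[OF 0(2)] by simp
  next
    assume qp: "q \<in> spin_frames D x \<and> p = spinor_coord \<psi> q"
    then obtain g1 g2 where g: "g1 \<in> SpinE" "g2 \<in> SpinM" "q = frame_act q0 g1 g2" using frame_act_trans[OF 0(2)] by blast
    then show "(q, p) \<in> \<psi>" using mem[OF g(1,2)] coord[OF g(1,2)] qp by simp
  qed
  assume q: "q \<in> spin_frames D x"
  then obtain g1 g2 where g: "g1 \<in> SpinE" "g2 \<in> SpinM" "q = frame_act q0 g1 g2" using frame_act_trans[OF 0(2)] by blast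
  show "spinor_coord \<psi> q \<in> H0"
    unfolding g(3) coord[OF g(1,2)] using spin_unit[OF g(1,2)] 0(3) by (simp add: Spin22_iff H0_hmul H0_hconj)
  show "spinor_coord \<psi> q = h1 \<otimes> h2 \<otimes> spinor_coord \<psi> (frame_act q h1 h2)" if h: "h1 \<in> SpinE" "h2 \<in> SpinM" for h1 h2
  proof -
    have gh: "g1 \<otimes> h1 \<in> SpinE" "g2 \<otimes> h2 \<in> SpinM" using g h spin_group_SpinE spin_group_SpinM by auto
    have eq: "frame_act q h1 h2 = frame_act q0 (g1 \<otimes> h1) (g2 \<otimes> h2)"
      unfolding g(3) by (rule frame_act_act[OF 0(2) g(1,2) h])
    have "g1 \<otimes> h1 \<otimes> (g2 \<otimes> h2) = (g1 \<otimes> g2) \<otimes> (h1 \<otimes> h2)"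
      using SpinE_SpinM_commute[OF h(1) g(2)] by (simp add: hmul_assoc) (simp add: hmul_assoc[symmetric])
    then have "spinor_coord \<psi> (frame_act q h1 h2) = hconj (h1 \<otimes> h2) \<otimes> (hconj (g1 \<otimes> g2) \<otimes> p0)"
      unfolding eq coord[OF gh] by (simp add: hconj_hmul hmul_assoc)
    then show ?thesis unfolding g(3) coord[OF g(1,2)] using spin_cancel(2)[OF h] by simp
  qed
qed

text \<open>Conversely every equivariant function with values in \<open>H0\<close> is the coordinate of a spinor.\<close>

lemma spinor_fibreI:
  assumes H0: "\<And>q. q \<in> spin_frames D x \<Longrightarrow> c q \<in> H0"
    and eq: "\<And>q g1 g2. q \<in> spin_frames D x \<Longrightarrow> g1 \<in> SpinE \<Longrightarrow> g2 \<in> SpinM \<Longrightarrow> c q = g1 \<otimes> g2 \<otimes> c (frame_act q g1 g2)"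
  shows "{(q, c q) | q. q \<in> spin_frames D x} \<in> spinor_fibre D x"
    and "q \<in> spin_frames D x \<Longrightarrow> spinor_coord {(q, c q) | q. q \<in> spin_frames D x} q = c q"
proof -
  obtain q0 where q0: "q0 \<in> spin_frames D x" by (rule ex_spin_frame)
  have "{(q, c q) | q. q \<in> spin_frames D x} = spinor_class D q0 (c q0)"
  proof (intro set_eqI)
    fix qp :: "('q \<times> 'p) \<times> hac"
    obtain q p where qp: "qp = (q, p)" by (cases qp)
    have "(q, p) \<in> spinor_class D q0 (c q0) \<longleftrightarrow> q \<in> spin_frames D x \<and> p = c q"
    proof
      assume "(q, p) \<in> spinor_class D q0 (c q0)"
      then obtain g1 g2 where g: "g1 \<in> SpinE" "g2 \<in> SpinM" "q = frame_act q0 g1 g2" "c q0 = g1 \<otimes> g2 \<otimes> p"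
        unfolding spinor_class_mem by blast
      have "p = hconj (g1 \<otimes> g2) \<otimes> c q0" unfolding g(4) spin_cancel(1)[OF g(1,2)] ..
      also have "\<dots> = c q" unfolding eq[OF q0 g(1,2)] g(3) spin_cancel(1)[OF g(1,2)] ..
      finally have "p = c q" .
      with g show "q \<in> spin_frames D x \<and> p = c q" using frame_act_mem[OF q0 g(1,2)] g(3) by simp
    next
      assume a: "q \<in> spin_frames D x \<and> p = c q"
      then obtain g1 g2 where g: "g1 \<in> SpinE" "g2 \<in> SpinM" "q = frame_act q0 g1 g2" using frame_act_trans[OF q0] by blast
      then show "(q, p) \<in> spinor_class D q0 (c q0)"
        unfolding g(3) spinor_class_frame[OF q0 g(1,2)] using a[unfolded g(3)] H0 eq[OF q0 g(1,2)] by simp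
    qed
    then show "qp \<in> {(q, c q) | q. q \<in> spin_frames D x} \<longleftrightarrow> qp \<in> spinor_class D q0 (c q0)" unfolding qp by auto
  qed
  then show "{(q, c q) | q. q \<in> spin_frames D x} \<in> spinor_fibre D x"
    unfolding spinor_fibre_def using q0 H0 by blast
  show "spinor_coord {(q, c q) | q. q \<in> spin_frames D x} q = c q" if "q \<in> spin_frames D x"
    unfolding spinor_coord_def using that by simp
qed

lemma spinor_class_fibre:
  assumes "q \<in> spin_frames D x" "p \<in> H0"
  shows "spinor_class D q p \<in> spinor_fibre D x" "spinor_coord (spinor_class D q p) q = p"
proof -
  show f: "spinor_class D q p \<in> spinor_fibre D x" using assms unfolding spinor_fibre_def by blast
  have "frame_act q hone hone = q" using assms by (cases q) (simp add: frame_act_def spin_frames_iff principalD(3)[OF principalE, where x = x] principalD(3)[OF principalT, where x = x])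
  then have "(q, p) \<in> spinor_class D q p"
    using spinor_class_frame[OF assms(1) spin_group_SpinE(1) spin_group_SpinM(1), of p p] assms by simp
  then show "spinor_coord (spinor_class D q p) q = p" using spinor_graph[OF f] by simp
qed

lemma spinor_eqI:
  assumes "\<psi> \<in> spinor_fibre D x" "\<psi>' \<in> spinor_fibre D x" "q \<in> spin_frames D x" "spinor_coord \<psi> q = spinor_coord \<psi>' q"
  shows "\<psi> = \<psi>'"
proof -
  have that: "spinor_coord \<psi> q' = spinor_coord \<psi>' q'" if q': "q' \<in> spin_frames D x" for q'
  proof -
    obtain g1 g2 where g: "g1 \<in> SpinE" "g2 \<in> SpinM" "q' = frame_act q g1 g2" using frame_act_trans[OF assms(3) q'] .
    show ?thesis
      using spinor_coord_act[OF assms(1,3) g(1,2)] spinor_coord_act[OF assms(2,3) g(1,2)] assms(4) g(3)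
        spin_cancel(1)[OF g(1,2)] by metis
  qed
  have "(q, p) \<in> \<psi> \<longleftrightarrow> (q, p) \<in> \<psi>'" for q p
    unfolding spinor_graph[OF assms(1)] spinor_graph[OF assms(2)] using that[of q] by auto
  then show ?thesis by auto
qed

text \<open>This covers right-multiplication, scaling and the Clifford action, which are all given by a map of
  coordinates.\<close>

lemma spinor_fibre_map:
  assumes \<psi>: "\<psi> \<in> spinor_fibre D x"
    and H0: "\<And>q p. q \<in> spin_frames D x \<Longrightarrow> p \<in> H0 \<Longrightarrow> f q p \<in> H0"
    and eq: "\<And>q p g1 g2. q \<in> spin_frames D x \<Longrightarrow> g1 \<in> SpinE \<Longrightarrow> g2 \<in> SpinM \<Longrightarrow>
      f q (g1 \<otimes> g2 \<otimes> p) = g1 \<otimes> g2 \<otimes> f (frame_act q g1 g2) p"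
  shows "{(q, f q p) | q p. (q, p) \<in> \<psi>} \<in> spinor_fibre D x"
    "q \<in> spin_frames D x \<Longrightarrow> spinor_coord {(q, f q p) | q p. (q, p) \<in> \<psi>} q = f q (spinor_coord \<psi> q)"
proof -
  let ?c = "\<lambda>q. f q (spinor_coord \<psi> q)"
  have set: "{(q, f q p) | q p. (q, p) \<in> \<psi>} = {(q, ?c q) | q. q \<in> spin_frames D x}"
    using spinor_graph[OF \<psi>] by auto
  have 1: "?c q \<in> H0" if "q \<in> spin_frames D x" for q
    using H0[OF that spinor_coord_H0[OF \<psi> that]] .
  have 2: "?c q = g1 \<otimes> g2 \<otimes> ?c (frame_act q g1 g2)" if "q \<in> spin_frames D x" "g1 \<in> SpinE" "g2 \<in> SpinM" for q g1 g2
    using eq[OF that, of "spinor_coord \<psi> (frame_act q g1 g2)"] spinor_coord_act[OF \<psi> that] by simp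
  show "{(q, f q p) | q p. (q, p) \<in> \<psi>} \<in> spinor_fibre D x" unfolding set by (rule spinor_fibreI(1)[OF 1 2])
  show "spinor_coord {(q, f q p) | q p. (q, p) \<in> \<psi>} q = f q (spinor_coord \<psi> q)" if "q \<in> spin_frames D x"
    unfolding set by (rule spinor_fibreI(2)[OF 1 2 that])
qed

lemma spinor_right_fibre:
  assumes \<psi>: "\<psi> \<in> spinor_fibre D x" and a: "a \<in> H0"
  shows "spinor_right \<psi> a \<in> spinor_fibre D x"
    "q \<in> spin_frames D x \<Longrightarrow> spinor_coord (spinor_right \<psi> a) q = spinor_coord \<psi> q \<otimes> a"
  unfolding spinor_right_def
  by (rule spinor_fibre_map[OF \<psi>]; simp add: H0_hmul a hmul_assoc)+

lemma spinor_scale_fibre: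
  assumes \<psi>: "\<psi> \<in> spinor_fibre D x"
  shows "spinor_scale r \<psi> \<in> spinor_fibre D x"
    "q \<in> spin_frames D x \<Longrightarrow> spinor_coord (spinor_scale r \<psi>) q = r *\<^sub>R spinor_coord \<psi> q"
  unfolding spinor_scale_def
  by (rule spinor_fibre_map[OF \<psi>]; simp add: H0_scaleR hmul.scaleR_right)+

lemma spinor_add_fibre:
  assumes \<psi>: "\<psi> \<in> spinor_fibre D x" and \<psi>': "\<psi>' \<in> spinor_fibre D x"
  shows "spinor_add \<psi> \<psi>' \<in> spinor_fibre D x"
    "q \<in> spin_frames D x \<Longrightarrow> spinor_coord (spinor_add \<psi> \<psi>') q = spinor_coord \<psi> q + spinor_coord \<psi>' q"
proof -
  let ?c = "\<lambda>q. spinor_coord \<psi> q + spinor_coord \<psi>' q"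
  have set: "spinor_add \<psi> \<psi>' = {(q, ?c q) | q. q \<in> spin_frames D x}"
    unfolding spinor_add_def using spinor_graph[OF \<psi>] spinor_graph[OF \<psi>'] by auto
  have 1: "?c q \<in> H0" if "q \<in> spin_frames D x" for q
    by (intro H0_add spinor_coord_H0[OF \<psi> that] spinor_coord_H0[OF \<psi>' that])
  have 2: "?c q = g1 \<otimes> g2 \<otimes> ?c (frame_act q g1 g2)" if "q \<in> spin_frames D x" "g1 \<in> SpinE" "g2 \<in> SpinM" for q g1 g2
    using spinor_coord_act[OF \<psi> that] spinor_coord_act[OF \<psi>' that] by (simp add: hmul.add_right)
  show "spinor_add \<psi> \<psi>' \<in> spinor_fibre D x" unfolding set by (rule spinor_fibreI(1)[OF 1 2])
  show "spinor_coord (spinor_add \<psi> \<psi>') q = ?c q" if "q \<in> spin_frames D x"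
    unfolding set by (rule spinor_fibreI(2)[OF 1 2 that])
qed

subsection \<open>Vectors in spinorial frames\<close>

text \<open>The minus signs belong to the timelike vectors \<open>e0\<close> and \<open>e2\<close>.\<close>

definition frame_coords :: "'m \<Rightarrow> 'q \<times> 'p \<Rightarrow> 'v \<times> 'm tvec \<Rightarrow> r22" where
  "frame_coords x q Z = (- met (bE D) x (fst Z) (fst (sframe (sE D) (fst q))), met (bE D) x (fst Z) (snd (sframe (sE D) (fst q))),
     - met (bT D) x (snd Z) (fst (sframe (sT D) (snd q))), met (bT D) x (snd Z) (snd (sframe (sT D) (snd q))))"

lemma vector_coord_frame_coords: "vector_coord D x q Z = r22_to_hac (frame_coords x q Z)"
proof -
  obtain q1 q2 \<nu> X where q: "q = (q1, q2)" "Z = (\<nu>, X)" by fastforce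
  obtain e0 e1 e2 e3 where e: "sframe (sE D) q1 = (e0, e1)" "sframe (sT D) q2 = (e2, e3)" by fastforce
  show ?thesis
    by (simp add: q e frame_coords_def r22_to_hac_hom(1)[symmetric] del: r22_to_hac.simps)
qed

lemma frame_oframes:
  assumes "q \<in> spin_frames D x"
  shows "sframe (sE D) (fst q) \<in> oframes (bE D) x" "sframe (sT D) (snd q) \<in> oframes (bT D) x"
proof -
  have "fst q \<in> sfib (sE D) x" "snd q \<in> sfib (sT D) x" using assms by (cases q; simp add: spin_frames_iff)+
  then show "sframe (sE D) (fst q) \<in> oframes (bE D) x" "sframe (sT D) (snd q) \<in> oframes (bT D) x"
    using spinE[unfolded spin_structure_def, THEN conjunct2, THEN conjunct1]
      spinT[unfolded spin_structure_def, THEN conjunct2, THEN conjunct1] by blast+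
qed

lemma vector_coord_act:
  assumes q: "q \<in> spin_frames D x" and g: "g1 \<in> SpinE" "g2 \<in> SpinM"
    and Z: "\<nu> \<in> fib (bE D) x" "X \<in> tangent_space (atl D) x"
  shows "vector_coord D x q (\<nu>, X) = (g1 \<otimes> g2) \<otimes> vector_coord D x (frame_act q g1 g2) (\<nu>, X) \<otimes> hconj (hhat (g1 \<otimes> g2))"
proof -
  obtain q1 q2 where q12: "q = (q1, q2)" by fastforce
  have f: "q1 \<in> sfib (sE D) x" "q2 \<in> sfib (sT D) x" using q q12 by (auto simp: spin_frames_iff)
  have E: "iotaE (ocoords (bE D) x (sframe (sE D) q1) \<nu>) =
      g1 \<otimes> iotaE (ocoords (bE D) x (sframe (sE D) (sact (sE D) q1 g1)) \<nu>) \<otimes> hconj (hhat g1)" (is "_ = g1 \<otimes> ?z \<otimes> _")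
    using spinE[unfolded spin_structure_def, THEN conjunct2, THEN conjunct1, rule_format, OF f(1)] g Z by blast
  have T: "iotaM (ocoords (bT D) x (sframe (sT D) q2) X) =
      g2 \<otimes> iotaM (ocoords (bT D) x (sframe (sT D) (sact (sT D) q2 g2)) X) \<otimes> hconj (hhat g2)" (is "_ = g2 \<otimes> ?w \<otimes> _")
    using spinT[unfolded spin_structure_def, THEN conjunct2, THEN conjunct1, rule_format, OF f(2)] g Z
    unfolding tangent_fib by blast
  have comm: "g1 \<otimes> g2 = g2 \<otimes> g1" by (rule SpinE_SpinM_commute[OF g])
  have hh: "hconj (hhat (g1 \<otimes> g2)) = hconj (hhat g2) \<otimes> hconj (hhat g1)" by (simp add: hhat_hmul hconj_hmul)
  have hh': "hconj (hhat (g2 \<otimes> g1)) = hconj (hhat g1) \<otimes> hconj (hhat g2)" by (simp add: hhat_hmul hconj_hmul)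
  have "(g1 \<otimes> g2) \<otimes> ?z \<otimes> hconj (hhat (g1 \<otimes> g2)) = g1 \<otimes> (g2 \<otimes> ?z \<otimes> hconj (hhat g2)) \<otimes> hconj (hhat g1)"
    unfolding hh by (simp only: hmul_assoc)
  also have "\<dots> = g1 \<otimes> ?z \<otimes> hconj (hhat g1)" unfolding SpinM_iotaE[OF g(2)] ..
  finally have 1: "(g1 \<otimes> g2) \<otimes> ?z \<otimes> hconj (hhat (g1 \<otimes> g2)) = g1 \<otimes> ?z \<otimes> hconj (hhat g1)" .
  have "(g1 \<otimes> g2) \<otimes> ?w \<otimes> hconj (hhat (g1 \<otimes> g2)) = g2 \<otimes> (g1 \<otimes> ?w \<otimes> hconj (hhat g1)) \<otimes> hconj (hhat g2)"
    unfolding comm hh' by (simp only: hmul_assoc)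
  also have "\<dots> = g2 \<otimes> ?w \<otimes> hconj (hhat g2)" unfolding SpinE_iotaM[OF g(1)] ..
  finally have 2: "(g1 \<otimes> g2) \<otimes> ?w \<otimes> hconj (hhat (g1 \<otimes> g2)) = g2 \<otimes> ?w \<otimes> hconj (hhat g2)" .
  show ?thesis
    unfolding q12 frame_act_def fst_conv snd_conv vector_coord.simps hmul.add_left hmul.add_right 1 2 E[symmetric] T[symmetric] ..
qed

lemma clifford_fibre:
  assumes \<psi>: "\<psi> \<in> spinor_fibre D x" and Z: "\<nu> \<in> fib (bE D) x" "X \<in> tangent_space (atl D) x"
  shows "clifford D x (\<nu>, X) \<psi> \<in> spinor_fibre D x"
    "q \<in> spin_frames D x \<Longrightarrow>
      spinor_coord (clifford D x (\<nu>, X) \<psi>) q = clifford_coord (vector_coord D x q (\<nu>, X)) (spinor_coord \<psi> q)"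
proof -
  define j :: hac where "j = (asigma \<i>, 0, 0, 0)"
  have j: "hscale (asigma \<i>) y = j \<otimes> y" "y \<otimes> j = j \<otimes> y" "htau j = - j" for y
    by (cases y rule: hac_cases; simp only: j_def hscale.simps hmul.simps amul_unit_simps amul_comm[of _ "asigma \<i>"]; simp add: asigma_def zero_prod_def)+
  have H0: "clifford_coord (vector_coord D x q (\<nu>, X)) p \<in> H0" if "p \<in> H0" for q p
    using that unfolding H0_iff clifford_coord_def j vector_coord_frame_coords
    by (simp add: htau_hmul htau_hhat j htau_r22 hmul.minus_left hmul.minus_right)
  have eq: "clifford_coord (vector_coord D x q (\<nu>, X)) (g1 \<otimes> g2 \<otimes> p) =
      g1 \<otimes> g2 \<otimes> clifford_coord (vector_coord D x (frame_act q g1 g2) (\<nu>, X)) p"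
    if q: "q \<in> spin_frames D x" and g: "g1 \<in> SpinE" "g2 \<in> SpinM" for q p g1 g2
  proof -
    define G where "G = g1 \<otimes> g2"
    have u: "hconj G \<otimes> G = hone" using spin_unit[OF g] unfolding G_def by (simp add: Spin22_iff)
    have uh: "hconj (hhat G) \<otimes> (hhat G \<otimes> y) = y" for y
      using arg_cong[OF u, of hhat] by (simp add: hhat_hmul hhat_hconj hmul_assoc[symmetric])
    show ?thesis
      unfolding vector_coord_act[OF q g Z] G_def[symmetric] clifford_coord_def j(1)
      by (simp add: hhat_hmul hmul_assoc uh) (simp only: hmul_assoc[symmetric] j(2))
  qed
  show "clifford D x (\<nu>, X) \<psi> \<in> spinor_fibre D x"
    "q \<in> spin_frames D x \<Longrightarrow>
      spinor_coord (clifford D x (\<nu>, X) \<psi>) q = clifford_coord (vector_coord D x q (\<nu>, X)) (spinor_coord \<psi> q)"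
    unfolding clifford_def by (rule spinor_fibre_map[OF \<psi> H0 eq]; assumption)+
qed

lemma spinor_H_coord:
  assumes \<psi>: "\<psi> \<in> spinor_fibre D x" and q: "q \<in> spin_frames D x"
  shows "spinor_H \<psi> \<psi> = hform (spinor_coord \<psi> q) (spinor_coord \<psi> q)"
proof -
  have indep: "hform (spinor_coord \<psi> q') (spinor_coord \<psi> q') = hform (spinor_coord \<psi> q) (spinor_coord \<psi> q)"
    if q': "q' \<in> spin_frames D x" for q'
  proof -
    obtain g1 g2 where g: "g1 \<in> SpinE" "g2 \<in> SpinM" "q' = frame_act q g1 g2" using frame_act_trans[OF q q'] .
    have u: "hconj (g1 \<otimes> g2) \<otimes> (g1 \<otimes> g2 \<otimes> y) = y" for y using spin_cancel(1)[OF g(1,2)] .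
    have "hconj (spinor_coord \<psi> q) \<otimes> spinor_coord \<psi> q = hconj (spinor_coord \<psi> q') \<otimes> spinor_coord \<psi> q'"
      unfolding spinor_coord_act[OF \<psi> q g(1,2)] g(3) hconj_hmul[of "g1 \<otimes> g2"] hmul_assoc[of _ "hconj (g1 \<otimes> g2)"] u ..
    then show ?thesis by (simp add: hconj_hmul_self)
  qed
  show ?thesis
    unfolding spinor_H_def
  proof (rule the_equality)
    show "\<exists>q' p p'. (q', p) \<in> \<psi> \<and> (q', p') \<in> \<psi> \<and> hform (spinor_coord \<psi> q) (spinor_coord \<psi> q) = hform p p'"
      by (intro exI[of _ q] exI[of _ "spinor_coord \<psi> q"]) (simp only: spinor_graph[OF \<psi>] q simp_thms)
    fix h assume "\<exists>q p p'. (q, p) \<in> \<psi> \<and> (q, p') \<in> \<psi> \<and> h = hform p p'"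
    then obtain q' where "q' \<in> spin_frames D x" "h = hform (spinor_coord \<psi> q') (spinor_coord \<psi> q')"
      unfolding spinor_graph[OF \<psi>] by (elim exE conjE) (simp only:)
    then show "h = hform (spinor_coord \<psi> q) (spinor_coord \<psi> q)" using indep by simp
  qed
qed

text \<open>The pairing does not depend on the spinorial frame, since another frame changes both coordinates by a
  factor \<open>g\<close> from the left with \<open>hconj g \<otimes> g = hone\<close>.\<close>

lemma spinor_pairing_coord:
  assumes \<psi>: "\<psi> \<in> spinor_fibre D x" and Z: "\<nu> \<in> fib (bE D) x" "X \<in> tangent_space (atl D) x" and q: "q \<in> spin_frames D x"
  shows "spinor_pairing (clifford D x (\<nu>, X) \<psi>) \<psi> = spin_rot (spinor_coord \<psi> q) (vector_coord D x q (\<nu>, X))"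
proof -
  have indep: "spin_rot (spinor_coord \<psi> q') (vector_coord D x q' (\<nu>, X)) = spin_rot (spinor_coord \<psi> q) (vector_coord D x q (\<nu>, X))"
    if q': "q' \<in> spin_frames D x" for q'
  proof -
    obtain g1 g2 where g: "g1 \<in> SpinE" "g2 \<in> SpinM" "q' = frame_act q g1 g2" using frame_act_trans[OF q q'] .
    define G where "G = g1 \<otimes> g2"
    have u: "hconj G \<otimes> (G \<otimes> y) = y" for y using spin_cancel(1)[OF g(1,2)] unfolding G_def .
    have u1: "hconj G \<otimes> G = hone" using u[of hone] by simp
    have uh: "hconj (hhat G) \<otimes> (hhat G \<otimes> y) = y" for y
      using arg_cong[OF u1, of hhat] by (simp add: hhat_hmul hhat_hconj hmul_assoc[symmetric])
    show ?thesis
      unfolding spinor_coord_act[OF \<psi> q g(1,2)] vector_coord_act[OF q g(1,2) Z] g(3) G_def[symmetric] spin_rot_def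
      by (simp add: hconj_hmul hhat_hmul hmul_assoc u uh)
  qed
  note C = clifford_fibre[OF \<psi> Z]
  show ?thesis
    unfolding spinor_pairing_def
  proof (rule the_equality)
    show "\<exists>q' p p'. (q', p) \<in> clifford D x (\<nu>, X) \<psi> \<and> (q', p') \<in> \<psi> \<and>
      spin_rot (spinor_coord \<psi> q) (vector_coord D x q (\<nu>, X)) = hscale (asigma \<i>) (hconj p' \<otimes> p)"
      by (intro exI[of _ q] exI[of _ "spinor_coord \<psi> q"] exI[of _ "spinor_coord (clifford D x (\<nu>, X) \<psi>) q"])
        (simp only: spinor_graph[OF C(1)] spinor_graph[OF \<psi>] q C(2) pairing_clifford_coord simp_thms)
    fix h assume "\<exists>q p p'. (q, p) \<in> clifford D x (\<nu>, X) \<psi> \<and> (q, p') \<in> \<psi> \<and> h = hscale (asigma \<i>) (hconj p' \<otimes> p)"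
    then obtain q' where "q' \<in> spin_frames D x"
      "h = hscale (asigma \<i>) (hconj (spinor_coord \<psi> q') \<otimes> spinor_coord (clifford D x (\<nu>, X) \<psi>) q')"
      unfolding spinor_graph[OF C(1)] spinor_graph[OF \<psi>] by (elim exE conjE) (simp only:)
    then show "h = spin_rot (spinor_coord \<psi> q) (vector_coord D x q (\<nu>, X))"
      using indep by (simp add: C(2) pairing_clifford_coord)
  qed
qed

end

section \<open>Change of orthonormal frame\<close>

context lorentz_bundle
begin

text \<open>If \<open>C = cosh v\<close> and \<open>S = sinh v\<close>, the new frame is boosted by \<open>-2 v\<close>, and \<open>2 (C dS - S dC) = 2 dv\<close>.\<close>

lemma boosted_frame:
  assumes W: "open W" and f: "oframe_on \<A> V W a b"
    and C: "msmooth_on \<A> W C" and S: "msmooth_on \<A> W S" and CS: "\<And>y. y \<in> W \<Longrightarrow> (C y)\<^sup>2 - (S y)\<^sup>2 = 1"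
    and a': "\<And>y. y \<in> W \<Longrightarrow> a' y = ((C y)\<^sup>2 + (S y)\<^sup>2) *\<^sub>R a y + (- 2 * C y * S y) *\<^sub>R b y"
    and b': "\<And>y. y \<in> W \<Longrightarrow> b' y = (- 2 * C y * S y) *\<^sub>R a y + ((C y)\<^sup>2 + (S y)\<^sup>2) *\<^sub>R b y"
    and o': "\<And>y. y \<in> W \<Longrightarrow> (a' y, b' y) \<in> oframes V y"
  shows "oframe_on \<A> V W a' b'"
    and "x \<in> W \<Longrightarrow> X \<in> tangent_space \<A> x \<Longrightarrow> conn_form a' b' x X =
      conn_form a b x X - 2 * (C x * mdiff \<A> S x X - S x * mdiff \<A> C x X)"
proof -
  note sa = oframe_onD(1)[OF f] and sb = oframe_onD(2)[OF f]
  define ch where "ch y = C y * C y + S y * S y" for y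
  define sh where "sh y = (- 2) * (C y * S y)" for y
  have ch: "msmooth_on \<A> W ch" unfolding ch_def by (intro msmooth_on_add msmooth_on_mult W C S)
  have sh: "msmooth_on \<A> W sh" unfolding sh_def by (intro msmooth_on_mult msmooth_on_const W C S)
  have a'': "a' y = ch y *\<^sub>R a y + sh y *\<^sub>R b y" and b'': "b' y = sh y *\<^sub>R a y + ch y *\<^sub>R b y" if "y \<in> W" for y
    using a'[OF that] b'[OF that] by (simp_all add: ch_def sh_def power2_eq_square mult.assoc)
  have s: "smooth_section \<A> V W (\<lambda>y. ch y *\<^sub>R a y)" "smooth_section \<A> V W (\<lambda>y. sh y *\<^sub>R b y)"
    "smooth_section \<A> V W (\<lambda>y. sh y *\<^sub>R a y)" "smooth_section \<A> V W (\<lambda>y. ch y *\<^sub>R b y)"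
    by (intro section_scaleR W sa sb ch sh)+
  have sa': "smooth_section \<A> V W a'" by (rule section_cong[OF section_add[OF W s(1,2)]]) (simp add: a'')
  have sb': "smooth_section \<A> V W b'" by (rule section_cong[OF section_add[OF W s(3,4)]]) (simp add: b'')
  show "oframe_on \<A> V W a' b'" unfolding oframe_on_def using sa' sb' o' by blast
  show "conn_form a' b' x X = conn_form a b x X - 2 * (C x * mdiff \<A> S x X - S x * mdiff \<A> C x X)"
    if x: "x \<in> W" and X: "X \<in> tangent_space \<A> x"
  proof -
    note o = oframeD[OF oframe_onD(3)[OF f x]]
    note dC = msmooth_on_imp_has_mdiff[OF C x] and dS = msmooth_on_imp_has_mdiff[OF S x]
    let ?w = "conn_form a b x X"
    have dch: "mdiff \<A> ch x X = 2 * C x * mdiff \<A> C x X + 2 * S x * mdiff \<A> S x X"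
      unfolding ch_def using has_mdiff_imp_mdiff[OF has_mdiff_add[OF has_mdiff_mult[OF dC dC] has_mdiff_mult[OF dS dS]] X] by simp
    have dsh: "mdiff \<A> sh x X = - 2 * (C x * mdiff \<A> S x X + S x * mdiff \<A> C x X)"
      unfolding sh_def has_mdiff_imp_mdiff[OF has_mdiff_mult[OF has_mdiff_const has_mdiff_mult[OF dC dS]] X]
      by (simp add: algebra_simps)
    have "nabla V a' x X = nabla V (\<lambda>y. ch y *\<^sub>R a y + sh y *\<^sub>R b y) x X"
      by (rule nabla_cong[OF W section_add[OF W s(1,2)] _ x X]) (rule a'')
    also have "\<dots> = (mdiff \<A> ch x X *\<^sub>R a x + ch x *\<^sub>R nabla V a x X) + (mdiff \<A> sh x X *\<^sub>R b x + sh x *\<^sub>R nabla V b x X)"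
      unfolding nabla_add[OF W s(1,2) x X] nabla_scaleR[OF W sa ch x X] nabla_scaleR[OF W sb sh x X] ..
    also have "\<dots> = (mdiff \<A> ch x X + sh x * ?w) *\<^sub>R a x + (mdiff \<A> sh x X + ch x * ?w) *\<^sub>R b x"
      unfolding nabla_oframe[OF W f x X] by (simp add: algebra_simps)
    finally have "conn_form a' b' x X = - (mdiff \<A> ch x X + sh x * ?w) * sh x + (mdiff \<A> sh x X + ch x * ?w) * ch x"
      unfolding conn_form_def[of a'] b''[OF x] using o by (simp add: met_simps algebra_simps)
    also have "\<dots> = ?w * (ch x * ch x - sh x * sh x) + (ch x * mdiff \<A> sh x X - sh x * mdiff \<A> ch x X)"
      by (simp add: algebra_simps)
    also have "ch x * ch x - sh x * sh x = ((C x)\<^sup>2 - (S x)\<^sup>2)\<^sup>2"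
      by (simp add: ch_def sh_def power2_eq_square algebra_simps)
    also have "ch x * mdiff \<A> sh x X - sh x * mdiff \<A> ch x X =
      - 2 * ((C x)\<^sup>2 - (S x)\<^sup>2) * (C x * mdiff \<A> S x X - S x * mdiff \<A> C x X)"
      unfolding dch dsh by (simp add: ch_def sh_def power2_eq_square algebra_simps)
    finally show ?thesis using CS[OF x] by simp
  qed
qed

end

lemma boostE_action: "boostE C S \<otimes> iotaE (x0, x1) \<otimes> hconj (hhat (boostE C S)) =
    iotaE ((C\<^sup>2 + S\<^sup>2) * x0 - 2 * C * S * x1, (C\<^sup>2 + S\<^sup>2) * x1 - 2 * C * S * x0)"
  unfolding boost_conj iotaE.simps
  by (simp only: boostE_def explicit_simps; intro conjI; simp add: complex_eq_iff; simp add: algebra_simps power2_eq_square)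

lemma boostM_action: "boostM C S \<otimes> iotaM (x0, x1) \<otimes> hconj (hhat (boostM C S)) =
    iotaM ((C\<^sup>2 + S\<^sup>2) * x0 - 2 * C * S * x1, (C\<^sup>2 + S\<^sup>2) * x1 - 2 * C * S * x0)"
  unfolding boost_conj iotaM.simps
  by (simp only: boostM_def explicit_simps; intro conjI; simp add: complex_eq_iff; simp add: algebra_simps power2_eq_square)

lemma iotaE_inj: "iotaE x = iotaE y \<Longrightarrow> x = y" and iotaM_inj: "iotaM x = iotaM y \<Longrightarrow> x = y"
  by (cases x; cases y; simp add: r22_to_hac_inj del: r22_to_hac.simps)+

lemma boost_coords: "fst (boostE C S) = (of_real C, 0)" "fst (boostM C S) = (of_real C, 0)"
  "fst (snd (boostE C S)) = (0, \<i> * of_real S)" "fst (snd (boostM C S)) = (\<i> * of_real S, 0)"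
  by (simp_all add: boostE_def boostM_def aconst_def asigma_def)

lemma boost_commute_lie:
  "boostE C S \<otimes> lie_elem (wE, wT, 0, 0, 0, 0) = lie_elem (wE, wT, 0, 0, 0, 0) \<otimes> boostE C S"
  "boostM C S \<otimes> lie_elem (wE, wT, 0, 0, 0, 0) = lie_elem (wE, wT, 0, 0, 0, 0) \<otimes> boostM C S"
  by (simp only: lie_elem.simps boostE_def boostM_def explicit_simps; intro conjI; simp add: complex_eq_iff; simp add: field_simps)+

text \<open>The velocity of a curve on the hyperbola, written as an element of the Lie algebra times the group
  element.\<close>

lemma boost_differential:
  assumes "C\<^sup>2 - S\<^sup>2 = 1" "C * dC = S * dS"
  shows "boostE dC dS = lie_elem (2 * (C * dS - S * dC), 0, 0, 0, 0, 0) \<otimes> boostE C S"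
    "boostM dC dS = lie_elem (0, 2 * (C * dS - S * dC), 0, 0, 0, 0) \<otimes> boostM C S"
proof -
  have "(C * dS - S * dC) * S = dC * (C\<^sup>2 - S\<^sup>2)" "(C * dS - S * dC) * C = dS * (C\<^sup>2 - S\<^sup>2)"
    using assms(2) by (simp_all add: power2_eq_square algebra_simps)
  then have *: "(C * dS - S * dC) * S = dC" "(C * dS - S * dC) * C = dS" using assms(1) by simp_all
  define k where "k = C * dS - S * dC"
  have k: "dC = k * S" "dS = k * C" using * by (simp_all add: k_def)
  have "boostE (k * S) (k * C) = lie_elem (2 * k, 0, 0, 0, 0, 0) \<otimes> boostE C S"
    "boostM (k * S) (k * C) = lie_elem (0, 2 * k, 0, 0, 0, 0) \<otimes> boostM C S"
    by (simp only: lie_elem.simps boostE_def boostM_def explicit_simps; intro conjI; simp add: complex_eq_iff)+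
  then show "boostE dC dS = lie_elem (2 * (C * dS - S * dC), 0, 0, 0, 0, 0) \<otimes> boostE C S"
    "boostM dC dS = lie_elem (0, 2 * (C * dS - S * dC), 0, 0, 0, 0) \<otimes> boostM C S"
    unfolding k[symmetric] unfolding k_def .
qed

section \<open>The spinor equation in local frames\<close>

context spin_surface
begin

abbreviation "eE0 s \<equiv> (\<lambda>y. fst (sframe (sE D) (s y)))"
abbreviation "eE1 s \<equiv> (\<lambda>y. snd (sframe (sE D) (s y)))"
abbreviation "eT0 s \<equiv> (\<lambda>y. fst (sframe (sT D) (s y)))"
abbreviation "eT1 s \<equiv> (\<lambda>y. snd (sframe (sT D) (s y)))"

definition adapted :: "'m set \<Rightarrow> ('m \<Rightarrow> 'q) \<Rightarrow> ('m \<Rightarrow> 'p) \<Rightarrow> bool" where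
  "adapted U s1 s2 \<longleftrightarrow> open U \<and> (\<forall>y\<in>U. (s1 y, s2 y) \<in> spin_frames D y) \<and>
    oframe_on (atl D) (bE D) U (eE0 s1) (eE1 s1) \<and> oframe_on (atl D) (bT D) U (eT0 s2) (eT1 s2)"

lemma adaptedD:
  assumes "adapted U s1 s2"
  shows "open U" "y \<in> U \<Longrightarrow> (s1 y, s2 y) \<in> spin_frames D y"
    "oframe_on (atl D) (bE D) U (eE0 s1) (eE1 s1)" "oframe_on (atl D) (bT D) U (eT0 s2) (eT1 s2)"
  using assms unfolding adapted_def by blast+

lemma adapted_subset: "adapted U s1 s2 \<Longrightarrow> open U' \<Longrightarrow> U' \<subseteq> U \<Longrightarrow> adapted U' s1 s2"
  unfolding adapted_def using E.oframe_on_subset T.oframe_on_subset by blast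

lemma section_adapted:
  assumes "(W1, s1) \<in> ssecs (sE D)" "(W2, s2) \<in> ssecs (sT D)"
  shows "adapted (W1 \<inter> W2) s1 s2" "open W1" "open W2"
    "smooth_principal_section (atl D) SpinE (sE D) W1 s1" "smooth_principal_section (atl D) SpinM (sT D) W2 s2"
proof -
  have 1: "open W1 \<and> smooth_principal_section (atl D) SpinE (sE D) W1 s1"
    using principalE[unfolded principal_bundle_def, THEN conjunct2, THEN conjunct2, THEN conjunct2, rule_format, OF assms(1)] by simp
  have 2: "open W2 \<and> smooth_principal_section (atl D) SpinM (sT D) W2 s2"
    using principalT[unfolded principal_bundle_def, THEN conjunct2, THEN conjunct2, THEN conjunct2, rule_format, OF assms(2)] by simp
  have 3: "oframe_on (atl D) (bE D) W1 (eE0 s1) (eE1 s1)"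
    using spinE[unfolded spin_structure_def, THEN conjunct2, THEN conjunct2, rule_format, OF assms(1)] by (simp add: o_def)
  have 4: "oframe_on (atl D) (bT D) W2 (eT0 s2) (eT1 s2)"
    using spinT[unfolded spin_structure_def, THEN conjunct2, THEN conjunct2, rule_format, OF assms(2)] by (simp add: o_def)
  show "open W1" "open W2"
    "smooth_principal_section (atl D) SpinE (sE D) W1 s1" "smooth_principal_section (atl D) SpinM (sT D) W2 s2"
    using 1 2 by auto
  show "adapted (W1 \<inter> W2) s1 s2"
    unfolding adapted_def
    using 1 2 E.oframe_on_subset[OF 3] T.oframe_on_subset[OF 4]
    by (auto simp: smooth_principal_section_def spin_frames_iff)
qed

lemma ex_section:
  obtains W1 s1 W2 s2 where "(W1, s1) \<in> ssecs (sE D)" "(W2, s2) \<in> ssecs (sT D)" "x \<in> W1 \<inter> W2"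
proof -
  obtain W1 s1 where "(W1, s1) \<in> ssecs (sE D)" "x \<in> W1" by (rule principal_sections[OF principalE])
  moreover obtain W2 s2 where "(W2, s2) \<in> ssecs (sT D)" "x \<in> W2" by (rule principal_sections[OF principalT])
  ultimately show ?thesis using that by blast
qed

text \<open>The one-form of the spinor equation in the sections \<open>s1\<close> and \<open>s2\<close>: the connection forms of \<open>E\<close> and \<open>TM\<close>,
  followed by the coordinates of \<open>B(X, e2)\<close> and \<open>B(X, e3)\<close> in \<open>E\<close>.\<close>

definition lie_at :: "('m \<Rightarrow> 'q) \<Rightarrow> ('m \<Rightarrow> 'p) \<Rightarrow> 'm \<Rightarrow> 'm tvec \<Rightarrow> lie_coords" where
  "lie_at s1 s2 x X = (E.conn_form (eE0 s1) (eE1 s1) x X, T.conn_form (eT0 s2) (eT1 s2) x X,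
     - met (bE D) x (B x X (eT0 s2 x)) (eE0 s1 x), - met (bE D) x (B x X (eT1 s2 x)) (eE0 s1 x),
     met (bE D) x (B x X (eT0 s2 x)) (eE1 s1 x), met (bE D) x (B x X (eT1 s2 x)) (eE1 s1 x))"

lemma form_fib: "X \<in> tangent_space (atl D) x \<Longrightarrow> Y \<in> tangent_space (atl D) x \<Longrightarrow> B x X Y \<in> fib (bE D) x"
  and form_sym: "X \<in> tangent_space (atl D) x \<Longrightarrow> Y \<in> tangent_space (atl D) x \<Longrightarrow> B x X Y = B x Y X"
  and form_linear_right: "X \<in> tangent_space (atl D) x \<Longrightarrow> linear_map_on (tangent_space (atl D) x) (B x X)"
  using form[unfolded symmetric_bilinear_map_def, THEN conjunct1, rule_format, of X x] by blast+

lemma form_add_right: "X \<in> tangent_space (atl D) x \<Longrightarrow> Y \<in> tangent_space (atl D) x \<Longrightarrow> Z \<in> tangent_space (atl D) x \<Longrightarrow>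
    B x X (Y + Z) = B x X Y + B x X Z"
  and form_scaleR_right: "X \<in> tangent_space (atl D) x \<Longrightarrow> Y \<in> tangent_space (atl D) x \<Longrightarrow> B x X (r *\<^sub>R Y) = r *\<^sub>R B x X Y"
  using form_linear_right[of X x] unfolding linear_map_on_def by blast+

lemma form_add_left: "X \<in> tangent_space (atl D) x \<Longrightarrow> Y \<in> tangent_space (atl D) x \<Longrightarrow> Z \<in> tangent_space (atl D) x \<Longrightarrow>
    B x (Y + Z) X = B x Y X + B x Z X"
  using form_add_right[of X x Y Z] form_sym[of "Y + Z" x X] form_sym[of Y x X] form_sym[of Z x X] by (simp add: tangent_add)

lemma form_scaleR_left: "X \<in> tangent_space (atl D) x \<Longrightarrow> Y \<in> tangent_space (atl D) x \<Longrightarrow> B x (r *\<^sub>R Y) X = r *\<^sub>R B x Y X"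
  using form_scaleR_right[of X x Y r] form_sym[of "r *\<^sub>R Y" x X] form_sym[of Y x X] by (simp add: tangent_scaleR)

lemma form_smooth: "open W \<Longrightarrow> vector_field (atl D) W X \<Longrightarrow> vector_field (atl D) W Y \<Longrightarrow>
    smooth_section (atl D) (bE D) W (\<lambda>x. B x (X x) (Y x))"
  using form[unfolded symmetric_bilinear_map_def, THEN conjunct2] by blast

lemma frame_tangent:
  assumes "q \<in> spin_frames D x"
  shows "fst (sframe (sT D) (snd q)) \<in> tangent_space (atl D) x" "snd (sframe (sT D) (snd q)) \<in> tangent_space (atl D) x"
    "fst (sframe (sE D) (fst q)) \<in> fib (bE D) x" "snd (sframe (sE D) (fst q)) \<in> fib (bE D) x"
  using T.oframeD(1,2)[of "fst (sframe (sT D) (snd q))" "snd (sframe (sT D) (snd q))" x]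
    E.oframeD(1,2)[of "fst (sframe (sE D) (fst q))" "snd (sframe (sE D) (fst q))" x] frame_oframes[OF assms]
  by (auto simp: tangent_fib)

subsection \<open>The action of the form\<close>

text \<open>The quaternion by which \<open>\<eta>(X)\<close> acts on coordinates in the spinorial frame \<open>q\<close>, computed from a basis
  \<open>(f2, f3)\<close> of the tangent plane that may differ from the one under \<open>q\<close>.\<close>

definition eta_quat :: "'m \<Rightarrow> 'q \<times> 'p \<Rightarrow> 'm tvec \<Rightarrow> 'm tvec \<Rightarrow> 'm tvec \<Rightarrow> hac" where
  "eta_quat x q f2 f3 X = (1/2) *\<^sub>R (vector_coord D x q (0, f2) \<otimes> hhat (vector_coord D x q (B x X f2, 0)))
     - (1/2) *\<^sub>R (vector_coord D x q (0, f3) \<otimes> hhat (vector_coord D x q (B x X f3, 0)))"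

definition form_coords :: "'m \<Rightarrow> 'q \<times> 'p \<Rightarrow> 'm tvec \<Rightarrow> lie_coords" where
  "form_coords x q X = (let e = sframe (sE D) (fst q); f = sframe (sT D) (snd q) in
    (0, 0, - met (bE D) x (B x X (fst f)) (fst e), - met (bE D) x (B x X (snd f)) (fst e),
     met (bE D) x (B x X (fst f)) (snd e), met (bE D) x (B x X (snd f)) (snd e)))"

text \<open>The sum over the basis in \<open>\<eta>(X)\<close> is the same for all orthonormal bases; in coordinates this is
  expressed by the relations \<open>rel\<close> between two such bases.\<close>

lemma eta_quat_coords:
  assumes q: "q \<in> spin_frames D x" and f: "(f2, f3) \<in> oframes (bT D) x" and X: "X \<in> tangent_space (atl D) x"
  shows "eta_quat x q f2 f3 X = lie_elem (form_coords x q X)"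
proof -
  obtain e0 e1 e2 e3 where e: "sframe (sE D) (fst q) = (e0, e1)" "sframe (sT D) (snd q) = (e2, e3)" by fastforce
  have eE: "(e0, e1) \<in> oframes (bE D) x" and eT: "(e2, e3) \<in> oframes (bT D) x" using frame_oframes[OF q] e by auto
  note oE = E.oframeD[OF eE] and oT = T.oframeD[OF eT] and of = T.oframeD[OF f]
  note tf = tangent_fib
  define y2 y3 z2 z3 where "y2 = - met (bT D) x f2 e2" and "y3 = met (bT D) x f2 e3"
    and "z2 = - met (bT D) x f3 e2" and "z3 = met (bT D) x f3 e3"
  have f23: "f2 = y2 *\<^sub>R e2 + y3 *\<^sub>R e3" "f3 = z2 *\<^sub>R e2 + z3 *\<^sub>R e3"
    using oT(7)[OF of(1)] oT(7)[OF of(2)] by (simp_all add: y2_def y3_def z2_def z3_def)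
  have sym: "met (bT D) x e2 f2 = - y2" "met (bT D) x e2 f3 = - z2" "met (bT D) x e3 f2 = y3" "met (bT D) x e3 f3 = z3"
    using of(1,2) oT(1,2) by (simp_all add: y2_def y3_def z2_def z3_def T.met_sym)
  have rel: "y2 * y2 - z2 * z2 = 1" "y3 * y3 - z3 * z3 = -1" "y2 * y3 = z2 * z3"
    using T.met_oframe[OF f oT(1,1)] T.met_oframe[OF f oT(2,2)] T.met_oframe[OF f oT(1,2)] oT(3-6)
    unfolding sym by simp_all
  define b02 b03 b12 b13 where "b02 = - met (bE D) x (B x X e2) e0" and "b03 = - met (bE D) x (B x X e3) e0"
    and "b12 = met (bE D) x (B x X e2) e1" and "b13 = met (bE D) x (B x X e3) e1"
  have eT': "e2 \<in> tangent_space (atl D) x" "e3 \<in> tangent_space (atl D) x" using oT(1,2) by (simp_all add: tf)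
  have BX: "B x X (u *\<^sub>R e2 + v *\<^sub>R e3) = u *\<^sub>R B x X e2 + v *\<^sub>R B x X e3" for u v
    using eT' X by (simp add: form_add_right form_scaleR_right tangent_scaleR)
  have fb: "B x X e2 \<in> fib (bE D) x" "B x X e3 \<in> fib (bE D) x" using form_fib[OF X] eT' by auto
  have vT: "vector_coord D x q (0, u *\<^sub>R e2 + v *\<^sub>R e3) = r22_to_hac (0, 0, u, v)" for u v
    unfolding vector_coord_frame_coords frame_coords_def
    using oE oT by (simp add: e T.met_simps E.met_simps del: r22_to_hac.simps)
  have vE: "vector_coord D x q (u *\<^sub>R B x X e2 + v *\<^sub>R B x X e3, 0) = r22_to_hac (u * b02 + v * b03, u * b12 + v * b13, 0, 0)" for u v
    unfolding vector_coord_frame_coords frame_coords_def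
    using oE oT fb by (simp add: e T.met_simps E.met_simps b02_def b03_def b12_def b13_def algebra_simps del: r22_to_hac.simps)
  have "eta_quat x q f2 f3 X = (1/2) *\<^sub>R (r22_to_hac (0, 0, y2, y3) \<otimes> hhat (r22_to_hac (y2 * b02 + y3 * b03, y2 * b12 + y3 * b13, 0, 0)))
    - (1/2) *\<^sub>R (r22_to_hac (0, 0, z2, z3) \<otimes> hhat (r22_to_hac (z2 * b02 + z3 * b03, z2 * b12 + z3 * b13, 0, 0)))"
    unfolding eta_quat_def f23 BX vT vE ..
  also have "\<dots> = (y2 * y2 - z2 * z2) *\<^sub>R lie_elem (0, 0, b02, 0, b12, 0) + (- (y3 * y3 - z3 * z3)) *\<^sub>R lie_elem (0, 0, 0, b03, 0, b13)
     + (y2 * y3 - z2 * z3) *\<^sub>R (lie_elem (0, 0, b03, - b02, b13, - b12))"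
    by (simp only: explicit_simps lie_elem.simps; intro conjI; simp add: complex_eq_iff; simp add: field_simps)
  also have "\<dots> = lie_elem (0, 0, b02, b03, b12, b13)"
    unfolding rel lie_elem_hom[symmetric] by simp
  finally show ?thesis unfolding form_coords_def e Let_def fst_conv snd_conv b02_def b03_def b12_def b13_def .
qed

lemma lie_at_split:
  "lie_at s1 s2 x X = (E.conn_form (eE0 s1) (eE1 s1) x X, T.conn_form (eT0 s2) (eT1 s2) x X, 0, 0, 0, 0) + form_coords x (s1 x, s2 x) X"
  by (simp add: lie_at_def form_coords_def Let_def)

lemma eta_action_coord:
  assumes q: "q \<in> spin_frames D x" and f: "(f2, f3) \<in> oframes (bT D) x" and X: "X \<in> tangent_space (atl D) x"
    and \<psi>: "\<psi> \<in> spinor_fibre D x"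
  shows "eta_action D B x f2 f3 X \<psi> \<in> spinor_fibre D x"
    "spinor_coord (eta_action D B x f2 f3 X \<psi>) q = lie_elem (form_coords x q X) \<otimes> spinor_coord \<psi> q"
proof -
  note of = T.oframeD[OF f]
  have f': "f2 \<in> tangent_space (atl D) x" "f3 \<in> tangent_space (atl D) x" using of(1,2) by (simp_all add: tangent_fib)
  have z: "0 \<in> tangent_space (atl D) x" using T.fib_zero[of x] by (simp add: tangent_fib)
  note c1 = clifford_fibre[OF \<psi> form_fib[OF X f'(1)] z] and c2 = clifford_fibre[OF \<psi> form_fib[OF X f'(2)] z]
  note d1 = clifford_fibre[OF c1(1) E.fib_zero f'(1)] and d2 = clifford_fibre[OF c2(1) E.fib_zero f'(2)]
  note s1 = spinor_scale_fibre[OF d1(1)] and s2 = spinor_scale_fibre[OF d2(1)]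
  note a = spinor_add_fibre[OF s1(1) s2(1)]
  note t = spinor_scale_fibre[OF a(1)]
  show "eta_action D B x f2 f3 X \<psi> \<in> spinor_fibre D x" unfolding eta_action_def Let_def by (rule t(1))
  show "spinor_coord (eta_action D B x f2 f3 X \<psi>) q = lie_elem (form_coords x q X) \<otimes> spinor_coord \<psi> q"
    unfolding eta_action_def Let_def t(2)[OF q] a(2)[OF q] s1(2)[OF q] s2(2)[OF q] d1(2)[OF q] d2(2)[OF q] c1(2)[OF q] c2(2)[OF q]
      clifford_coord_twice eta_quat_coords[OF q f X, symmetric] eta_quat_def of(3,4)
    by (simp add: hmul.diff_left hmul.scaleR_left scaleR_add_right scaleR_diff_right)
qed

text \<open>The terms of the spinorial connection are Clifford products of two vectors and act, like \<open>\<eta>(X)\<close>, by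
  multiplication with an element of the Lie algebra.\<close>

lemma has_spinor_deriv_eta:
  assumes f: "(f2, f3) \<in> oframes (bT D) x" and X: "X \<in> tangent_space (atl D) x" and \<psi>: "\<phi> x \<in> spinor_fibre D x"
  shows "has_spinor_deriv D \<phi> x X (eta_action D B x f2 f3 X (\<phi> x)) \<longleftrightarrow>
    (\<forall>W s1 s2. open W \<and> x \<in> W \<and> smooth_principal_section (atl D) SpinE (sE D) W s1 \<and>
       smooth_principal_section (atl D) SpinM (sT D) W s2 \<longrightarrow>
     mdiff (atl D) (\<lambda>y. spinor_coord (\<phi> y) (s1 y, s2 y)) x X = lie_elem (lie_at s1 s2 x X) \<otimes> spinor_coord (\<phi> x) (s1 x, s2 x))"
proof -
  have *: "(spinor_coord (eta_action D B x f2 f3 X (\<phi> x)) (s1 x, s2 x) = m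
         - (1/2 * met (bE D) x (nabla (bE D) (eE0 s1) x X) (eE1 s1 x)) *\<^sub>R
           clifford_coord (vector_coord D x (s1 x, s2 x) (eE0 s1 x, 0)) (clifford_coord (vector_coord D x (s1 x, s2 x) (eE1 s1 x, 0)) (spinor_coord (\<phi> x) (s1 x, s2 x)))
         - (1/2 * met (bT D) x (nabla (bT D) (eT0 s2) x X) (eT1 s2 x)) *\<^sub>R
           clifford_coord (vector_coord D x (s1 x, s2 x) (0, eT0 s2 x)) (clifford_coord (vector_coord D x (s1 x, s2 x) (0, eT1 s2 x)) (spinor_coord (\<phi> x) (s1 x, s2 x)))) \<longleftrightarrow>
     m = lie_elem (lie_at s1 s2 x X) \<otimes> spinor_coord (\<phi> x) (s1 x, s2 x)"
    if s: "(s1 x, s2 x) \<in> spin_frames D x" for s1 s2 m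
  proof -
    obtain e0 e1 e2 e3 where e: "sframe (sE D) (s1 x) = (e0, e1)" "sframe (sT D) (s2 x) = (e2, e3)" by fastforce
    have eE: "(e0, e1) \<in> oframes (bE D) x" and eT: "(e2, e3) \<in> oframes (bT D) x" using frame_oframes[OF s] e by auto
    note o = E.oframeD[OF eE] T.oframeD[OF eT]
    let ?p = "spinor_coord (\<phi> x) (s1 x, s2 x)" and ?wE = "E.conn_form (eE0 s1) (eE1 s1) x X" and ?wT = "T.conn_form (eT0 s2) (eT1 s2) x X"
    have v: "vector_coord D x (s1 x, s2 x) (e0, 0) = r22_to_hac (1, 0, 0, 0)" "vector_coord D x (s1 x, s2 x) (e1, 0) = r22_to_hac (0, 1, 0, 0)"
      "vector_coord D x (s1 x, s2 x) (0, e2) = r22_to_hac (0, 0, 1, 0)" "vector_coord D x (s1 x, s2 x) (0, e3) = r22_to_hac (0, 0, 0, 1)"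
      unfolding vector_coord_frame_coords frame_coords_def
      using o by (simp_all add: e T.met_simps E.met_simps del: r22_to_hac.simps)
    have l: "(1/2 * wE) *\<^sub>R (r22_to_hac (1, 0, 0, 0) \<otimes> hhat (r22_to_hac (0, 1, 0, 0))) +
       (1/2 * wT) *\<^sub>R (r22_to_hac (0, 0, 1, 0) \<otimes> hhat (r22_to_hac (0, 0, 0, 1))) = lie_elem (wE, wT, 0, 0, 0, 0)" for wE wT
      by (simp only: explicit_simps lie_elem.simps; intro conjI; simp add: complex_eq_iff)
    have "(1/2 * ?wE) *\<^sub>R (r22_to_hac (1, 0, 0, 0) \<otimes> hhat (r22_to_hac (0, 1, 0, 0)) \<otimes> ?p) +
       (1/2 * ?wT) *\<^sub>R (r22_to_hac (0, 0, 1, 0) \<otimes> hhat (r22_to_hac (0, 0, 0, 1)) \<otimes> ?p) + lie_elem (form_coords x (s1 x, s2 x) X) \<otimes> ?p =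
       lie_elem (lie_at s1 s2 x X) \<otimes> ?p"
      unfolding lie_at_split lie_elem_hom(1) l[symmetric] hmul.add_left hmul.scaleR_left ..
    then show ?thesis
      unfolding eta_action_coord(2)[OF s f X \<psi>] e fst_conv snd_conv v clifford_coord_twice
        E.conn_form_def[unfolded e, symmetric] T.conn_form_def[unfolded e, symmetric]
      by (auto simp: E.conn_form_def T.conn_form_def e algebra_simps)
  qed
  have fr: "(s1 x, s2 x) \<in> spin_frames D x" if "x \<in> W" "smooth_principal_section (atl D) SpinE (sE D) W s1"
       "smooth_principal_section (atl D) SpinM (sT D) W s2" for W s1 s2
    using that by (auto simp: smooth_principal_section_def spin_frames_iff)
  show ?thesis
  proof
    assume a: "has_spinor_deriv D \<phi> x X (eta_action D B x f2 f3 X (\<phi> x))"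
    show "\<forall>W s1 s2. open W \<and> x \<in> W \<and> smooth_principal_section (atl D) SpinE (sE D) W s1 \<and>
       smooth_principal_section (atl D) SpinM (sT D) W s2 \<longrightarrow>
     mdiff (atl D) (\<lambda>y. spinor_coord (\<phi> y) (s1 y, s2 y)) x X = lie_elem (lie_at s1 s2 x X) \<otimes> spinor_coord (\<phi> x) (s1 x, s2 x)"
    proof (intro allI impI)
      fix W s1 s2 assume s: "open W \<and> x \<in> W \<and> smooth_principal_section (atl D) SpinE (sE D) W s1 \<and>
       smooth_principal_section (atl D) SpinM (sT D) W s2"
      have "(s1 x, s2 x) \<in> spin_frames D x" using fr s by blast
      from *[of s1 s2, OF this, THEN iffD1, OF a[unfolded has_spinor_deriv_def Let_def, THEN conjunct2, rule_format, OF s]]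
      show "mdiff (atl D) (\<lambda>y. spinor_coord (\<phi> y) (s1 y, s2 y)) x X = lie_elem (lie_at s1 s2 x X) \<otimes> spinor_coord (\<phi> x) (s1 x, s2 x)" .
    qed
  next
    assume a: "\<forall>W s1 s2. open W \<and> x \<in> W \<and> smooth_principal_section (atl D) SpinE (sE D) W s1 \<and>
       smooth_principal_section (atl D) SpinM (sT D) W s2 \<longrightarrow>
     mdiff (atl D) (\<lambda>y. spinor_coord (\<phi> y) (s1 y, s2 y)) x X = lie_elem (lie_at s1 s2 x X) \<otimes> spinor_coord (\<phi> x) (s1 x, s2 x)"
    obtain q where q: "q \<in> spin_frames D x" by (rule ex_spin_frame)
    show "has_spinor_deriv D \<phi> x X (eta_action D B x f2 f3 X (\<phi> x))"
      unfolding has_spinor_deriv_def Let_def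
    proof (intro conjI allI impI)
      show "eta_action D B x f2 f3 X (\<phi> x) \<in> spinor_fibre D x" by (rule eta_action_coord(1)[OF q f X \<psi>])
      fix W s1 s2 assume s: "open W \<and> x \<in> W \<and> smooth_principal_section (atl D) SpinE (sE D) W s1 \<and>
       smooth_principal_section (atl D) SpinM (sT D) W s2"
      have "(s1 x, s2 x) \<in> spin_frames D x" using fr s by blast
      from *[of s1 s2, OF this, THEN iffD2, OF a[rule_format, OF s]]
      show "spinor_coord (eta_action D B x f2 f3 X (\<phi> x)) (s1 x, s2 x) = mdiff (atl D) (\<lambda>y. spinor_coord (\<phi> y) (s1 y, s2 y)) x X
         - (1/2 * met (bE D) x (nabla (bE D) (eE0 s1) x X) (eE1 s1 x)) *\<^sub>R
           clifford_coord (vector_coord D x (s1 x, s2 x) (eE0 s1 x, 0)) (clifford_coord (vector_coord D x (s1 x, s2 x) (eE1 s1 x, 0)) (spinor_coord (\<phi> x) (s1 x, s2 x)))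
         - (1/2 * met (bT D) x (nabla (bT D) (eT0 s2) x X) (eT1 s2 x)) *\<^sub>R
           clifford_coord (vector_coord D x (s1 x, s2 x) (0, eT0 s2 x)) (clifford_coord (vector_coord D x (s1 x, s2 x) (0, eT1 s2 x)) (spinor_coord (\<phi> x) (s1 x, s2 x)))" .
    qed
  qed
qed

end

section \<open>Gauge covariance\<close>

lemma boost_linear: "boostE C S = C *\<^sub>R boostE 1 0 + S *\<^sub>R boostE 0 1" "boostM C S = C *\<^sub>R boostM 1 0 + S *\<^sub>R boostM 0 1"
  by (simp_all add: boostE_def boostM_def aconst_def asigma_def zero_prod_def scaleR_conv_of_real)

lemma (in surface) has_mdiff_boost:
  assumes U: "open U" "x \<in> U" and C: "msmooth_on \<A> U C" and S: "msmooth_on \<A> U S" and CS: "\<And>y. y \<in> U \<Longrightarrow> (C y)\<^sup>2 - (S y)\<^sup>2 = 1"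
  shows "has_mdiff (\<lambda>y. boostE (C y) (S y)) x
      (\<lambda>X. lie_elem (2 * (C x * mdiff \<A> S x X - S x * mdiff \<A> C x X), 0, 0, 0, 0, 0) \<otimes> boostE (C x) (S x))"
    and "has_mdiff (\<lambda>y. boostM (C y) (S y)) x
      (\<lambda>X. lie_elem (0, 2 * (C x * mdiff \<A> S x X - S x * mdiff \<A> C x X), 0, 0, 0, 0) \<otimes> boostM (C x) (S x))"
proof -
  note dC = msmooth_on_imp_has_mdiff[OF C U(2)] and dS = msmooth_on_imp_has_mdiff[OF S U(2)]
  have rel: "C x * mdiff \<A> C x X = S x * mdiff \<A> S x X" if X: "X \<in> tangent_space \<A> x" for X
  proof -
    have "has_mdiff (\<lambda>y. C y * C y - S y * S y) x (\<lambda>X. 0)"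
      by (rule has_mdiff_cong[OF U _ has_mdiff_const[of 1]]) (use CS in \<open>simp add: power2_eq_square\<close>)
    from has_mdiff_imp_mdiff[OF this X] has_mdiff_imp_mdiff[OF has_mdiff_diff[OF has_mdiff_mult[OF dC dC] has_mdiff_mult[OF dS dS]] X]
    show ?thesis by (simp add: mult.commute)
  qed
  note d = boost_differential[OF CS[OF U(2)] rel]
  have lin: "has_mdiff (\<lambda>y. C y *\<^sub>R u + S y *\<^sub>R v) x (\<lambda>X. mdiff \<A> C x X *\<^sub>R u + mdiff \<A> S x X *\<^sub>R v)" for u v :: hac
    by (intro has_mdiff_add has_mdiff_linear[OF bounded_linear_scaleR_left] dC dS)
  show "has_mdiff (\<lambda>y. boostE (C y) (S y)) x
      (\<lambda>X. lie_elem (2 * (C x * mdiff \<A> S x X - S x * mdiff \<A> C x X), 0, 0, 0, 0, 0) \<otimes> boostE (C x) (S x))"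
    by (rule has_mdiff_cong_deriv[OF lin[of "boostE 1 0" "boostE 0 1", folded boost_linear(1)] d(1)])
  show "has_mdiff (\<lambda>y. boostM (C y) (S y)) x
      (\<lambda>X. lie_elem (0, 2 * (C x * mdiff \<A> S x X - S x * mdiff \<A> C x X), 0, 0, 0, 0) \<otimes> boostM (C x) (S x))"
    by (rule has_mdiff_cong_deriv[OF lin[of "boostM 1 0" "boostM 0 1", folded boost_linear(2)] d(2)])
qed

context spin_surface
begin

lemma eta_quat_act:
  assumes q: "q \<in> spin_frames D x" and g: "g1 \<in> SpinE" "g2 \<in> SpinM" and f: "(f2, f3) \<in> oframes (bT D) x" and X: "X \<in> tangent_space (atl D) x"
  shows "eta_quat x q f2 f3 X = (g1 \<otimes> g2) \<otimes> eta_quat x (frame_act q g1 g2) f2 f3 X \<otimes> hconj (g1 \<otimes> g2)"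
proof -
  define G where "G = g1 \<otimes> g2"
  have u1: "hconj G \<otimes> G = hone" using spin_unit[OF g] unfolding G_def by (simp add: Spin22_iff)
  have uh: "hconj (hhat G) \<otimes> (hhat G \<otimes> y) = y" for y
    using arg_cong[OF u1, of hhat] by (simp add: hhat_hmul hhat_hconj hmul_assoc[symmetric])
  note of = T.oframeD(1,2)[OF f, unfolded tangent_fib]
  have z: "0 \<in> tangent_space (atl D) x" using T.fib_zero[of x] by (simp add: tangent_fib)
  have v: "vector_coord D x q (0, e) \<otimes> hhat (vector_coord D x q (B x X e, 0)) =
     G \<otimes> (vector_coord D x (frame_act q g1 g2) (0, e) \<otimes> hhat (vector_coord D x (frame_act q g1 g2) (B x X e, 0))) \<otimes> hconj G"
    if e: "e \<in> tangent_space (atl D) x" for e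
    unfolding vector_coord_act[OF q g E.fib_zero e] vector_coord_act[OF q g form_fib[OF X e] z] G_def[symmetric]
    by (simp add: hhat_hmul hhat_hconj hmul_assoc uh)
  show ?thesis
    unfolding eta_quat_def v[OF of(1)] v[OF of(2)] G_def[symmetric]
    by (simp add: hmul.diff_left hmul.diff_right hmul.scaleR_left hmul.scaleR_right)
qed

text \<open>Gauge covariance.  If \<open>G = g1 \<otimes> g2\<close>, the spinor coordinates change by \<open>p = G p'\<close>, and \<open>dp = u p\<close> becomes
  \<open>dp' = u' p'\<close> with \<open>u - dG G\<^sup>-\<^sup>1 = G u' G\<^sup>-\<^sup>1\<close>.  The term with \<open>dG\<close> is the change of the connection
  forms under a boost of the frames, and the part of \<open>B\<close> is conjugated by \<open>G\<close>.\<close>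

lemma section_change:
  assumes ad: "adapted U r1 r2" and g: "msmooth_on (atl D) U g1" "msmooth_on (atl D) U g2"
    "\<And>y. y \<in> U \<Longrightarrow> g1 y \<in> SpinE" "\<And>y. y \<in> U \<Longrightarrow> g2 y \<in> SpinM"
    and s: "\<And>y. y \<in> U \<Longrightarrow> s1 y = sact (sE D) (r1 y) (g1 y)" "\<And>y. y \<in> U \<Longrightarrow> s2 y = sact (sT D) (r2 y) (g2 y)"
  shows "x \<in> U \<Longrightarrow> (\<And>y. y \<in> U \<Longrightarrow> \<phi> y \<in> spinor_fibre D y) \<Longrightarrow>
      has_mdiff (\<lambda>y. spinor_coord (\<phi> y) (r1 y, r2 y)) x (\<lambda>X. lie_elem (lie_at r1 r2 x X) \<otimes> spinor_coord (\<phi> x) (r1 x, r2 x)) \<Longrightarrow>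
      has_mdiff (\<lambda>y. spinor_coord (\<phi> y) (s1 y, s2 y)) x (\<lambda>X. lie_elem (lie_at s1 s2 x X) \<otimes> spinor_coord (\<phi> x) (s1 x, s2 x))"
proof -
  note U = adaptedD(1)[OF ad] and fr = adaptedD(2)[OF ad] and fE = adaptedD(3)[OF ad] and fT = adaptedD(4)[OF ad]
  define C1 S1 where "C1 y = Re (fst (fst (g1 y)))" and "S1 y = Im (snd (fst (snd (g1 y))))" for y
  define C2 S2 where "C2 y = Re (fst (fst (g2 y)))" and "S2 y = Im (fst (fst (snd (g2 y))))" for y
  have sm: "msmooth_on (atl D) U C1" "msmooth_on (atl D) U S1" "msmooth_on (atl D) U C2" "msmooth_on (atl D) U S2"
    unfolding C1_def S1_def C2_def S2_def
    by (intro msmooth_on_linear[OF U _ g(1)] msmooth_on_linear[OF U _ g(2)]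
        bounded_linear_compose[OF bounded_linear_Re] bounded_linear_compose[OF bounded_linear_Im]
        bounded_linear_compose[OF bounded_linear_fst] bounded_linear_compose[OF bounded_linear_snd] bounded_linear_fst bounded_linear_snd)+
  have g1: "g1 y = boostE (C1 y) (S1 y)" "(C1 y)\<^sup>2 - (S1 y)\<^sup>2 = 1" if "y \<in> U" for y
    using g(3)[OF that] unfolding SpinE_alt by (auto simp: C1_def S1_def boost_coords)
  have g2: "g2 y = boostM (C2 y) (S2 y)" "(C2 y)\<^sup>2 - (S2 y)\<^sup>2 = 1" if "y \<in> U" for y
    using g(4)[OF that] unfolding SpinM_alt by (auto simp: C2_def S2_def boost_coords)
  have act: "(s1 y, s2 y) = frame_act (r1 y, r2 y) (g1 y) (g2 y)" if "y \<in> U" for y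
    using s that by (simp add: frame_act_def)
  have fs: "(s1 y, s2 y) \<in> spin_frames D y" if "y \<in> U" for y
    unfolding act[OF that] by (rule frame_act_mem[OF fr[OF that] g(3,4)[OF that]])
  have oE: "(eE0 s1 y, eE1 s1 y) \<in> oframes (bE D) y" and oT: "(eT0 s2 y, eT1 s2 y) \<in> oframes (bT D) y" if "y \<in> U" for y
    using frame_oframes[OF fs[OF that]] by auto
  have E1: "ocoords (bE D) y (sframe (sE D) (r1 y)) \<nu> =
      (((C1 y)\<^sup>2 + (S1 y)\<^sup>2) * x0 - 2 * C1 y * S1 y * x1, ((C1 y)\<^sup>2 + (S1 y)\<^sup>2) * x1 - 2 * C1 y * S1 y * x0)"
    if y: "y \<in> U" and \<nu>: "\<nu> \<in> fib (bE D) y" and c: "ocoords (bE D) y (sframe (sE D) (s1 y)) \<nu> = (x0, x1)" for y \<nu> x0 x1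
  proof -
    have "r1 y \<in> sfib (sE D) y" using fr[OF y] by (simp add: spin_frames_iff)
    then have "iotaE (ocoords (bE D) y (sframe (sE D) (r1 y)) \<nu>) = g1 y \<otimes> iotaE (ocoords (bE D) y (sframe (sE D) (s1 y)) \<nu>) \<otimes> hconj (hhat (g1 y))"
      using spinE[unfolded spin_structure_def, THEN conjunct2, THEN conjunct1, rule_format] g(3)[OF y] \<nu> s(1)[OF y] by simp
    then show ?thesis unfolding c g1(1)[OF y] boostE_action by (rule iotaE_inj)
  qed
  have T1: "ocoords (bT D) y (sframe (sT D) (r2 y)) \<nu> =
      (((C2 y)\<^sup>2 + (S2 y)\<^sup>2) * x0 - 2 * C2 y * S2 y * x1, ((C2 y)\<^sup>2 + (S2 y)\<^sup>2) * x1 - 2 * C2 y * S2 y * x0)"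
    if y: "y \<in> U" and \<nu>: "\<nu> \<in> fib (bT D) y" and c: "ocoords (bT D) y (sframe (sT D) (s2 y)) \<nu> = (x0, x1)" for y \<nu> x0 x1
  proof -
    have "r2 y \<in> sfib (sT D) y" using fr[OF y] by (simp add: spin_frames_iff)
    then have "iotaM (ocoords (bT D) y (sframe (sT D) (r2 y)) \<nu>) = g2 y \<otimes> iotaM (ocoords (bT D) y (sframe (sT D) (s2 y)) \<nu>) \<otimes> hconj (hhat (g2 y))"
      using spinT[unfolded spin_structure_def, THEN conjunct2, THEN conjunct1, rule_format] g(4)[OF y] \<nu> s(2)[OF y] by simp
    then show ?thesis unfolding c g2(1)[OF y] boostM_action by (rule iotaM_inj)
  qed
  have E2: "eE0 s1 y = ((C1 y)\<^sup>2 + (S1 y)\<^sup>2) *\<^sub>R eE0 r1 y + (- 2 * C1 y * S1 y) *\<^sub>R eE1 r1 y"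
    "eE1 s1 y = (- 2 * C1 y * S1 y) *\<^sub>R eE0 r1 y + ((C1 y)\<^sup>2 + (S1 y)\<^sup>2) *\<^sub>R eE1 r1 y" if y: "y \<in> U" for y
  proof -
    note o = E.oframeD[OF oE[OF y]] and o' = E.oframeD[OF E.oframe_onD(3)[OF fE y]]
    obtain e0 e1 where e: "sframe (sE D) (s1 y) = (e0, e1)" by fastforce
    obtain r0 r1' where r: "sframe (sE D) (r1 y) = (r0, r1')" by fastforce
    have c: "ocoords (bE D) y (sframe (sE D) (s1 y)) (eE0 s1 y) = (1, 0)" "ocoords (bE D) y (sframe (sE D) (s1 y)) (eE1 s1 y) = (0, 1)"
      using o(3-6) by (simp_all add: e)
    show "eE0 s1 y = ((C1 y)\<^sup>2 + (S1 y)\<^sup>2) *\<^sub>R eE0 r1 y + (- 2 * C1 y * S1 y) *\<^sub>R eE1 r1 y"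
      using E1[OF y o(1) c(1)] o'(7)[OF o(1)] by (simp add: e r)
    show "eE1 s1 y = (- 2 * C1 y * S1 y) *\<^sub>R eE0 r1 y + ((C1 y)\<^sup>2 + (S1 y)\<^sup>2) *\<^sub>R eE1 r1 y"
      using E1[OF y o(2) c(2)] o'(7)[OF o(2)] by (simp add: e r)
  qed
  have T2: "eT0 s2 y = ((C2 y)\<^sup>2 + (S2 y)\<^sup>2) *\<^sub>R eT0 r2 y + (- 2 * C2 y * S2 y) *\<^sub>R eT1 r2 y"
    "eT1 s2 y = (- 2 * C2 y * S2 y) *\<^sub>R eT0 r2 y + ((C2 y)\<^sup>2 + (S2 y)\<^sup>2) *\<^sub>R eT1 r2 y" if y: "y \<in> U" for y
  proof -
    note o = T.oframeD[OF oT[OF y]] and o' = T.oframeD[OF T.oframe_onD(3)[OF fT y]]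
    obtain e0 e1 where e: "sframe (sT D) (s2 y) = (e0, e1)" by fastforce
    obtain r0 r1' where r: "sframe (sT D) (r2 y) = (r0, r1')" by fastforce
    have c: "ocoords (bT D) y (sframe (sT D) (s2 y)) (eT0 s2 y) = (1, 0)" "ocoords (bT D) y (sframe (sT D) (s2 y)) (eT1 s2 y) = (0, 1)"
      using o(3-6) by (simp_all add: e)
    show "eT0 s2 y = ((C2 y)\<^sup>2 + (S2 y)\<^sup>2) *\<^sub>R eT0 r2 y + (- 2 * C2 y * S2 y) *\<^sub>R eT1 r2 y"
      using T1[OF y o(1) c(1)] o'(7)[OF o(1)] by (simp add: e r)
    show "eT1 s2 y = (- 2 * C2 y * S2 y) *\<^sub>R eT0 r2 y + ((C2 y)\<^sup>2 + (S2 y)\<^sup>2) *\<^sub>R eT1 r2 y"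
      using T1[OF y o(2) c(2)] o'(7)[OF o(2)] by (simp add: e r)
  qed
  note bE = E.boosted_frame[OF U fE sm(1,2) g1(2) E2 oE] and bT = T.boosted_frame[OF U fT sm(3,4) g2(2) T2 oT]
  assume x: "x \<in> U" and \<phi>: "\<And>y. y \<in> U \<Longrightarrow> \<phi> y \<in> spinor_fibre D y"
    and pr: "has_mdiff (\<lambda>y. spinor_coord (\<phi> y) (r1 y, r2 y)) x (\<lambda>X. lie_elem (lie_at r1 r2 x X) \<otimes> spinor_coord (\<phi> x) (r1 x, r2 x))"
  define G where "G y = boostE (C1 y) (S1 y) \<otimes> boostM (C2 y) (S2 y)" for y
  have G: "G y = g1 y \<otimes> g2 y" if "y \<in> U" for y using g1(1) g2(1) that by (simp add: G_def)
  have coord: "spinor_coord (\<phi> y) (s1 y, s2 y) = hconj (G y) \<otimes> spinor_coord (\<phi> y) (r1 y, r2 y)" if y: "y \<in> U" for y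
    unfolding G[OF y] act[OF y] using spinor_coord_act[OF \<phi>[OF y] fr[OF y] g(3,4)[OF y]] spin_cancel(1)[OF g(3,4)[OF y]] by simp
  have u: "hconj (G x) \<otimes> G x = hone" using spin_unit[OF g(3,4)[OF x]] unfolding G[OF x] by (simp add: Spin22_iff)
  define w where "w X = (2 * (C1 x * mdiff (atl D) S1 x X - S1 x * mdiff (atl D) C1 x X),
     2 * (C2 x * mdiff (atl D) S2 x X - S2 x * mdiff (atl D) C2 x X))" for X
  let ?l = "\<lambda>X. lie_elem (fst (w X), snd (w X), 0, 0, 0, 0)"
  let ?pr = "spinor_coord (\<phi> x) (r1 x, r2 x)" and ?ps = "spinor_coord (\<phi> x) (s1 x, s2 x)"
  have dG: "has_mdiff G x (\<lambda>X. ?l X \<otimes> G x)"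
  proof (rule has_mdiff_cong_deriv)
    show "has_mdiff G x (\<lambda>X. boostE (C1 x) (S1 x) \<otimes> (lie_elem (0, snd (w X), 0, 0, 0, 0) \<otimes> boostM (C2 x) (S2 x)) +
      (lie_elem (fst (w X), 0, 0, 0, 0, 0) \<otimes> boostE (C1 x) (S1 x)) \<otimes> boostM (C2 x) (S2 x))"
      unfolding G_def w_def fst_conv snd_conv
      by (rule has_mdiff_bilinear[OF bounded_bilinear_hmul has_mdiff_boost(1)[OF U x sm(1,2) g1(2)] has_mdiff_boost(2)[OF U x sm(3,4) g2(2)]])
    fix X
    have "?l X = lie_elem (0, snd (w X), 0, 0, 0, 0) + lie_elem (fst (w X), 0, 0, 0, 0, 0)"
      by (simp add: lie_elem_hom(1)[symmetric] del: lie_elem.simps)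
    then show "boostE (C1 x) (S1 x) \<otimes> (lie_elem (0, snd (w X), 0, 0, 0, 0) \<otimes> boostM (C2 x) (S2 x)) +
      (lie_elem (fst (w X), 0, 0, 0, 0, 0) \<otimes> boostE (C1 x) (S1 x)) \<otimes> boostM (C2 x) (S2 x) = ?l X \<otimes> G x"
      by (simp only: hmul_assoc[symmetric] boost_commute_lie(1)) (simp only: G_def hmul.add_left hmul_assoc)
  qed
  have Gl: "G x \<otimes> lie_elem (u, v, 0, 0, 0, 0) = lie_elem (u, v, 0, 0, 0, 0) \<otimes> G x" for u v
    unfolding G_def hmul_assoc boost_commute_lie(2)
    unfolding hmul_assoc[symmetric] boost_commute_lie(1) ..
  have rel: "lie_elem (lie_at r1 r2 x X) - ?l X = G x \<otimes> lie_elem (lie_at s1 s2 x X) \<otimes> hconj (G x)" if X: "X \<in> tangent_space (atl D) x" for X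
  proof -
    let ?wE = "E.conn_form (eE0 r1) (eE1 r1) x X" and ?wT = "T.conn_form (eT0 r2) (eT1 r2) x X"
    have cs: "E.conn_form (eE0 s1) (eE1 s1) x X = ?wE - fst (w X)" "T.conn_form (eT0 s2) (eT1 s2) x X = ?wT - snd (w X)"
      unfolding w_def fst_conv snd_conv
      by (rule bE(2), (assumption | rule x X)+, rule bT(2), (assumption | rule x X)+)
    note f = oT[OF x]
    have 1: "lie_elem (form_coords x (r1 x, r2 x) X) = G x \<otimes> lie_elem (form_coords x (s1 x, s2 x) X) \<otimes> hconj (G x)"
      unfolding eta_quat_coords[OF fr[OF x] f X, symmetric] eta_quat_coords[OF fs[OF x] f X, symmetric]
        eta_quat_act[OF fr[OF x] g(3,4)[OF x] f X] act[OF x, symmetric] G[OF x] ..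
    let ?d = "lie_elem (?wE - fst (w X), ?wT - snd (w X), 0, 0, 0, 0)"
    have 2: "?d = G x \<otimes> ?d \<otimes> hconj (G x)"
      unfolding Gl hmul_assoc unit_right[OF u] hone_simps ..
    have 3: "lie_elem (?wE, ?wT, 0, 0, 0, 0) - ?l X = ?d"
      by (simp only: lie_elem_hom(2)[symmetric] diff_Pair diff_zero)
    have "lie_elem (lie_at r1 r2 x X) - ?l X = ?d + lie_elem (form_coords x (r1 x, r2 x) X)"
      unfolding lie_at_split lie_elem_hom(1) 3[symmetric] by (simp only: algebra_simps)
    also have "\<dots> = G x \<otimes> (?d + lie_elem (form_coords x (s1 x, s2 x) X)) \<otimes> hconj (G x)"
      unfolding hmul.add_right hmul.add_left 1 by (subst 2) (rule refl)
    also have "?d + lie_elem (form_coords x (s1 x, s2 x) X) = lie_elem (lie_at s1 s2 x X)"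
      unfolding lie_at_split lie_elem_hom(1) cs ..
    finally show ?thesis .
  qed
  show "has_mdiff (\<lambda>y. spinor_coord (\<phi> y) (s1 y, s2 y)) x (\<lambda>X. lie_elem (lie_at s1 s2 x X) \<otimes> ?ps)"
  proof (rule has_mdiff_cong[OF U x])
    show "hconj (G y) \<otimes> spinor_coord (\<phi> y) (r1 y, r2 y) = spinor_coord (\<phi> y) (s1 y, s2 y)" if "y \<in> U" for y
      using coord[OF that] by simp
    show "has_mdiff (\<lambda>y. hconj (G y) \<otimes> spinor_coord (\<phi> y) (r1 y, r2 y)) x (\<lambda>X. lie_elem (lie_at s1 s2 x X) \<otimes> ?ps)"
    proof (rule has_mdiff_cong_deriv[OF has_mdiff_bilinear[OF bounded_bilinear_hmul has_mdiff_linear[OF bounded_linear_hconj dG] pr]])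
      fix X assume X: "X \<in> tangent_space (atl D) x"
      have "hconj (G x) \<otimes> (lie_elem (lie_at r1 r2 x X) \<otimes> ?pr) + hconj (?l X \<otimes> G x) \<otimes> ?pr =
        hconj (G x) \<otimes> ((lie_elem (lie_at r1 r2 x X) - ?l X) \<otimes> ?pr)"
        by (simp only: hconj_hmul hconj_lie_elem hmul.diff_left hmul.diff_right hmul.minus_left hmul.minus_right hmul_assoc) simp
      also have "\<dots> = (hconj (G x) \<otimes> G x) \<otimes> (lie_elem (lie_at s1 s2 x X) \<otimes> (hconj (G x) \<otimes> ?pr))"
        unfolding rel[OF X] by (simp only: hmul_assoc)
      also have "\<dots> = lie_elem (lie_at s1 s2 x X) \<otimes> ?ps" unfolding u coord[OF x] hone_simps ..
      finally show "hconj (G x) \<otimes> (lie_elem (lie_at r1 r2 x X) \<otimes> ?pr) + hconj (?l X \<otimes> G x) \<otimes> ?pr = lie_elem (lie_at s1 s2 x X) \<otimes> ?ps" .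
    qed
  qed
qed

definition spinor_eq_at :: "('m \<Rightarrow> ('q, 'p) spinor) \<Rightarrow> 'm \<Rightarrow> ('m \<Rightarrow> 'q) \<Rightarrow> ('m \<Rightarrow> 'p) \<Rightarrow> bool" where
  "spinor_eq_at \<phi> x s1 s2 \<longleftrightarrow> has_mdiff (\<lambda>y. spinor_coord (\<phi> y) (s1 y, s2 y)) x
     (\<lambda>X. lie_elem (lie_at s1 s2 x X) \<otimes> spinor_coord (\<phi> x) (s1 x, s2 x))"

lemma spinor_eq_at_transfer:
  assumes r: "(W1, r1) \<in> ssecs (sE D)" "(W2, r2) \<in> ssecs (sT D)" "x \<in> W1 \<inter> W2"
    and s: "open W" "x \<in> W" "smooth_principal_section (atl D) SpinE (sE D) W s1" "smooth_principal_section (atl D) SpinM (sT D) W s2"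
    and V: "open V" "x \<in> V" "\<And>y. y \<in> V \<Longrightarrow> \<phi> y \<in> spinor_fibre D y"
  shows "spinor_eq_at \<phi> x r1 r2 \<Longrightarrow> spinor_eq_at \<phi> x s1 s2"
proof -
  note R = section_adapted[OF r(1,2)]
  define U where "U = W1 \<inter> W2 \<inter> W \<inter> V"
  have U: "open U" "x \<in> U" "U \<subseteq> W1 \<inter> W2" "U \<subseteq> W1 \<inter> W" "U \<subseteq> W2 \<inter> W" "U \<subseteq> V" using R s V r unfolding U_def by auto
  obtain g1 where g1: "msmooth_on (atl D) (W1 \<inter> W) g1" "\<And>y. y \<in> W1 \<inter> W \<Longrightarrow> g1 y \<in> SpinE \<and> s1 y = sact (sE D) (r1 y) (g1 y)"
    using s(3)[unfolded smooth_principal_section_def, THEN conjunct2, rule_format, OF r(1)] by auto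
  obtain g2 where g2: "msmooth_on (atl D) (W2 \<inter> W) g2" "\<And>y. y \<in> W2 \<inter> W \<Longrightarrow> g2 y \<in> SpinM \<and> s2 y = sact (sT D) (r2 y) (g2 y)"
    using s(4)[unfolded smooth_principal_section_def, THEN conjunct2, rule_format, OF r(2)] by auto
  show "spinor_eq_at \<phi> x r1 r2 \<Longrightarrow> spinor_eq_at \<phi> x s1 s2"
    unfolding spinor_eq_at_def
    by (rule section_change[OF adapted_subset[OF R(1) U(1,3)] msmooth_on_subset[OF g1(1) U(4)] msmooth_on_subset[OF g2(1) U(5)] _ _ _ _ U(2)])
      (use g1(2) g2(2) U V(3) in blast)+
qed

end

section \<open>Flatness\<close>

context spin_surface
begin

lemma coord_vector_field:
  assumes \<kappa>: "\<kappa> \<in> atl D" shows "vector_field (atl D) (fst \<kappa>) (coord_vector (atl D) \<kappa> w)"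
proof -
  have fr: "(fst \<kappa>, coord1 \<kappa>, coord2 \<kappa>) \<in> frames (bT D)"
    unfolding tangent_frames using \<kappa> by (auto simp: tangent_bundle_def)
  have s: "smooth_section (atl D) (bT D) (fst \<kappa>) (coord1 \<kappa>)" "smooth_section (atl D) (bT D) (fst \<kappa>) (coord2 \<kappa>)"
    using T.vector_bundle[unfolded vector_bundle_def, THEN conjunct2, rule_format, OF fr] by simp_all
  note o = chart_props(1)[OF \<kappa>]
  have "smooth_section (atl D) (bT D) (fst \<kappa>) (\<lambda>x. w $ 1 *\<^sub>R coord1 \<kappa> x + w $ 2 *\<^sub>R coord2 \<kappa> x)"
    by (intro T.section_add T.section_scaleR o s msmooth_on_const)
  then have "smooth_section (atl D) (bT D) (fst \<kappa>) (coord_vector (atl D) \<kappa> w)"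
    by (rule T.section_cong) (simp add: coord_vector_decomp[of _ \<kappa> w] chart_at_def \<kappa>)
  then show ?thesis by (simp add: tangent_section)
qed

lemma vector_field_subset: "vector_field (atl D) W X \<Longrightarrow> W' \<subseteq> W \<Longrightarrow> vector_field (atl D) W' X"
  using T.section_subset by (simp add: tangent_section)

lemma lie_bracket_tangent:
  assumes "open W" "vector_field (atl D) W X" "vector_field (atl D) W Y" "x \<in> W"
  shows "nabla (bT D) Y x (X x) - nabla (bT D) X x (Y x) = lie_bracket (atl D) X Y x"
    and "lie_bracket (atl D) X Y x \<in> tangent_space (atl D) x"
proof -
  show eq: "nabla (bT D) Y x (X x) - nabla (bT D) X x (Y x) = lie_bracket (atl D) X Y x"
    using torsion_free assms unfolding torsion_free_def by blast
  have "nabla (bT D) Y x (X x) \<in> fib (bT D) x" "nabla (bT D) X x (Y x) \<in> fib (bT D) x"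
    using assms vector_field_tangent by (auto intro!: T.nabla_fib[of W] simp: tangent_section)
  then show "lie_bracket (atl D) X Y x \<in> tangent_space (atl D) x"
    unfolding eq[symmetric] using T.fib_diff by (simp add: tangent_fib)
qed

text \<open>The connection is torsion-free, and the bracket of coordinate fields vanishes because their
  components are constant.\<close>

lemma coord_fields_commute:
  assumes c: "chart_at (atl D) x \<kappa>"
  shows "nabla (bT D) (coord_vector (atl D) \<kappa> w) x (coord_vector (atl D) \<kappa> v x) = nabla (bT D) (coord_vector (atl D) \<kappa> v) x (coord_vector (atl D) \<kappa> w x)"
proof -
  note c' = chart_at_D[OF c]
  note o = chart_props(1)[OF c'(1)]
  let ?v = "coord_vector (atl D) \<kappa> v" and ?w = "coord_vector (atl D) \<kappa> w"
  note l = lie_bracket_tangent[OF o coord_vector_field[OF c'(1), of v] coord_vector_field[OF c'(1), of w] c'(2)]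
  have "mdiff (atl D) (\<lambda>y. coord_vector (atl D) \<kappa> u y \<kappa>) x t = 0" if "t \<in> tangent_space (atl D) x" for u t
  proof -
    have "has_mdiff (\<lambda>y. coord_vector (atl D) \<kappa> u y \<kappa>) x (\<lambda>v. 0)"
      by (rule has_mdiff_cong[OF o c'(2) _ has_mdiff_const[of u]]) (simp add: chart_at_def c')
    from has_mdiff_imp_mdiff[OF this that] show ?thesis .
  qed
  then have "lie_bracket (atl D) ?v ?w x \<kappa> = 0"
    using coord_vector_tangent[OF c] by (simp add: lie_bracket_component[OF c])
  then have "lie_bracket (atl D) ?v ?w x = 0"
    using tangent_eqI[OF l(2) _ c, of 0] T.fib_zero[of x] by (simp add: tangent_fib)
  with l(1) show ?thesis by simp
qed

lemma shape_operator_frame: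
  assumes \<nu>: "\<nu> \<in> fib (bE D) x" and X: "X \<in> tangent_space (atl D) x" and f: "(e2, e3) \<in> oframes (bT D) x"
  shows "shape_operator (bT D) (bE D) B x \<nu> X =
    (- met (bE D) x (B x X e2) \<nu>) *\<^sub>R e2 + met (bE D) x (B x X e3) \<nu> *\<^sub>R e3"
proof -
  note o = T.oframeD[OF f]
  have t: "e2 \<in> tangent_space (atl D) x" "e3 \<in> tangent_space (atl D) x" using o(1,2) by (simp_all add: tangent_fib)
  let ?Z = "(- met (bE D) x (B x X e2) \<nu>) *\<^sub>R e2 + met (bE D) x (B x X e3) \<nu> *\<^sub>R e3"
  show ?thesis
    unfolding shape_operator_def
  proof (rule the_equality)
    have Z: "?Z \<in> fib (bT D) x" by (intro T.fib_add T.fib_scaleR o)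
    have "met (bT D) x ?Z Y = met (bE D) x (B x X Y) \<nu>" if Y: "Y \<in> fib (bT D) x" for Y
    proof -
      have "B x X Y = (- met (bT D) x Y e2) *\<^sub>R B x X e2 + met (bT D) x Y e3 *\<^sub>R B x X e3"
        by (subst o(7)[OF Y]) (simp only: form_add_right form_scaleR_right X t tangent_scaleR)
      then have "met (bE D) x (B x X Y) \<nu> = (- met (bT D) x Y e2) * met (bE D) x (B x X e2) \<nu> + met (bT D) x Y e3 * met (bE D) x (B x X e3) \<nu>"
        using form_fib[OF X t(1)] form_fib[OF X t(2)] by (simp only: E.met_add_left E.met_scaleR_left \<nu> E.fib_scaleR)
      moreover have "met (bT D) x ?Z Y = (- met (bE D) x (B x X e2) \<nu>) * met (bT D) x e2 Y + met (bE D) x (B x X e3) \<nu> * met (bT D) x e3 Y"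
        by (simp only: T.met_add_left T.met_scaleR_left o(1,2) Y T.fib_scaleR)
      ultimately show ?thesis using T.met_sym[OF Y o(1)] T.met_sym[OF Y o(2)] by simp
    qed
    with Z show "?Z \<in> fib (bT D) x \<and> (\<forall>Y\<in>fib (bT D) x. met (bT D) x ?Z Y = met (bE D) x (B x X Y) \<nu>)" by blast
    fix Z assume "Z \<in> fib (bT D) x \<and> (\<forall>Y\<in>fib (bT D) x. met (bT D) x Z Y = met (bE D) x (B x X Y) \<nu>)"
    then show "Z = ?Z" using o(1,2) o(7)[of Z] by simp
  qed
qed

lemma lie_at_linear:
  assumes ad: "adapted U s1 s2" and x: "x \<in> U"
  shows "linear_map_on (tangent_space (atl D) x) (lie_at s1 s2 x)"
proof -
  note fr = adaptedD(2)[OF ad x]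
  note t = frame_tangent[OF fr, simplified]
  show ?thesis
    using E.conn_form_linear[OF adaptedD(1,3)[OF ad] x] T.conn_form_linear[OF adaptedD(1,4)[OF ad] x] t
    unfolding linear_map_on_def lie_at_def
    by (simp add: form_add_left form_scaleR_left form_fib E.met_add_left E.met_scaleR_left E.fib_scaleR)
qed

lemma lie_at_smooth:
  assumes ad: "adapted U s1 s2" and X: "vector_field (atl D) U X"
  shows "msmooth_on (atl D) U (\<lambda>y. lie_at s1 s2 y (X y))"
proof -
  note U = adaptedD(1)[OF ad] and fE = adaptedD(3)[OF ad] and fT = adaptedD(4)[OF ad]
  note vf = T.oframe_onD(1,2)[OF fT, unfolded tangent_section] and se = E.oframe_onD(1,2)[OF fE]
  note m = E.met_smooth[OF U form_smooth[OF U X vf(1)] se(1)] E.met_smooth[OF U form_smooth[OF U X vf(2)] se(1)]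
    E.met_smooth[OF U form_smooth[OF U X vf(1)] se(2)] E.met_smooth[OF U form_smooth[OF U X vf(2)] se(2)]
  show ?thesis
    unfolding lie_at_def
    by (intro msmooth_on_Pair U E.conn_form_smooth[OF U fE X] T.conn_form_smooth[OF U fT X] msmooth_on_minus m)
qed

lemma frame_det_nonzero:
  assumes f: "(e2, e3) \<in> oframes (bT D) x" and c: "chart_at (atl D) x \<kappa>"
  shows "e2 \<kappa> $ 1 * e3 \<kappa> $ 2 - e2 \<kappa> $ 2 * e3 \<kappa> $ 1 \<noteq> 0"
proof
  assume det: "e2 \<kappa> $ 1 * e3 \<kappa> $ 2 - e2 \<kappa> $ 2 * e3 \<kappa> $ 1 = 0"
  note o = T.oframeD[OF f, unfolded tangent_fib]
  have "\<exists>p q. v $ 1 = p * e2 \<kappa> $ 1 + q * e3 \<kappa> $ 1 \<and> v $ 2 = p * e2 \<kappa> $ 2 + q * e3 \<kappa> $ 2" for v :: "real^2"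
  proof -
    define p q where "p = - met (bT D) x (coord_vector (atl D) \<kappa> v x) e2" and "q = met (bT D) x (coord_vector (atl D) \<kappa> v x) e3"
    have "coord_vector (atl D) \<kappa> v x = p *\<^sub>R e2 + q *\<^sub>R e3"
      unfolding p_def q_def by (rule o(7)[OF coord_vector_tangent[OF c]])
    then have "coord_vector (atl D) \<kappa> v x \<kappa> = p *\<^sub>R e2 \<kappa> + q *\<^sub>R e3 \<kappa>"
      by (simp only: plus_fun_apply scaleR_fun_def)
    then have "v $ i = p * e2 \<kappa> $ i + q * e3 \<kappa> $ i" for i unfolding coord_vector_self[OF c] by simp
    then show ?thesis by blast
  qed
  from this[of "axis 1 1"] this[of "axis 2 1"] obtain p q r s where
    "1 = p * e2 \<kappa> $ 1 + q * e3 \<kappa> $ 1" "0 = p * e2 \<kappa> $ 2 + q * e3 \<kappa> $ 2"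
    "0 = r * e2 \<kappa> $ 1 + s * e3 \<kappa> $ 1" "1 = r * e2 \<kappa> $ 2 + s * e3 \<kappa> $ 2"
    by (auto simp: axis_def)
  then have "1 = (p * e2 \<kappa> $ 1 + q * e3 \<kappa> $ 1) * (r * e2 \<kappa> $ 2 + s * e3 \<kappa> $ 2) -
      (p * e2 \<kappa> $ 2 + q * e3 \<kappa> $ 2) * (r * e2 \<kappa> $ 1 + s * e3 \<kappa> $ 1)" by simp
  also have "\<dots> = (p * s - q * r) * (e2 \<kappa> $ 1 * e3 \<kappa> $ 2 - e2 \<kappa> $ 2 * e3 \<kappa> $ 1)" by (simp add: algebra_simps)
  finally show False using det by simp
qed

text \<open>The heart of the theorem: the one-form \<open>u\<close> of the spinor equation satisfies \<open>du = u \<and> u\<close>, evaluated here on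
  coordinate fields.  The Ricci and Gauss equations give the components of the connection forms.  They are
  stated in the frame \<open>(e2, e3)\<close> and are converted to coordinate fields by division by the determinant \<open>dt\<close>
  of the frame.  The other four components follow from the Codazzi equation for the two coordinate fields
  and \<open>e2\<close> or \<open>e3\<close>, where the derivatives of \<open>e0, e1\<close> and of \<open>e2, e3\<close> contribute the mixed terms of the
  commutator.\<close>

lemma lie_at_flat:
  assumes ad: "adapted U s1 s2" and x: "x \<in> U" and c: "chart_at (atl D) x \<kappa>"
    and d1: "has_mdiff (\<lambda>y. lie_at s1 s2 y (coord1 \<kappa> y)) x d1" and d2: "has_mdiff (\<lambda>y. lie_at s1 s2 y (coord2 \<kappa> y)) x d2"
  shows "d2 (coord1 \<kappa> x) - d1 (coord2 \<kappa> x) = lie_bracket_coords (lie_at s1 s2 x (coord1 \<kappa> x)) (lie_at s1 s2 x (coord2 \<kappa> x))"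
proof -
  note c' = chart_at_D[OF c]
  define N where "N = U \<inter> fst \<kappa>"
  have N: "open N" "x \<in> N" "N \<subseteq> U" "N \<subseteq> fst \<kappa>"
    using adaptedD(1)[OF ad] chart_props(1)[OF c'(1)] x c' unfolding N_def by auto
  note adN = adapted_subset[OF ad N(1,3)]
  note fE = adaptedD(3)[OF adN] and fT = adaptedD(4)[OF adN]
  define e0 e1 e2 e3 where "e0 = eE0 s1" and "e1 = eE1 s1" and "e2 = eT0 s2" and "e3 = eT1 s2"
  have fE': "oframe_on (atl D) (bE D) N e0 e1" and fT': "oframe_on (atl D) (bT D) N e2 e3"
    using fE fT by (simp_all add: e0_def e1_def e2_def e3_def)
  note oE = E.oframeD[OF E.oframe_onD(3)[OF fE' N(2)]] and oT = T.oframeD[OF T.oframe_onD(3)[OF fT' N(2)], unfolded tangent_fib]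
  note vf = T.oframe_onD(1,2)[OF fT', unfolded tangent_section] and se = E.oframe_onD(1,2)[OF fE']
  let ?d1 = "coord1 \<kappa>" and ?d2 = "coord2 \<kappa>"
  note v1 = vector_field_subset[OF coord_vector_field[OF c'(1), of "axis 1 1"] N(4)]
    and v2 = vector_field_subset[OF coord_vector_field[OF c'(1), of "axis 2 1"] N(4)]
  have t: "?d1 x \<in> tangent_space (atl D) x" "?d2 x \<in> tangent_space (atl D) x" using coord_vector_tangent[OF c] by auto
  note t = t oT(1,2)
  define wE where "wE = E.conn_form e0 e1"
  define wT where "wT = T.conn_form e2 e3"
  define b0 where "b0 X Y = - met (bE D) x (B x X Y) (e0 x)" for X Y
  define b1 where "b1 X Y = met (bE D) x (B x X Y) (e1 x)" for X Y
  have lie: "lie_at s1 s2 y X = (wE y X, wT y X, - met (bE D) y (B y X (e2 y)) (e0 y), - met (bE D) y (B y X (e3 y)) (e0 y),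
     met (bE D) y (B y X (e2 y)) (e1 y), met (bE D) y (B y X (e3 y)) (e1 y))" for y X
    by (simp add: lie_at_def wE_def wT_def e0_def e1_def e2_def e3_def)
  have liex: "lie_at s1 s2 x X = (wE x X, wT x X, b0 X (e2 x), b0 X (e3 x), b1 X (e2 x), b1 X (e3 x))" for X
    by (simp add: lie b0_def b1_def)
  have lin: "linear_map_on (tangent_space (atl D) x) (\<lambda>X. b0 X Y)" "linear_map_on (tangent_space (atl D) x) (\<lambda>X. b1 X Y)"
    if "Y \<in> tangent_space (atl D) x" for Y
    using that oE(1,2) unfolding linear_map_on_def b0_def b1_def
    by (simp_all add: form_add_left form_scaleR_left form_fib E.met_add_left E.met_scaleR_left E.fib_scaleR)
  have sym: "b0 (e3 x) (e2 x) = b0 (e2 x) (e3 x)" "b1 (e3 x) (e2 x) = b1 (e2 x) (e3 x)"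
    using form_sym[OF t(3,4)] by (simp_all add: b0_def b1_def)
  define E2 E3 where "E2 = e2 x \<kappa>" and "E3 = e3 x \<kappa>"
  have exp: "f (e2 x) = E2 $ 1 * f (?d1 x) + E2 $ 2 * f (?d2 x)" "f (e3 x) = E3 $ 1 * f (?d1 x) + E3 $ 2 * f (?d2 x)"
    if "linear_map_on (tangent_space (atl D) x) f" for f :: "'m tvec \<Rightarrow> real"
    using linear_map_on_tangent[OF that t(3) c] linear_map_on_tangent[OF that t(4) c] by (simp_all add: E2_def E3_def)
  define dt where "dt = E2 $ 1 * E3 $ 2 - E2 $ 2 * E3 $ 1"
  have dt: "dt \<noteq> 0" using frame_det_nonzero[OF T.oframe_onD(3)[OF fT' N(2)] c] by (simp add: dt_def E2_def E3_def)
  note br = lie_bracket_tangent(2)[OF N(1) vf(1) vf(2) N(2)]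

  have smE: "has_mdiff (\<lambda>y. wE y (Z y)) x (mdiff (atl D) (\<lambda>y. wE y (Z y)) x)"
    and smT: "has_mdiff (\<lambda>y. wT y (Z y)) x (mdiff (atl D) (\<lambda>y. wT y (Z y)) x)" if "vector_field (atl D) N Z" for Z
    unfolding wE_def wT_def
    using msmooth_on_imp_has_mdiff[OF E.conn_form_smooth[OF N(1) fE' that] N(2)]
      msmooth_on_imp_has_mdiff[OF T.conn_form_smooth[OF N(1) fT' that] N(2)] by auto
  note extE = exterior_derivative_coords[OF c N(1,2) E.conn_form_linear[OF N(1) fE', folded wE_def] smE[OF v1] smE[OF v2] vf br,
      folded E2_def E3_def, folded dt_def]
  note extT = exterior_derivative_coords[OF c N(1,2) T.conn_form_linear[OF N(1) fT', folded wT_def] smT[OF v1] smT[OF v2] vf br,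
      folded E2_def E3_def, folded dt_def]
  define LE where "LE = mdiff (atl D) (\<lambda>y. wE y (?d2 y)) x (?d1 x) - mdiff (atl D) (\<lambda>y. wE y (?d1 y)) x (?d2 x)"
  define LT where "LT = mdiff (atl D) (\<lambda>y. wT y (?d2 y)) x (?d1 x) - mdiff (atl D) (\<lambda>y. wT y (?d1 y)) x (?d2 x)"

  have Gauss: "dt * LT = b1 (e2 x) (e3 x) * b1 (e3 x) (e2 x) - b0 (e2 x) (e3 x) * b0 (e3 x) (e2 x)
     - b1 (e2 x) (e2 x) * b1 (e3 x) (e3 x) + b0 (e2 x) (e2 x) * b0 (e3 x) (e3 x)"
  proof -
    have m: "met (bE D) x (B x X Y) (B x Z W) = - b0 X Y * b0 Z W + b1 X Y * b1 Z W"
      if "X \<in> tangent_space (atl D) x" "Y \<in> tangent_space (atl D) x" "Z \<in> tangent_space (atl D) x" "W \<in> tangent_space (atl D) x" for X Y Z W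
      using E.met_oframe[OF E.oframe_onD(3)[OF fE' N(2)] form_fib[OF that(1,2)] form_fib[OF that(3,4)]] by (simp add: b0_def b1_def)
    have "gauss_curvature (atl D) (bT D) e2 e3 x = met (bE D) x (B x (e2 x) (e3 x)) (B x (e2 x) (e3 x)) -
        met (bE D) x (B x (e2 x) (e2 x)) (B x (e3 x) (e3 x))"
      using gauss[unfolded gauss_equation_def, rule_format, OF conjI[OF N(1) fT'] N(2)] .
    also have "\<dots> = b1 (e2 x) (e3 x) * b1 (e3 x) (e2 x) - b0 (e2 x) (e3 x) * b0 (e3 x) (e2 x)
     - b1 (e2 x) (e2 x) * b1 (e3 x) (e3 x) + b0 (e2 x) (e2 x) * b0 (e3 x) (e3 x)"
      by (simp add: m t sym)
    also have "gauss_curvature (atl D) (bT D) e2 e3 x = dt * LT"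
      using T.curvature_conn_form(2)[OF N(1) fT' vf(1) t(3) vf(2) t(4) N(2) br, folded wT_def] extT
      unfolding gauss_curvature_def oT(3-5) LT_def by simp
    finally show ?thesis .
  qed
  have Ricci: "dt * LE = b1 (e2 x) (e2 x) * b0 (e3 x) (e2 x) - b1 (e2 x) (e3 x) * b0 (e3 x) (e3 x)
     - b0 (e2 x) (e2 x) * b1 (e3 x) (e2 x) + b0 (e2 x) (e3 x) * b1 (e3 x) (e3 x)"
  proof -
    let ?S = "shape_operator (bT D) (bE D) B x"
    note fx = T.oframe_onD(3)[OF fT' N(2)]
    have S: "?S (e0 x) X = b0 X (e2 x) *\<^sub>R e2 x + (- b0 X (e3 x)) *\<^sub>R e3 x" "?S (e1 x) X = (- b1 X (e2 x)) *\<^sub>R e2 x + b1 X (e3 x) *\<^sub>R e3 x"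
      if "X \<in> tangent_space (atl D) x" for X
      using shape_operator_frame[OF oE(1) that fx] shape_operator_frame[OF oE(2) that fx] by (simp_all add: b0_def b1_def)
    have St: "?S (e0 x) X \<in> tangent_space (atl D) x" "?S (e1 x) X \<in> tangent_space (atl D) x" if "X \<in> tangent_space (atl D) x" for X
      unfolding S[OF that] by (intro tangent_add tangent_scaleR t)+
    have Sm: "met (bT D) x (?S (e0 x) X) (e3 x) = - b0 X (e3 x)" "met (bT D) x (?S (e1 x) X) (e3 x) = b1 X (e3 x)"
      if "X \<in> tangent_space (atl D) x" for X
      unfolding S[OF that]
      by (simp_all add: T.met_add_left T.met_scaleR_left T.fib_scaleR oT(1,2)[folded tangent_fib] oT(4,5) del: scaleR_minus_left)
    have bS: "b0 (?S (e1 x) X) Y = (- b1 X (e2 x)) * b0 (e2 x) Y + b1 X (e3 x) * b0 (e3 x) Y"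
      "b1 (?S (e0 x) X) Y = b0 X (e2 x) * b1 (e2 x) Y + (- b0 X (e3 x)) * b1 (e3 x) Y"
      if "X \<in> tangent_space (atl D) x" "Y \<in> tangent_space (atl D) x" for X Y
      unfolding S[OF that(1)] using lin[OF that(2)] t tangent_scaleR unfolding linear_map_on_def by (simp_all del: scaleR_minus_left)
    have "dt * LE = met (bE D) x (bundle_curvature (atl D) (bE D) e2 e3 e0 x) (e1 x)"
      using E.curvature_conn_form(1)[OF N(1) fE' vf(1) t(3) vf(2) t(4) N(2) br, folded wE_def] extE
      unfolding LE_def by simp
    also have "\<dots> = met (bT D) x (?S (e0 x) (?S (e1 x) (e2 x)) - ?S (e1 x) (?S (e0 x) (e2 x))) (e3 x)"
      using ricci[unfolded ricci_equation_def Let_def, rule_format, OF conjI[OF N(1) conjI[OF fE' fT']] N(2)] .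
    also have "\<dots> = met (bT D) x (?S (e0 x) (?S (e1 x) (e2 x))) (e3 x) - met (bT D) x (?S (e1 x) (?S (e0 x) (e2 x))) (e3 x)"
      by (rule T.met_diff_left) (simp_all add: tangent_fib St t)
    also have "\<dots> = - b0 (?S (e1 x) (e2 x)) (e3 x) - b1 (?S (e0 x) (e2 x)) (e3 x)"
      unfolding Sm(1)[OF St(2)[OF t(3)]] Sm(2)[OF St(1)[OF t(3)]] ..
    also have "\<dots> = b1 (e2 x) (e2 x) * b0 (e3 x) (e2 x) - b1 (e2 x) (e3 x) * b0 (e3 x) (e3 x)
     - b0 (e2 x) (e2 x) * b1 (e3 x) (e2 x) + b0 (e2 x) (e3 x) * b1 (e3 x) (e3 x)"
      unfolding bS(1)[OF t(3,4)] bS(2)[OF t(3,4)] sym by (simp add: algebra_simps)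
    finally show ?thesis .
  qed
  have expb: "b0 (e2 x) Y = E2 $ 1 * b0 (?d1 x) Y + E2 $ 2 * b0 (?d2 x) Y" "b0 (e3 x) Y = E3 $ 1 * b0 (?d1 x) Y + E3 $ 2 * b0 (?d2 x) Y"
    "b1 (e2 x) Y = E2 $ 1 * b1 (?d1 x) Y + E2 $ 2 * b1 (?d2 x) Y" "b1 (e3 x) Y = E3 $ 1 * b1 (?d1 x) Y + E3 $ 2 * b1 (?d2 x) Y"
    if "Y \<in> tangent_space (atl D) x" for Y
    using exp[OF lin(1)[OF that]] exp[OF lin(2)[OF that]] by auto
  \<comment> \<open>Both sides are alternating in the two tangent vectors, so the equations in the frame are
    \<open>dt\<close> times those for the coordinate fields.\<close>
  have GT: "LT = b0 (?d1 x) (e2 x) * b0 (?d2 x) (e3 x) - b0 (?d1 x) (e3 x) * b0 (?d2 x) (e2 x)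
      + b1 (?d1 x) (e3 x) * b1 (?d2 x) (e2 x) - b1 (?d1 x) (e2 x) * b1 (?d2 x) (e3 x)" (is "_ = ?RT")
  proof -
    have "dt * LT = dt * ?RT" unfolding Gauss expb[OF t(3)] expb[OF t(4)] by (simp add: dt_def algebra_simps)
    then show ?thesis using dt by simp
  qed
  have GE: "LE = b1 (?d1 x) (e2 x) * b0 (?d2 x) (e2 x) - b0 (?d1 x) (e2 x) * b1 (?d2 x) (e2 x)
      + b0 (?d1 x) (e3 x) * b1 (?d2 x) (e3 x) - b1 (?d1 x) (e3 x) * b0 (?d2 x) (e3 x)" (is "_ = ?RE")
  proof -
    have "dt * LE = dt * ?RE" unfolding Ricci expb[OF t(3)] expb[OF t(4)] by (simp add: dt_def algebra_simps)
    then show ?thesis using dt by simp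
  qed

  have Cod: "nabla (bE D) (\<lambda>y. B y (?d2 y) (e y)) x (?d1 x) - nabla (bE D) (\<lambda>y. B y (?d1 y) (e y)) x (?d2 x) =
     B x (?d2 x) (nabla (bT D) e x (?d1 x)) - B x (?d1 x) (nabla (bT D) e x (?d2 x))" if e: "vector_field (atl D) N e" for e
  proof -
    have "deriv_bilinear (bT D) (bE D) B ?d1 ?d2 e x - deriv_bilinear (bT D) (bE D) B ?d2 ?d1 e x = 0"
      using codazzi[unfolded codazzi_equation_def, rule_format, of N ?d1 ?d2 e x] N v1 v2 e by blast
    then show ?thesis
      unfolding deriv_bilinear_def coord_fields_commute[OF c, of "axis 2 1" "axis 1 1"] by (simp add: algebra_simps)
  qed
  have sB: "smooth_section (atl D) (bE D) N (\<lambda>y. B y (Z y) (e y))" if "vector_field (atl D) N Z" "vector_field (atl D) N e" for Z e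
    by (rule form_smooth[OF N(1) that])
  define nB where "nB Z e X = nabla (bE D) (\<lambda>y. B y (Z y) (e y)) x X" for Z e X
  have nBf: "nB Z e X \<in> fib (bE D) x" if "vector_field (atl D) N Z" "vector_field (atl D) N e" "X \<in> tangent_space (atl D) x" for Z e X
    unfolding nB_def by (rule E.nabla_fib[OF N(1) sB[OF that(1,2)] N(2) that(3)])
  have db0: "has_mdiff (\<lambda>y. - met (bE D) y (B y (Z y) (e y)) (e0 y)) x (\<lambda>X. - (met (bE D) x (nB Z e X) (e0 x) + wE x X * b1 (Z x) (e x)))"
    and db1: "has_mdiff (\<lambda>y. met (bE D) y (B y (Z y) (e y)) (e1 y)) x (\<lambda>X. met (bE D) x (nB Z e X) (e1 x) - wE x X * b0 (Z x) (e x))"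
    if "vector_field (atl D) N Z" "vector_field (atl D) N e" for Z e
    using has_mdiff_minus[OF E.has_mdiff_coords(1)[OF N(1) fE' sB[OF that] N(2)]] E.has_mdiff_coords(2)[OF N(1) fE' sB[OF that] N(2)]
    unfolding nB_def wE_def b0_def b1_def by simp_all
  have nabT: "nabla (bT D) e2 x X = wT x X *\<^sub>R e3 x" "nabla (bT D) e3 x X = wT x X *\<^sub>R e2 x" if "X \<in> tangent_space (atl D) x" for X
    using T.nabla_oframe[OF N(1) fT' N(2) that] unfolding wT_def by auto
  have nBd: "nB ?d2 e2 (?d1 x) - nB ?d1 e2 (?d2 x) = wT x (?d1 x) *\<^sub>R B x (?d2 x) (e3 x) - wT x (?d2 x) *\<^sub>R B x (?d1 x) (e3 x)"
    "nB ?d2 e3 (?d1 x) - nB ?d1 e3 (?d2 x) = wT x (?d1 x) *\<^sub>R B x (?d2 x) (e2 x) - wT x (?d2 x) *\<^sub>R B x (?d1 x) (e2 x)"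
    unfolding nB_def Cod[OF vf(1)] Cod[OF vf(2)] nabT[OF t(1)] nabT[OF t(2)]
    by (simp_all add: form_scaleR_right t)
  have m: "met (bE D) x (nB ?d2 e2 (?d1 x)) \<nu> - met (bE D) x (nB ?d1 e2 (?d2 x)) \<nu> =
      wT x (?d1 x) * met (bE D) x (B x (?d2 x) (e3 x)) \<nu> - wT x (?d2 x) * met (bE D) x (B x (?d1 x) (e3 x)) \<nu>"
    "met (bE D) x (nB ?d2 e3 (?d1 x)) \<nu> - met (bE D) x (nB ?d1 e3 (?d2 x)) \<nu> =
      wT x (?d1 x) * met (bE D) x (B x (?d2 x) (e2 x)) \<nu> - wT x (?d2 x) * met (bE D) x (B x (?d1 x) (e2 x)) \<nu>"
    if \<nu>: "\<nu> \<in> fib (bE D) x" for \<nu>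
  proof -
    note d = E.met_diff_left[OF \<nu>]
    have 1: "met (bE D) x (r *\<^sub>R B x X Y - s *\<^sub>R B x X' Y') \<nu> = r * met (bE D) x (B x X Y) \<nu> - s * met (bE D) x (B x X' Y') \<nu>"
      if "X \<in> tangent_space (atl D) x" "Y \<in> tangent_space (atl D) x" "X' \<in> tangent_space (atl D) x" "Y' \<in> tangent_space (atl D) x" for r s X Y X' Y'
      by (simp add: d E.fib_scaleR form_fib that E.met_scaleR_left \<nu>)
    show "met (bE D) x (nB ?d2 e2 (?d1 x)) \<nu> - met (bE D) x (nB ?d1 e2 (?d2 x)) \<nu> =
      wT x (?d1 x) * met (bE D) x (B x (?d2 x) (e3 x)) \<nu> - wT x (?d2 x) * met (bE D) x (B x (?d1 x) (e3 x)) \<nu>"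
      unfolding d[OF nBf[OF v2 vf(1) t(1)] nBf[OF v1 vf(1) t(2)], symmetric] nBd by (rule 1[OF t(2,4,1,4)])
    show "met (bE D) x (nB ?d2 e3 (?d1 x)) \<nu> - met (bE D) x (nB ?d1 e3 (?d2 x)) \<nu> =
      wT x (?d1 x) * met (bE D) x (B x (?d2 x) (e2 x)) \<nu> - wT x (?d2 x) * met (bE D) x (B x (?d1 x) (e2 x)) \<nu>"
      unfolding d[OF nBf[OF v2 vf(2) t(1)] nBf[OF v1 vf(2) t(2)], symmetric] nBd by (rule 1[OF t(2,3,1,3)])
  qed

  have dlie: "d X = (mdiff (atl D) (\<lambda>y. wE y (Z y)) x X, mdiff (atl D) (\<lambda>y. wT y (Z y)) x X,
      - (met (bE D) x (nB Z e2 X) (e0 x) + wE x X * b1 (Z x) (e2 x)), - (met (bE D) x (nB Z e3 X) (e0 x) + wE x X * b1 (Z x) (e3 x)),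
      met (bE D) x (nB Z e2 X) (e1 x) - wE x X * b0 (Z x) (e2 x), met (bE D) x (nB Z e3 X) (e1 x) - wE x X * b0 (Z x) (e3 x))"
    if Z: "vector_field (atl D) N Z" and d: "has_mdiff (\<lambda>y. lie_at s1 s2 y (Z y)) x d" and X: "X \<in> tangent_space (atl D) x" for Z d X
    using has_mdiff_imp_mdiff[OF d X] has_mdiff_imp_mdiff[OF has_mdiff_Pair[OF smE[OF Z] has_mdiff_Pair[OF smT[OF Z]
       has_mdiff_Pair[OF db0[OF Z vf(1)] has_mdiff_Pair[OF db0[OF Z vf(2)] has_mdiff_Pair[OF db1[OF Z vf(1)] db1[OF Z vf(2)]]]]]] X]
    unfolding lie by simp
  show ?thesis
    unfolding dlie[OF v2 d2 t(1)] dlie[OF v1 d1 t(2)] liex lie_bracket_coords.simps diff_Pair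
    using GE GT m[OF oE(1)] m[OF oE(2)] by (simp add: LE_def LT_def b0_def b1_def algebra_simps)
qed

end

section \<open>Solutions of the spinor equation\<close>

context surface
begin

text \<open>The theorem on flat linear systems, carried to the surface by a chart.  It is used with the product of
  quaternions for the spinor equation, and with a nilpotent product for \<open>dF = \<xi>\<close>.\<close>

lemma local_linear_system:
  fixes A :: "'m \<Rightarrow> 'm tvec \<Rightarrow> 'a::real_normed_vector" and mul :: "'a \<Rightarrow> 'b::banach \<Rightarrow> 'b"
  assumes bil: "bounded_bilinear mul" and c: "chart_at \<A> x \<kappa>" and U: "open U" "x \<in> U"
    and lin: "\<And>y. y \<in> U \<Longrightarrow> linear_map_on (tangent_space \<A> y) (A y)"
    and sm: "msmooth_on \<A> (fst \<kappa> \<inter> U) (\<lambda>y. A y (coord1 \<kappa> y))" "msmooth_on \<A> (fst \<kappa> \<inter> U) (\<lambda>y. A y (coord2 \<kappa> y))"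
    and flat: "\<And>y d1 d2 v. y \<in> U \<Longrightarrow> chart_at \<A> y \<kappa> \<Longrightarrow> has_mdiff (\<lambda>z. A z (coord1 \<kappa> z)) y d1 \<Longrightarrow> has_mdiff (\<lambda>z. A z (coord2 \<kappa> z)) y d2 \<Longrightarrow>
      mul (d2 (coord1 \<kappa> y)) v - mul (d1 (coord2 \<kappa> y)) v =
      mul (A y (coord1 \<kappa> y)) (mul (A y (coord2 \<kappa> y)) v) - mul (A y (coord2 \<kappa> y)) (mul (A y (coord1 \<kappa> y)) v)"
  obtains r where "r > 0" "ball (snd \<kappa> x) r \<subseteq> snd \<kappa> ` (fst \<kappa> \<inter> U)"
    "\<And>c. \<exists>p. p x = c \<and> (\<forall>y\<in>chart_inv \<kappa> ` ball (snd \<kappa> x) r. has_mdiff p y (\<lambda>X. mul (A y X) (p y)))"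
proof -
  note c' = chart_at_D[OF c]
  define S where "S = snd \<kappa> ` (fst \<kappa> \<inter> U)"
  have S: "open S" "snd \<kappa> x \<in> S" using open_chart_image[OF c'(1) U(1)] c' U by (auto simp: S_def)
  have inS: "chart_at \<A> (chart_inv \<kappa> z) \<kappa>" "chart_inv \<kappa> z \<in> U" "snd \<kappa> (chart_inv \<kappa> z) = z" if "z \<in> S" for z
    using chart_inv_mem[OF c'(1) that[unfolded S_def]] c'(1) by (auto simp: chart_at_def)
  let ?A1 = "\<lambda>z. A (chart_inv \<kappa> z) (coord1 \<kappa> (chart_inv \<kappa> z))" and ?A2 = "\<lambda>z. A (chart_inv \<kappa> z) (coord2 \<kappa> (chart_inv \<kappa> z))"
  have eq: "fst \<kappa> \<inter> (fst \<kappa> \<inter> U) = fst \<kappa> \<inter> U" by auto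
  have smA: "smooth_on S ?A1" "smooth_on S ?A2"
    using msmooth_onD[OF sm(1) c'(1)] msmooth_onD[OF sm(2) c'(1)] unfolding S_def eq by auto
  have fl: "mul (frechet_derivative ?A2 (at z) (axis 1 1)) v - mul (frechet_derivative ?A1 (at z) (axis 2 1)) v =
      mul (?A1 z) (mul (?A2 z) v) - mul (?A2 z) (mul (?A1 z) v)" if z: "z \<in> S" for z v
  proof -
    let ?y = "chart_inv \<kappa> z"
    note y = inS[OF z]
    have ym: "?y \<in> fst \<kappa> \<inter> U" using y by (auto simp: chart_at_def)
    note d1 = msmooth_on_imp_has_mdiff[OF sm(1) ym] and d2 = msmooth_on_imp_has_mdiff[OF sm(2) ym]
    show ?thesis
      using flat[OF y(2,1) d1 d2, of v] frechet_coord[OF d1 y(1), of "axis 2 1"] frechet_coord[OF d2 y(1), of "axis 1 1"]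
      unfolding y(3) o_def by simp
  qed
  obtain r where r: "r > 0" "ball (snd \<kappa> x) r \<subseteq> S" and sol: "\<forall>c. \<exists>p. p (snd \<kappa> x) = c \<and> (\<forall>z\<in>ball (snd \<kappa> x) r.
    (p has_derivative (\<lambda>v. v $ 1 *\<^sub>R mul (?A1 z) (p z) + v $ 2 *\<^sub>R mul (?A2 z) (p z))) (at z))"
    using flat_linear_system_local_solution[OF S bil smA fl] by blast
  show thesis
  proof (rule that[OF r[unfolded S_def]])
    fix c
    obtain p where p: "p (snd \<kappa> x) = c" "\<And>z. z \<in> ball (snd \<kappa> x) r \<Longrightarrow>
      (p has_derivative (\<lambda>v. v $ 1 *\<^sub>R mul (?A1 z) (p z) + v $ 2 *\<^sub>R mul (?A2 z) (p z))) (at z)"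
      using sol by blast
    have "has_mdiff (\<lambda>y. p (snd \<kappa> y)) y (\<lambda>X. mul (A y X) (p (snd \<kappa> y)))" if y: "y \<in> chart_inv \<kappa> ` ball (snd \<kappa> x) r" for y
    proof -
      obtain z where z: "z \<in> ball (snd \<kappa> x) r" "y = chart_inv \<kappa> z" using y by blast
      note zS = inS[OF subsetD[OF r(2) z(1)], folded z(2)]
      have "(((\<lambda>y. p (snd \<kappa> y)) \<circ> chart_inv \<kappa>) has_derivative (\<lambda>v. v $ 1 *\<^sub>R mul (?A1 z) (p z) + v $ 2 *\<^sub>R mul (?A2 z) (p z))) (at z)"
        by (rule has_derivative_transform_within_open[OF p(2)[OF z(1)] open_ball z(1)]) (use inS(3) r(2) in auto)
      from has_mdiff_chartI[OF zS(1) this[folded zS(3)]]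
      show ?thesis
      proof (rule has_mdiff_cong_deriv)
        fix X assume X: "X \<in> tangent_space \<A> y"
        show "X \<kappa> $ 1 *\<^sub>R mul (?A1 (snd \<kappa> y)) (p (snd \<kappa> y)) + X \<kappa> $ 2 *\<^sub>R mul (?A2 (snd \<kappa> y)) (p (snd \<kappa> y)) = mul (A y X) (p (snd \<kappa> y))"
          unfolding linear_map_on_tangent[OF lin[OF zS(2)] X zS(1)] chart_props(6)[OF chart_at_D(1)[OF zS(1)] chart_at_D(2)[OF zS(1)]]
          by (simp add: bounded_bilinear.add_left[OF bil] bounded_bilinear.scaleR_left[OF bil])
      qed
    qed
    then show "\<exists>q. q x = c \<and> (\<forall>y\<in>chart_inv \<kappa> ` ball (snd \<kappa> x) r. has_mdiff q y (\<lambda>X. mul (A y X) (q y)))"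
      using p(1) by (intro exI[of _ "\<lambda>y. p (snd \<kappa> y)"]) blast
  qed
qed

text \<open>The derivative of the product is \<open>hconj p \<otimes> (- u + u) \<otimes> p'\<close>, since \<open>hconj\<close> reverses the sign on the Lie
  algebra.\<close>

lemma hconj_hmul_constant:
  assumes V: "open V" "connected V"
    and p: "\<And>y. y \<in> V \<Longrightarrow> has_mdiff p y (\<lambda>X. lie_elem (u y X) \<otimes> p y)"
    and p': "\<And>y. y \<in> V \<Longrightarrow> has_mdiff p' y (\<lambda>X. lie_elem (u y X) \<otimes> p' y)" and xy: "x \<in> V" "y \<in> V"
  shows "hconj (p x) \<otimes> p' x = hconj (p y) \<otimes> p' y"
proof (rule has_mdiff_zero_constant[OF V _ xy])
  fix z assume z: "z \<in> V"
  show "has_mdiff (\<lambda>z. hconj (p z) \<otimes> p' z) z (\<lambda>X. 0)"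
    by (rule has_mdiff_cong_deriv[OF has_mdiff_bilinear[OF bounded_bilinear_hmul has_mdiff_linear[OF bounded_linear_hconj p[OF z]] p'[OF z]]])
      (simp add: hconj_hmul hconj_lie_elem hmul.minus_right hmul.minus_left hmul_assoc)
qed

end

lemma (in locally_constant_sheaf) global_unique:
  assumes "connected (UNIV :: 'm set)" "\<And>x. P \<phi> x" "\<And>x. P \<psi> x" "\<phi> x0 = \<psi> x0"
  shows "\<phi> = \<psi>"
proof
  fix x
  show "\<phi> x = \<psi> x"
  proof (rule connected_induction_simple[where P = "\<lambda>z. \<phi> z = \<psi> z", OF assms(1) UNIV_I UNIV_I assms(4)])
    fix a :: 'm
    obtain V where "open V" "a \<in> V" "\<And>y z. y \<in> V \<Longrightarrow> z \<in> V \<Longrightarrow> \<phi> y = \<psi> y \<Longrightarrow> \<phi> z = \<psi> z"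
      by (rule local_dichotomy[OF open_UNIV _ open_UNIV _ UNIV_I UNIV_I, of \<phi> \<psi> a]) (simp_all add: assms(2,3))
    then show "\<exists>T. openin (top_of_set UNIV) T \<and> a \<in> T \<and> (\<forall>x\<in>T. \<forall>y\<in>T. \<phi> x = \<psi> x \<longrightarrow> \<phi> y = \<psi> y)"
      unfolding subtopology_UNIV open_openin[symmetric] by (intro exI[of _ V]) blast
  qed
qed

context spin_surface
begin

lemma smooth_principal_subset:
  assumes "smooth_principal_section (atl D) G S W s" "W' \<subseteq> W"
  shows "smooth_principal_section (atl D) G S W' s"
  unfolding smooth_principal_section_def
proof (intro conjI ballI)
  show "s x \<in> sfib S x" if "x \<in> W'" for x using assms that unfolding smooth_principal_section_def by blast
  fix t assume t: "t \<in> ssecs S"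
  obtain U r where Ur: "t = (U, r)" by (cases t)
  obtain g where g: "msmooth_on (atl D) (U \<inter> W) g" "\<forall>x\<in>U \<inter> W. g x \<in> G \<and> s x = sact S (r x) (g x)"
    using assms(1)[unfolded smooth_principal_section_def, THEN conjunct2, rule_format, OF t] Ur by auto
  have sub: "U \<inter> W' \<subseteq> U \<inter> W" using assms(2) by blast
  show "case t of (U, t) \<Rightarrow> \<exists>g. msmooth_on (atl D) (U \<inter> W') g \<and> (\<forall>x\<in>U \<inter> W'. g x \<in> G \<and> s x = sact S (t x) (g x))"
    unfolding Ur prod.case by (intro exI[of _ g] conjI msmooth_on_subset[OF g(1) sub]) (use g(2) sub in blast)
qed

lemma lie_elem_at_linear:
  assumes "adapted U s1 s2" "x \<in> U"
  shows "linear_map_on (tangent_space (atl D) x) (\<lambda>X. lie_elem (lie_at s1 s2 x X))"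
  using lie_at_linear[OF assms] unfolding linear_map_on_def by (simp add: lie_elem_hom del: lie_elem.simps)

lemma lie_elem_at_smooth:
  assumes ad: "adapted U s1 s2" and \<kappa>: "\<kappa> \<in> atl D"
  shows "msmooth_on (atl D) (fst \<kappa> \<inter> U) (\<lambda>y. lie_elem (lie_at s1 s2 y (coord_vector (atl D) \<kappa> w y)))"
proof -
  have o: "open (fst \<kappa> \<inter> U)" using chart_props(1)[OF \<kappa>] adaptedD(1)[OF ad] by auto
  have ad': "adapted (fst \<kappa> \<inter> U) s1 s2" by (rule adapted_subset[OF ad o]) auto
  show ?thesis
    by (intro msmooth_on_linear[OF o bounded_linear_lie_elem] lie_at_smooth[OF ad'] vector_field_subset[OF coord_vector_field[OF \<kappa>]]) auto
qed

text \<open>The local solution \<open>P\<close> with the value \<open>1\<close> at \<open>x\<close> stays in the group.  It has unit norm because \<open>hconj P \<otimes> P\<close> is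
  constant, and it lies in \<open>H0\<close> because \<open>htau P\<close> solves the same equation with the same value at \<open>x\<close>.\<close>

lemma local_unit_solution:
  assumes ad: "adapted U s1 s2" and x: "x \<in> U" and c: "chart_at (atl D) x \<kappa>"
  obtains r P where "r > 0" "ball (snd \<kappa> x) r \<subseteq> snd \<kappa> ` (fst \<kappa> \<inter> U)"
    "\<And>y. y \<in> chart_inv \<kappa> ` ball (snd \<kappa> x) r \<Longrightarrow> P y \<in> Spin22"
    "\<And>y. y \<in> chart_inv \<kappa> ` ball (snd \<kappa> x) r \<Longrightarrow> has_mdiff P y (\<lambda>X. lie_elem (lie_at s1 s2 y X) \<otimes> P y)"
proof -
  note c' = chart_at_D[OF c]
  have flat: "d2 (coord1 \<kappa> y) \<otimes> v - d1 (coord2 \<kappa> y) \<otimes> v =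
      lie_elem (lie_at s1 s2 y (coord1 \<kappa> y)) \<otimes> (lie_elem (lie_at s1 s2 y (coord2 \<kappa> y)) \<otimes> v) -
      lie_elem (lie_at s1 s2 y (coord2 \<kappa> y)) \<otimes> (lie_elem (lie_at s1 s2 y (coord1 \<kappa> y)) \<otimes> v)"
    if y: "y \<in> U" "chart_at (atl D) y \<kappa>" and d1: "has_mdiff (\<lambda>z. lie_elem (lie_at s1 s2 z (coord1 \<kappa> z))) y d1"
      and d2: "has_mdiff (\<lambda>z. lie_elem (lie_at s1 s2 z (coord2 \<kappa> z))) y d2" for y d1 d2 v
  proof -
    note y' = chart_at_D[OF y(2)]
    define N where "N = fst \<kappa> \<inter> U"
    have N: "open N" "y \<in> N" "N \<subseteq> U" "N \<subseteq> fst \<kappa>" using chart_props(1)[OF y'(1)] adaptedD(1)[OF ad] y y' by (auto simp: N_def)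
    note adN = adapted_subset[OF ad N(1,3)]
    have D: "has_mdiff (\<lambda>z. lie_at s1 s2 z (coord_vector (atl D) \<kappa> w z)) y (mdiff (atl D) (\<lambda>z. lie_at s1 s2 z (coord_vector (atl D) \<kappa> w z)) y)" for w
      by (rule msmooth_on_imp_has_mdiff[OF lie_at_smooth[OF adN vector_field_subset[OF coord_vector_field[OF y'(1)] N(4)]] N(2)])
    have e: "d1 (coord2 \<kappa> y) = lie_elem (mdiff (atl D) (\<lambda>z. lie_at s1 s2 z (coord1 \<kappa> z)) y (coord2 \<kappa> y))"
      "d2 (coord1 \<kappa> y) = lie_elem (mdiff (atl D) (\<lambda>z. lie_at s1 s2 z (coord2 \<kappa> z)) y (coord1 \<kappa> y))"
      using has_mdiff_imp_mdiff[OF d1 coord_vector_tangent[OF y(2)]] has_mdiff_imp_mdiff[OF d2 coord_vector_tangent[OF y(2)]]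
        has_mdiff_imp_mdiff[OF has_mdiff_linear[OF bounded_linear_lie_elem D] coord_vector_tangent[OF y(2)]] by metis+
    have "d2 (coord1 \<kappa> y) - d1 (coord2 \<kappa> y) = lie_elem (lie_bracket_coords (lie_at s1 s2 y (coord1 \<kappa> y)) (lie_at s1 s2 y (coord2 \<kappa> y)))"
      unfolding e lie_elem_hom(2)[symmetric] lie_at_flat[OF ad y D D] ..
    also have "\<dots> = lie_elem (lie_at s1 s2 y (coord1 \<kappa> y)) \<otimes> lie_elem (lie_at s1 s2 y (coord2 \<kappa> y)) -
      lie_elem (lie_at s1 s2 y (coord2 \<kappa> y)) \<otimes> lie_elem (lie_at s1 s2 y (coord1 \<kappa> y))"
      by (rule lie_elem_commutator[symmetric])
    finally show "d2 (coord1 \<kappa> y) \<otimes> v - d1 (coord2 \<kappa> y) \<otimes> v =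
      lie_elem (lie_at s1 s2 y (coord1 \<kappa> y)) \<otimes> (lie_elem (lie_at s1 s2 y (coord2 \<kappa> y)) \<otimes> v) -
      lie_elem (lie_at s1 s2 y (coord2 \<kappa> y)) \<otimes> (lie_elem (lie_at s1 s2 y (coord1 \<kappa> y)) \<otimes> v)"
      unfolding hmul.diff_left[symmetric] hmul_assoc[symmetric] by simp
  qed
  have "\<exists>r>0. ball (snd \<kappa> x) r \<subseteq> snd \<kappa> ` (fst \<kappa> \<inter> U) \<and>
      (\<forall>c. \<exists>p. p x = c \<and> (\<forall>y\<in>chart_inv \<kappa> ` ball (snd \<kappa> x) r. has_mdiff p y (\<lambda>X. lie_elem (lie_at s1 s2 y X) \<otimes> p y)))"
    by (rule local_linear_system[where A = "\<lambda>y X. lie_elem (lie_at s1 s2 y X)", OF bounded_bilinear_hmul c adaptedD(1)[OF ad] x lie_elem_at_linear[OF ad] lie_elem_at_smooth[OF ad c'(1)] lie_elem_at_smooth[OF ad c'(1)]], assumption, rule flat, assumption+, rule_tac x = r in exI, intro conjI allI, assumption, assumption, blast)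
  then obtain r where r: "r > 0" "ball (snd \<kappa> x) r \<subseteq> snd \<kappa> ` (fst \<kappa> \<inter> U)"
    and ex: "\<And>c. \<exists>p. p x = c \<and> (\<forall>y\<in>chart_inv \<kappa> ` ball (snd \<kappa> x) r. has_mdiff p y (\<lambda>X. lie_elem (lie_at s1 s2 y X) \<otimes> p y))"
    by (elim exE conjE) (rule that, assumption+, erule spec)
  define V where "V = chart_inv \<kappa> ` ball (snd \<kappa> x) r"
  have "ball (snd \<kappa> x) r \<subseteq> snd \<kappa> ` fst \<kappa>" using r(2) by blast
  note V = chart_ball_nbhd[OF c r(1) this, folded V_def]
  have conn: "connected V" using V(3) by (rule path_connected_imp_connected)
  obtain P where P: "P x = hone" "\<And>y. y \<in> V \<Longrightarrow> has_mdiff P y (\<lambda>X. lie_elem (lie_at s1 s2 y X) \<otimes> P y)"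
    using ex[of hone] unfolding V_def by blast
  have unit: "hconj (P y) \<otimes> P y = hone" if "y \<in> V" for y
    using hconj_hmul_constant[OF V(1) conn P(2) P(2) that V(2)] P(1) by simp
  have tau: "has_mdiff (\<lambda>y. htau (P y)) y (\<lambda>X. lie_elem (lie_at s1 s2 y X) \<otimes> htau (P y))" if "y \<in> V" for y
    by (rule has_mdiff_cong_deriv[OF has_mdiff_linear[OF bounded_linear_htau P(2)[OF that]]])
      (simp add: htau_hmul lie_elem_H0[unfolded H0_iff] del: lie_elem.simps)
  have "htau (P y) = P y" if y: "y \<in> V" for y
  proof -
    have "hconj (P y) \<otimes> htau (P y) = hone"
      using hconj_hmul_constant[OF V(1) conn P(2) tau y V(2)] P(1) hone_H0 by (simp add: H0_iff)
    then have "P y \<otimes> (hconj (P y) \<otimes> htau (P y)) = P y" by simp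
    then show ?thesis using unit_cancel(2)[OF unit[OF y]] by simp
  qed
  then have "P y \<in> Spin22" if "y \<in> V" for y using unit that by (simp add: Spin22_iff H0_iff)
  then show thesis using that[OF r] P(2) unfolding V_def by blast
qed

text \<open>The conditions on a solution, localized at a point.  The equation is required in all of the
  distinguished sections; by gauge covariance it suffices to check it in one of them (\<open>solves_atI\<close>).\<close>

definition solves_at :: "('m \<Rightarrow> ('q, 'p) spinor) \<Rightarrow> 'm \<Rightarrow> bool" where
  "solves_at \<phi> x \<longleftrightarrow> \<phi> x \<in> spinor_fibre D x \<and> spinor_H (\<phi> x) (\<phi> x) = aconst 1 \<and>
    (\<forall>W1 r1 W2 r2. (W1, r1) \<in> ssecs (sE D) \<longrightarrow> (W2, r2) \<in> ssecs (sT D) \<longrightarrow> x \<in> W1 \<inter> W2 \<longrightarrow> spinor_eq_at \<phi> x r1 r2)"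

definition unit_spinors :: "'m \<Rightarrow> ('q, 'p) spinor set" where
  "unit_spinors x = {\<psi> \<in> spinor_fibre D x. spinor_H \<psi> \<psi> = aconst 1}"

lemma unit_spinor_coord:
  assumes "q \<in> spin_frames D x" "\<psi> \<in> spinor_fibre D x"
  shows "spinor_H \<psi> \<psi> = aconst 1 \<longleftrightarrow> spinor_coord \<psi> q \<in> Spin22"
  using spinor_H_coord[OF assms(2,1)] spinor_coord_H0[OF assms(2,1)] by (simp add: Spin22_iff hform_eq_1_iff)

lemma solves_atI:
  assumes V: "open V" "x \<in> V" and fib: "\<And>y. y \<in> V \<Longrightarrow> \<phi> y \<in> spinor_fibre D y" and H: "spinor_H (\<phi> x) (\<phi> x) = aconst 1"
    and r: "(W1, r1) \<in> ssecs (sE D)" "(W2, r2) \<in> ssecs (sT D)" "x \<in> W1 \<inter> W2" and eq: "spinor_eq_at \<phi> x r1 r2"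
  shows "solves_at \<phi> x"
  unfolding solves_at_def
proof (intro conjI allI impI)
  fix U1 t1 U2 t2 assume t: "(U1, t1) \<in> ssecs (sE D)" "(U2, t2) \<in> ssecs (sT D)" "x \<in> U1 \<inter> U2"
  note S = section_adapted[OF t(1,2)]
  have o: "open (U1 \<inter> U2)" using S by auto
  show "spinor_eq_at \<phi> x t1 t2"
    by (rule spinor_eq_at_transfer[OF r o t(3) smooth_principal_subset[OF S(4)] smooth_principal_subset[OF S(5)] V fib eq]) auto
qed (use fib H V in auto)

text \<open>With the local solution \<open>P\<close> in \<open>Spin22\<close>, the solutions over the domain of \<open>P\<close> have the coordinates
  \<open>P \<otimes> a\<close>, where the constant \<open>a\<close> is determined by the value at one point.\<close>

lemma spinor_sheaf: "locally_constant_sheaf solves_at unit_spinors"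
proof
  fix V x and \<phi> \<psi> :: "'m \<Rightarrow> ('q, 'p) spinor"
  assume V: "open V" "x \<in> V" "\<And>y. y \<in> V \<Longrightarrow> \<phi> y = \<psi> y" and P: "solves_at \<phi> x"
  have "spinor_eq_at \<psi> x r1 r2" if "spinor_eq_at \<phi> x r1 r2" for r1 r2
    using that unfolding spinor_eq_at_def V(3)[OF V(2)] by (rule has_mdiff_cong[OF V(1,2), rotated]) (simp add: V(3))
  then show "solves_at \<psi> x" using P unfolding solves_at_def V(3)[OF V(2)] by blast
next
  fix \<phi> :: "'m \<Rightarrow> ('q, 'p) spinor" and x assume "solves_at \<phi> x"
  then show "\<phi> x \<in> unit_spinors x" unfolding solves_at_def unit_spinors_def by blast
next
  fix U and x :: 'm assume U: "open U" "x \<in> U"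
  obtain W1 s1 W2 s2 where s: "(W1, s1) \<in> ssecs (sE D)" "(W2, s2) \<in> ssecs (sT D)" "x \<in> W1 \<inter> W2" by (rule ex_section)
  note ad = section_adapted(1)[OF s(1,2)]
  obtain \<kappa> where c: "chart_at (atl D) x \<kappa>" by (rule ex_chart)
  note c' = chart_at_D[OF c]
  have o: "open (W1 \<inter> W2 \<inter> U)" using adaptedD(1)[OF ad] U by auto
  have adU: "adapted (W1 \<inter> W2 \<inter> U) s1 s2" by (rule adapted_subset[OF ad o]) auto
  obtain r P where r: "r > 0" "ball (snd \<kappa> x) r \<subseteq> snd \<kappa> ` (fst \<kappa> \<inter> (W1 \<inter> W2 \<inter> U))"
    and P: "\<And>y. y \<in> chart_inv \<kappa> ` ball (snd \<kappa> x) r \<Longrightarrow> P y \<in> Spin22"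
    "\<And>y. y \<in> chart_inv \<kappa> ` ball (snd \<kappa> x) r \<Longrightarrow> has_mdiff P y (\<lambda>X. lie_elem (lie_at s1 s2 y X) \<otimes> P y)"
    using local_unit_solution[OF adU _ c] s(3) U(2) by blast
  define V where "V = chart_inv \<kappa> ` ball (snd \<kappa> x) r"
  have "ball (snd \<kappa> x) r \<subseteq> snd \<kappa> ` fst \<kappa>" using r(2) by blast
  note V = chart_ball_nbhd[OF c r(1) this, folded V_def]
  have conn: "connected V" using V(3) by (rule path_connected_imp_connected)
  have VU: "V \<subseteq> W1 \<inter> W2 \<inter> U" using r(2) chart_inv_mem(1)[OF c'(1)] unfolding V_def by blast
  have fr: "(s1 y, s2 y) \<in> spin_frames D y" if "y \<in> V" for y using adaptedD(2)[OF adU] VU that by blast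
  note P = P[folded V_def]
  have ex: "\<exists>\<phi>. \<phi> y = c \<and> (\<forall>z\<in>V. solves_at \<phi> z)" if y: "y \<in> V" and c: "c \<in> unit_spinors y" for y c
  proof -
    define pc where "pc = spinor_coord c (s1 y, s2 y)"
    have c': "c \<in> spinor_fibre D y" "pc \<in> Spin22"
      using c unit_spinor_coord[OF fr[OF y]] by (auto simp: unit_spinors_def pc_def)
    define a where "a = hconj (P y) \<otimes> pc"
    have a: "a \<in> Spin22" unfolding a_def by (intro Spin22_hmul Spin22_hconj P(1) y c')
    define \<phi> where "\<phi> z = spinor_class D (s1 z, s2 z) (P z \<otimes> a)" for z
    have Pa: "P z \<otimes> a \<in> Spin22" if "z \<in> V" for z by (intro Spin22_hmul P(1) that a)
    have \<phi>: "\<phi> z \<in> spinor_fibre D z" "spinor_coord (\<phi> z) (s1 z, s2 z) = P z \<otimes> a" if "z \<in> V" for z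
      using spinor_class_fibre[OF fr[OF that]] Pa[OF that] unfolding \<phi>_def by (auto simp: Spin22_iff)
    have "\<phi> y = c"
    proof (rule spinor_eqI[OF \<phi>(1)[OF y] c'(1) fr[OF y]])
      show "spinor_coord (\<phi> y) (s1 y, s2 y) = spinor_coord c (s1 y, s2 y)"
        unfolding \<phi>(2)[OF y] a_def pc_def[symmetric] using P(1)[OF y] by (simp add: Spin22_iff unit_cancel)
    qed
    moreover have "solves_at \<phi> z" if z: "z \<in> V" for z
    proof (rule solves_atI[OF V(1) z \<phi>(1) _ s(1,2)])
      show "spinor_H (\<phi> z) (\<phi> z) = aconst 1" using unit_spinor_coord[OF fr[OF z] \<phi>(1)[OF z]] \<phi>(2)[OF z] Pa[OF z] by simp
      show "z \<in> W1 \<inter> W2" using VU z by blast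
      show "spinor_eq_at \<phi> z s1 s2"
        unfolding spinor_eq_at_def \<phi>(2)[OF z]
      proof (rule has_mdiff_cong[OF V(1) z])
        show "P y \<otimes> a = spinor_coord (\<phi> y) (s1 y, s2 y)" if "y \<in> V" for y using \<phi>(2)[OF that] by simp
        show "has_mdiff (\<lambda>y. P y \<otimes> a) z (\<lambda>X. lie_elem (lie_at s1 s2 z X) \<otimes> (P z \<otimes> a))"
          using has_mdiff_linear[OF hmul.bounded_linear_left P(2)[OF z]] unfolding hmul_assoc .
      qed
    qed
    ultimately show ?thesis by blast
  qed
  have uniq: "\<phi> z = \<psi> z" if sol: "\<forall>z\<in>V. solves_at \<phi> z \<and> solves_at \<psi> z" and y: "y \<in> V" "\<phi> y = \<psi> y" and z: "z \<in> V" for \<phi> \<psi> y z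
  proof -
    have fib: "\<phi> w \<in> spinor_fibre D w" "\<psi> w \<in> spinor_fibre D w" "spinor_H (\<phi> w) (\<phi> w) = aconst 1" if "w \<in> V" for w
      using sol that unfolding solves_at_def by blast+
    have eqs: "spinor_eq_at \<phi> w s1 s2" "spinor_eq_at \<psi> w s1 s2" if "w \<in> V" for w
      using sol that VU s(1,2) unfolding solves_at_def by blast+
    have u: "hconj (spinor_coord (\<phi> w) (s1 w, s2 w)) \<otimes> spinor_coord (\<phi> w) (s1 w, s2 w) = hone" if "w \<in> V" for w
      using unit_spinor_coord[OF fr[OF that] fib(1)[OF that]] fib(3)[OF that] by (simp add: Spin22_iff)
    have "hconj (spinor_coord (\<phi> z) (s1 z, s2 z)) \<otimes> spinor_coord (\<psi> z) (s1 z, s2 z) =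
      hconj (spinor_coord (\<phi> y) (s1 y, s2 y)) \<otimes> spinor_coord (\<psi> y) (s1 y, s2 y)"
      by (rule hconj_hmul_constant[where u = "lie_at s1 s2", OF V(1) conn eqs(1)[unfolded spinor_eq_at_def] eqs(2)[unfolded spinor_eq_at_def] z y(1)])
    also have "\<dots> = hone" unfolding y(2)[symmetric] by (rule u[OF y(1)])
    finally have "spinor_coord (\<phi> z) (s1 z, s2 z) \<otimes> (hconj (spinor_coord (\<phi> z) (s1 z, s2 z)) \<otimes> spinor_coord (\<psi> z) (s1 z, s2 z)) =
      spinor_coord (\<phi> z) (s1 z, s2 z)" by simp
    then have "spinor_coord (\<phi> z) (s1 z, s2 z) = spinor_coord (\<psi> z) (s1 z, s2 z)" unfolding unit_cancel(2)[OF u[OF z]] by simp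
    then show ?thesis by (rule spinor_eqI[OF fib(1,2)[OF z] fr[OF z]])
  qed
  show "\<exists>V. open V \<and> x \<in> V \<and> V \<subseteq> U \<and> path_connected V \<and>
       (\<forall>y\<in>V. \<forall>c\<in>unit_spinors y. \<exists>\<phi>. \<phi> y = c \<and> (\<forall>z\<in>V. solves_at \<phi> z)) \<and>
       (\<forall>\<phi> \<psi>. (\<forall>z\<in>V. solves_at \<phi> z \<and> solves_at \<psi> z) \<longrightarrow> (\<exists>y\<in>V. \<phi> y = \<psi> y) \<longrightarrow> (\<forall>z\<in>V. \<phi> z = \<psi> z))"
  proof (intro exI[of _ V] conjI allI impI ballI)
    show "V \<subseteq> U" using VU by blast
    show "\<exists>\<phi>. \<phi> y = c \<and> (\<forall>z\<in>V. solves_at \<phi> z)" if "y \<in> V" "c \<in> unit_spinors y" for y c by (rule ex[OF that])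
    show "\<phi> z = \<psi> z" if sol: "\<forall>z\<in>V. solves_at \<phi> z \<and> solves_at \<psi> z" and y: "\<exists>y\<in>V. \<phi> y = \<psi> y" and z: "z \<in> V" for \<phi> \<psi> z
    proof -
      obtain y where "y \<in> V" "\<phi> y = \<psi> y" using y by (rule bexE)
      then show ?thesis by (rule uniq[OF sol _ _ z])
    qed
  qed (rule V(1-3))+
qed

lemma solution_smooth:
  assumes sol: "\<And>x. solves_at \<phi> x" and r: "(W1, r1) \<in> ssecs (sE D)" "(W2, r2) \<in> ssecs (sT D)"
  shows "msmooth_on (atl D) (W1 \<inter> W2) (\<lambda>x. spinor_coord (\<phi> x) (r1 x, r2 x))"
proof (rule msmooth_on_linear_system[OF _ bounded_bilinear_hmul])
  note R = section_adapted[OF r]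
  show "open (W1 \<inter> W2)" using R by auto
  show "has_mdiff (\<lambda>x. spinor_coord (\<phi> x) (r1 x, r2 x)) x (\<lambda>X. lie_elem (lie_at r1 r2 x X) \<otimes> spinor_coord (\<phi> x) (r1 x, r2 x))"
    if "x \<in> W1 \<inter> W2" for x
    using sol[of x] r that unfolding solves_at_def spinor_eq_at_def by blast
  show "msmooth_on (atl D) (W1 \<inter> W2 \<inter> fst \<kappa>) (\<lambda>x. lie_elem (lie_at r1 r2 x (coord_vector (atl D) \<kappa> w x)))" if "\<kappa> \<in> atl D" for \<kappa> w
    using lie_elem_at_smooth[OF R(1) that, of w] by (simp add: Int_commute)
qed

text \<open>The derivative of a spinor field is tested in all smooth sections, which amounts to one section by gauge
  covariance.  The smoothness of a solution follows from the equation.\<close>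

lemma spinor_solution_iff: "spinor_solution D B \<phi> \<longleftrightarrow> (\<forall>x. solves_at \<phi> x)"
proof
  assume sol: "spinor_solution D B \<phi>"
  note s = sol[unfolded spinor_solution_def]
  have fields: "\<phi> \<in> spinor_fields D" using s by blast
  have fib: "\<phi> x \<in> spinor_fibre D x" for x using fields unfolding spinor_fields_def by blast
  show "\<forall>x. solves_at \<phi> x"
  proof
    fix x
    obtain W1 r1 W2 r2 where r: "(W1, r1) \<in> ssecs (sE D)" "(W2, r2) \<in> ssecs (sT D)" "x \<in> W1 \<inter> W2" by (rule ex_section)
    note R = section_adapted[OF r(1,2)]
    have o: "open (W1 \<inter> W2)" using R by auto
    note p = smooth_principal_subset[OF R(4) Int_lower1[of W1 W2]] smooth_principal_subset[OF R(5) Int_lower2[of W1 W2]]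
    have "\<forall>t1\<in>ssecs (sE D). \<forall>t2\<in>ssecs (sT D). msmooth_on (atl D) (fst t1 \<inter> fst t2) (\<lambda>x. spinor_coord (\<phi> x) (snd t1 x, snd t2 x))"
      using fields unfolding spinor_fields_def by (simp add: case_prod_unfold)
    from this[rule_format, OF r(1,2)] have "msmooth_on (atl D) (W1 \<inter> W2) (\<lambda>x. spinor_coord (\<phi> x) (r1 x, r2 x))" by simp
    note d = msmooth_on_imp_has_mdiff[OF this r(3)]
    obtain q where q: "q \<in> spin_frames D x" by (rule ex_spin_frame)
    obtain f2 f3 where f: "(f2, f3) \<in> oframes (bT D) x" using frame_oframes(2)[OF q] by (metis prod.exhaust)
    have "spinor_eq_at \<phi> x r1 r2"
      unfolding spinor_eq_at_def
    proof (rule has_mdiff_cong_deriv[OF d])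
      fix X assume X: "X \<in> tangent_space (atl D) x"
      have "has_spinor_deriv D \<phi> x X (eta_action D B x f2 f3 X (\<phi> x))"
        using s X f by blast
      from this[unfolded has_spinor_deriv_eta[where \<phi> = \<phi>, OF f X fib], rule_format, OF conjI[OF o conjI[OF r(3) conjI[OF p]]]]
      show "mdiff (atl D) (\<lambda>x. spinor_coord (\<phi> x) (r1 x, r2 x)) x X = lie_elem (lie_at r1 r2 x X) \<otimes> spinor_coord (\<phi> x) (r1 x, r2 x)"
        by simp
    qed
    then show "solves_at \<phi> x" by (intro solves_atI[OF open_UNIV UNIV_I fib _ r]) (use s in blast)+
  qed
next
  assume sol: "\<forall>x. solves_at \<phi> x"
  have fib: "\<phi> x \<in> spinor_fibre D x" for x using sol unfolding solves_at_def by blast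
  have "\<phi> \<in> spinor_fields D"
    unfolding spinor_fields_def using fib solution_smooth sol by blast
  moreover have "has_spinor_deriv D \<phi> x X (eta_action D B x f2 f3 X (\<phi> x))"
    if X: "X \<in> tangent_space (atl D) x" and f: "(f2, f3) \<in> oframes (bT D) x" for x X f2 f3
    unfolding has_spinor_deriv_eta[where \<phi> = \<phi>, OF f X fib]
  proof (intro allI impI)
    fix W s1 s2 assume s: "open W \<and> x \<in> W \<and> smooth_principal_section (atl D) SpinE (sE D) W s1 \<and> smooth_principal_section (atl D) SpinM (sT D) W s2"
    obtain W1 r1 W2 r2 where r: "(W1, r1) \<in> ssecs (sE D)" "(W2, r2) \<in> ssecs (sT D)" "x \<in> W1 \<inter> W2" by (rule ex_section)
    have "spinor_eq_at \<phi> x r1 r2" using sol r unfolding solves_at_def by blast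
    moreover have s': "open W" "x \<in> W" "smooth_principal_section (atl D) SpinE (sE D) W s1" "smooth_principal_section (atl D) SpinM (sT D) W s2"
      using s by simp_all
    ultimately have "spinor_eq_at \<phi> x s1 s2"
      by (intro spinor_eq_at_transfer[OF r s' open_UNIV UNIV_I fib])
    from has_mdiff_imp_mdiff[OF this[unfolded spinor_eq_at_def] X]
    show "mdiff (atl D) (\<lambda>y. spinor_coord (\<phi> y) (s1 y, s2 y)) x X = lie_elem (lie_at s1 s2 x X) \<otimes> spinor_coord (\<phi> x) (s1 x, s2 x)" .
  qed
  ultimately show "spinor_solution D B \<phi>"
    unfolding spinor_solution_def using sol unfolding solves_at_def by blast
qed

theorem ex_spinor_solution:
  assumes "simply_connected (UNIV :: 'm set)" shows "\<exists>\<phi>. spinor_solution D B \<phi>"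
proof -
  interpret locally_constant_sheaf solves_at unit_spinors by (rule spinor_sheaf)
  fix x0 :: 'm
  obtain q where q: "q \<in> spin_frames D x0" by (rule ex_spin_frame)
  have "hone \<in> Spin22" by (simp add: Spin22_iff hone_H0)
  then have "spinor_class D q hone \<in> unit_spinors x0"
    using spinor_class_fibre[OF q hone_H0] unit_spinor_coord[OF q] by (simp add: unit_spinors_def)
  from global_solution[OF assms this] show ?thesis unfolding spinor_solution_iff by blast
qed

lemma solves_at_right:
  assumes sol: "\<And>x. solves_at \<phi> x" and a: "a \<in> Spin22"
  shows "solves_at (\<lambda>x. spinor_right (\<phi> x) a) x"
proof -
  have aH: "a \<in> H0" using a by (simp add: Spin22_iff)
  have fib: "\<phi> x \<in> spinor_fibre D x" for x using sol unfolding solves_at_def by blast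
  note R = spinor_right_fibre[OF fib aH]
  obtain W1 r1 W2 r2 where r: "(W1, r1) \<in> ssecs (sE D)" "(W2, r2) \<in> ssecs (sT D)" "x \<in> W1 \<inter> W2" by (rule ex_section)
  note ad = section_adapted(1)[OF r(1,2)]
  note fr = adaptedD(2)[OF ad]
  show ?thesis
  proof (rule solves_atI[OF open_UNIV UNIV_I R(1) _ r])
    have "spinor_coord (\<phi> x) (r1 x, r2 x) \<in> Spin22"
      using unit_spinor_coord[OF fr[OF r(3)] fib] sol[of x] unfolding solves_at_def by blast
    then show "spinor_H (spinor_right (\<phi> x) a) (spinor_right (\<phi> x) a) = aconst 1"
      unfolding unit_spinor_coord[OF fr[OF r(3)] R(1)] R(2)[OF fr[OF r(3)]] using a by (rule Spin22_hmul)
    have eq: "spinor_eq_at \<phi> x r1 r2" using sol[of x] r unfolding solves_at_def by blast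
    show "spinor_eq_at (\<lambda>x. spinor_right (\<phi> x) a) x r1 r2"
      unfolding spinor_eq_at_def R(2)[OF fr[OF r(3)]]
    proof (rule has_mdiff_cong[OF adaptedD(1)[OF ad] r(3)])
      show "spinor_coord (\<phi> y) (r1 y, r2 y) \<otimes> a = spinor_coord (spinor_right (\<phi> y) a) (r1 y, r2 y)" if "y \<in> W1 \<inter> W2" for y
        using R(2)[OF fr[OF that]] by simp
      show "has_mdiff (\<lambda>y. spinor_coord (\<phi> y) (r1 y, r2 y) \<otimes> a) x (\<lambda>X. lie_elem (lie_at r1 r2 x X) \<otimes> (spinor_coord (\<phi> x) (r1 x, r2 x) \<otimes> a))"
        using has_mdiff_linear[OF hmul.bounded_linear_left eq[unfolded spinor_eq_at_def]] unfolding hmul_assoc .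
    qed
  qed
qed

text \<open>The constant \<open>a\<close> is read off at one point; both sides are solutions with the same value there.\<close>

theorem spinor_solution_unique:
  assumes conn: "connected (UNIV :: 'm set)" and \<phi>: "spinor_solution D B \<phi>"
  shows "spinor_solution D B \<phi>' \<longleftrightarrow> (\<exists>a\<in>Spin22. \<phi>' = (\<lambda>x. spinor_right (\<phi> x) a))"
proof
  assume "spinor_solution D B \<phi>'"
  then have sol: "solves_at \<phi> x" "solves_at \<phi>' x" for x using \<phi> unfolding spinor_solution_iff by auto
  fix x0 :: 'm
  obtain q where q: "q \<in> spin_frames D x0" by (rule ex_spin_frame)
  have fib: "\<phi> x \<in> spinor_fibre D x" "\<phi>' x \<in> spinor_fibre D x" for x using sol unfolding solves_at_def by blast+
  have p: "spinor_coord (\<phi> x0) q \<in> Spin22" "spinor_coord (\<phi>' x0) q \<in> Spin22"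
    using unit_spinor_coord[OF q fib(1)] unit_spinor_coord[OF q fib(2)] sol[of x0] unfolding solves_at_def by blast+
  define a where "a = hconj (spinor_coord (\<phi> x0) q) \<otimes> spinor_coord (\<phi>' x0) q"
  have a: "a \<in> Spin22" unfolding a_def by (intro Spin22_hmul Spin22_hconj p)
  then have aH: "a \<in> H0" by (simp add: Spin22_iff)
  note R = spinor_right_fibre[OF fib(1) aH]
  have "spinor_coord (\<phi>' x0) q = spinor_coord (spinor_right (\<phi> x0) a) q"
    unfolding R(2)[OF q] unfolding a_def using p(1) by (simp add: Spin22_iff unit_cancel)
  then have eq: "\<phi>' x0 = spinor_right (\<phi> x0) a" by (rule spinor_eqI[OF fib(2) R(1) q])
  interpret locally_constant_sheaf solves_at unit_spinors by (rule spinor_sheaf)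
  have "\<phi>' = (\<lambda>x. spinor_right (\<phi> x) a)"
    by (rule global_unique[OF conn sol(2) solves_at_right[OF sol(1) a] eq])
  with a show "\<exists>a\<in>Spin22. \<phi>' = (\<lambda>x. spinor_right (\<phi> x) a)" by blast
next
  assume "\<exists>a\<in>Spin22. \<phi>' = (\<lambda>x. spinor_right (\<phi> x) a)"
  then show "spinor_solution D B \<phi>'" using \<phi> solves_at_right unfolding spinor_solution_iff by blast
qed

end

section \<open>The immersion\<close>

context lorentz_bundle
begin

lemma section_zero: "open W \<Longrightarrow> smooth_section \<A> V W (\<lambda>x. 0)"
  unfolding smooth_section_def
  by (rule section_onI) (auto simp: fib_zero intro!: exI[of _ "\<lambda>x. 0"] msmooth_on_const)

lemma nabla_zero:
  assumes "open W" "x \<in> W" "X \<in> tangent_space \<A> x" shows "nabla V (\<lambda>y. 0) x X = 0"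
proof -
  have "nabla V (\<lambda>y. 0 *\<^sub>R 0) x X = mdiff \<A> (\<lambda>y. 0 :: real) x X *\<^sub>R 0 + 0 *\<^sub>R nabla V (\<lambda>y. 0) x X"
    by (rule nabla_scaleR[OF assms(1) section_zero[OF assms(1)] msmooth_on_const assms(2,3)])
  then show ?thesis by simp
qed

lemma met_ext:
  assumes f: "(a, b) \<in> oframes V x" and \<nu>: "\<nu> \<in> fib V x" "\<mu> \<in> fib V x"
    and eq: "met V x \<nu> a = met V x \<mu> a" "met V x \<nu> b = met V x \<mu> b"
  shows "\<nu> = \<mu>"
  using oframeD(7)[OF f \<nu>(1)] oframeD(7)[OF f \<nu>(2)] eq by simp

end

text \<open>The derivatives of the two factors \<open>p\<close> combine to the infinitesimal action of \<open>u\<close> on the vector between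
  them.\<close>

lemma (in surface) has_mdiff_spin_rot:
  assumes p: "has_mdiff p x (\<lambda>X. lie_elem (u X) \<otimes> p x)" and z: "has_mdiff z x dz"
  shows "has_mdiff (\<lambda>y. spin_rot (p y) (r22_to_hac (z y))) x (\<lambda>X. spin_rot (p x) (r22_to_hac (dz X + lie_action (u X) (z x))))"
proof -
  note Z = has_mdiff_linear[OF bounded_linear_r22_to_hac z]
  note d = has_mdiff_minus[OF has_mdiff_bilinear[OF bounded_bilinear_hmul has_mdiff_bilinear[OF bounded_bilinear_hmul has_mdiff_linear[OF bounded_linear_hconj p] Z]
    has_mdiff_linear[OF bounded_linear_hhat p]]]
  show ?thesis
    unfolding spin_rot_def
  proof (rule has_mdiff_cong_deriv[OF d])
    fix X
    show "- (hconj (p x) \<otimes> r22_to_hac (z x) \<otimes> hhat (lie_elem (u X) \<otimes> p x) +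
          (hconj (p x) \<otimes> r22_to_hac (dz X) + hconj (lie_elem (u X) \<otimes> p x) \<otimes> r22_to_hac (z x)) \<otimes> hhat (p x)) =
      - (hconj (p x) \<otimes> r22_to_hac (dz X + lie_action (u X) (z x)) \<otimes> hhat (p x))"
      unfolding r22_to_hac_hom(1) lie_elem_action[symmetric] hconj_hmul hhat_hmul hconj_lie_elem
      by (simp add: hmul.add_left hmul.add_right hmul.diff_left hmul.diff_right hmul.minus_left hmul.minus_right hmul_assoc del: lie_elem.simps)
  qed
qed

context spin_surface
begin

text \<open>The trivialization \<open>Z \<mapsto> \<langle>\<langle>Z \<cdot> \<phi>, \<phi>\<rangle>\<rangle>\<close> of \<open>E \<oplus> TM\<close>.  For a solution \<open>\<phi>\<close> the pairing represents a vector,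
  so that \<open>hac_to_r22\<close> loses nothing (\<open>ambient_coord\<close>).\<close>

definition ambient :: "('m \<Rightarrow> ('q, 'p) spinor) \<Rightarrow> 'm \<Rightarrow> 'v \<times> 'm tvec \<Rightarrow> r22" where
  "ambient \<phi> x Z = hac_to_r22 (spinor_pairing (clifford D x Z (\<phi> x)) (\<phi> x))"

lemma zero_tangent: "0 \<in> tangent_space (atl D) x"
  using T.fib_zero[of x] by (simp add: tangent_fib)

lemma frame_coords_add:
  assumes q: "q \<in> spin_frames D x" and Z: "\<nu> \<in> fib (bE D) x" "X \<in> tangent_space (atl D) x" "\<nu>' \<in> fib (bE D) x" "X' \<in> tangent_space (atl D) x"
  shows "frame_coords x q (\<nu> + \<nu>', X + X') = frame_coords x q (\<nu>, X) + frame_coords x q (\<nu>', X')"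
  using frame_tangent[OF q] Z unfolding frame_coords_def
  by (simp add: E.met_simps T.met_simps tangent_fib del: plus_fun_apply)

lemma frame_coords_scaleR:
  assumes q: "q \<in> spin_frames D x" and Z: "\<nu> \<in> fib (bE D) x" "X \<in> tangent_space (atl D) x"
  shows "frame_coords x q (r *\<^sub>R \<nu>, r *\<^sub>R X) = r *\<^sub>R frame_coords x q (\<nu>, X)"
  using frame_tangent[OF q] Z unfolding frame_coords_def
  by (simp add: E.met_simps T.met_simps tangent_fib)

lemma frame_coords_metric:
  assumes q: "q \<in> spin_frames D x" and Z: "\<nu> \<in> fib (bE D) x" "X \<in> tangent_space (atl D) x" "\<nu>' \<in> fib (bE D) x" "X' \<in> tangent_space (atl D) x"
  shows "metric22 (frame_coords x q (\<nu>, X)) (frame_coords x q (\<nu>', X')) = met (bE D) x \<nu> \<nu>' + met (bT D) x X X'"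
proof -
  obtain e f where q': "q = (e, f)" by (cases q)
  obtain a b where e: "sframe (sE D) e = (a, b)" by (cases "sframe (sE D) e")
  obtain c d where f: "sframe (sT D) f = (c, d)" by (cases "sframe (sT D) f")
  have o: "(a, b) \<in> oframes (bE D) x" "(c, d) \<in> oframes (bT D) x" using frame_oframes[OF q] q' e f by auto
  show ?thesis unfolding frame_coords_def E.met_oframe[OF o(1) Z(1,3)] T.met_oframe[OF o(2) Z(2,4)[folded tangent_fib]]
    by (simp add: q' e f)
qed

context
  fixes \<phi> assumes sol: "\<And>x. solves_at \<phi> x"
begin

lemma solution_fib: "\<phi> x \<in> spinor_fibre D x"
  using sol[of x] unfolding solves_at_def by (rule conjunct1)

lemma solution_unit: "q \<in> spin_frames D x \<Longrightarrow> spinor_coord (\<phi> x) q \<in> Spin22"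
  using unit_spinor_coord[OF _ solution_fib, of q x] sol[of x] unfolding solves_at_def by blast

lemma ambient_coord:
  assumes q: "q \<in> spin_frames D x" and Z: "\<nu> \<in> fib (bE D) x" "X \<in> tangent_space (atl D) x"
  shows "r22_to_hac (ambient \<phi> x (\<nu>, X)) = spinor_pairing (clifford D x (\<nu>, X) (\<phi> x)) (\<phi> x)"
    "r22_to_hac (ambient \<phi> x (\<nu>, X)) = spin_rot (spinor_coord (\<phi> x) q) (r22_to_hac (frame_coords x q (\<nu>, X)))"
  using spin_rot_r22 solution_unit[OF q] unfolding ambient_def spinor_pairing_coord[OF solution_fib Z q] vector_coord_frame_coords
  by (auto simp: Spin22_iff)

lemma ambient_add:
  assumes Z: "\<nu> \<in> fib (bE D) x" "X \<in> tangent_space (atl D) x" "\<nu>' \<in> fib (bE D) x" "X' \<in> tangent_space (atl D) x"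
  shows "ambient \<phi> x (\<nu> + \<nu>', X + X') = ambient \<phi> x (\<nu>, X) + ambient \<phi> x (\<nu>', X')"
proof -
  obtain q where q: "q \<in> spin_frames D x" by (rule ex_spin_frame)
  show ?thesis
    unfolding r22_to_hac_inj[symmetric] r22_to_hac_hom(1) ambient_coord(2)[OF q Z(1,2)] ambient_coord(2)[OF q Z(3,4)]
      ambient_coord(2)[OF q E.fib_add[OF Z(1,3)] tangent_add[OF Z(2,4)]] frame_coords_add[OF q Z] spin_rot_add ..
qed

lemma ambient_scaleR:
  assumes Z: "\<nu> \<in> fib (bE D) x" "X \<in> tangent_space (atl D) x"
  shows "ambient \<phi> x (r *\<^sub>R \<nu>, r *\<^sub>R X) = r *\<^sub>R ambient \<phi> x (\<nu>, X)"
proof -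
  obtain q where q: "q \<in> spin_frames D x" by (rule ex_spin_frame)
  show ?thesis
    unfolding r22_to_hac_inj[symmetric] r22_to_hac_hom(4) ambient_coord(2)[OF q Z]
      ambient_coord(2)[OF q E.fib_scaleR[OF Z(1)] tangent_scaleR[OF Z(2)]] frame_coords_scaleR[OF q Z] spin_rot_scaleR ..
qed

lemma ambient_split:
  assumes Z: "\<nu> \<in> fib (bE D) x" "X \<in> tangent_space (atl D) x"
  shows "ambient \<phi> x (\<nu>, X) = ambient \<phi> x (\<nu>, 0) + ambient \<phi> x (0, X)"
  using ambient_add[OF Z(1) zero_tangent E.fib_zero Z(2)] by (simp del: plus_fun_apply)

lemma ambient_linear:
  "linear_map_on (tangent_space (atl D) x) (\<lambda>X. ambient \<phi> x (0, X))" "linear_map_on (fib (bE D) x) (\<lambda>\<nu>. ambient \<phi> x (\<nu>, 0))"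
proof -
  show "linear_map_on (tangent_space (atl D) x) (\<lambda>X. ambient \<phi> x (0, X))"
    unfolding linear_map_on_def
    using ambient_add[OF E.fib_zero _ E.fib_zero] ambient_scaleR[OF E.fib_zero] by simp
  show "linear_map_on (fib (bE D) x) (\<lambda>\<nu>. ambient \<phi> x (\<nu>, 0))"
    unfolding linear_map_on_def
    using ambient_add[OF _ zero_tangent _ zero_tangent] ambient_scaleR[OF _ zero_tangent] by simp
qed

lemma ambient_metric:
  assumes Z: "\<nu> \<in> fib (bE D) x" "X \<in> tangent_space (atl D) x" "\<nu>' \<in> fib (bE D) x" "X' \<in> tangent_space (atl D) x"
  shows "metric22 (ambient \<phi> x (\<nu>, X)) (ambient \<phi> x (\<nu>', X')) = met (bE D) x \<nu> \<nu>' + met (bT D) x X X'"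
proof -
  obtain q where q: "q \<in> spin_frames D x" by (rule ex_spin_frame)
  show ?thesis
    using spin_rot_metric[OF solution_unit[OF q] ambient_coord(2)[OF q Z(1,2)] ambient_coord(2)[OF q Z(3,4)]] frame_coords_metric[OF q Z] by simp
qed

lemma ambient_inj:
  assumes Z: "\<nu> \<in> fib (bE D) x" "X \<in> tangent_space (atl D) x" "\<nu>' \<in> fib (bE D) x" "X' \<in> tangent_space (atl D) x"
    and eq: "ambient \<phi> x (\<nu>, X) = ambient \<phi> x (\<nu>', X')"
  shows "\<nu> = \<nu>'" "X = X'"
proof -
  obtain q where q: "q \<in> spin_frames D x" by (rule ex_spin_frame)
  note o = frame_oframes[OF q] and t = frame_tangent[OF q]
  have met: "met (bE D) x \<nu> \<mu> + met (bT D) x X Y = met (bE D) x \<nu>' \<mu> + met (bT D) x X' Y"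
    if "\<mu> \<in> fib (bE D) x" "Y \<in> tangent_space (atl D) x" for \<mu> Y
    using ambient_metric[OF Z(1,2) that] ambient_metric[OF Z(3,4) that] eq by simp
  have z: "met (bT D) x X 0 = 0" "met (bT D) x X' 0 = 0" "met (bE D) x \<nu> 0 = 0" "met (bE D) x \<nu>' 0 = 0"
    using T.met_zero_left T.met_sym E.met_zero_left E.met_sym Z T.fib_zero E.fib_zero unfolding tangent_fib by metis+
  show "\<nu> = \<nu>'"
    by (rule E.met_ext[OF _ Z(1,3), of "fst (sframe (sE D) (fst q))" "snd (sframe (sE D) (fst q))"])
      (use o met[OF t(3) zero_tangent] met[OF t(4) zero_tangent] z in auto)
  show "X = X'"
    by (rule T.met_ext[OF _ Z(2,4)[folded tangent_fib], of "fst (sframe (sT D) (snd q))" "snd (sframe (sT D) (snd q))"])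
      (use o met[OF E.fib_zero t(1)] met[OF E.fib_zero t(2)] z in \<open>auto simp: E.met_zero_left E.fib_zero\<close>)
qed

text \<open>The rotation by \<open>hconj p\<close> is inverse to the rotation by \<open>p\<close>.\<close>

lemma ambient_surj:
  obtains \<nu> X where "\<nu> \<in> fib (bE D) x" "X \<in> tangent_space (atl D) x" "ambient \<phi> x (\<nu>, X) = w"
proof -
  obtain q where q: "q \<in> spin_frames D x" by (rule ex_spin_frame)
  define p where "p = spinor_coord (\<phi> x) q"
  have p: "hconj p \<otimes> p = hone" "hconj p \<in> H0" using solution_unit[OF q] by (auto simp: p_def Spin22_iff H0_hconj)
  obtain z0 z1 z2 z3 where z: "hac_to_r22 (spin_rot (hconj p) (r22_to_hac w)) = (z0, z1, z2, z3)" by (metis prod.exhaust)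
  obtain a b where e: "sframe (sE D) (fst q) = (a, b)" by (cases "sframe (sE D) (fst q)")
  obtain c d where f: "sframe (sT D) (snd q) = (c, d)" by (cases "sframe (sT D) (snd q)")
  have o: "(a, b) \<in> oframes (bE D) x" "(c, d) \<in> oframes (bT D) x" using frame_oframes[OF q] e f by auto
  note oE = E.oframeD(1-6)[OF o(1)] and oT = T.oframeD(1-6)[OF o(2)]
  define \<nu> X where "\<nu> = z0 *\<^sub>R a + z1 *\<^sub>R b" and "X = z2 *\<^sub>R c + z3 *\<^sub>R d"
  have mem: "\<nu> \<in> fib (bE D) x" "X \<in> tangent_space (atl D) x"
    using oE oT unfolding \<nu>_def X_def tangent_fib[symmetric] by (auto intro!: E.fib_add E.fib_scaleR T.fib_add T.fib_scaleR)
  have "frame_coords x q (\<nu>, X) = (z0, z1, z2, z3)"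
    unfolding frame_coords_def \<nu>_def X_def fst_conv snd_conv e f using oE oT by (simp add: E.met_simps T.met_simps)
  then have "r22_to_hac (ambient \<phi> x (\<nu>, X)) = spin_rot p (spin_rot (hconj p) (r22_to_hac w))"
    using ambient_coord(2)[OF q mem] spin_rot_r22[OF p(2), of w] unfolding z[symmetric] p_def[symmetric] by simp
  also have "\<dots> = (hconj p \<otimes> p) \<otimes> r22_to_hac w \<otimes> hhat (hconj p \<otimes> p)"
    by (simp add: spin_rot_def hmul_assoc hhat_hmul hmul.minus_left hmul.minus_right)
  also have "\<dots> = r22_to_hac w" using p(1) by simp
  finally show thesis using that mem by (simp add: r22_to_hac_inj)
qed

text \<open>The formulas of Gauss and Weingarten.  The coordinates of a section are differentiated by
  \<open>has_mdiff_coords\<close>, which brings in the connection forms; these cancel against the first two components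
  of the Lie algebra action, and the other four components contribute \<open>B\<close> and the shape operator.\<close>

lemma ambient_deriv:
  assumes U: "open U" "x \<in> U" and \<nu>: "smooth_section (atl D) (bE D) U \<nu>" and Y: "vector_field (atl D) U Y"
  shows "has_mdiff (\<lambda>y. ambient \<phi> y (\<nu> y, Y y)) x (\<lambda>X. ambient \<phi> x
    (nabla (bE D) \<nu> x X + B x X (Y x), nabla (bT D) Y x X - shape_operator (bT D) (bE D) B x (\<nu> x) X))"
    and "\<exists>N. open N \<and> x \<in> N \<and> msmooth_on (atl D) (U \<inter> N) (\<lambda>y. ambient \<phi> y (\<nu> y, Y y))"
proof -
  obtain W1 r1 W2 r2 where r: "(W1, r1) \<in> ssecs (sE D)" "(W2, r2) \<in> ssecs (sT D)" "x \<in> W1 \<inter> W2" by (rule ex_section)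
  note R = section_adapted[OF r(1,2)]
  define N where "N = U \<inter> (W1 \<inter> W2)"
  have N: "open N" "x \<in> N" "N \<subseteq> U" "N \<subseteq> W1 \<inter> W2" using U R r(3) by (auto simp: N_def)
  note ad = adapted_subset[OF R(1) N(1,4)]
  note q = adaptedD(2)[OF ad]
  note \<nu>N = E.section_subset[OF \<nu> N(3)] and YN = vector_field_subset[OF Y N(3)]
  have mem: "\<nu> y \<in> fib (bE D) y" "Y y \<in> tangent_space (atl D) y" if "y \<in> N" for y
    using E.section_fib[OF \<nu>N that] vector_field_tangent[OF YN that] .
  define p z where "p y = spinor_coord (\<phi> y) (r1 y, r2 y)" and "z y = frame_coords y (r1 y, r2 y) (\<nu> y, Y y)" for y
  have amb: "ambient \<phi> y (\<nu> y, Y y) = hac_to_r22 (spin_rot (p y) (r22_to_hac (z y)))" if "y \<in> N" for y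
    using ambient_coord(2)[OF q[OF that] mem[OF that]] unfolding p_def z_def by (metis hac_to_r22_inverse)
  note cE = E.has_mdiff_coords[OF N(1) adaptedD(3)[OF ad] \<nu>N N(2)]
  note cT = T.has_mdiff_coords[OF N(1) adaptedD(4)[OF ad] YN[folded tangent_section] N(2)]
  define dz where "dz X = (- (met (bE D) x (nabla (bE D) \<nu> x X) (eE0 r1 x) + E.conn_form (eE0 r1) (eE1 r1) x X * met (bE D) x (\<nu> x) (eE1 r1 x)),
    met (bE D) x (nabla (bE D) \<nu> x X) (eE1 r1 x) + E.conn_form (eE0 r1) (eE1 r1) x X * met (bE D) x (\<nu> x) (eE0 r1 x),
    - (met (bT D) x (nabla (bT D) Y x X) (eT0 r2 x) + T.conn_form (eT0 r2) (eT1 r2) x X * met (bT D) x (Y x) (eT1 r2 x)),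
    met (bT D) x (nabla (bT D) Y x X) (eT1 r2 x) + T.conn_form (eT0 r2) (eT1 r2) x X * met (bT D) x (Y x) (eT0 r2 x))" for X
  have dz: "has_mdiff z x dz"
    unfolding z_def[abs_def] dz_def[abs_def] frame_coords_def fst_conv snd_conv
    by (intro has_mdiff_Pair has_mdiff_minus cE cT)
  have dp: "has_mdiff p x (\<lambda>X. lie_elem (lie_at r1 r2 x X) \<otimes> p x)"
    using sol[of x] r unfolding solves_at_def spinor_eq_at_def p_def by blast
  have sE: "eE0 r1 x \<in> fib (bE D) x" "eE1 r1 x \<in> fib (bE D) x" "eT0 r2 x \<in> tangent_space (atl D) x" "eT1 r2 x \<in> tangent_space (atl D) x"
    using frame_tangent[OF q[OF N(2)]] by auto
  note of = frame_oframes[OF q[OF N(2)], unfolded fst_conv snd_conv]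
  have oE: "(eE0 r1 x, eE1 r1 x) \<in> oframes (bE D) x" and oT: "(eT0 r2 x, eT1 r2 x) \<in> oframes (bT D) x" using of by simp_all
  show "has_mdiff (\<lambda>y. ambient \<phi> y (\<nu> y, Y y)) x (\<lambda>X. ambient \<phi> x
    (nabla (bE D) \<nu> x X + B x X (Y x), nabla (bT D) Y x X - shape_operator (bT D) (bE D) B x (\<nu> x) X))"
  proof (rule has_mdiff_cong[OF N(1,2) amb[symmetric]])
    show "has_mdiff (\<lambda>y. hac_to_r22 (spin_rot (p y) (r22_to_hac (z y)))) x (\<lambda>X. ambient \<phi> x
      (nabla (bE D) \<nu> x X + B x X (Y x), nabla (bT D) Y x X - shape_operator (bT D) (bE D) B x (\<nu> x) X))"
    proof (rule has_mdiff_cong_deriv[OF has_mdiff_linear[OF bounded_linear_hac_to_r22 has_mdiff_spin_rot[OF dp dz]]])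
      fix X assume X: "X \<in> tangent_space (atl D) x"
      note Yx = mem[OF N(2)]
      define n where "n = nabla (bE D) \<nu> x X"
      define m where "m = nabla (bT D) Y x X"
      have n: "n \<in> fib (bE D) x" unfolding n_def by (rule E.nabla_fib[OF N(1) \<nu>N N(2) X])
      have m: "m \<in> tangent_space (atl D) x" unfolding m_def using T.nabla_fib[OF N(1) YN[folded tangent_section] N(2) X] by (simp add: tangent_fib)
      note S = shape_operator_frame[OF Yx(1) X oT]
      have Sm: "shape_operator (bT D) (bE D) B x (\<nu> x) X \<in> tangent_space (atl D) x"
        unfolding S by (intro tangent_add tangent_scaleR sE)
      define f0 f1 e0 e1 where fe: "f0 = eT0 r2 x" "f1 = eT1 r2 x" "e0 = eE0 r1 x" "e1 = eE1 r1 x"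
      note sE' = sE[folded fe] and oE' = oE[folded fe] and oT' = oT[folded fe]
      have Bf: "B x X f0 \<in> fib (bE D) x" "B x X f1 \<in> fib (bE D) x" using form_fib[OF X] sE' by auto
      have BY: "B x X (Y x) = (- met (bT D) x (Y x) f0) *\<^sub>R B x X f0 + met (bT D) x (Y x) f1 *\<^sub>R B x X f1"
        (is "_ = ?a *\<^sub>R _ + ?b *\<^sub>R _")
      proof -
        have "Y x = ?a *\<^sub>R f0 + ?b *\<^sub>R f1" using T.oframeD(7)[OF oT'] Yx(2) unfolding tangent_fib by blast
        then have "B x X (Y x) = B x X (?a *\<^sub>R f0 + ?b *\<^sub>R f1)" by (rule arg_cong)
        also have "\<dots> = B x X (?a *\<^sub>R f0) + B x X (?b *\<^sub>R f1)" by (intro form_add_right X tangent_scaleR sE')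
        also have "\<dots> = ?a *\<^sub>R B x X f0 + ?b *\<^sub>R B x X f1" unfolding form_scaleR_right[OF X sE'(3)] form_scaleR_right[OF X sE'(4)] ..
        finally show ?thesis .
      qed
      have Bm: "met (bE D) x (B x X (Y x)) e = - met (bT D) x (Y x) f0 * met (bE D) x (B x X f0) e + met (bT D) x (Y x) f1 * met (bE D) x (B x X f1) e"
        if "e \<in> fib (bE D) x" for e
        unfolding BY using Bf that by (simp add: E.met_simps E.met_diff_left)
      define s where "s = shape_operator (bT D) (bE D) B x (\<nu> x) X"
      note S = shape_operator_frame[OF Yx(1) X oT', folded s_def]
      have sm: "s \<in> tangent_space (atl D) x" unfolding S by (intro tangent_add tangent_scaleR sE')
      have St: "met (bT D) x s f0 = met (bE D) x (B x X f0) (\<nu> x)" "met (bT D) x s f1 = met (bE D) x (B x X f1) (\<nu> x)"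
        unfolding S using T.oframeD(1-6)[OF oT'] by (simp_all add: T.met_simps T.met_diff_left)
      note M = T.met_diff_left[unfolded tangent_fib, OF sE'(3) m sm] T.met_diff_left[unfolded tangent_fib, OF sE'(4) m sm]
        E.met_add_left[OF sE'(1) n form_fib[OF X Yx(2)]] E.met_add_left[OF sE'(2) n form_fib[OF X Yx(2)]]
        Bm[OF sE'(1)] Bm[OF sE'(2)] St E.met_oframe[OF oE' Bf(1) Yx(1)] E.met_oframe[OF oE' Bf(2) Yx(1)]
      have "dz X + lie_action (lie_at r1 r2 x X) (z x) = frame_coords x (r1 x, r2 x) (n + B x X (Y x), m - s)"
        unfolding dz_def lie_at_def z_def frame_coords_def fst_conv snd_conv lie_action.simps add_Pair
          n_def[symmetric] m_def[symmetric] fe[symmetric] M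
        by (simp add: algebra_simps)
      then show "hac_to_r22 (spin_rot (p x) (r22_to_hac (dz X + lie_action (lie_at r1 r2 x X) (z x)))) =
        ambient \<phi> x (nabla (bE D) \<nu> x X + B x X (Y x), nabla (bT D) Y x X - shape_operator (bT D) (bE D) B x (\<nu> x) X)"
        using ambient_coord(2)[OF q[OF N(2)] E.fib_add[OF n form_fib[OF X Yx(2)]] T.fib_diff[unfolded tangent_fib, OF m sm]]
        unfolding n_def[symmetric] m_def[symmetric] s_def[symmetric] p_def by (metis hac_to_r22_inverse)
    qed
  qed
  show "\<exists>N. open N \<and> x \<in> N \<and> msmooth_on (atl D) (U \<inter> N) (\<lambda>y. ambient \<phi> y (\<nu> y, Y y))"
  proof (intro exI conjI)
    show "open N" "x \<in> N" by (rule N)+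
    have sm: "msmooth_on (atl D) N p" unfolding p_def[abs_def] by (rule msmooth_on_subset[OF solution_smooth[OF sol r(1,2)] N(4)])
    have zsm: "msmooth_on (atl D) N z"
      unfolding z_def[abs_def] frame_coords_def fst_conv snd_conv
      by (intro msmooth_on_Pair msmooth_on_minus N(1) E.met_smooth T.met_smooth \<nu>N YN[folded tangent_section]
        E.oframe_onD(1)[OF adaptedD(3)[OF ad]] E.oframe_onD(2)[OF adaptedD(3)[OF ad]] T.oframe_onD(1)[OF adaptedD(4)[OF ad]] T.oframe_onD(2)[OF adaptedD(4)[OF ad]])
    have "msmooth_on (atl D) N (\<lambda>y. hac_to_r22 (spin_rot (p y) (r22_to_hac (z y))))"
      unfolding spin_rot_def
      by (intro msmooth_on_linear[OF N(1) bounded_linear_hac_to_r22] msmooth_on_minus msmooth_on_bilinear[OF N(1) bounded_bilinear_hmul]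
        msmooth_on_linear[OF N(1) bounded_linear_hconj] msmooth_on_linear[OF N(1) bounded_linear_hhat] msmooth_on_linear[OF N(1) bounded_linear_r22_to_hac] sm zsm N(1))
    then have "msmooth_on (atl D) N (\<lambda>y. ambient \<phi> y (\<nu> y, Y y))" by (rule msmooth_on_cong[OF N(1), rotated]) (rule amb[symmetric])
    then show "msmooth_on (atl D) (U \<inter> N) (\<lambda>y. ambient \<phi> y (\<nu> y, Y y))" by (rule msmooth_on_subset) auto
  qed
qed

lemma ambient_smooth:
  assumes U: "open U" and \<nu>: "smooth_section (atl D) (bE D) U \<nu>" and Y: "vector_field (atl D) U Y"
  shows "msmooth_on (atl D) U (\<lambda>y. ambient \<phi> y (\<nu> y, Y y))"
  by (rule msmooth_on_local) (rule ambient_deriv(2)[OF U _ \<nu> Y])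

lemma zero_vector_field: "open U \<Longrightarrow> vector_field (atl D) U (\<lambda>y. 0)"
  using T.section_zero unfolding tangent_section .

lemma shape_operator_zero: "X \<in> tangent_space (atl D) x \<Longrightarrow> shape_operator (bT D) (bE D) B x 0 X = 0"
proof -
  assume X: "X \<in> tangent_space (atl D) x"
  obtain q where q: "q \<in> spin_frames D x" by (rule ex_spin_frame)
  obtain c d where f: "(c, d) \<in> oframes (bT D) x" using frame_oframes(2)[OF q] by (metis prod.exhaust)
  have t: "c \<in> tangent_space (atl D) x" "d \<in> tangent_space (atl D) x" using T.oframeD(1,2)[OF f] by (auto simp: tangent_fib)
  have "met (bE D) x (B x X e) 0 = 0" if "e \<in> tangent_space (atl D) x" for e
    using E.met_sym[OF form_fib[OF X that] E.fib_zero] E.met_zero_left[OF form_fib[OF X that]] by simp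
  then show ?thesis unfolding shape_operator_frame[OF E.fib_zero X f] using t by simp
qed

lemma ambient_tangent_deriv:
  assumes U: "open U" "x \<in> U" and Y: "vector_field (atl D) U Y"
  shows "has_mdiff (\<lambda>y. ambient \<phi> y (0, Y y)) x (\<lambda>X. ambient \<phi> x (B x X (Y x), nabla (bT D) Y x X))"
  by (rule has_mdiff_cong_deriv[OF ambient_deriv(1)[OF U E.section_zero[OF U(1)] Y]])
    (simp add: shape_operator_zero E.nabla_zero[OF U])

lemma ambient_normal_deriv:
  assumes U: "open U" "x \<in> U" and \<nu>: "smooth_section (atl D) (bE D) U \<nu>"
  shows "has_mdiff (\<lambda>y. ambient \<phi> y (\<nu> y, 0)) x (\<lambda>X. ambient \<phi> x (nabla (bE D) \<nu> x X, - shape_operator (bT D) (bE D) B x (\<nu> x) X))"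
proof (rule has_mdiff_cong_deriv[OF ambient_deriv(1)[OF U \<nu> zero_vector_field[OF U(1)]]])
  fix X assume X: "X \<in> tangent_space (atl D) x"
  have "B x X 0 = 0" using form_scaleR_right[OF X zero_tangent, of 0] by simp
  then show "ambient \<phi> x (nabla (bE D) \<nu> x X + B x X 0, nabla (bT D) (\<lambda>y. 0) x X - shape_operator (bT D) (bE D) B x (\<nu> x) X) =
    ambient \<phi> x (nabla (bE D) \<nu> x X, - shape_operator (bT D) (bE D) B x (\<nu> x) X)"
    by (simp add: T.nabla_zero[OF U X])
qed

text \<open>The inhomogeneous equation \<open>dF = \<xi>\<close> is a homogeneous linear system for \<open>(F, 1)\<close>.  Since the product of
  two of the occurring maps vanishes, flatness of this system is closedness of \<open>\<xi>\<close>.\<close>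

lemma bounded_bilinear_affine: "bounded_bilinear (\<lambda>(a :: r22) (w :: r22 \<times> real). (snd w *\<^sub>R a, 0))"
  unfolding bilinear_conv_bounded_bilinear[symmetric] bilinear_def linear_iff by (auto simp: algebra_simps)

text \<open>On two coordinate fields, \<open>d\<xi>\<close> is the image under the trivialization of
  \<open>B(\<partial>\<^sub>1, \<partial>\<^sub>2) - B(\<partial>\<^sub>2, \<partial>\<^sub>1)\<close> and of the commutator of the covariant derivatives, and both vanish.\<close>

lemma immersion_sheaf: "locally_constant_sheaf (\<lambda>F x. has_mdiff F x (\<lambda>X. ambient \<phi> x (0, X))) (\<lambda>x. UNIV)"
proof
  show "has_mdiff g x (\<lambda>X. ambient \<phi> x (0, X))" if "open V" "x \<in> V" "\<And>y. y \<in> V \<Longrightarrow> f y = g y" "has_mdiff f x (\<lambda>X. ambient \<phi> x (0, X))" for V x f g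
    by (rule has_mdiff_cong[OF that])
next
  fix U and x :: 'm assume U: "open U" "x \<in> U"
  obtain \<kappa> where c: "chart_at (atl D) x \<kappa>" by (rule ex_chart)
  note c' = chart_at_D[OF c]
  let ?mul = "\<lambda>(a :: r22) (w :: r22 \<times> real). (snd w *\<^sub>R a, 0 :: real)"
  have o: "open (fst \<kappa> \<inter> U)" using chart_props(1)[OF c'(1)] U by auto
  have sm: "msmooth_on (atl D) (fst \<kappa> \<inter> U) (\<lambda>y. ambient \<phi> y (0, coord_vector (atl D) \<kappa> w y))" for w
    by (rule ambient_smooth[OF o E.section_zero[OF o] vector_field_subset[OF coord_vector_field[OF c'(1)]]]) auto
  have flat: "?mul (d2 (coord1 \<kappa> y)) v - ?mul (d1 (coord2 \<kappa> y)) v =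
      ?mul (ambient \<phi> y (0, coord1 \<kappa> y)) (?mul (ambient \<phi> y (0, coord2 \<kappa> y)) v) -
      ?mul (ambient \<phi> y (0, coord2 \<kappa> y)) (?mul (ambient \<phi> y (0, coord1 \<kappa> y)) v)"
    if y: "y \<in> U" "chart_at (atl D) y \<kappa>" and d1: "has_mdiff (\<lambda>z. ambient \<phi> z (0, coord1 \<kappa> z)) y d1"
      and d2: "has_mdiff (\<lambda>z. ambient \<phi> z (0, coord2 \<kappa> z)) y d2" for y d1 d2 v
  proof -
    note y' = chart_at_D[OF y(2)]
    have D: "has_mdiff (\<lambda>z. ambient \<phi> z (0, coord_vector (atl D) \<kappa> w z)) y
        (\<lambda>X. ambient \<phi> y (B y X (coord_vector (atl D) \<kappa> w y), nabla (bT D) (coord_vector (atl D) \<kappa> w) y X))" for w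
      by (rule ambient_tangent_deriv[OF chart_props(1)[OF y'(1)] y'(2) coord_vector_field[OF y'(1)]])
    note t = coord_vector_tangent[OF y(2)]
    have "d2 (coord1 \<kappa> y) = ambient \<phi> y (B y (coord1 \<kappa> y) (coord2 \<kappa> y), nabla (bT D) (coord2 \<kappa>) y (coord1 \<kappa> y))"
      by (rule trans[OF has_mdiff_imp_mdiff[OF d2 t, symmetric] has_mdiff_imp_mdiff[OF D t]])
    moreover have "d1 (coord2 \<kappa> y) = ambient \<phi> y (B y (coord2 \<kappa> y) (coord1 \<kappa> y), nabla (bT D) (coord1 \<kappa>) y (coord2 \<kappa> y))"
      by (rule trans[OF has_mdiff_imp_mdiff[OF d1 t, symmetric] has_mdiff_imp_mdiff[OF D t]])
    ultimately have "d2 (coord1 \<kappa> y) = d1 (coord2 \<kappa> y)"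
      unfolding form_sym[OF t t, of "axis 1 1" "axis 2 1"] coord_fields_commute[OF y(2), of "axis 2 1" "axis 1 1"] by simp
    then show ?thesis by simp
  qed
  have "\<exists>r>0. ball (snd \<kappa> x) r \<subseteq> snd \<kappa> ` (fst \<kappa> \<inter> U) \<and>
      (\<forall>c. \<exists>p. p x = c \<and> (\<forall>y\<in>chart_inv \<kappa> ` ball (snd \<kappa> x) r. has_mdiff p y (\<lambda>X. ?mul (ambient \<phi> y (0, X)) (p y))))"
    by (rule local_linear_system[where A = "\<lambda>y X. ambient \<phi> y (0, X)", OF bounded_bilinear_affine c U ambient_linear(1) sm sm],
      rule flat, assumption+, rule_tac x = r in exI, intro conjI allI, assumption, assumption, blast)
  then obtain r where r: "r > 0" "ball (snd \<kappa> x) r \<subseteq> snd \<kappa> ` (fst \<kappa> \<inter> U)"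
    and ex: "\<And>c. \<exists>p. p x = c \<and> (\<forall>y\<in>chart_inv \<kappa> ` ball (snd \<kappa> x) r. has_mdiff p y (\<lambda>X. ?mul (ambient \<phi> y (0, X)) (p y)))"
    by (elim exE conjE) (rule that, assumption+, erule spec)
  define V where "V = chart_inv \<kappa> ` ball (snd \<kappa> x) r"
  have "ball (snd \<kappa> x) r \<subseteq> snd \<kappa> ` fst \<kappa>" using r(2) by blast
  note V = chart_ball_nbhd[OF c r(1) this, folded V_def]
  have conn: "connected V" using V(3) by (rule path_connected_imp_connected)
  have VU: "V \<subseteq> U" using r(2) chart_inv_mem(1)[OF c'(1)] unfolding V_def by blast
  obtain p where p: "p x = (0, 1)" "\<And>y. y \<in> V \<Longrightarrow> has_mdiff p y (\<lambda>X. ?mul (ambient \<phi> y (0, X)) (p y))"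
    using ex[of "(0, 1)"] unfolding V_def by blast
  have p2: "snd (p y) = 1" if "y \<in> V" for y
    using has_mdiff_zero_constant[OF V(1) conn _ that V(2), of "\<lambda>y. snd (p y)"] has_mdiff_linear[OF bounded_linear_snd p(2)] p(1) by simp
  have p1: "has_mdiff (\<lambda>y. fst (p y)) y (\<lambda>X. ambient \<phi> y (0, X))" if "y \<in> V" for y
    using has_mdiff_linear[OF bounded_linear_fst p(2)[OF that]] p2[OF that] by simp
  show "\<exists>V. open V \<and> x \<in> V \<and> V \<subseteq> U \<and> path_connected V \<and>
       (\<forall>y\<in>V. \<forall>c\<in>UNIV. \<exists>F. F y = c \<and> (\<forall>z\<in>V. has_mdiff F z (\<lambda>X. ambient \<phi> z (0, X)))) \<and>
       (\<forall>F G. (\<forall>z\<in>V. has_mdiff F z (\<lambda>X. ambient \<phi> z (0, X)) \<and> has_mdiff G z (\<lambda>X. ambient \<phi> z (0, X))) \<longrightarrow>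
         (\<exists>y\<in>V. F y = G y) \<longrightarrow> (\<forall>z\<in>V. F z = G z))"
  proof (intro exI[of _ V] conjI allI impI ballI)
    fix y c assume y: "y \<in> V"
    have "has_mdiff (\<lambda>z. fst (p z) + (c - fst (p y))) z (\<lambda>X. ambient \<phi> z (0, X))" if "z \<in> V" for z
      using has_mdiff_add[OF p1[OF that] has_mdiff_const] by simp
    then show "\<exists>F. F y = c \<and> (\<forall>z\<in>V. has_mdiff F z (\<lambda>X. ambient \<phi> z (0, X)))"
      by (intro exI[of _ "\<lambda>z. fst (p z) + (c - fst (p y))"]) simp
  next
    fix F G z assume FG: "\<forall>z\<in>V. has_mdiff F z (\<lambda>X. ambient \<phi> z (0, X)) \<and> has_mdiff G z (\<lambda>X. ambient \<phi> z (0, X))"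
      and y: "\<exists>y\<in>V. F y = G y" and z: "z \<in> V"
    obtain y where y: "y \<in> V" "F y = G y" using y by (rule bexE)
    have "has_mdiff (\<lambda>y. F y - G y) w (\<lambda>X. 0)" if "w \<in> V" for w
      using has_mdiff_diff[of F w _ G] FG that by fastforce
    from has_mdiff_zero_constant[OF V(1) conn this z y(1)] y(2) show "F z = G z" by simp
  qed (rule V(1-3) VU)+
qed simp

lemma immersion_smooth:
  assumes "\<And>x. has_mdiff F x (\<lambda>X. ambient \<phi> x (0, X))" shows "msmooth_on (atl D) UNIV F"
proof -
  have "msmooth_on (atl D) UNIV (\<lambda>x. (F x, 1 :: real))"
  proof (rule msmooth_on_linear_system[OF open_UNIV bounded_bilinear_affine])
    show "has_mdiff (\<lambda>x. (F x, 1 :: real)) x (\<lambda>v. (snd (F x, 1) *\<^sub>R ambient \<phi> x (0, v), 0))" for x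
      using has_mdiff_Pair[OF assms has_mdiff_const[of 1 x]] by simp
    show "msmooth_on (atl D) (UNIV \<inter> fst \<kappa>) (\<lambda>x. ambient \<phi> x (0, coord_vector (atl D) \<kappa> w x))" if "\<kappa> \<in> atl D" for \<kappa> w
      using ambient_smooth[OF chart_props(1)[OF that] E.section_zero[OF chart_props(1)[OF that]] coord_vector_field[OF that]] by simp
  qed
  from msmooth_on_linear[OF open_UNIV bounded_linear_fst this] show ?thesis by simp
qed

lemma immersion_solution_iff: "immersion_solution D \<phi> F \<longleftrightarrow> (\<forall>x. has_mdiff F x (\<lambda>X. ambient \<phi> x (0, X)))"
proof
  assume F: "immersion_solution D \<phi> F"
  show "\<forall>x. has_mdiff F x (\<lambda>X. ambient \<phi> x (0, X))"
  proof
    fix x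
    have "msmooth_on (atl D) UNIV F" using F unfolding immersion_solution_def by (rule conjunct1)
    from msmooth_on_imp_has_mdiff[OF this UNIV_I]
    show "has_mdiff F x (\<lambda>X. ambient \<phi> x (0, X))"
    proof (rule has_mdiff_cong_deriv)
      fix X assume X: "X \<in> tangent_space (atl D) x"
      obtain q where q: "q \<in> spin_frames D x" by (rule ex_spin_frame)
      have "r22_to_hac (mdiff (atl D) F x X) = spinor_pairing (clifford D x (0, X) (\<phi> x)) (\<phi> x)"
        using F X unfolding immersion_solution_def by blast
      then show "mdiff (atl D) F x X = ambient \<phi> x (0, X)" using ambient_coord(1)[OF q E.fib_zero X] by (simp add: r22_to_hac_inj[symmetric])
    qed
  qed
next
  assume F: "\<forall>x. has_mdiff F x (\<lambda>X. ambient \<phi> x (0, X))"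
  show "immersion_solution D \<phi> F"
    unfolding immersion_solution_def
  proof (intro conjI allI ballI)
    show "msmooth_on (atl D) UNIV F" using F by (intro immersion_smooth) (rule spec)
    fix x X assume X: "X \<in> tangent_space (atl D) x"
    obtain q where q: "q \<in> spin_frames D x" by (rule ex_spin_frame)
    show "r22_to_hac (mdiff (atl D) F x X) = spinor_pairing (clifford D x (0, X) (\<phi> x)) (\<phi> x)"
      unfolding has_mdiff_imp_mdiff[OF F[rule_format] X] by (rule ambient_coord(1)[OF q E.fib_zero X])
  qed
qed

theorem ex_immersion_solution:
  assumes "simply_connected (UNIV :: 'm set)" shows "\<exists>F. immersion_solution D \<phi> F"
proof -
  interpret locally_constant_sheaf "\<lambda>F x. has_mdiff F x (\<lambda>X. ambient \<phi> x (0, X))" "\<lambda>x. UNIV" by (rule immersion_sheaf)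
  obtain F where "\<forall>x. has_mdiff F x (\<lambda>X. ambient \<phi> x (0, X))" using global_solution[OF assms UNIV_I] by blast
  then show ?thesis unfolding immersion_solution_iff by blast
qed

theorem immersion_solution_unique:
  assumes conn: "connected (UNIV :: 'm set)" and F: "immersion_solution D \<phi> F"
  shows "immersion_solution D \<phi> F' \<longleftrightarrow> (\<exists>c. \<forall>x. F' x = F x + c)"
proof
  note F = F[unfolded immersion_solution_iff, rule_format]
  { assume "immersion_solution D \<phi> F'"
    then have F': "has_mdiff F' x (\<lambda>X. ambient \<phi> x (0, X))" for x unfolding immersion_solution_iff by (rule spec)
    have "F' x - F x = F' y - F y" for x y
      by (rule has_mdiff_zero_constant[OF open_UNIV conn _ UNIV_I UNIV_I]) (use has_mdiff_diff[OF F' F] in simp)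
    then have "\<forall>x. F' x = F x + (F' y - F y)" for y by (metis add_diff_cancel_left' add.commute diff_add_cancel)
    then show "\<exists>c. \<forall>x. F' x = F x + c" by blast }
  { assume "\<exists>c. \<forall>x. F' x = F x + c"
    then obtain c where "F' = (\<lambda>x. F x + c)" by blast
    then show "immersion_solution D \<phi> F'"
      unfolding immersion_solution_iff using has_mdiff_add[OF F has_mdiff_const] by simp }
qed

context
  fixes F assumes F: "immersion_solution D \<phi> F"
begin

lemma mdiff_immersion: "X \<in> tangent_space (atl D) x \<Longrightarrow> mdiff (atl D) F x X = ambient \<phi> x (0, X)"
  using has_mdiff_imp_mdiff[OF F[unfolded immersion_solution_iff, rule_format]] .

theorem immersion_isometric: "isometric_immersion (atl D) (bT D) F"
  unfolding isometric_immersion_def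
proof (intro conjI allI ballI)
  show "msmooth_on (atl D) UNIV F" using F unfolding immersion_solution_def by (rule conjunct1)
  show "inj_on (mdiff (atl D) F x) (tangent_space (atl D) x)" for x
    by (rule inj_onI) (use ambient_inj(2)[OF E.fib_zero _ E.fib_zero] mdiff_immersion in metis)
  fix x X Y assume X: "X \<in> tangent_space (atl D) x" and Y: "Y \<in> tangent_space (atl D) x"
  show "metric22 (mdiff (atl D) F x X) (mdiff (atl D) F x Y) = met (bT D) x X Y"
    unfolding mdiff_immersion[OF X] mdiff_immersion[OF Y] ambient_metric[OF E.fib_zero X E.fib_zero Y] using E.met_zero_left[OF E.fib_zero] by simp
qed

lemma ambient_normal: "\<nu> \<in> fib (bE D) x \<Longrightarrow> ambient \<phi> x (\<nu>, 0) \<in> normal_space (atl D) F x"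
  unfolding normal_space_def
  by (simp add: mdiff_immersion ambient_metric zero_tangent E.fib_zero T.met_zero_left[unfolded tangent_fib] E.met_sym[of \<nu> x 0] E.met_zero_left)

text \<open>The metric of \<open>TM\<close> is nondegenerate, and so the tangential component of a normal vector vanishes.\<close>

lemma normal_space_ambient:
  assumes n: "n \<in> normal_space (atl D) F x"
  obtains \<nu> where "\<nu> \<in> fib (bE D) x" "n = ambient \<phi> x (\<nu>, 0)"
proof -
  obtain \<nu> X where Z: "\<nu> \<in> fib (bE D) x" "X \<in> tangent_space (atl D) x" "ambient \<phi> x (\<nu>, X) = n" by (rule ambient_surj)
  obtain q where q: "q \<in> spin_frames D x" by (rule ex_spin_frame)
  obtain c d where f: "(c, d) \<in> oframes (bT D) x" using frame_oframes(2)[OF q] by (metis prod.exhaust)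
  have "met (bT D) x X Y = 0" if "Y \<in> tangent_space (atl D) x" for Y
  proof -
    have "metric22 n (mdiff (atl D) F x Y) = 0" using n that unfolding normal_space_def by blast
    then show ?thesis
      unfolding mdiff_immersion[OF that] Z(3)[symmetric] ambient_metric[OF Z(1,2) E.fib_zero that]
      using E.met_sym[OF Z(1) E.fib_zero] E.met_zero_left[OF Z(1)] by simp
  qed
  then have "X = 0"
    using T.met_ext[OF f Z(2)[folded tangent_fib] T.fib_zero] T.oframeD(1,2)[OF f] by (simp add: tangent_fib[symmetric] T.met_zero_left)
  with Z that show thesis by blast
qed

lemma normal_part_ambient:
  assumes Z: "\<nu> \<in> fib (bE D) x" "X \<in> tangent_space (atl D) x"
  shows "normal_part (atl D) F x (ambient \<phi> x (\<nu>, X)) = ambient \<phi> x (\<nu>, 0)"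
  unfolding normal_part_def
proof (rule the_equality, intro conjI)
  show "ambient \<phi> x (\<nu>, 0) \<in> normal_space (atl D) F x" by (rule ambient_normal[OF Z(1)])
  show "ambient \<phi> x (\<nu>, X) - ambient \<phi> x (\<nu>, 0) \<in> mdiff (atl D) F x ` tangent_space (atl D) x"
    using mdiff_immersion[OF Z(2)] Z(2) unfolding ambient_split[OF Z] by (auto intro!: image_eqI[of _ _ X])
next
  fix n assume n: "n \<in> normal_space (atl D) F x \<and> ambient \<phi> x (\<nu>, X) - n \<in> mdiff (atl D) F x ` tangent_space (atl D) x"
  obtain \<mu> where \<mu>: "\<mu> \<in> fib (bE D) x" "n = ambient \<phi> x (\<mu>, 0)" by (rule normal_space_ambient[OF n[THEN conjunct1]])
  obtain Y where Y: "Y \<in> tangent_space (atl D) x" "ambient \<phi> x (\<nu>, X) - n = mdiff (atl D) F x Y"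
    by (rule imageE[OF n[THEN conjunct2]])
  note Y2 = Y(2)[unfolded mdiff_immersion[OF Y(1)]]
  have "ambient \<phi> x (\<nu>, X) = ambient \<phi> x (\<mu>, Y)"
    using Y2 unfolding ambient_split[OF \<mu>(1) Y(1)] \<mu>(2) by (simp add: algebra_simps)
  from ambient_inj(1)[OF Z \<mu>(1) Y(1) this] show "n = ambient \<phi> x (\<nu>, 0)" unfolding \<mu>(2) by simp
qed

text \<open>The bundle isometry is the restriction of the trivialization to \<open>E\<close>; the two formulas are the normal
  parts of \<open>ambient_normal_deriv\<close> and \<open>ambient_tangent_deriv\<close>.\<close>

theorem immersion_normal_bundle_and_form: "has_normal_bundle_and_form (atl D) (bE D) B F"
  unfolding has_normal_bundle_and_form_def
proof (intro exI[of _ "\<lambda>x \<nu>. ambient \<phi> x (\<nu>, 0)"] conjI allI ballI impI)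
  show "linear_map_on (fib (bE D) x) (\<lambda>\<nu>. ambient \<phi> x (\<nu>, 0))" for x by (rule ambient_linear)
  show "bij_betw (\<lambda>\<nu>. ambient \<phi> x (\<nu>, 0)) (fib (bE D) x) (normal_space (atl D) F x)" for x
    unfolding bij_betw_def
  proof
    show "inj_on (\<lambda>\<nu>. ambient \<phi> x (\<nu>, 0)) (fib (bE D) x)"
      by (rule inj_onI) (rule ambient_inj(1)[OF _ zero_tangent _ zero_tangent])
    show "(\<lambda>\<nu>. ambient \<phi> x (\<nu>, 0)) ` fib (bE D) x = normal_space (atl D) F x"
    proof (rule antisym)
      show "(\<lambda>\<nu>. ambient \<phi> x (\<nu>, 0)) ` fib (bE D) x \<subseteq> normal_space (atl D) F x" using ambient_normal by (rule image_subsetI)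
      show "normal_space (atl D) F x \<subseteq> (\<lambda>\<nu>. ambient \<phi> x (\<nu>, 0)) ` fib (bE D) x"
        by (rule subsetI) (erule normal_space_ambient, blast)
    qed
  qed
  show "metric22 (ambient \<phi> x (\<nu>, 0)) (ambient \<phi> x (\<mu>, 0)) = met (bE D) x \<nu> \<mu>"
    if "\<nu> \<in> fib (bE D) x" "\<mu> \<in> fib (bE D) x" for x \<nu> \<mu>
    unfolding ambient_metric[OF that(1) zero_tangent that(2) zero_tangent] using T.met_zero_left[OF T.fib_zero] by simp
next
  fix W s assume s: "open W \<and> smooth_section (atl D) (bE D) W s"
  note s = s[THEN conjunct1] s[THEN conjunct2]
  show "msmooth_on (atl D) W (\<lambda>x. ambient \<phi> x (s x, 0))" by (rule ambient_smooth[OF s zero_vector_field[OF s(1)]])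
  fix x X assume x: "x \<in> W" and X: "X \<in> tangent_space (atl D) x"
  obtain q where q: "q \<in> spin_frames D x" by (rule ex_spin_frame)
  obtain c d where f: "(c, d) \<in> oframes (bT D) x" using frame_oframes(2)[OF q] by (metis prod.exhaust)
  have t: "c \<in> tangent_space (atl D) x" "d \<in> tangent_space (atl D) x" using T.oframeD(1,2)[OF f] by (auto simp: tangent_fib)
  have S: "- shape_operator (bT D) (bE D) B x (s x) X \<in> tangent_space (atl D) x"
    unfolding shape_operator_frame[OF E.section_fib[OF s(2) x] X f]
    by (subst scaleR_minus1_left[symmetric]) (intro tangent_scaleR tangent_add t)
  show "ambient \<phi> x (nabla (bE D) s x X, 0) = normal_part (atl D) F x (mdiff (atl D) (\<lambda>y. ambient \<phi> y (s y, 0)) x X)"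
    unfolding has_mdiff_imp_mdiff[OF ambient_normal_deriv[OF s(1) x s(2)] X]
    by (rule normal_part_ambient[OF E.nabla_fib[OF s x X] S, symmetric])
next
  fix W Y x X assume Y: "open W \<and> vector_field (atl D) W Y" and x: "x \<in> W" and X: "X \<in> tangent_space (atl D) x"
  note Y = Y[THEN conjunct1] Y[THEN conjunct2]
  have "mdiff (atl D) (\<lambda>y. mdiff (atl D) F y (Y y)) x X = mdiff (atl D) (\<lambda>y. ambient \<phi> y (0, Y y)) x X"
    by (rule mdiff_cong[OF Y(1) x]) (rule mdiff_immersion[OF vector_field_tangent[OF Y(2)]])
  also have "\<dots> = ambient \<phi> x (B x X (Y x), nabla (bT D) Y x X)"
    by (rule has_mdiff_imp_mdiff[OF ambient_tangent_deriv[OF Y(1) x Y(2)] X])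
  finally show "ambient \<phi> x (B x X (Y x), 0) = normal_part (atl D) F x (mdiff (atl D) (\<lambda>y. mdiff (atl D) F y (Y y)) x X)"
    using normal_part_ambient[OF form_fib[OF X vector_field_tangent[OF Y(2) x]] T.nabla_fib[OF Y(1) Y(2)[folded tangent_section] x X, unfolded tangent_fib]] by simp
qed

end

end

end

lemma simply_connected_UNIV_connected:
  assumes "simply_connected (UNIV :: 'm::topological_space set)" shows "connected (UNIV :: 'm set)"
proof (rule path_connected_imp_connected, unfold path_connected_def, intro ballI)
  fix x y :: 'm
  obtain g where "path g" "pathstart g = x" "pathfinish g = y" by (rule simply_connected_imp_path[OF assms])
  then show "\<exists>g. path g \<and> path_image g \<subseteq> UNIV \<and> pathstart g = x \<and> pathfinish g = y" by blast
qed

theorem corollary1: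
  fixes D :: "('m::{t2_space, second_countable_topology}, 'v::real_vector, 'q, 'p) spin_data"
    and B :: "'m \<Rightarrow> 'm tvec \<Rightarrow> 'm tvec \<Rightarrow> 'v"
  assumes "oriented_lorentzian_surface (atl D) (bT D)"
    and "simply_connected (UNIV :: 'm set)"
    and "oriented_lorentzian_bundle (atl D) (bE D)"
    and "spin_structure_tangent (atl D) (bT D) (sT D)"
    and "spin_structure_normal (atl D) (bE D) (sE D)"
    and "symmetric_bilinear_map (atl D) (bE D) B"
    and "gauss_equation (atl D) (bT D) (bE D) B"
    and "ricci_equation (atl D) (bT D) (bE D) B"
    and "codazzi_equation (atl D) (bT D) (bE D) B"
  shows "(\<exists>\<phi>. spinor_solution D B \<phi>) \<and>
    (\<forall>\<phi>. spinor_solution D B \<phi> \<longrightarrow>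
       (\<forall>\<phi>'. spinor_solution D B \<phi>' \<longleftrightarrow> (\<exists>a\<in>Spin22. \<phi>' = (\<lambda>x. spinor_right (\<phi> x) a))) \<and>
       (\<exists>F. immersion_solution D \<phi> F) \<and>
       (\<forall>F. immersion_solution D \<phi> F \<longrightarrow>
          (\<forall>F'. immersion_solution D \<phi> F' \<longleftrightarrow> (\<exists>c. \<forall>x. F' x = F x + c)) \<and>
          isometric_immersion (atl D) (bT D) F \<and>
          has_normal_bundle_and_form (atl D) (bE D) B F))"
proof -
  interpret spin_surface D B
    by (rule spin_surface.intro) (rule assms)+
  have conn: "connected (UNIV :: 'm set)" by (rule simply_connected_UNIV_connected[OF assms(2)])
  show ?thesis
  proof (intro conjI allI impI)
    show "\<exists>\<phi>. spinor_solution D B \<phi>" by (rule ex_spinor_solution[OF assms(2)])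
    fix \<phi> assume \<phi>: "spinor_solution D B \<phi>"
    then have sol: "solves_at \<phi> x" for x unfolding spinor_solution_iff by (rule spec)
    show "spinor_solution D B \<phi>' \<longleftrightarrow> (\<exists>a\<in>Spin22. \<phi>' = (\<lambda>x. spinor_right (\<phi> x) a))" for \<phi>'
      by (rule spinor_solution_unique[OF conn \<phi>])
    show "\<exists>F. immersion_solution D \<phi> F" by (rule ex_immersion_solution[OF sol assms(2)])
    fix F assume F: "immersion_solution D \<phi> F"
    show "immersion_solution D \<phi> F' \<longleftrightarrow> (\<exists>c. \<forall>x. F' x = F x + c)" for F' by (rule immersion_solution_unique[OF sol conn F])
    show "isometric_immersion (atl D) (bT D) F" by (rule immersion_isometric[OF sol F])
    show "has_normal_bundle_and_form (atl D) (bE D) B F" by (rule immersion_normal_bundle_and_form[OF sol F])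
  qed
qed

end
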